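(* Let $G$ be a countable group with one end and let $G \curvearrowright (X,\mu) = \prod_{g \in G} (\{0,1\},\mu_g)$ be a nonsingular Bernoulli action for which there is a $\delta>0$ with $\mu_g(0) \in [\delta,1-\delta]$ for all $g \in G$. For $g\in G$ let $c_g\in\ell^2(G)$ be given by $c_g(h) = \mu_h(0)-\mu_{g^{-1}h}(0)$. Assume that $$\sum_{g \in G} \exp(-4\kappa \, \|c_g\|_2^2) =+\infty$$ for some $\kappa > \delta^{-1} (1-\delta)^{-1}$. Then $G \curvearrowright (X,\mu)$ is weakly mixing and of type III$_1$, unless $\sum_{g \in G} (\mu_g(0)-\lambda)^2 < +\infty$ for some $\lambda \in (0,1)$, in which case the action is of type II$_1$.
   Context: Bernoulli action: given a countable group $G$ and probability measures $(\mu_g)_{g\in G}$ on $\{0,1\}$ with $\mu_g(0)\in(0,1)$ for all $g$, the Bernoulli action is the action of $G$ on $(X,\mu)=\prod_{g\in G}(\{0,1\},\mu_g)$ given by $(g\cdot x)_h = x_{g^{-1}h}$. An action of $G$ by Borel bijections of a standard probability space is nonsingular if it preserves the class of null sets. When $\mu_g(0)\in[\delta,1-\delta]$ for all $g$, the Bernoulli action is nonsingular if and only if $c_g\in\ell^2(G)$ for all $g\in G$ (Kakutani). Write $\frac{d\mu(g\cdot x)}{d\mu(x)}$ for the Radon-Nikodym derivative at $x$ of the measure $\mathcal{U}\mapsto \mu(g\cdot \mathcal{U})$ with respect to $\mu$. A subset $W\subset G$ is almost invariant if $|gW\vartriangle W|<\infty$ for all $g\in G$. A group $G$ has more than one end if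 it has an almost invariant subset $W$ with $W$ and $G\setminus W$ both infinite; $G$ has one end if it is infinite and does not have more than one end. A nonsingular action is ergodic if all invariant Borel sets have measure $0$ or $1$. It is weakly mixing if for every ergodic probability measure preserving (pmp) action $G\curvearrowright(Y,\eta)$ the diagonal action $G\curvearrowright (X\times Y,\mu\times\eta)$ is ergodic. An ergodic nonsingular action $G\curvearrowright (X,\mu)$ with $\mu$ nonatomic is of type II$_1$ if there is a finite $G$-invariant measure equivalent to $\mu$. The ratio set is the set of $t\in[0,+\infty)$ such that for every $\varepsilon>0$ and every Borel set $\mathcal{U}$ of positive measure there are $g\in G$ and a Borel set $\mathcal{V}\subset\mathcal{U}$ of positive measure with $g\cdot\mathcal{V}\subset\mathcal{U}$ and $|\frac{d\mu(g\cdot x)}{d\mu(x)}-t|<\varepsilon$ for all $x\in\mathcal{V}$. The action is of type III$_1$ if its ratio set is $[0,+\infty)$. *)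

theory Defs
  imports
    "HOL-Probability.Probability"
    "HOL-Algebra.Coset"
    "HOL-Algebra.Group_Action"
begin

definition almost_invariant :: "('g, 'm) monoid_scheme \<Rightarrow> 'g set \<Rightarrow> bool" where
  "almost_invariant G W \<longleftrightarrow>
     W \<subseteq> carrier G \<and> (\<forall>g\<in>carrier G. finite (sym_diff (g <#\<^bsub>G\<^esub> W) W))"

definition more_than_one_end :: "('g, 'm) monoid_scheme \<Rightarrow> bool" where
  "more_than_one_end G \<longleftrightarrow>
     (\<exists>W. almost_invariant G W \<and> infinite W \<and> infinite (carrier G - W))"

definition one_end :: "('g, 'm) monoid_scheme \<Rightarrow> bool" where
  "one_end G \<longleftrightarrow> infinite (carrier G) \<and> \<not> more_than_one_end G"

definition standard_borel :: "'x measure \<Rightarrow> bool" where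
  "standard_borel M \<longleftrightarrow>
     (\<exists>T. topspace T = space M \<and> completely_metrizable_space T \<and> second_countable T \<and>
          sets M = sigma_sets (space M) {U. openin T U})"

definition borel_action ::
    "('g, 'm) monoid_scheme \<Rightarrow> 'x measure \<Rightarrow> ('g \<Rightarrow> 'x \<Rightarrow> 'x) \<Rightarrow> bool" where
  "borel_action G M \<alpha> \<longleftrightarrow>
     standard_borel M \<and> prob_space M \<and> group_action G (space M) \<alpha> \<and>
     (\<forall>g\<in>carrier G. \<alpha> g \<in> measurable M M)"

definition nonsingular_action ::
    "('g, 'm) monoid_scheme \<Rightarrow> 'x measure \<Rightarrow> ('g \<Rightarrow> 'x \<Rightarrow> 'x) \<Rightarrow> bool" where
  "nonsingular_action G M \<alpha> \<longleftrightarrow>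
     borel_action G M \<alpha> \<and>
     (\<forall>g\<in>carrier G. \<forall>A\<in>sets M. emeasure M (\<alpha> g ` A) = 0 \<longleftrightarrow> emeasure M A = 0)"

definition pmp_action ::
    "('g, 'm) monoid_scheme \<Rightarrow> 'x measure \<Rightarrow> ('g \<Rightarrow> 'x \<Rightarrow> 'x) \<Rightarrow> bool" where
  "pmp_action G M \<alpha> \<longleftrightarrow>
     borel_action G M \<alpha> \<and>
     (\<forall>g\<in>carrier G. \<forall>A\<in>sets M. emeasure M (\<alpha> g ` A) = emeasure M A)"

definition ergodic ::
    "('g, 'm) monoid_scheme \<Rightarrow> 'x measure \<Rightarrow> ('g \<Rightarrow> 'x \<Rightarrow> 'x) \<Rightarrow> bool" where
  "ergodic G M \<alpha> \<longleftrightarrow>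
     (\<forall>A\<in>sets M. (\<forall>g\<in>carrier G. \<alpha> g ` A = A) \<longrightarrow> emeasure M A = 0 \<or> emeasure M A = 1)"

definition diagonal_action ::
    "'x measure \<Rightarrow> 'y measure \<Rightarrow> ('g \<Rightarrow> 'x \<Rightarrow> 'x) \<Rightarrow> ('g \<Rightarrow> 'y \<Rightarrow> 'y) \<Rightarrow> 'g \<Rightarrow> 'x \<times> 'y \<Rightarrow> 'x \<times> 'y" where
  "diagonal_action M N \<alpha> \<beta> g = (\<lambda>(x, y)\<in>space (M \<Otimes>\<^sub>M N). (\<alpha> g x, \<beta> g y))"

(* HOL cannot quantify over types inside a formula, so the type carrying the pmp action is a
   parameter. Left as a type variable in the conclusion of a theorem, it is universally
   quantified, and all pmp actions are covered. *)
definition weakly_mixing ::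
    "'y itself \<Rightarrow> ('g, 'm) monoid_scheme \<Rightarrow> 'x measure \<Rightarrow> ('g \<Rightarrow> 'x \<Rightarrow> 'x) \<Rightarrow> bool" where
  "weakly_mixing _ G M \<alpha> \<longleftrightarrow>
     (\<forall>(N :: 'y measure) \<beta>. pmp_action G N \<beta> \<longrightarrow> ergodic G N \<beta> \<longrightarrow>
        ergodic G (M \<Otimes>\<^sub>M N) (diagonal_action M N \<alpha> \<beta>))"

(* For a finite measure only. *)
definition nonatomic :: "'x measure \<Rightarrow> bool" where
  "nonatomic M \<longleftrightarrow>
     (\<forall>A\<in>sets M. emeasure M A > 0 \<longrightarrow>
        (\<exists>B\<in>sets M. B \<subseteq> A \<and> 0 < emeasure M B \<and> emeasure M B < emeasure M A))"

(* The image of M under the inverse of g is the measure sending U to M (g U). *)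
definition translate_deriv ::
    "('g, 'm) monoid_scheme \<Rightarrow> 'x measure \<Rightarrow> ('g \<Rightarrow> 'x \<Rightarrow> 'x) \<Rightarrow> 'g \<Rightarrow> 'x \<Rightarrow> real" where
  "translate_deriv G M \<alpha> g x = enn2real (RN_deriv M (distr M M (\<alpha> (inv\<^bsub>G\<^esub> g))) x)"

(* RN_deriv is determined only almost everywhere. This does not affect the ratio set, because
   null sets can be removed from V. *)
definition ratio_set ::
    "('g, 'm) monoid_scheme \<Rightarrow> 'x measure \<Rightarrow> ('g \<Rightarrow> 'x \<Rightarrow> 'x) \<Rightarrow> real set" where
  "ratio_set G M \<alpha> =
     {t. t \<ge> 0 \<and>
         (\<forall>\<epsilon>>0. \<forall>U\<in>sets M. emeasure M U > 0 \<longrightarrow>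
            (\<exists>g\<in>carrier G. \<exists>V\<in>sets M. V \<subseteq> U \<and> emeasure M V > 0 \<and> \<alpha> g ` V \<subseteq> U \<and>
               (\<forall>x\<in>V. \<bar>translate_deriv G M \<alpha> g x - t\<bar> < \<epsilon>)))}"

definition type_II1 ::
    "('g, 'm) monoid_scheme \<Rightarrow> 'x measure \<Rightarrow> ('g \<Rightarrow> 'x \<Rightarrow> 'x) \<Rightarrow> bool" where
  "type_II1 G M \<alpha> \<longleftrightarrow>
     nonsingular_action G M \<alpha> \<and> ergodic G M \<alpha> \<and> nonatomic M \<and>
     (\<exists>\<nu>. sets \<nu> = sets M \<and> finite_measure \<nu> \<and>
          absolutely_continuous M \<nu> \<and> absolutely_continuous \<nu> M \<and>
          (\<forall>g\<in>carrier G. \<forall>A\<in>sets M. emeasure \<nu> (\<alpha> g ` A) = emeasure \<nu> A))"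

definition type_III1 ::
    "('g, 'm) monoid_scheme \<Rightarrow> 'x measure \<Rightarrow> ('g \<Rightarrow> 'x \<Rightarrow> 'x) \<Rightarrow> bool" where
  "type_III1 G M \<alpha> \<longleftrightarrow>
     nonsingular_action G M \<alpha> \<and> ergodic G M \<alpha> \<and> nonatomic M \<and> ratio_set G M \<alpha> = {0..}"

(* The points 0 and 1 of the base space are encoded as False and True. *)
definition bernoulli_measure ::
    "('g, 'm) monoid_scheme \<Rightarrow> ('g \<Rightarrow> bool pmf) \<Rightarrow> ('g \<Rightarrow> bool) measure" where
  "bernoulli_measure G \<mu> = (\<Pi>\<^sub>M g\<in>carrier G. measure_pmf (\<mu> g))"

definition bernoulli_action ::
    "('g, 'm) monoid_scheme \<Rightarrow> 'g \<Rightarrow> ('g \<Rightarrow> bool) \<Rightarrow> 'g \<Rightarrow> bool" where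
  "bernoulli_action G g =
     (\<lambda>x\<in>(carrier G \<rightarrow>\<^sub>E UNIV). \<lambda>h\<in>carrier G. x (inv\<^bsub>G\<^esub> g \<otimes>\<^bsub>G\<^esub> h))"

definition bernoulli_cocycle ::
    "('g, 'm) monoid_scheme \<Rightarrow> ('g \<Rightarrow> bool pmf) \<Rightarrow> 'g \<Rightarrow> 'g \<Rightarrow> real" where
  "bernoulli_cocycle G \<mu> g h = pmf (\<mu> h) False - pmf (\<mu> (inv\<^bsub>G\<^esub> g \<otimes>\<^bsub>G\<^esub> h)) False"

(* Squared norm in l2 of the group. It is only meaningful for square-summable c: infsum is 0
   when the series diverges. *)
definition l2_norm_sq :: "('g, 'm) monoid_scheme \<Rightarrow> ('g \<Rightarrow> real) \<Rightarrow> real" where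
  "l2_norm_sq G c = (\<Sum>\<^sub>\<infinity>h\<in>carrier G. (c h)\<^sup>2)"

end

theory Submission
  imports Defs
begin

text \<open>Write \<open>D\<^sub>g\<close> for the density of the translate \<open>g \<mu>\<close> with respect to \<open>\<mu>\<close>. Resampling the coordinate \<open>g b\<close>
  changes \<open>D\<^sub>h\<close> only by a factor controlled by \<open>c\<^sub>h(g b)\<close>, while it averages \<open>a(g\<^sup>-\<^sup>1 x)\<close> to zero if \<open>a\<close> depends on
  finitely many coordinates and has mean zero in the coordinate \<open>b\<close>. Estimating the second moment of
  \<open>\<Sum>\<^bsub>g\<in>F\<^esub> a(g\<^sup>-\<^sup>1 x) D\<^sub>g(x)\<close> against \<open>1 / \<Sum>\<^bsub>g\<in>F\<^esub> D\<^sub>g\<close>, the divergence of \<open>\<Sum> exp (- 4 \<kappa> \<parallel>c\<^sub>g\<parallel>\<^sup>2)\<close> yields finite sets \<open>F\<close>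
  along which these averages are small in \<open>L\<^sup>1\<close>, and on which moreover all marginals at \<open>g b\<close> are close to one
  value \<open>l\<close>, independent of \<open>b\<close>. So the sections of an invariant set of \<open>X \<times> Y\<close> have a measure that is 0 or 1, and
  the action is weakly mixing.

  For an invariant function on the Maharam extension \<open>X \<times> \<real>\<close>, smoothed in the real variable, the same averages
  show that flipping the coordinate \<open>b\<close> of \<open>x\<close> amounts to a translation by the difference of the log odds of \<open>\<mu>\<^sub>b\<close>
  and of \<open>l\<close>. Replacing a finite block of coordinates by an independent copy therefore translates by a random sum
  \<open>Z\<close>. Since an integrable function is almost a cylinder function, it is nearly invariant under each translation
  that is approximated by \<open>Z\<close> with a probability bounded below, for blocks avoiding any given finite set. If
  \<open>\<Sum> (\<mu>\<^sub>g(0) - l)\<^sup>2\<close> diverges, one-endedness provides such blocks at every scale: otherwise the large log odds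
  would form an almost invariant set. So the smoothed function is constant, which forces the ratio set to be
  \<open>[0, \<infinity>)\<close>. If the sum converges, \<open>\<mu>\<close> is equivalent to an invariant product measure by Kakutani's theorem.\<close>

section \<open>Products of two-point measures\<close>

text \<open>Let V be the sum to be estimated and J the sum of the densities over F. As |V| \<le> J
  and J has integral card F, it suffices that the integral of V^2 / J is small against card F. The
  obstacle: 1 / J depends on every coordinate, so resampling gb cancels the pair (g, h) only up to
  the relative change of the densities; square summability of the cocycles controls the sum of these
  errors. The diagonal is bounded through 1 / J \<le> (card F)^(-2) \<Sum> 1 / D_k and the integral
  of D_g^2 / D_k, at most exp(2 (|c_g|^2 + |c_k|^2) / (\<delta> (1 - \<delta>))). If both squared
  norms are at most W this is exp(4 W / (\<delta> (1 - \<delta>))), whence the 4 and the bound on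
  \<kappa>: a divergent series has level sets with more elements. The strict inequality for \<kappa>
  pays for the exponents 2 + e and 2 - e caused by a kernel exp(- e |s|) on the real line, for right
  translation by b, and for a factor linear in W. The type III part rests on scale invariance: a
  block of size r moves by a distance comparable to r, with a probability bounded below
  independently of r and an error that is small against r.\<close>

abbreviation bits :: "'i set \<Rightarrow> ('i \<Rightarrow> bool pmf) \<Rightarrow> ('i \<Rightarrow> bool) measure" where
  "bits I \<nu> \<equiv> (\<Pi>\<^sub>M i\<in>I. measure_pmf (\<nu> i))"

definition cyl :: "'i set \<Rightarrow> 'i set \<Rightarrow> ('i \<Rightarrow> bool) \<Rightarrow> ('i \<Rightarrow> bool) set" where
  "cyl I J y = {z \<in> I \<rightarrow>\<^sub>E UNIV. \<forall>i\<in>J. z i = y i}"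

lemma prob_space_bits: "prob_space (bits I \<nu>)"
  by (intro prob_space_PiM) (rule measure_pmf.prob_space_axioms)

lemma space_bits [simp]: "space (bits I \<nu>) = I \<rightarrow>\<^sub>E UNIV"
  by (simp add: space_PiM)

lemma sets_bits_cong: "sets (bits I \<nu>) = sets (bits I \<nu>')"
  by (rule sets_PiM_cong) auto

lemma measurable_bits_coord [measurable]:
  "i \<in> I \<Longrightarrow> (\<lambda>z. z i) \<in> measurable (bits I \<nu>) (count_space UNIV)"
  using measurable_component_singleton[of i I "\<lambda>i. measure_pmf (\<nu> i)"]
    measurable_cong_sets[OF refl sets_measure_pmf_count_space, of "bits I \<nu>" "\<nu> i"]
  by simp

lemma measurable_bits_comp:
  "i \<in> I \<Longrightarrow> f \<in> UNIV \<rightarrow> space N \<Longrightarrow> (\<lambda>z. f (z i)) \<in> measurable (bits I \<nu>) N"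
  using measurable_compose[OF measurable_bits_coord, of i I f N \<nu>] by simp

lemma measurable_bits_fun:
  "i \<in> I \<Longrightarrow> (\<lambda>z. (f (z i) :: 'b :: topological_space)) \<in> borel_measurable (bits I \<nu>)"
  by (rule measurable_bits_comp) auto

lemma sets_cyl [measurable]:
  assumes "finite J" "J \<subseteq> I" shows "cyl I J y \<in> sets (bits I \<nu>)"
proof -
  have "{z \<in> space (bits I \<nu>). \<forall>i\<in>J. z i = y i} \<in> sets (bits I \<nu>)"
  proof (rule sets.sets_Collect_finite_All[OF _ assms(1)])
    fix i assume "i \<in> J"
    then have "(\<lambda>z. z i) -` {y i} \<inter> space (bits I \<nu>) \<in> sets (bits I \<nu>)"
      using assms(2) by (rule_tac measurable_sets[OF measurable_bits_coord]) auto
    also have "(\<lambda>z. z i) -` {y i} \<inter> space (bits I \<nu>) = {z \<in> space (bits I \<nu>). z i = y i}" by auto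
    finally show "{z \<in> space (bits I \<nu>). z i = y i} \<in> sets (bits I \<nu>)" .
  qed
  then show ?thesis unfolding cyl_def space_bits .
qed

lemma emeasure_cyl:
  assumes "finite J" "J \<subseteq> I"
  shows "emeasure (bits I \<nu>) (cyl I J y) = ennreal (\<Prod>i\<in>J. pmf (\<nu> i) (y i))"
proof -
  have "cyl I J y = prod_emb I (\<lambda>i. measure_pmf (\<nu> i)) J (\<Pi>\<^sub>E i\<in>J. {y i})"
    using assms by (auto simp: cyl_def prod_emb_def space_PiM restrict_PiE_iff)
  then have "emeasure (bits I \<nu>) (cyl I J y) = (\<Prod>i\<in>J. emeasure (measure_pmf (\<nu> i)) {y i})"
    using assms by (simp add: emeasure_PiM_emb measure_pmf.prob_space_axioms)
  then show ?thesis
    by (simp add: emeasure_pmf_single prod_ennreal)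
qed

text \<open>The coordinates are two-valued, so a box over finitely many coordinates is a finite
  disjoint union of cylinders. Measures on the product can thus be identified by cylinder masses
  alone.\<close>

lemma cyl_eqI:
  assumes P: "sets P = sets (bits I \<nu>)" and Q: "sets Q = sets (bits I \<nu>)"
    and eq: "\<And>J y. finite J \<Longrightarrow> J \<subseteq> I \<Longrightarrow> emeasure P (cyl I J y) = emeasure Q (cyl I J y)"
    and fin: "finite_measure P"
  shows "P = Q"
proof (rule measure_eqI_PiM_infinite[OF P Q _ fin])
  fix A :: "'a \<Rightarrow> bool set" and J assume J: "finite J" "J \<subseteq> I"
  have fA: "finite (\<Pi>\<^sub>E i\<in>J. A i)" using J by (intro finite_PiE) auto
  have un: "prod_emb I (\<lambda>i. measure_pmf (\<nu> i)) J (Pi\<^sub>E J A) = (\<Union>y\<in>(\<Pi>\<^sub>E i\<in>J. A i). cyl I J y)"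
  proof (rule Set.set_eqI, rule iffI)
    fix z assume "z \<in> prod_emb I (\<lambda>i. measure_pmf (\<nu> i)) J (Pi\<^sub>E J A)"
    then have "z \<in> I \<rightarrow>\<^sub>E UNIV" "restrict z J \<in> Pi\<^sub>E J A" by (auto simp: prod_emb_def space_PiM)
    then show "z \<in> (\<Union>y\<in>(\<Pi>\<^sub>E i\<in>J. A i). cyl I J y)" by (auto simp: cyl_def intro!: bexI[of _ "restrict z J"])
  next
    fix z assume "z \<in> (\<Union>y\<in>(\<Pi>\<^sub>E i\<in>J. A i). cyl I J y)"
    then obtain y where y: "y \<in> Pi\<^sub>E J A" "z \<in> I \<rightarrow>\<^sub>E UNIV" "\<forall>i\<in>J. z i = y i" by (auto simp: cyl_def)
    have "restrict z J = y"
    proof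
      fix i show "restrict z J i = y i" using y PiE_arb[OF y(1), of i] by (cases "i \<in> J") auto
    qed
    with y show "z \<in> prod_emb I (\<lambda>i. measure_pmf (\<nu> i)) J (Pi\<^sub>E J A)" by (auto simp: prod_emb_def space_PiM)
  qed
  have disj: "disjoint_family_on (cyl I J) (\<Pi>\<^sub>E i\<in>J. A i)"
    unfolding disjoint_family_on_def cyl_def
  proof (intro ballI impI)
    fix m n assume mn: "m \<in> Pi\<^sub>E J A" "n \<in> Pi\<^sub>E J A" "m \<noteq> n"
    then obtain i where "i \<in> J" "m i \<noteq> n i" using PiE_ext[OF mn(1,2)] by blast
    then show "{z \<in> I \<rightarrow>\<^sub>E UNIV. \<forall>i\<in>J. z i = m i} \<inter> {z \<in> I \<rightarrow>\<^sub>E UNIV. \<forall>i\<in>J. z i = n i} = {}" by auto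
  qed
  have "emeasure R (\<Union>y\<in>(\<Pi>\<^sub>E i\<in>J. A i). cyl I J y) = (\<Sum>y\<in>(\<Pi>\<^sub>E i\<in>J. A i). emeasure R (cyl I J y))"
    if "sets R = sets (bits I \<nu>)" for R
    using that J by (intro sum_emeasure[symmetric] disj fA) auto
  then show "emeasure P (prod_emb I (\<lambda>i. measure_pmf (\<nu> i)) J (Pi\<^sub>E J A)) = emeasure Q (prod_emb I (\<lambda>i. measure_pmf (\<nu> i)) J (Pi\<^sub>E J A))"
    unfolding un using P Q eq[OF J] by simp
qed

section \<open>Resampling one coordinate\<close>

lemma upd_in_bits: "j \<in> I \<Longrightarrow> z \<in> I \<rightarrow>\<^sub>E UNIV \<Longrightarrow> z(j := y) \<in> I \<rightarrow>\<^sub>E UNIV"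
  by (auto simp: PiE_iff extensional_def)

lemma measurable_upd [measurable]:
  assumes "j \<in> I" shows "(\<lambda>z. z(j := y)) \<in> measurable (bits I \<nu>) (bits I \<nu>)"
proof (rule measurable_PiM_single')
  fix i assume i: "i \<in> I"
  show "(\<lambda>z. (z(j := y)) i) \<in> measurable (bits I \<nu>) (measure_pmf (\<nu> i))"
    using i by (cases "i = j") (auto intro: measurable_component_singleton)
qed (use assms in \<open>auto simp: upd_in_bits PiE_iff extensional_def\<close>)

text \<open>Overwriting coordinate \<open>j\<close> by an independent draw from its own marginal
  preserves every cylinder mass: the factor at \<open>j\<close> is split off and put back.\<close>

lemma nn_resample:
  assumes j: "j \<in> I" and f [measurable]: "f \<in> borel_measurable (bits I \<nu>)"
  shows "(\<integral>\<^sup>+z. f z \<partial>bits I \<nu>) =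
    (\<integral>\<^sup>+z. ennreal (pmf (\<nu> j) True) * f (z(j := True)) + ennreal (pmf (\<nu> j) False) * f (z(j := False)) \<partial>bits I \<nu>)"
proof -
  let ?M = "bits I \<nu>"
  define Q where "Q = distr (measure_pmf (\<nu> j) \<Otimes>\<^sub>M ?M) ?M (\<lambda>(y, z). z(j := y))"
  interpret M: prob_space ?M by (rule prob_space_bits)
  interpret pair_sigma_finite "measure_pmf (\<nu> j)" ?M ..
  interpret PP: pair_prob_space "measure_pmf (\<nu> j)" ?M ..
  have m [measurable]: "(\<lambda>(y, z). z(j := y)) \<in> measurable (measure_pmf (\<nu> j) \<Otimes>\<^sub>M ?M) ?M"
  proof (rule measurable_PiM_single')
    fix i assume i: "i \<in> I"
    have 1: "(\<lambda>p. snd p i) \<in> measurable (measure_pmf (\<nu> j) \<Otimes>\<^sub>M ?M) (measure_pmf (\<nu> i))"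
      by (rule measurable_compose[OF measurable_snd measurable_component_singleton[OF i]])
    have 2: "fst \<in> measurable (measure_pmf (\<nu> j) \<Otimes>\<^sub>M ?M) (measure_pmf (\<nu> j))" by (rule measurable_fst)
    show "(\<lambda>p. (case p of (y, z) \<Rightarrow> z(j := y)) i) \<in> measurable (measure_pmf (\<nu> j) \<Otimes>\<^sub>M ?M) (measure_pmf (\<nu> i))"
      using 1 2 by (cases "i = j") (auto simp: case_prod_beta cong: measurable_cong)
  next
    show "(\<lambda>(y, z). z(j := y)) \<in> space (measure_pmf (\<nu> j) \<Otimes>\<^sub>M ?M) \<rightarrow> (\<Pi>\<^sub>E i\<in>I. space (measure_pmf (\<nu> i)))"
    proof
      fix p assume "p \<in> space (measure_pmf (\<nu> j) \<Otimes>\<^sub>M ?M)"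
      then have "snd p \<in> I \<rightarrow>\<^sub>E UNIV" by (auto simp: space_pair_measure)
      then show "(case p of (y, z) \<Rightarrow> z(j := y)) \<in> (\<Pi>\<^sub>E i\<in>I. space (measure_pmf (\<nu> i)))"
        using upd_in_bits[OF j, of "snd p" "fst p"] by (simp add: case_prod_beta)
    qed
  qed
  have "Q = distr (measure_pmf (\<nu> j) \<Otimes>\<^sub>M (\<Pi>\<^sub>M i\<in>I - {j}. measure_pmf (\<nu> i))) (\<Pi>\<^sub>M i\<in>insert j (I - {j}). measure_pmf (\<nu> i)) (\<lambda>(x, X). X(j := x))"
  proof (rule cyl_eqI[of _ I \<nu>])
    show "sets Q = sets ?M" by (simp add: Q_def)
    show "sets (distr (measure_pmf (\<nu> j) \<Otimes>\<^sub>M (\<Pi>\<^sub>M i\<in>I - {j}. measure_pmf (\<nu> i))) (\<Pi>\<^sub>M i\<in>insert j (I - {j}). measure_pmf (\<nu> i)) (\<lambda>(x, X). X(j := x))) = sets ?M"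
      using j by (simp add: insert_absorb)
    show "finite_measure Q" unfolding Q_def
      by (intro finite_measure.finite_measure_distr m PP.P.finite_measure)
    fix J y assume J: "finite J" "J \<subseteq> I"
    have cyl: "cyl I J y \<in> sets ?M" using J by simp
    have eq: "(\<lambda>(y, z). z(j := y)) -` cyl I J y \<inter> space (measure_pmf (\<nu> j) \<Otimes>\<^sub>M ?M)
      = (if j \<in> J then {y j} else UNIV) \<times> cyl I (J - {j}) y"
    proof (rule Set.set_eqI, clarify)
      fix u :: bool and z :: "'a \<Rightarrow> bool"
      have "(z(j := u) \<in> cyl I J y \<and> z \<in> I \<rightarrow>\<^sub>E UNIV) = ((j \<in> J \<longrightarrow> u = y j) \<and> z \<in> cyl I (J - {j}) y)"
        using upd_in_bits[OF j, of z u] by (auto simp: cyl_def)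
      then show "((u, z) \<in> (\<lambda>(y, z). z(j := y)) -` cyl I J y \<inter> space (measure_pmf (\<nu> j) \<Otimes>\<^sub>M ?M))
        = ((u, z) \<in> (if j \<in> J then {y j} else UNIV) \<times> cyl I (J - {j}) y)"
        by (simp add: space_pair_measure)
    qed
    have "emeasure Q (cyl I J y) = emeasure (measure_pmf (\<nu> j)) (if j \<in> J then {y j} else UNIV) * emeasure ?M (cyl I (J - {j}) y)"
      unfolding Q_def using J by (subst emeasure_distr[OF m cyl], subst eq, subst M.emeasure_pair_measure_Times) (auto intro!: sets_cyl)
    also have "\<dots> = emeasure ?M (cyl I J y)"
    proof (cases "j \<in> J")
      case True
      then have "(\<Prod>i\<in>J. pmf (\<nu> i) (y i)) = pmf (\<nu> j) (y j) * (\<Prod>i\<in>J - {j}. pmf (\<nu> i) (y i))"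
        using J by (simp add: prod.remove)
      then show ?thesis using True J
        by (simp add: emeasure_cyl emeasure_pmf_single ennreal_mult'' prod_nonneg subset_iff)
    next
      case False then show ?thesis by (simp add: measure_pmf.emeasure_space_1[simplified])
    qed
    finally show "emeasure Q (cyl I J y) = emeasure (distr (measure_pmf (\<nu> j) \<Otimes>\<^sub>M (\<Pi>\<^sub>M i\<in>I - {j}. measure_pmf (\<nu> i))) (\<Pi>\<^sub>M i\<in>insert j (I - {j}). measure_pmf (\<nu> i)) (\<lambda>(x, X). X(j := x))) (cyl I J y)"
      using j by (subst distr_pair_PiM_eq_PiM) (auto simp: insert_absorb intro: measure_pmf.prob_space_axioms)
  qed
  also have "\<dots> = ?M"
    using j by (subst distr_pair_PiM_eq_PiM) (auto simp: insert_absorb intro: measure_pmf.prob_space_axioms)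
  finally have QM: "Q = ?M" .
  have "(\<integral>\<^sup>+z. f z \<partial>?M) = (\<integral>\<^sup>+z. f z \<partial>Q)" by (simp add: QM)
  also have "\<dots> = (\<integral>\<^sup>+p. f ((\<lambda>(y, z). z(j := y)) p) \<partial>(measure_pmf (\<nu> j) \<Otimes>\<^sub>M ?M))"
    unfolding Q_def by (rule nn_integral_distr) auto
  also have "\<dots> = (\<integral>\<^sup>+z. \<integral>\<^sup>+y. f (z(j := y)) \<partial>measure_pmf (\<nu> j) \<partial>?M)"
    by (subst nn_integral_snd[symmetric]) (auto simp: case_prod_beta)
  also have "\<dots> = (\<integral>\<^sup>+z. ennreal (pmf (\<nu> j) True) * f (z(j := True)) + ennreal (pmf (\<nu> j) False) * f (z(j := False)) \<partial>?M)"
    by (intro nn_integral_cong) (simp add: nn_integral_measure_pmf nn_integral_count_space_finite UNIV_bool add.commute mult.commute)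
  finally show ?thesis .
qed

text \<open>An abstract version of \<open>nn_resample\<close>: if \<open>y\<close> is drawn from
  \<open>q\<close>, then \<open>U y\<close> preserves \<open>P\<close>. It is separated from
  \<open>bits\<close> because it is needed on \<open>M\<close> times Lebesgue measure and on either
  factor of \<open>M\<close> times \<open>M\<close>; integrals with values in [0, \<infinity>] are
  used since \<open>P\<close> may be infinite.\<close>

definition resamples :: "'w measure \<Rightarrow> bool pmf \<Rightarrow> (bool \<Rightarrow> 'w \<Rightarrow> 'w) \<Rightarrow> bool" where
  "resamples P q U \<longleftrightarrow> (\<forall>y. U y \<in> measurable P P) \<and>
     (\<forall>f\<in>borel_measurable P. (\<integral>\<^sup>+w. f w \<partial>P) =
        (\<integral>\<^sup>+w. ennreal (pmf q True) * f (U True w) + ennreal (pmf q False) * f (U False w) \<partial>P))"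

lemma resamples_meas: "resamples P q U \<Longrightarrow> U y \<in> measurable P P"
  by (simp add: resamples_def)

lemma resamples_nn_sum:
  assumes "resamples P q U" "f \<in> borel_measurable P"
  shows "(\<integral>\<^sup>+w. f w \<partial>P) = (\<integral>\<^sup>+w. ennreal (pmf q True) * f (U True w) + ennreal (pmf q False) * f (U False w) \<partial>P)"
  using assms unfolding resamples_def by blast

lemma resamples_nn:
  assumes "resamples P q U" "f \<in> borel_measurable P"
  shows "(\<integral>\<^sup>+w. f w \<partial>P) = ennreal (pmf q True) * (\<integral>\<^sup>+w. f (U True w) \<partial>P) + ennreal (pmf q False) * (\<integral>\<^sup>+w. f (U False w) \<partial>P)"
proof -
  have [measurable]: "f \<in> borel_measurable P" "U True \<in> measurable P P" "U False \<in> measurable P P"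
    using assms by (auto simp: resamples_def)
  have "(\<integral>\<^sup>+w. f w \<partial>P) = (\<integral>\<^sup>+w. ennreal (pmf q True) * f (U True w) + ennreal (pmf q False) * f (U False w) \<partial>P)"
    using assms unfolding resamples_def by blast
  then show ?thesis by (subst (asm) nn_integral_add) (auto simp: nn_integral_cmult)
qed

lemma resamples_bits: "j \<in> I \<Longrightarrow> resamples (bits I \<nu>) (\<nu> j) (\<lambda>y z. z(j := y))"
  unfolding resamples_def by (auto intro: measurable_upd nn_resample)

lemma resamples_fst:
  assumes r: "resamples P q U" and P: "sigma_finite_measure P" and N: "sigma_finite_measure N"
  shows "resamples (P \<Otimes>\<^sub>M N) q (\<lambda>y w. (U y (fst w), snd w))"
proof -
  interpret P: sigma_finite_measure P by fact
  interpret N: sigma_finite_measure N by fact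
  interpret pair_sigma_finite P N ..
  have [measurable]: "U True \<in> measurable P P" "U False \<in> measurable P P" "\<And>y. U y \<in> measurable P P"
    using r by (auto simp: resamples_def)
  show ?thesis unfolding resamples_def
  proof (intro conjI allI ballI)
    fix y show "(\<lambda>w. (U y (fst w), snd w)) \<in> measurable (P \<Otimes>\<^sub>M N) (P \<Otimes>\<^sub>M N)" by measurable
  next
    fix f :: "'a \<times> 'b \<Rightarrow> ennreal" assume [measurable]: "f \<in> borel_measurable (P \<Otimes>\<^sub>M N)"
    let ?g = "\<lambda>w. ennreal (pmf q True) * f (U True (fst w), snd w) + ennreal (pmf q False) * f (U False (fst w), snd w)"
    have "(\<integral>\<^sup>+w. f w \<partial>(P \<Otimes>\<^sub>M N)) = (\<integral>\<^sup>+y. \<integral>\<^sup>+x. f (x, y) \<partial>P \<partial>N)"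
      by (rule nn_integral_snd[symmetric]) simp
    also have "\<dots> = (\<integral>\<^sup>+y. \<integral>\<^sup>+x. ?g (x, y) \<partial>P \<partial>N)"
    proof (rule nn_integral_cong)
      fix y assume "y \<in> space N"
      then have "(\<lambda>x. f (x, y)) \<in> borel_measurable P" by measurable
      from resamples_nn_sum[OF r this] show "(\<integral>\<^sup>+x. f (x, y) \<partial>P) = (\<integral>\<^sup>+x. ?g (x, y) \<partial>P)"
        unfolding fst_conv snd_conv .
    qed
    also have "\<dots> = (\<integral>\<^sup>+w. ?g w \<partial>(P \<Otimes>\<^sub>M N))"
      by (rule nn_integral_snd) measurable
    finally show "(\<integral>\<^sup>+w. f w \<partial>(P \<Otimes>\<^sub>M N)) = (\<integral>\<^sup>+w. ?g w \<partial>(P \<Otimes>\<^sub>M N))" .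
  qed
qed

lemma resamples_snd:
  assumes r: "resamples P q U" and P: "sigma_finite_measure P" and N: "sigma_finite_measure N"
  shows "resamples (N \<Otimes>\<^sub>M P) q (\<lambda>y w. (fst w, U y (snd w)))"
proof -
  interpret P: sigma_finite_measure P by fact
  interpret N: sigma_finite_measure N by fact
  have [measurable]: "U True \<in> measurable P P" "U False \<in> measurable P P" "\<And>y. U y \<in> measurable P P"
    using r by (auto simp: resamples_def)
  show ?thesis unfolding resamples_def
  proof (intro conjI allI ballI)
    fix y show "(\<lambda>w. (fst w, U y (snd w))) \<in> measurable (N \<Otimes>\<^sub>M P) (N \<Otimes>\<^sub>M P)" by measurable
  next
    fix f :: "'b \<times> 'a \<Rightarrow> ennreal" assume [measurable]: "f \<in> borel_measurable (N \<Otimes>\<^sub>M P)"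
    let ?g = "\<lambda>w. ennreal (pmf q True) * f (fst w, U True (snd w)) + ennreal (pmf q False) * f (fst w, U False (snd w))"
    have "(\<integral>\<^sup>+w. f w \<partial>(N \<Otimes>\<^sub>M P)) = (\<integral>\<^sup>+x. \<integral>\<^sup>+y. f (x, y) \<partial>P \<partial>N)"
      by (rule P.nn_integral_fst[symmetric]) simp
    also have "\<dots> = (\<integral>\<^sup>+x. \<integral>\<^sup>+y. ?g (x, y) \<partial>P \<partial>N)"
    proof (rule nn_integral_cong)
      fix y assume "y \<in> space N"
      then have "(\<lambda>x. f (y, x)) \<in> borel_measurable P" by measurable
      from resamples_nn_sum[OF r this] show "(\<integral>\<^sup>+x. f (y, x) \<partial>P) = (\<integral>\<^sup>+x. ?g (y, x) \<partial>P)"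
        unfolding fst_conv snd_conv .
    qed
    also have "\<dots> = (\<integral>\<^sup>+w. ?g w \<partial>(N \<Otimes>\<^sub>M P))"
      by (rule P.nn_integral_fst) measurable
    finally show "(\<integral>\<^sup>+w. f w \<partial>(N \<Otimes>\<^sub>M P)) = (\<integral>\<^sup>+w. ?g w \<partial>(N \<Otimes>\<^sub>M P))" .
  qed
qed

text \<open>A value \<open>y\<close> that is drawn with positive probability cannot lead from a set
  of positive measure into a null set.\<close>

lemma resamples_AE:
  assumes r: "resamples P q U" and q: "0 < pmf q y" and ae: "AE w in P. Q w"
  shows "AE w in P. Q (U y w)"
proof -
  obtain Z where Z: "{w\<in>space P. \<not> Q w} \<subseteq> Z" "Z \<in> sets P" "emeasure P Z = 0"
    using ae by (auto elim: AE_E)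
  note [measurable] = Z(2) and Um = resamples_meas[OF r]
  have "ennreal (pmf q True) * (\<integral>\<^sup>+w. indicator Z (U True w) \<partial>P) + ennreal (pmf q False) * (\<integral>\<^sup>+w. indicator Z (U False w) \<partial>P) = 0"
    using resamples_nn[OF r, of "indicator Z"] Z by simp
  then have "ennreal (pmf q y) * (\<integral>\<^sup>+w. indicator Z (U y w) \<partial>P) = 0"
    by (cases y) (auto simp: add_eq_0_iff_both_eq_0)
  then have "(\<integral>\<^sup>+w. indicator Z (U y w) \<partial>P) = 0" using q by (auto simp: ennreal_eq_0_iff)
  then have "AE w in P. indicator Z (U y w) = (0::ennreal)"
    using Um[of y] by (subst (asm) nn_integral_0_iff_AE) auto
  moreover have "w \<in> space P \<Longrightarrow> U y w \<in> space P" for w using measurable_space[OF Um] by blast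
  ultimately show ?thesis using Z(1) by (elim AE_mp) (auto intro!: AE_I2 simp: indicator_def split: if_splits)
qed

lemma resamples_integrable:
  fixes f :: "'w \<Rightarrow> real"
  assumes r: "resamples P q U" and q: "0 < pmf q y" and f: "integrable P f"
  shows "integrable P (\<lambda>w. f (U y w))"
proof (rule integrableI_bounded)
  have [measurable]: "f \<in> borel_measurable P" "U y \<in> measurable P P"
    using f resamples_meas[OF r] by auto
  show "(\<lambda>w. f (U y w)) \<in> borel_measurable P" by measurable
  have "ennreal (pmf q y) * (\<integral>\<^sup>+w. norm (f (U y w)) \<partial>P) \<le> (\<integral>\<^sup>+w. norm (f w) \<partial>P)"
    by (subst (2) resamples_nn[OF r]) (cases y; simp)+
  also have "\<dots> < \<infinity>" using f by (simp add: integrable_iff_bounded)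
  finally show "(\<integral>\<^sup>+w. norm (f (U y w)) \<partial>P) < \<infinity>"
    using q by (auto simp: ennreal_mult_less_top)
qed

lemma resamples_integral:
  fixes f :: "'w \<Rightarrow> real"
  assumes r: "resamples P q U" and q: "\<And>y. 0 < pmf q y" and f: "integrable P f"
  shows "(\<integral>w. f w \<partial>P) = pmf q True * (\<integral>w. f (U True w) \<partial>P) + pmf q False * (\<integral>w. f (U False w) \<partial>P)"
proof -
  have [measurable]: "f \<in> borel_measurable P" "\<And>y. U y \<in> measurable P P"
    using f resamples_meas[OF r] by auto
  have fU: "integrable P (\<lambda>w. f (U y w))" for y
    by (rule resamples_integrable[OF r q f])
  have fin: "(\<integral>\<^sup>+w. ennreal (g w) \<partial>P) < \<infinity>" if "integrable P g" for g :: "'w \<Rightarrow> real"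
  proof -
    have "(\<integral>\<^sup>+w. ennreal (g w) \<partial>P) \<le> (\<integral>\<^sup>+w. norm (g w) \<partial>P)" by (intro nn_integral_mono) (simp add: ennreal_leI)
    also have "\<dots> < \<infinity>" using that by (simp add: integrable_iff_bounded)
    finally show ?thesis .
  qed
  have *: "enn2real (\<integral>\<^sup>+w. ennreal (g w) \<partial>P) = pmf q True * enn2real (\<integral>\<^sup>+w. ennreal (g (U True w)) \<partial>P) + pmf q False * enn2real (\<integral>\<^sup>+w. ennreal (g (U False w)) \<partial>P)"
    if g: "integrable P g" for g
  proof -
    have [measurable]: "g \<in> borel_measurable P" using g by auto
    have gU: "integrable P (\<lambda>w. g (U y w))" for y
      by (rule resamples_integrable[OF r q g])
    show ?thesis using fin[OF gU[of True]] fin[OF gU[of False]]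
      by (subst resamples_nn[OF r]) (auto simp: enn2real_plus enn2real_mult ennreal_mult_less_top)
  qed
  show ?thesis
    using *[OF f] *[of "\<lambda>w. - f w"] f fU by (simp add: real_lebesgue_integral_def algebra_simps)
qed

text \<open>Source of the cancellation in \<open>averaging_step\<close>: there the average over the
  resampled coordinate vanishes pointwise.\<close>

lemma resamples_cancel:
  fixes f :: "'w \<Rightarrow> real"
  assumes r: "resamples P q U" and q: "\<And>y. 0 < pmf q y" and f: "integrable P f"
    and 0: "\<And>w. w \<in> space P \<Longrightarrow> pmf q True * f (U True w) + pmf q False * f (U False w) = 0"
  shows "(\<integral>w. f w \<partial>P) = 0"
proof -
  have fU: "integrable P (\<lambda>w. f (U y w))" for y
    by (rule resamples_integrable[OF r q f])
  have "(\<integral>w. f w \<partial>P) = (\<integral>w. pmf q True * f (U True w) + pmf q False * f (U False w) \<partial>P)"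
    using resamples_integral[OF r q f] fU by simp
  also have "\<dots> = (\<integral>w. 0 \<partial>P)" by (rule Bochner_Integration.integral_cong) (use 0 in auto)
  finally show ?thesis by simp
qed

section \<open>Expectations of products and likelihood ratios\<close>

definition bexp :: "bool pmf \<Rightarrow> (bool \<Rightarrow> real) \<Rightarrow> real" where
  "bexp q u = pmf q True * u True + pmf q False * u False"

lemma prod_bits_measurable:
  assumes "S \<subseteq> I"
  shows "(\<lambda>z. \<Prod>i\<in>S. (u i (z i) :: real)) \<in> borel_measurable (bits I \<nu>)"
  using assms by (intro borel_measurable_prod measurable_bits_fun) auto

lemma prod_bits:
  fixes u :: "'i \<Rightarrow> bool \<Rightarrow> real"
  assumes "finite S" "S \<subseteq> I" and pos: "\<And>i y. i \<in> I \<Longrightarrow> 0 < pmf (\<nu> i) y"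
  shows integrable_prod_bits: "integrable (bits I \<nu>) (\<lambda>z. \<Prod>i\<in>S. u i (z i))" (is ?A)
    and integral_prod_bits: "(\<integral>z. (\<Prod>i\<in>S. u i (z i)) \<partial>bits I \<nu>) = (\<Prod>i\<in>S. bexp (\<nu> i) (u i))" (is ?B)
proof -
  interpret prob_space "bits I \<nu>" by (rule prob_space_bits)
  have int: "integrable (bits I \<nu>) (\<lambda>z. \<Prod>i\<in>S. u i (z i))" if "finite S" "S \<subseteq> I" for S
  proof (rule integrable_const_bound[where B = "\<Prod>i\<in>S. max \<bar>u i True\<bar> \<bar>u i False\<bar>"])
    have "\<bar>u i y\<bar> \<le> max \<bar>u i True\<bar> \<bar>u i False\<bar>" for i y by (cases y) auto
    then show "AE x in bits I \<nu>. norm (\<Prod>i\<in>S. u i (x i)) \<le> (\<Prod>i\<in>S. max \<bar>u i True\<bar> \<bar>u i False\<bar>)"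
      by (intro AE_I2) (auto simp: abs_prod intro!: prod_mono)
    show "(\<lambda>x. \<Prod>i\<in>S. u i (x i)) \<in> borel_measurable (bits I \<nu>)"
      using that by (intro prod_bits_measurable)
  qed
  show ?A using int assms by blast
  show ?B using assms(1,2)
  proof (induction S rule: finite_induct)
    case empty then show ?case using prob_space by simp
  next
    case (insert j S)
    have j: "j \<in> I" using insert by auto
    have "(\<integral>z. (\<Prod>i\<in>insert j S. u i (z i)) \<partial>bits I \<nu>) = (\<Sum>y\<in>UNIV. pmf (\<nu> j) y * (\<integral>z. (\<Prod>i\<in>insert j S. u i ((z(j := y)) i)) \<partial>bits I \<nu>))"
      by (subst resamples_integral[OF resamples_bits[OF j]]) (use pos j int[of "insert j S"] insert.prems insert.hyps(1) in \<open>auto simp: UNIV_bool simp del: prod.insert\<close>)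
    also have "\<dots> = (\<Sum>y\<in>UNIV. pmf (\<nu> j) y * (u j y * (\<integral>z. (\<Prod>i\<in>S. u i (z i)) \<partial>bits I \<nu>)))"
    proof -
      have "(\<Prod>i\<in>insert j S. u i ((z(j := y)) i)) = u j y * (\<Prod>i\<in>S. u i (z i))" for z y
        using insert by (subst prod.insert) (auto intro!: prod.cong)
      then show ?thesis by simp
    qed
    also have "\<dots> = bexp (\<nu> j) (u j) * (\<Prod>i\<in>S. bexp (\<nu> i) (u i))"
      using insert by (simp add: UNIV_bool bexp_def algebra_simps)
    finally show ?case using insert by simp
  qed
qed

lemma pmf_bool_True: "pmf q True = 1 - pmf q False"
proof -
  have "sum (pmf q) UNIV = 1" by (rule sum_pmf_eq_1) auto
  then show ?thesis by (simp add: UNIV_bool)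
qed

lemma bexp_ratio:
  assumes "\<And>y. 0 < pmf q y" shows "bexp q (\<lambda>y. pmf p y / pmf q y) = 1"
proof -
  have "pmf q True \<noteq> 0" "pmf q False \<noteq> 0" using assms by (metis less_irrefl)+
  then show ?thesis by (simp add: bexp_def pmf_bool_True[of p])
qed

lemma chi_square_two_point:
  fixes a b c :: real
  assumes "b \<noteq> 0" "c \<noteq> 0" "c = 1 - b"
  shows "c * ((1 - a) / c)\<^sup>2 + b * (a / b)\<^sup>2 = 1 + (a - b)\<^sup>2 / (b * c)"
proof -
  have "c * ((1 - a) / c)\<^sup>2 + b * (a / b)\<^sup>2 = (1 - a)\<^sup>2 / c + a\<^sup>2 / b"
    using assms by (simp add: power2_eq_square)
  also have "\<dots> = ((1 - a)\<^sup>2 * b + a\<^sup>2 * c) / (b * c)" using assms(1,2) by (simp add: divide_simps mult.commute)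
  also have "(1 - a)\<^sup>2 * b + a\<^sup>2 * c = b * c + (a - b)\<^sup>2" unfolding assms(3) by algebra
  also have "(b * c + (a - b)\<^sup>2) / (b * c) = 1 + (a - b)\<^sup>2 / (b * c)" using assms(1,2) by (simp add: add_divide_distrib)
  finally show ?thesis .
qed

text \<open>The excess over 1 is the chi-square divergence of \<open>p\<close> from
  \<open>q\<close>. For two-point measures it is quadratic in the difference of the masses, which is
  how square summability enters.\<close>

lemma bexp_ratio_sq:
  assumes "\<And>y. 0 < pmf q y"
  shows "bexp q (\<lambda>y. (pmf p y / pmf q y)\<^sup>2) = 1 + (pmf p False - pmf q False)\<^sup>2 / (pmf q False * pmf q True)"
proof -
  have "pmf q True \<noteq> 0" "pmf q False \<noteq> 0" using assms by (metis less_irrefl)+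
  then show ?thesis using chi_square_two_point[of "pmf q False" "pmf q True" "pmf p False"]
    by (simp add: bexp_def pmf_bool_True[of p] pmf_bool_True[of q])
qed

text \<open>Under \<open>q\<close> the mean of \<open>q / p\<close> is the second moment of
  \<open>q / p\<close> under \<open>p\<close>, so the previous formula applies with \<open>p\<close>
  and \<open>q\<close> exchanged. It serves for the positivity of the limit in
  \<open>product_density\<close>.\<close>

lemma bexp_ratio_inverse:
  assumes "\<And>y. 0 < pmf q y" "\<And>y. 0 < pmf p y"
  shows "bexp q (\<lambda>y. pmf q y / pmf p y) = 1 + (pmf p False - pmf q False)\<^sup>2 / (pmf p False * pmf p True)"
proof -
  have n: "pmf p True \<noteq> 0" "pmf p False \<noteq> 0" using assms by (metis less_irrefl)+
  then have "bexp q (\<lambda>y. pmf q y / pmf p y) = bexp p (\<lambda>y. (pmf q y / pmf p y)\<^sup>2)"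
    by (simp add: bexp_def power2_eq_square)
  then show ?thesis using bexp_ratio_sq[of p q] assms by (simp add: power2_commute)
qed

lemma countable_exhaust:
  assumes "countable I"
  obtains S :: "nat \<Rightarrow> 'i set" where "incseq S" "\<And>n. finite (S n)" "(\<Union>n. S n) = I"
proof (cases "I = {}")
  case True then show ?thesis using that[of "\<lambda>_. {}"] by (auto simp: incseq_def)
next
  case False
  then have "range (from_nat_into I) = I" using assms by (rule range_from_nat_into)
  then have "(\<Union>n. from_nat_into I ` {..<n}) = I" by blast
  moreover have "incseq (\<lambda>n. from_nat_into I ` {..<n})" by (force simp: incseq_def)
  ultimately show ?thesis using that[of "\<lambda>n. from_nat_into I ` {..<n}"] by blast
qed

lemma exp_bound_prod:
  fixes m :: "'i \<Rightarrow> real"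
  assumes "finite S" "\<And>i. i \<in> S \<Longrightarrow> 0 \<le> m i" "\<And>i. i \<in> S \<Longrightarrow> m i \<le> 1 + e i"
  shows "(\<Prod>i\<in>S. m i) \<le> exp (\<Sum>i\<in>S. e i)"
proof -
  have "(\<Prod>i\<in>S. m i) \<le> (\<Prod>i\<in>S. exp (e i))"
  proof (intro prod_mono conjI)
    fix i assume "i \<in> S"
    then show "0 \<le> m i" "m i \<le> exp (e i)" using assms(2) order_trans[OF assms(3) exp_ge_add_one_self[of "e i"]] by auto
  qed
  then show ?thesis using assms by (simp add: exp_sum)
qed

section \<open>Densities of product measures\<close>

text \<open>The finite partial products are bounded in \<open>L\<^sup>2\<close>, hence converge in \<open>L\<^sup>1\<close>; \<open>D\<close> is the almost everywhere limit
  along a subsequence \<open>T\<close>, extended by 0 to the points where the limit does not exist.\<close>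
lemma product_density:
  fixes I :: "'i set" and \<nu> \<nu>' :: "'i \<Rightarrow> bool pmf"
  defines "\<rho> \<equiv> \<lambda>i y. pmf (\<nu>' i) y / pmf (\<nu> i) y"
  assumes I: "countable I" and \<delta>: "0 < \<delta>"
    and q: "\<And>i y. i \<in> I \<Longrightarrow> \<delta> \<le> pmf (\<nu> i) y" and p: "\<And>i y. i \<in> I \<Longrightarrow> \<delta> \<le> pmf (\<nu>' i) y"
    and sm: "(\<lambda>i. (pmf (\<nu>' i) False - pmf (\<nu> i) False)\<^sup>2) summable_on I"
  obtains D :: "('i \<Rightarrow> bool) \<Rightarrow> real" and T :: "nat \<Rightarrow> 'i set" where
    "D \<in> borel_measurable (bits I \<nu>)" "\<And>z. 0 \<le> D z" "AE z in bits I \<nu>. 0 < D z"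
    "bits I \<nu>' = density (bits I \<nu>) (\<lambda>z. ennreal (D z))"
    "\<And>z j y. z \<in> I \<rightarrow>\<^sub>E UNIV \<Longrightarrow> j \<in> I \<Longrightarrow> D (z(j := y)) * \<rho> j (z j) = D z * \<rho> j y"
    "\<And>k. finite (T k)" "\<And>k. T k \<subseteq> I"
    "AE z in bits I \<nu>. (\<lambda>k. \<Prod>i\<in>T k. \<rho> i (z i)) \<longlonglongrightarrow> D z"
proof -
  let ?M = "bits I \<nu>"
  interpret prob_space ?M by (rule prob_space_bits)
  have qp: "\<And>i y. i \<in> I \<Longrightarrow> 0 < pmf (\<nu> i) y" and pp: "\<And>i y. i \<in> I \<Longrightarrow> 0 < pmf (\<nu>' i) y"
    using \<delta> q p by (meson less_le_trans)+
  have \<rho>p: "i \<in> I \<Longrightarrow> 0 < \<rho> i y" for i y using qp pp by (simp add: \<rho>_def)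
  define \<Delta> where "\<Delta> i = (pmf (\<nu>' i) False - pmf (\<nu> i) False)\<^sup>2" for i
  define P where "P S z = (\<Prod>i\<in>S. \<rho> i (z i))" for S z
  \<comment> \<open>\<open>A S\<close> is the second moment of the partial product
    \<open>P S\<close>. Its factors lie between 1 and
    \<open>1 + \<Delta> i / \<delta>\<^sup>2\<close>, so it increases with \<open>S\<close> and is
    bounded by \<open>K\<close>.\<close>
  define A where "A S = (\<Prod>i\<in>S. bexp (\<nu> i) (\<lambda>y. (\<rho> i y)\<^sup>2))" for S
  define K where "K = exp (\<Sum>\<^sub>\<infinity>i\<in>I. \<Delta> i / \<delta>\<^sup>2)"
  have sm': "(\<lambda>i. \<Delta> i / \<delta>\<^sup>2) summable_on I"
    using summable_on_cmult_left[OF sm, of "1 / \<delta>\<^sup>2"] by (simp add: \<Delta>_def)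
  have Pm: "S \<subseteq> I \<Longrightarrow> P S \<in> borel_measurable ?M" for S
    using prod_bits_measurable[of S I \<rho>] by (simp add: P_def[abs_def])
  have Pp: "S \<subseteq> I \<Longrightarrow> 0 < P S z" for S z unfolding P_def using \<rho>p by (intro prod_pos) auto
  have dbd: "\<delta>\<^sup>2 \<le> pmf (\<nu> i) False * pmf (\<nu> i) True" "\<delta>\<^sup>2 \<le> pmf (\<nu>' i) False * pmf (\<nu>' i) True" if "i \<in> I" for i
    using q[OF that] p[OF that] \<delta> by (auto simp: power2_eq_square intro!: mult_mono order.strict_implies_order[OF qp] order.strict_implies_order[OF pp] that)
  have Kbd: "(\<Prod>i\<in>S. m i) \<le> K" if S: "finite S" "S \<subseteq> I" and m: "\<And>i. i \<in> I \<Longrightarrow> 0 \<le> m i" "\<And>i. i \<in> I \<Longrightarrow> m i \<le> 1 + \<Delta> i / \<delta>\<^sup>2" for S m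
  proof -
    have "(\<Prod>i\<in>S. m i) \<le> exp (\<Sum>i\<in>S. \<Delta> i / \<delta>\<^sup>2)"
      using S m by (intro exp_bound_prod) auto
    also have "\<dots> \<le> K" unfolding K_def
      using finite_sum_le_infsum[OF sm' S] by (simp add: \<Delta>_def)
    finally show ?thesis .
  qed
  have m1: "1 \<le> bexp (\<nu> i) (\<lambda>y. (\<rho> i y)\<^sup>2)" "bexp (\<nu> i) (\<lambda>y. (\<rho> i y)\<^sup>2) \<le> 1 + \<Delta> i / \<delta>\<^sup>2" if i: "i \<in> I" for i
    unfolding \<rho>_def using bexp_ratio_sq[of "\<nu> i" "\<nu>' i"] qp[OF i] dbd[OF i] \<delta> by (auto simp: \<Delta>_def intro!: divide_left_mono)
  have Amono: "A S \<le> A T" if "finite T" "S \<subseteq> T" "T \<subseteq> I" for S T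
  proof -
    have "A T = A (T - S) * A S" unfolding A_def using that by (intro prod.subset_diff) auto
    moreover have "1 \<le> A (T - S)" unfolding A_def using that m1 by (intro prod_ge_1) auto
    moreover have "0 \<le> A S" unfolding A_def using that by (intro prod_nonneg ballI order_trans[OF zero_le_one m1(1)]) auto
    ultimately show ?thesis using mult_right_mono[of 1 "A (T - S)" "A S"] by simp
  qed
  have AK: "A S \<le> K" if "finite S" "S \<subseteq> I" for S
    unfolding A_def using that by (intro Kbd m1) (auto intro: order_trans[OF zero_le_one m1(1)])
  have Pint: "integrable ?M (P S)" if "finite S" "S \<subseteq> I" for S
    using integrable_prod_bits[of S I \<nu> \<rho>] that qp by (simp add: P_def[abs_def])
  \<comment> \<open>The partial products form a martingale: the factors outside \<open>S\<close>
    have mean 1, so the mixed term has integral \<open>A S\<close> and increments are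
    orthogonal.\<close>
  have L2: "integrable ?M (\<lambda>z. (P T z - P S z)\<^sup>2)" "(\<integral>z. (P T z - P S z)\<^sup>2 \<partial>?M) = A T - A S" if ST: "finite T" "S \<subseteq> T" "T \<subseteq> I" for S T
  proof -
    have fS: "finite S" "S \<subseteq> I" using ST by (auto intro: finite_subset)
    have TT: "(\<lambda>z. (P T z)\<^sup>2) = (\<lambda>z. \<Prod>i\<in>T. (\<rho> i (z i))\<^sup>2)" "(\<lambda>z. (P S z)\<^sup>2) = (\<lambda>z. \<Prod>i\<in>S. (\<rho> i (z i))\<^sup>2)"
      by (auto simp: P_def prod_power_distrib)
    have TS: "(\<lambda>z. P T z * P S z) = (\<lambda>z. \<Prod>i\<in>T. (if i \<in> S then (\<rho> i (z i))\<^sup>2 else \<rho> i (z i)))"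
    proof
      fix z
      have "P T z = (\<Prod>i\<in>T - S. \<rho> i (z i)) * P S z" unfolding P_def using ST by (intro prod.subset_diff) auto
      moreover have "(\<Prod>i\<in>T. (if i \<in> S then (\<rho> i (z i))\<^sup>2 else \<rho> i (z i))) = (\<Prod>i\<in>T - S. \<rho> i (z i)) * (\<Prod>i\<in>S. (\<rho> i (z i))\<^sup>2)"
        using ST by (subst prod.subset_diff[of S T]) auto
      ultimately show "P T z * P S z = (\<Prod>i\<in>T. (if i \<in> S then (\<rho> i (z i))\<^sup>2 else \<rho> i (z i)))"
        by (simp add: P_def prod_power_distrib power2_eq_square prod.distrib)
    qed
    have i1: "integrable ?M (\<lambda>z. (P T z)\<^sup>2)" "(\<integral>z. (P T z)\<^sup>2 \<partial>?M) = A T"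
      using integrable_prod_bits[of T I \<nu> "\<lambda>i y. (\<rho> i y)\<^sup>2"] integral_prod_bits[of T I \<nu> "\<lambda>i y. (\<rho> i y)\<^sup>2"] ST qp
      by (auto simp: TT A_def)
    have i2: "integrable ?M (\<lambda>z. (P S z)\<^sup>2)" "(\<integral>z. (P S z)\<^sup>2 \<partial>?M) = A S"
      using integrable_prod_bits[of S I \<nu> "\<lambda>i y. (\<rho> i y)\<^sup>2"] integral_prod_bits[of S I \<nu> "\<lambda>i y. (\<rho> i y)\<^sup>2"] fS qp
      by (auto simp: TT A_def)
    let ?u = "\<lambda>i y. if i \<in> S then (\<rho> i y)\<^sup>2 else \<rho> i y"
    have "(\<Prod>i\<in>T. bexp (\<nu> i) (?u i)) = (\<Prod>i\<in>T - S. bexp (\<nu> i) (?u i)) * (\<Prod>i\<in>S. bexp (\<nu> i) (?u i))"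
      using ST by (intro prod.subset_diff) auto
    also have "(\<Prod>i\<in>T - S. bexp (\<nu> i) (?u i)) = (\<Prod>i\<in>T - S. 1)"
      using ST qp by (intro prod.cong refl) (auto simp: \<rho>_def bexp_ratio subset_iff)
    finally have AS: "(\<Prod>i\<in>T. bexp (\<nu> i) (?u i)) = A S" by (simp add: A_def)
    have i3: "integrable ?M (\<lambda>z. P T z * P S z)" "(\<integral>z. P T z * P S z \<partial>?M) = A S"
      using integrable_prod_bits[of T I \<nu> ?u] integral_prod_bits[of T I \<nu> ?u] ST qp
      by (auto simp: TS AS)
    have e: "(P T z - P S z)\<^sup>2 = (P T z)\<^sup>2 - 2 * (P T z * P S z) + (P S z)\<^sup>2" for z by (simp add: power2_diff)
    show "integrable ?M (\<lambda>z. (P T z - P S z)\<^sup>2)" unfolding e using i1 i2 i3 by auto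
    show "(\<integral>z. (P T z - P S z)\<^sup>2 \<partial>?M) = A T - A S" unfolding e using i1 i2 i3 by simp
  qed
  \<comment> \<open>The arithmetic-geometric mean inequality with weight \<open>e\<close> turns the
    bound on the second moment into one on the first.\<close>
  have L1: "(\<integral>z. \<bar>P T z - P S z\<bar> \<partial>?M) \<le> e" if ST: "finite T" "S \<subseteq> T" "T \<subseteq> I" and e: "0 < e" "A T - A S \<le> e\<^sup>2" for S T e
  proof -
    have fS: "finite S" "S \<subseteq> I" using ST by (auto intro: finite_subset)
    have "\<bar>x\<bar> \<le> e / 2 + x\<^sup>2 / (2 * e)" for x :: real
    proof -
      have "0 \<le> (\<bar>x\<bar> - e)\<^sup>2" by simp
      then have "2 * e * \<bar>x\<bar> \<le> e\<^sup>2 + x\<^sup>2" by (simp add: power2_diff algebra_simps)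
      then show ?thesis using e by (simp add: field_simps power2_eq_square)
    qed
    then have "(\<integral>z. \<bar>P T z - P S z\<bar> \<partial>?M) \<le> (\<integral>z. e / 2 + (P T z - P S z)\<^sup>2 / (2 * e) \<partial>?M)"
      using Pint[OF ST(1,3)] Pint[OF fS] L2[OF ST] by (intro integral_mono) auto
    also have "\<dots> = e / 2 + (A T - A S) / (2 * e)" using L2[OF ST] prob_space by simp
    also have "\<dots> \<le> e" using e by (simp add: field_simps power2_eq_square)
    finally show ?thesis .
  qed
  obtain S where S: "incseq S" "\<And>n. finite (S n)" "(\<Union>n. S n) = I" using countable_exhaust[OF I] by blast
  have SI: "S n \<subseteq> I" for n using S(3) by auto
  have "incseq (\<lambda>n. A (S n))" using S SI by (auto simp: incseq_def intro!: Amono)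
  moreover have "A (S n) \<le> K" for n using AK S SI by blast
  ultimately obtain AL where AL: "(\<lambda>n. A (S n)) \<longlonglongrightarrow> AL" "\<And>n. A (S n) \<le> AL" using incseq_convergent by metis
  have cau: "\<exists>N. \<forall>i\<ge>N. \<forall>j\<ge>N. (\<integral>z. norm (P (S i) z - P (S j) z) \<partial>?M) \<le> e" if e: "0 < e" for e
  proof -
    from LIMSEQ_D[OF AL(1), of "e\<^sup>2"] e obtain N where N: "\<And>n. n \<ge> N \<Longrightarrow> AL - A (S n) < e\<^sup>2" using AL(2)
      by (auto simp: abs_if split: if_splits) (smt (verit))
    have *: "(\<integral>z. norm (P (S j) z - P (S i) z) \<partial>?M) \<le> e" if "N \<le> i" "i \<le> j" for i j
      using N[OF that(1)] AL(2)[of j] that S SI e by (simp, intro L1) (auto simp: incseq_def)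
    have "(\<integral>z. norm (P (S i) z - P (S j) z) \<partial>?M) \<le> e" if "N \<le> i" "N \<le> j" for i j
      using *[of i j] *[of j i] that by (cases "i \<le> j") (auto simp: abs_minus_commute)
    then show ?thesis by blast
  qed
  obtain r where r: "strict_mono r" "AE z in ?M. Cauchy (\<lambda>k. P (S (r k)) z)"
  proof (rule cauchy_L1_AE_cauchy_subseq[of ?M "\<lambda>n. P (S n)"])
    show "integrable ?M (P (S n))" for n using S SI by (intro Pint) auto
    fix e :: real assume e: "0 < e"
    then obtain N where "\<forall>i\<ge>N. \<forall>j\<ge>N. (\<integral>z. norm (P (S i) z - P (S j) z) \<partial>?M) \<le> e / 2" using cau[of "e/2"] by auto
    moreover have "e / 2 < e" using e by simp
    ultimately show "\<exists>N. \<forall>i\<ge>N. \<forall>j\<ge>N. (\<integral>z. norm (P (S i) z - P (S j) z) \<partial>?M) < e"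
      by (meson le_less_trans)
  qed blast
  define T where "T k = S (r k)" for k
  have T: "finite (T k)" "T k \<subseteq> I" for k using S SI by (auto simp: T_def)
  have Tev: "\<forall>\<^sub>F k in sequentially. J \<subseteq> T k" if J: "finite J" "J \<subseteq> I" for J
  proof -
    have "\<exists>n. J \<subseteq> S n" using J
    proof (induction J rule: finite_induct)
      case (insert j J)
      then obtain n m where "J \<subseteq> S n" "j \<in> S m" using S(3) by auto
      then have "insert j J \<subseteq> S (max n m)" using S(1) unfolding incseq_def
        by (meson insert_subset max.cobounded1 max.cobounded2 order_trans subsetD)
      then show ?case by blast
    qed auto
    then obtain n where "J \<subseteq> S n" by blast
    moreover have "S n \<subseteq> T k" if "n \<le> k" for k
      using S(1) seq_suble[OF r(1), of k] that unfolding T_def incseq_def by (meson order_trans)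
    ultimately show ?thesis unfolding eventually_sequentially by blast
  qed
  define D where "D z = (if Cauchy (\<lambda>k. P (T k) z) then lim (\<lambda>k. P (T k) z) else 0)" for z
  have PTm [measurable]: "P (T k) \<in> borel_measurable ?M" for k by (rule Pm[OF T(2)])
  have Dm [measurable]: "D \<in> borel_measurable ?M"
    unfolding D_def[abs_def]
    by (rule measurable_If[OF borel_measurable_lim_metric[OF PTm] _ sets_Collect_Cauchy[OF PTm]]) simp
  have lim: "(\<lambda>k. P (T k) z) \<longlonglongrightarrow> D z" if "Cauchy (\<lambda>k. P (T k) z)" for z
    using that by (simp add: D_def Cauchy_convergent_iff convergent_LIMSEQ_iff)
  have D0: "0 \<le> D z" for z
  proof (cases "Cauchy (\<lambda>k. P (T k) z)")
    case True from lim[OF this] show ?thesis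
      by (rule LIMSEQ_le_const) (use Pp[OF T(2)] in \<open>auto intro!: less_imp_le\<close>)
  qed (simp add: D_def)
  have limAE: "AE z in ?M. (\<lambda>k. P (T k) z) \<longlonglongrightarrow> D z"
    using r(2) by eventually_elim (rule lim, simp add: T_def)
  \<comment> \<open>All late partial products change by the same factor when coordinate
    \<open>j\<close> is changed, so convergence at one point is equivalent to convergence at the
    other. With the value 0 elsewhere the rule holds at every point; this matters because the
    perturbation estimates for \<open>Th\<close> are pointwise.\<close>
  have upd: "D (z(j := y)) * \<rho> j (z j) = D z * \<rho> j y" if z: "z \<in> I \<rightarrow>\<^sub>E UNIV" and j: "j \<in> I" for z j y
  proof -
    have *: "P (T k) (z(j := y)) = P (T k) z * (\<rho> j y / \<rho> j (z j))" if "j \<in> T k" for k z y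
    proof -
      have "P (T k) (z(j := y)) = \<rho> j y * (\<Prod>i\<in>T k - {j}. \<rho> i ((z(j := y)) i))"
        unfolding P_def using that T by (subst prod.remove[of _ j]) auto
      also have "(\<Prod>i\<in>T k - {j}. \<rho> i ((z(j := y)) i)) = (\<Prod>i\<in>T k - {j}. \<rho> i (z i))" by (intro prod.cong) auto
      finally have "P (T k) (z(j := y)) = \<rho> j y * (\<Prod>i\<in>T k - {j}. \<rho> i (z i))" .
      moreover have "P (T k) z = \<rho> j (z j) * (\<Prod>i\<in>T k - {j}. \<rho> i (z i))"
        unfolding P_def using that T by (intro prod.remove) auto
      ultimately show ?thesis using \<rho>p[OF j, of "z j"] by simp
    qed
    have ev: "\<forall>\<^sub>F k in sequentially. j \<in> T k" using Tev[of "{j}"] j by simp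
    have lim': "(\<lambda>k. P (T k) (z(j := y))) \<longlonglongrightarrow> L * (\<rho> j y / \<rho> j (z j))" if "(\<lambda>k. P (T k) z) \<longlonglongrightarrow> L" for z L y
      by (rule Lim_transform_eventually[OF tendsto_mult_right[OF that]])
        (use ev in \<open>auto elim!: eventually_mono simp: *\<close>)
    show ?thesis
    proof (cases "Cauchy (\<lambda>k. P (T k) z)")
      case True
      from lim'[OF lim[OF this]] have l: "(\<lambda>k. P (T k) (z(j := y))) \<longlonglongrightarrow> D z * (\<rho> j y / \<rho> j (z j))" .
      then have "Cauchy (\<lambda>k. P (T k) (z(j := y)))" by (rule LIMSEQ_imp_Cauchy)
      from LIMSEQ_unique[OF l lim[OF this]] show ?thesis using \<rho>p[OF j, of "z j"] by (simp add: field_simps)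
    next
      case False
      have "\<not> Cauchy (\<lambda>k. P (T k) (z(j := y)))"
      proof
        assume "Cauchy (\<lambda>k. P (T k) (z(j := y)))"
        from lim'[OF lim[OF this], of "z j"] have "Cauchy (\<lambda>k. P (T k) (z(j := y, j := z j)))" by (rule LIMSEQ_imp_Cauchy)
        then show False using False by simp
      qed
      then show ?thesis using False by (simp add: D_def)
    qed
  qed
  \<comment> \<open>Fatou's lemma along the subsequence upgrades almost everywhere convergence to
    convergence in the mean.\<close>
  have L1lim: "\<forall>\<^sub>F n in sequentially. (\<integral>\<^sup>+z. ennreal \<bar>D z - P (T n) z\<bar> \<partial>?M) \<le> ennreal e" if e: "0 < e" for e
  proof -
    obtain N where N: "\<And>i j. i \<ge> N \<Longrightarrow> j \<ge> N \<Longrightarrow> (\<integral>z. norm (P (S i) z - P (S j) z) \<partial>?M) \<le> e" using cau[OF e] by blast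
    have "(\<integral>\<^sup>+z. ennreal \<bar>D z - P (T n) z\<bar> \<partial>?M) \<le> ennreal e" if n: "n \<ge> N" for n
    proof -
      have "(\<integral>\<^sup>+z. ennreal \<bar>D z - P (T n) z\<bar> \<partial>?M) = (\<integral>\<^sup>+z. liminf (\<lambda>k. ennreal \<bar>P (T k) z - P (T n) z\<bar>) \<partial>?M)"
      proof (rule nn_integral_cong_AE, use limAE in eventually_elim)
        case (elim z)
        then have "(\<lambda>k. ennreal \<bar>P (T k) z - P (T n) z\<bar>) \<longlonglongrightarrow> ennreal \<bar>D z - P (T n) z\<bar>"
          by (intro tendsto_intros tendsto_ennrealI) auto
        then show ?case by (rule lim_imp_Liminf[OF sequentially_bot, symmetric])
      qed
      also have "\<dots> \<le> liminf (\<lambda>k. \<integral>\<^sup>+z. ennreal \<bar>P (T k) z - P (T n) z\<bar> \<partial>?M)"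
        by (intro nn_integral_liminf) measurable
      also have "\<dots> \<le> liminf (\<lambda>k::nat. ennreal e)"
      proof (rule Liminf_mono)
        show "\<forall>\<^sub>F k in sequentially. (\<integral>\<^sup>+z. ennreal \<bar>P (T k) z - P (T n) z\<bar> \<partial>?M) \<le> ennreal e"
        proof (rule eventually_sequentiallyI[of N])
          fix k assume k: "N \<le> k"
          have "(\<integral>\<^sup>+z. ennreal \<bar>P (T k) z - P (T n) z\<bar> \<partial>?M) = ennreal (\<integral>z. \<bar>P (T k) z - P (T n) z\<bar> \<partial>?M)"
            using Pint[OF T] by (intro nn_integral_eq_integral) auto
          also have "\<dots> \<le> ennreal e"
            using N[of "r k" "r n"] seq_suble[OF r(1), of k] seq_suble[OF r(1), of n] k n by (intro ennreal_leI) (simp add: T_def)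
          finally show "(\<integral>\<^sup>+z. ennreal \<bar>P (T k) z - P (T n) z\<bar> \<partial>?M) \<le> ennreal e" .
        qed
      qed
      also have "\<dots> = ennreal e" by (simp add: Liminf_const)
      finally show ?thesis .
    qed
    then show ?thesis unfolding eventually_sequentially by blast
  qed
  have Dint: "integrable ?M D"
  proof -
    obtain n where n: "(\<integral>\<^sup>+z. ennreal \<bar>D z - P (T n) z\<bar> \<partial>?M) \<le> ennreal 1"
      using eventually_happens'[OF sequentially_bot L1lim[of 1]] by auto
    have "integrable ?M (\<lambda>z. D z - P (T n) z)"
      using n by (intro integrableI_bounded) (auto intro: le_less_trans)
    from Bochner_Integration.integrable_add[OF this Pint[OF T, of n]] show ?thesis by simp
  qed
  have dens: "bits I \<nu>' = density ?M (\<lambda>z. ennreal (D z))"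
  proof (rule cyl_eqI[of _ I \<nu>])
    show "sets (bits I \<nu>') = sets ?M" by (rule sets_bits_cong)
    show "sets (density ?M (\<lambda>z. ennreal (D z))) = sets ?M" by simp
    show "finite_measure (bits I \<nu>')" using prob_space_bits by (rule prob_space.finite_measure)
    fix J y assume J: "finite J" "J \<subseteq> I"
    have C [measurable]: "cyl I J y \<in> sets ?M" using sets_cyl[OF J] .
    let ?c = "\<Prod>i\<in>J. pmf (\<nu>' i) (y i)"
    let ?d = "\<integral>z. D z * indicator (cyl I J y) z \<partial>?M"
    have dI: "integrable ?M (\<lambda>z. D z * indicator (cyl I J y) z)"
      using Dint by (rule integrable_real_mult_indicator[OF C])
    have "\<bar>?d - ?c\<bar> \<le> e" if e: "0 < e" for e
    proof -
      obtain n where n: "J \<subseteq> T n" "(\<integral>\<^sup>+z. ennreal \<bar>D z - P (T n) z\<bar> \<partial>?M) \<le> ennreal e"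
        using eventually_happens'[OF sequentially_bot eventually_conj[OF Tev[OF J] L1lim[OF e]]] by auto
      \<comment> \<open>The indicator of the cylinder is absorbed into the factors, so the integral
        over the cylinder is again a product. It has the exact value as soon as
        \<open>J \<subseteq> T n\<close>.\<close>
      let ?u = "\<lambda>i t. \<rho> i t * (if i \<in> J \<and> t \<noteq> y i then 0 else 1)"
      have pr: "P (T n) z * indicator (cyl I J y) z = (\<Prod>i\<in>T n. ?u i (z i))" if zs: "z \<in> space ?M" for z
      proof -
        have "(\<Prod>i\<in>T n. (if i \<in> J \<and> z i \<noteq> y i then 0 else 1::real)) = indicator (cyl I J y) z"
        proof (cases "z \<in> cyl I J y")
          case True then show ?thesis by (auto simp: cyl_def intro!: prod.neutral)
        next
          case False
          then obtain i where "i \<in> J" "z i \<noteq> y i" using zs unfolding cyl_def space_bits by blast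
          then have "(\<Prod>i\<in>T n. (if i \<in> J \<and> z i \<noteq> y i then 0 else 1::real)) = 0"
            using n(1) T by (intro prod_zero) auto
          then show ?thesis using False by simp
        qed
        then show ?thesis by (simp add: P_def prod.distrib)
      qed
      have "(\<integral>z. P (T n) z * indicator (cyl I J y) z \<partial>?M) = (\<integral>z. (\<Prod>i\<in>T n. ?u i (z i)) \<partial>?M)"
        by (rule Bochner_Integration.integral_cong[OF refl pr])
      also have "\<dots> = (\<Prod>i\<in>T n. bexp (\<nu> i) (?u i))" using integral_prod_bits[of "T n" I \<nu> ?u] T qp by auto
      also have "\<dots> = (\<Prod>i\<in>T n. if i \<in> J then pmf (\<nu>' i) (y i) else 1)"
      proof (rule prod.cong[OF refl])
        fix i assume "i \<in> T n"
        then have i: "i \<in> I" using T by auto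
        show "bexp (\<nu> i) (?u i) = (if i \<in> J then pmf (\<nu>' i) (y i) else 1)"
        proof (cases "i \<in> J")
          case True
          have "pmf (\<nu> i) True \<noteq> 0" "pmf (\<nu> i) False \<noteq> 0" using qp[OF i] by (metis less_irrefl)+
          then show ?thesis using True by (cases "y i") (auto simp: bexp_def \<rho>_def)
        next
          case False
          then show ?thesis using bexp_ratio[of "\<nu> i" "\<nu>' i"] qp[OF i] by (simp add: \<rho>_def)
        qed
      qed
      also have "\<dots> = ?c" using n(1) T by (simp add: prod.If_cases Int_absorb1)
      finally have c: "(\<integral>z. P (T n) z * indicator (cyl I J y) z \<partial>?M) = ?c" .
      have PI: "integrable ?M (\<lambda>z. P (T n) z * indicator (cyl I J y) z)"
        using Pint[OF T] by (rule integrable_real_mult_indicator[OF C])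
      have "?d - ?c = (\<integral>z. (D z - P (T n) z) * indicator (cyl I J y) z \<partial>?M)"
        using dI PI by (simp add: c[symmetric] left_diff_distrib)
      also have "\<bar>\<dots>\<bar> \<le> (\<integral>z. \<bar>(D z - P (T n) z) * indicator (cyl I J y) z\<bar> \<partial>?M)" by (rule integral_abs_bound)
      also have "\<dots> \<le> (\<integral>z. \<bar>D z - P (T n) z\<bar> \<partial>?M)"
        using dI PI Dint Pint[OF T, of n] by (intro integral_mono) (auto simp: left_diff_distrib indicator_def)
      also have "\<dots> \<le> e"
      proof -
        have "ennreal (\<integral>z. \<bar>D z - P (T n) z\<bar> \<partial>?M) = (\<integral>\<^sup>+z. ennreal \<bar>D z - P (T n) z\<bar> \<partial>?M)"
          using Dint Pint[OF T, of n] by (intro nn_integral_eq_integral[symmetric]) auto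
        then have "ennreal (\<integral>z. \<bar>D z - P (T n) z\<bar> \<partial>?M) \<le> ennreal e" using n(2) by simp
        then show ?thesis using e by (simp add: ennreal_le_iff)
      qed
      finally show ?thesis .
    qed
    then have "\<bar>?d - ?c\<bar> \<le> 0" by (rule_tac field_le_epsilon) simp
    then have "?d = ?c" by simp
    have "emeasure (density ?M (\<lambda>z. ennreal (D z))) (cyl I J y) = (\<integral>\<^sup>+z. ennreal (D z * indicator (cyl I J y) z) \<partial>?M)"
      by (subst emeasure_density) (auto intro!: nn_integral_cong simp: indicator_def)
    also have "\<dots> = ennreal ?d" using dI D0 by (intro nn_integral_eq_integral) auto
    also have "\<dots> = ennreal ?c" using \<open>?d = ?c\<close> by simp
    finally show "emeasure (bits I \<nu>') (cyl I J y) = emeasure (density ?M (\<lambda>z. ennreal (D z))) (cyl I J y)"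
      using emeasure_cyl[OF J, of \<nu>' y] by simp
  qed
  \<comment> \<open>The integrals of \<open>1 / P (T k)\<close> are bounded by \<open>K\<close>, by
    \<open>bexp_ratio_inverse\<close>. Where the limit is 0 these functions tend to \<infinity>, and
    Fatou's lemma makes this a null set.\<close>
  have Dpos: "AE z in ?M. 0 < D z"
  proof -
    have "(\<integral>\<^sup>+z. liminf (\<lambda>k. ennreal (1 / P (T k) z)) \<partial>?M) \<le> liminf (\<lambda>k. \<integral>\<^sup>+z. ennreal (1 / P (T k) z) \<partial>?M)"
      by (intro nn_integral_liminf) measurable
    also have "\<dots> \<le> liminf (\<lambda>k::nat. ennreal K)"
    proof (rule Liminf_mono, rule always_eventually, rule allI)
      fix k
      have e: "1 / P (T k) z = (\<Prod>i\<in>T k. 1 / \<rho> i (z i))" for z by (simp add: P_def prod_dividef)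
      have "(\<integral>\<^sup>+z. ennreal (1 / P (T k) z) \<partial>?M) = ennreal (\<integral>z. 1 / P (T k) z \<partial>?M)"
        unfolding e using integrable_prod_bits[of "T k" I \<nu> "\<lambda>i y. 1 / \<rho> i y"] T qp \<rho>p
        by (intro nn_integral_eq_integral AE_I2 prod_nonneg) (auto intro!: less_imp_le \<rho>p subsetD[OF T(2)[of k]])
      also have "(\<integral>z. 1 / P (T k) z \<partial>?M) = (\<Prod>i\<in>T k. bexp (\<nu> i) (\<lambda>y. 1 / \<rho> i y))"
        unfolding e using integral_prod_bits[of "T k" I \<nu> "\<lambda>i y. 1 / \<rho> i y"] T qp by auto
      also have "\<dots> \<le> K"
      proof (rule Kbd[OF T])
        fix i assume i: "i \<in> I"
        show "0 \<le> bexp (\<nu> i) (\<lambda>y. 1 / \<rho> i y)" unfolding bexp_def using \<rho>p[OF i] by (auto intro!: add_nonneg_nonneg mult_nonneg_nonneg simp: less_imp_le)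
        show "bexp (\<nu> i) (\<lambda>y. 1 / \<rho> i y) \<le> 1 + \<Delta> i / \<delta>\<^sup>2"
          using bexp_ratio_inverse[of "\<nu> i" "\<nu>' i"] qp[OF i] pp[OF i] dbd[OF i] \<delta>
          by (auto simp: \<Delta>_def \<rho>_def intro!: divide_left_mono)
      qed
      finally show "(\<integral>\<^sup>+z. ennreal (1 / P (T k) z) \<partial>?M) \<le> ennreal K" by (simp add: ennreal_leI)
    qed
    also have "\<dots> < \<infinity>" by (simp add: Liminf_const)
    finally have "AE z in ?M. liminf (\<lambda>k. ennreal (1 / P (T k) z)) \<noteq> \<infinity>"
      by (intro nn_integral_noteq_infinite) auto
    then show ?thesis using limAE
    proof eventually_elim
      case (elim z)
      show ?case
      proof (rule ccontr)
        assume "\<not> 0 < D z"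
        then have "(\<lambda>k. P (T k) z) \<longlonglongrightarrow> 0" using elim(2) D0[of z] by simp
        then have "filterlim (\<lambda>k. inverse (P (T k) z)) at_top sequentially"
          using Pp[OF T(2)] by (intro filterlim_inverse_at_top) auto
        then have "(\<lambda>k. ennreal (1 / P (T k) z)) \<longlonglongrightarrow> \<infinity>"
          by (simp add: inverse_eq_divide ennreal_tendsto_top_eq_at_top)
        then show False using elim(1) lim_imp_Liminf[OF sequentially_bot] by metis
      qed
    qed
  qed
  show thesis
    by (rule that[OF Dm D0 Dpos dens upd T]) (use limAE in \<open>auto simp: P_def\<close>)
qed

section \<open>The densities of the translates\<close>

text \<open>Square summability of the cocycles is kept out of this locale: it is derived here from
  nonsingularity, and the locale is instantiated a second time with constant marginals.\<close>

locale elliptic_marginals = group G for G (structure) +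
  fixes \<mu> :: "'a \<Rightarrow> bool pmf" and \<delta> :: real
  assumes countable_carrier: "countable (carrier G)" and infinite_carrier: "infinite (carrier G)"
    and \<delta>_pos: "0 < \<delta>"
    and marginal: "\<And>g. g \<in> carrier G \<Longrightarrow> pmf (\<mu> g) False \<in> {\<delta>..1 - \<delta>}"
begin

abbreviation M where "M \<equiv> bits (carrier G) \<mu>"
abbreviation act where "act \<equiv> bernoulli_action G"
abbreviation coc where "coc \<equiv> bernoulli_cocycle G \<mu>"
definition sh where "sh g h = \<mu> (inv g \<otimes> h)"
definition ratio where "ratio g j y = pmf (sh g j) y / pmf (\<mu> j) y"
definition wt where "wt g = l2_norm_sq G (coc g)"

sublocale prob_space M by (rule prob_space_bits)

lemma marg_ge: "j \<in> carrier G \<Longrightarrow> \<delta> \<le> pmf (\<mu> j) y"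
  using marginal[of j] by (cases y) (auto simp: pmf_bool_True)

lemma marg_pos: "j \<in> carrier G \<Longrightarrow> 0 < pmf (\<mu> j) y"
  using marg_ge[of j y] \<delta>_pos by linarith

lemma marg_le: "j \<in> carrier G \<Longrightarrow> pmf (\<mu> j) y \<le> 1 - \<delta>"
  using marginal[of j] by (cases y) (auto simp: pmf_bool_True)

lemma sh_marg_ge: "g \<in> carrier G \<Longrightarrow> j \<in> carrier G \<Longrightarrow> \<delta> \<le> pmf (sh g j) y"
  unfolding sh_def by (rule marg_ge) auto

lemma ratio_pos: "g \<in> carrier G \<Longrightarrow> j \<in> carrier G \<Longrightarrow> 0 < ratio g j y"
  unfolding ratio_def using sh_marg_ge[of g j y] marg_pos[of j y] \<delta>_pos by (intro divide_pos_pos) linarith+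

lemma act_apply: "x \<in> carrier G \<rightarrow>\<^sub>E UNIV \<Longrightarrow> h \<in> carrier G \<Longrightarrow> act g x h = x (inv g \<otimes> h)"
  by (simp add: bernoulli_action_def)

lemma act_space: "x \<in> carrier G \<rightarrow>\<^sub>E UNIV \<Longrightarrow> act g x \<in> carrier G \<rightarrow>\<^sub>E UNIV"
  by (simp add: bernoulli_action_def)

lemma act_mult: "x \<in> carrier G \<rightarrow>\<^sub>E UNIV \<Longrightarrow> g \<in> carrier G \<Longrightarrow> h \<in> carrier G \<Longrightarrow> act g (act h x) = act (g \<otimes> h) x"
  by (rule PiE_ext[OF act_space act_space]) (auto simp: act_space act_apply inv_mult_group m_assoc)

lemma act_one: "x \<in> carrier G \<rightarrow>\<^sub>E UNIV \<Longrightarrow> act \<one> x = x"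
  by (rule PiE_ext[OF act_space]) (auto simp: act_apply)

lemma act_inv: "x \<in> carrier G \<rightarrow>\<^sub>E UNIV \<Longrightarrow> g \<in> carrier G \<Longrightarrow> act (inv g) (act g x) = x"
  "x \<in> carrier G \<rightarrow>\<^sub>E UNIV \<Longrightarrow> g \<in> carrier G \<Longrightarrow> act g (act (inv g) x) = x"
  by (simp_all add: act_mult act_one)

lemma act_measurable [measurable]: "g \<in> carrier G \<Longrightarrow> act g \<in> measurable M M"
proof (rule measurable_PiM_single')
  fix i assume i: "i \<in> carrier G" and g: "g \<in> carrier G"
  have eq: "act g x i = x (inv g \<otimes> i)" if "x \<in> space M" for x
    using that i by (simp add: act_apply)
  have "(\<lambda>x. x (inv g \<otimes> i)) \<in> measurable M (measure_pmf (\<mu> i))"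
    using measurable_bits_coord[of "inv g \<otimes> i" "carrier G" \<mu>] g i
      measurable_cong_sets[OF refl sets_measure_pmf_count_space, of M "\<mu> i"] by simp
  then show "(\<lambda>x. act g x i) \<in> measurable M (measure_pmf (\<mu> i))"
    using measurable_cong[OF eq, of M "\<lambda>x. x" "measure_pmf (\<mu> i)"] by blast
next
  show "act g \<in> space M \<rightarrow> (\<Pi>\<^sub>E i\<in>carrier G. space (measure_pmf (\<mu> i)))"
    by (rule Pi_I) (simp only: space_bits space_measure_pmf act_space)
qed

lemma distr_act: assumes g: "g \<in> carrier G" shows "distr M M (act g) = bits (carrier G) (sh g)"
proof -
  have "distr M (bits (carrier G) (sh g)) (\<lambda>\<omega>. \<lambda>n\<in>carrier G. \<omega> (inv g \<otimes> n)) = bits (carrier G) (sh g)"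
    unfolding sh_def
    by (rule distr_PiM_reindex[where f = "\<lambda>h. inv g \<otimes> h"])
      (use g in \<open>auto intro!: inj_onI measure_pmf.prob_space_axioms\<close>)
  moreover have "distr M M (act g) = distr M (bits (carrier G) (sh g)) (\<lambda>\<omega>. \<lambda>n\<in>carrier G. \<omega> (inv g \<otimes> n))"
    by (rule distr_cong) (auto simp: bernoulli_action_def sets_bits_cong[of "carrier G" \<mu> "sh g"])
  ultimately show ?thesis by simp
qed

end

locale bernoulli = elliptic_marginals G \<mu> \<delta> for G (structure) and \<mu> \<delta> +
  assumes square_summable: "\<And>g. g \<in> carrier G \<Longrightarrow> (\<lambda>h. (bernoulli_cocycle G \<mu> g h)\<^sup>2) summable_on carrier G"
begin

lemma coc_alt: "coc g h = pmf (\<mu> h) False - pmf (sh g h) False"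
  by (simp add: bernoulli_cocycle_def sh_def)

lemma wt_nonneg: "0 \<le> wt g"
  unfolding wt_def l2_norm_sq_def by (rule infsum_nonneg) simp

lemma wt_sum: "g \<in> carrier G \<Longrightarrow> finite S \<Longrightarrow> S \<subseteq> carrier G \<Longrightarrow> (\<Sum>h\<in>S. (coc g h)\<^sup>2) \<le> wt g"
  unfolding wt_def l2_norm_sq_def by (rule finite_sum_le_infsum[OF square_summable]) auto

lemma coc_mult:
  "g \<in> carrier G \<Longrightarrow> h \<in> carrier G \<Longrightarrow> k \<in> carrier G \<Longrightarrow> coc (g \<otimes> h) k = coc g k + coc h (inv g \<otimes> k)"
  by (simp add: bernoulli_cocycle_def inv_mult_group m_assoc)

lemma sq_add_le: "0 < t \<Longrightarrow> (a + b)\<^sup>2 \<le> (1 + t) * a\<^sup>2 + (1 + 1 / t) * (b::real)\<^sup>2"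
proof -
  assume t: "0 < t"
  have "0 \<le> (t * a - b)\<^sup>2 / t" using t by simp
  also have "\<dots> = t * a\<^sup>2 - 2 * a * b + b\<^sup>2 / t" using t by (simp add: power2_eq_square field_simps)
  finally show ?thesis by (simp add: power2_eq_square algebra_simps)
qed

text \<open>A quasi-triangle inequality from the cocycle identity. The parameter \<open>t\<close>
  brings the factor of \<open>wt g\<close> as close to 1 as desired; losing a fixed factor instead
  would exceed the margin that the strict inequality for \<kappa> leaves.\<close>

lemma wt_mult:
  assumes g: "g \<in> carrier G" and h: "h \<in> carrier G" and t: "0 < t"
  shows "wt (g \<otimes> h) \<le> (1 + t) * wt g + (1 + 1 / t) * wt h"
proof -
  have gh: "g \<otimes> h \<in> carrier G" using g h by simp
  have "(\<Sum>k\<in>S. (coc (g \<otimes> h) k)\<^sup>2) \<le> (1 + t) * wt g + (1 + 1 / t) * wt h" if S: "finite S" "S \<subseteq> carrier G" for S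
  proof -
    have "(\<Sum>k\<in>S. (coc (g \<otimes> h) k)\<^sup>2) \<le> (\<Sum>k\<in>S. (1 + t) * (coc g k)\<^sup>2 + (1 + 1 / t) * (coc h (inv g \<otimes> k))\<^sup>2)"
    proof (rule sum_mono)
      fix k assume "k \<in> S"
      then have "k \<in> carrier G" using S by auto
      then show "(coc (g \<otimes> h) k)\<^sup>2 \<le> (1 + t) * (coc g k)\<^sup>2 + (1 + 1 / t) * (coc h (inv g \<otimes> k))\<^sup>2"
        using sq_add_le[OF t, of "coc g k" "coc h (inv g \<otimes> k)"] coc_mult[OF g h] by simp
    qed
    also have "\<dots> = (1 + t) * (\<Sum>k\<in>S. (coc g k)\<^sup>2) + (1 + 1 / t) * (\<Sum>k\<in>S. (coc h (inv g \<otimes> k))\<^sup>2)"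
      by (simp only: sum.distrib sum_distrib_left)
    also have "(\<Sum>k\<in>S. (coc h (inv g \<otimes> k))\<^sup>2) = (\<Sum>k\<in>(\<lambda>k. inv g \<otimes> k) ` S. (coc h k)\<^sup>2)"
      using S g by (subst sum.reindex) (auto intro!: inj_onI simp: subset_iff)
    also have "(1 + t) * (\<Sum>k\<in>S. (coc g k)\<^sup>2) + (1 + 1 / t) * \<dots> \<le> (1 + t) * wt g + (1 + 1 / t) * wt h"
      using t S g h by (intro add_mono mult_left_mono wt_sum) auto
    finally show ?thesis .
  qed
  then show ?thesis unfolding wt_def[of "g \<otimes> h"] l2_norm_sq_def
    by (intro infsum_le_finite_sums square_summable gh) auto
qed

text \<open>\<open>dens g\<close> is the density of \<open>g \<mu>\<close> with respect to \<open>\<mu>\<close>, and \<open>dens_fin g\<close> a sequence of finite sets along which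
  the partial products converge to it.\<close>
definition is_dens where
  "is_dens g p \<longleftrightarrow> (case p of (D, T) \<Rightarrow>
    D \<in> borel_measurable M \<and> (\<forall>z. 0 \<le> D z) \<and> (AE z in M. 0 < D z) \<and>
    bits (carrier G) (sh g) = density M (\<lambda>z. ennreal (D z)) \<and>
    (\<forall>z j y. z \<in> carrier G \<rightarrow>\<^sub>E UNIV \<longrightarrow> j \<in> carrier G \<longrightarrow> D (z(j := y)) * ratio g j (z j) = D z * ratio g j y) \<and>
    (\<forall>k. finite (T k) \<and> T k \<subseteq> carrier G) \<and>
    (AE z in M. (\<lambda>k::nat. \<Prod>i\<in>T k. ratio g i (z i)) \<longlonglongrightarrow> D z))"

definition "dens g = fst (SOME p. is_dens g p)"
definition "dens_fin g = snd (SOME p. is_dens g p)"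

lemma is_dens: assumes g: "g \<in> carrier G" shows "is_dens g (dens g, dens_fin g)"
proof -
  have sm: "(\<lambda>i. (pmf (sh g i) False - pmf (\<mu> i) False)\<^sup>2) summable_on carrier G"
    using square_summable[OF g] by (simp add: coc_alt power2_commute)
  have "\<exists>p. is_dens g p"
  proof (rule product_density[OF countable_carrier \<delta>_pos marg_ge sh_marg_ge[OF g] sm])
    fix D :: "('a \<Rightarrow> bool) \<Rightarrow> real" and T :: "nat \<Rightarrow> 'a set"
    assume a: "D \<in> borel_measurable M" "\<And>z. 0 \<le> D z" "AE z in M. 0 < D z"
      "bits (carrier G) (sh g) = density M (\<lambda>x. ennreal (D x))"
      "\<And>z j y. z \<in> carrier G \<rightarrow>\<^sub>E UNIV \<Longrightarrow> j \<in> carrier G \<Longrightarrow>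
         D (z(j := y)) * (pmf (sh g j) (z j) / pmf (\<mu> j) (z j)) = D z * (pmf (sh g j) y / pmf (\<mu> j) y)"
      "\<And>k. finite (T k)" "\<And>k. T k \<subseteq> carrier G"
      "AE z in M. (\<lambda>k. \<Prod>i\<in>T k. pmf (sh g i) (z i) / pmf (\<mu> i) (z i)) \<longlonglongrightarrow> D z"
    have "is_dens g (D, T)" using a unfolding is_dens_def prod.case ratio_def by blast
    then show ?thesis by blast
  qed
  then have "is_dens g (SOME p. is_dens g p)" by (rule someI_ex)
  then show ?thesis unfolding dens_def dens_fin_def by simp
qed

lemma dens_measurable [measurable]: "g \<in> carrier G \<Longrightarrow> dens g \<in> borel_measurable M"
  and dens_nonneg: "g \<in> carrier G \<Longrightarrow> 0 \<le> dens g z"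
  and dens_pos: "g \<in> carrier G \<Longrightarrow> AE z in M. 0 < dens g z"
  and dens_upd: "g \<in> carrier G \<Longrightarrow> z \<in> carrier G \<rightarrow>\<^sub>E UNIV \<Longrightarrow> j \<in> carrier G \<Longrightarrow> dens g (z(j := y)) * ratio g j (z j) = dens g z * ratio g j y"
  and dens_fin: "g \<in> carrier G \<Longrightarrow> finite (dens_fin g k)" "g \<in> carrier G \<Longrightarrow> dens_fin g k \<subseteq> carrier G"
  and dens_lim: "g \<in> carrier G \<Longrightarrow> AE z in M. (\<lambda>k. \<Prod>i\<in>dens_fin g k. ratio g i (z i)) \<longlonglongrightarrow> dens g z"
  using is_dens[of g] unfolding is_dens_def prod.case by blast+

lemma distr_act_dens: assumes g: "g \<in> carrier G" shows "distr M M (act g) = density M (\<lambda>z. ennreal (dens g z))"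
  using is_dens[OF g] distr_act[OF g] unfolding is_dens_def prod.case by presburger

lemma nn_change:
  assumes g: "g \<in> carrier G" and f [measurable]: "f \<in> borel_measurable M"
  shows "(\<integral>\<^sup>+z. ennreal (dens g z) * f (act (inv g) z) \<partial>M) = (\<integral>\<^sup>+x. f x \<partial>M)"
proof -
  have [measurable]: "act (inv g) \<in> measurable M M" "act g \<in> measurable M M" "dens g \<in> borel_measurable M" using g by auto
  have "(\<integral>\<^sup>+z. ennreal (dens g z) * f (act (inv g) z) \<partial>M) = (\<integral>\<^sup>+z. f (act (inv g) z) \<partial>distr M M (act g))"
    unfolding distr_act_dens[OF g] by (subst nn_integral_density) auto
  also have "\<dots> = (\<integral>\<^sup>+x. f (act (inv g) (act g x)) \<partial>M)" by (rule nn_integral_distr) auto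
  also have "\<dots> = (\<integral>\<^sup>+x. f x \<partial>M)" using g by (intro nn_integral_cong) (simp add: act_inv)
  finally show ?thesis .
qed

text \<open>The right side does not involve \<open>g\<close>. An integral over \<open>M\<close> may
  thus be averaged over a finite set of group elements, which is how \<open>averaging\<close> is
  brought in.\<close>

lemma integral_change:
  fixes f :: "('a \<Rightarrow> bool) \<Rightarrow> real"
  assumes g: "g \<in> carrier G" and f [measurable]: "f \<in> borel_measurable M"
  shows "(\<integral>z. dens g z * f (act (inv g) z) \<partial>M) = (\<integral>x. f x \<partial>M)"
proof -
  have [measurable]: "act (inv g) \<in> measurable M M" "act g \<in> measurable M M" "dens g \<in> borel_measurable M" using g by auto
  have "(\<integral>z. dens g z * f (act (inv g) z) \<partial>M) = (\<integral>z. f (act (inv g) z) \<partial>distr M M (act g))"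
    unfolding distr_act_dens[OF g] by (subst integral_density) (use g in \<open>auto simp: dens_nonneg\<close>)
  also have "\<dots> = (\<integral>x. f (act (inv g) (act g x)) \<partial>M)" by (rule integral_distr) auto
  also have "\<dots> = (\<integral>x. f x \<partial>M)" using g by (intro Bochner_Integration.integral_cong) (auto simp: act_inv)
  finally show ?thesis .
qed

lemma integrable_dens: assumes g: "g \<in> carrier G" shows "integrable M (dens g)" "(\<integral>z. dens g z \<partial>M) = 1"
proof -
  have "(\<integral>\<^sup>+z. ennreal (dens g z) \<partial>M) = 1"
    using nn_change[OF g, of "\<lambda>_. 1"] emeasure_space_1 by simp
  then have "has_bochner_integral M (dens g) 1"
    using g by (intro has_bochner_integral_nn_integral) (auto simp: dens_nonneg)
  then show "integrable M (dens g)" "(\<integral>z. dens g z \<partial>M) = 1" by (auto simp: has_bochner_integral_iff)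
qed

lemma AE_act:
  assumes g: "g \<in> carrier G" and P: "AE x in M. P x" shows "AE x in M. P (act g x)"
proof -
  have "AE x in density M (\<lambda>z. ennreal (dens g z)). P x"
    using P g by (subst AE_density) (auto elim: eventually_mono)
  then show ?thesis unfolding distr_act_dens[OF g, symmetric]
    by (rule AE_distrD[OF act_measurable[OF g]])
qed

text \<open>Both sides are densities of the translate by \<open>g \<otimes> k\<close>, computed in
  two steps or in one; densities are unique almost everywhere.\<close>

lemma dens_cocycle:
  assumes g: "g \<in> carrier G" and k: "k \<in> carrier G"
  shows "AE z in M. dens g z * dens k (act (inv g) z) = dens (g \<otimes> k) z"
proof -
  have [measurable]: "act (inv g) \<in> measurable M M" "act g \<in> measurable M M" "dens g \<in> borel_measurable M"
    "dens k \<in> borel_measurable M" "dens (g \<otimes> k) \<in> borel_measurable M" using g k by auto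
  have "density M (\<lambda>z. ennreal (dens (g \<otimes> k) z)) = distr M M (act (g \<otimes> k))" using g k by (simp add: distr_act_dens)
  also have "\<dots> = distr (distr M M (act k)) M (act g)"
    using g k by (subst distr_distr) (auto intro!: distr_cong simp: act_mult)
  also have "\<dots> = density M (\<lambda>z. ennreal (dens g z * dens k (act (inv g) z)))"
  proof (rule measure_eqI)
    fix A assume "A \<in> sets (distr (distr M M (act k)) M (act g))"
    then have A [measurable]: "A \<in> sets M" by simp
    have vs: "act g -` A \<inter> space M \<in> sets M" by (rule measurable_sets[OF act_measurable[OF g] A])
    have "emeasure (distr (distr M M (act k)) M (act g)) A = emeasure (density M (\<lambda>z. ennreal (dens k z))) (act g -` A \<inter> space M)"
      using k by (subst emeasure_distr) (auto simp: distr_act_dens)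
    also have "\<dots> = (\<integral>\<^sup>+x. ennreal (dens k x) * indicator (act g -` A \<inter> space M) x \<partial>M)"
      by (rule emeasure_density[OF _ vs]) measurable
    also have "\<dots> = (\<integral>\<^sup>+x. ennreal (dens k x) * indicator A (act g x) \<partial>M)"
    proof (rule nn_integral_cong)
      fix x assume "x \<in> space M"
      then have "(indicator (act g -` A \<inter> space M) x :: ennreal) = indicator A (act g x)" unfolding indicator_def by (simp only: Int_iff vimage_eq simp_thms of_bool_def)
      then show "ennreal (dens k x) * indicator (act g -` A \<inter> space M) x = ennreal (dens k x) * indicator A (act g x)" by simp
    qed
    also have "\<dots> = (\<integral>\<^sup>+z. ennreal (dens g z) * (ennreal (dens k (act (inv g) z)) * indicator A (act g (act (inv g) z))) \<partial>M)"
    proof (rule nn_change[OF g, of "\<lambda>x. ennreal (dens k x) * indicator A (act g x)", symmetric])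
      have "(\<lambda>x. indicator A (act g x) :: ennreal) \<in> borel_measurable M"
        by (rule measurable_compose[OF act_measurable[OF g] borel_measurable_indicator[OF A]])
      with dens_measurable[OF k] show "(\<lambda>x. ennreal (dens k x) * indicator A (act g x)) \<in> borel_measurable M"
        by (intro borel_measurable_times_ennreal measurable_compose[OF _ measurable_ennreal])
    qed
    also have "\<dots> = (\<integral>\<^sup>+z. ennreal (dens g z * dens k (act (inv g) z)) * indicator A z \<partial>M)"
      using g k by (intro nn_integral_cong) (auto simp: act_inv ennreal_mult dens_nonneg mult.assoc)
    also have "\<dots> = emeasure (density M (\<lambda>z. ennreal (dens g z * dens k (act (inv g) z)))) A"
      by (rule emeasure_density[symmetric]) auto
    finally show "emeasure (distr (distr M M (act k)) M (act g)) A = emeasure (density M (\<lambda>z. ennreal (dens g z * dens k (act (inv g) z)))) A" .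
  qed simp
  finally have "AE z in M. ennreal (dens (g \<otimes> k) z) = ennreal (dens g z * dens k (act (inv g) z))"
    by (subst (asm) density_unique_iff) auto
  then show ?thesis by eventually_elim (use g k in \<open>auto simp: dens_nonneg\<close>)
qed

end

section \<open>Moments of quotients of densities\<close>

lemma powr_bounds:
  fixes r e :: real
  assumes "0 < r" "0 < e" "e \<le> 1"
  shows "r powr (2 + e) \<le> (1 - e) * r\<^sup>2 + e * r ^ 3" "r powr (2 - e) \<le> (1 - e) * r\<^sup>2 + e * r"
proof -
  \<comment> \<open>Weighted arithmetic-geometric mean: 2 + e lies between the exponents 2 and 3,
    and below 2 - e lies between 1 and 2.\<close>
  have "(r\<^sup>2) powr (1 - e) * (r ^ 3) powr e \<le> (1 - e) * r\<^sup>2 + e * r ^ 3"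
    using assms by (intro Youngs_inequality_0) auto
  moreover have "(r\<^sup>2) powr (1 - e) * (r ^ 3) powr e = r powr (2 + e)"
  proof -
    have "(r powr 2) powr (1 - e) * (r powr 3) powr e = r powr (2 * (1 - e) + 3 * e)" by (simp only: powr_powr powr_add)
    also have "2 * (1 - e) + 3 * e = 2 + e" by simp
    finally show ?thesis using assms by (simp add: powr_numeral)
  qed
  ultimately show "r powr (2 + e) \<le> (1 - e) * r\<^sup>2 + e * r ^ 3" by simp
  have "(r\<^sup>2) powr (1 - e) * r powr e \<le> (1 - e) * r\<^sup>2 + e * r"
    using assms by (intro Youngs_inequality_0) auto
  moreover have "(r\<^sup>2) powr (1 - e) * r powr e = r powr (2 - e)"
  proof -
    have "(r powr 2) powr (1 - e) * r powr e = r powr (2 * (1 - e) + e)" by (simp only: powr_powr powr_add)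
    also have "2 * (1 - e) + e = 2 - e" by simp
    finally show ?thesis using assms by (simp add: powr_numeral)
  qed
  ultimately show "r powr (2 - e) \<le> (1 - e) * r\<^sup>2 + e * r" by simp
qed

lemma bexp_mono: "(\<And>y. u y \<le> v y) \<Longrightarrow> bexp q u \<le> bexp q v"
  unfolding bexp_def by (intro add_mono mult_left_mono) auto

text \<open>As \<open>e\<close> tends to 0, \<open>kap \<delta> e\<close> tends to \<open>1 / (\<delta> (1 - \<delta>))\<close>, the lower bound for \<open>\<kappa>\<close>.\<close>
definition kap :: "real \<Rightarrow> real \<Rightarrow> real" where
  "kap \<delta> e = (1 + e * (2 + 1 / \<delta>)) / (\<delta> * (1 - \<delta>))"

text \<open>Interpolation by \<open>powr_bounds\<close> reduces both exponents to the moments of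
  order 1, 2 and 3 of the likelihood ratio; the bound \<open>1 / \<delta>\<close> on the ratio
  controls the third. Exponents other than 2 arise from the kernel in \<open>Th\<close>, see
  \<open>Th_quotient\<close>.\<close>

lemma two_point_powr:
  fixes p q :: "bool pmf"
  assumes \<delta>: "0 < \<delta>" "\<delta> < 1" and q: "\<And>y. \<delta> \<le> pmf q y" and p: "\<And>y. 0 < pmf p y"
    and e: "0 < e" "e \<le> 1" and s: "s = 2 + e \<or> s = 2 - e"
  shows "bexp q (\<lambda>y. (pmf p y / pmf q y) powr s) \<le> 1 + kap \<delta> e * (pmf p False - pmf q False)\<^sup>2"
proof -
  define r where "r y = pmf p y / pmf q y" for y
  have qp: "0 < pmf q y" for y using q[of y] \<delta> by linarith
  have rp: "0 < r y" for y using p qp by (simp add: r_def)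
  have rd: "r y \<le> 1 / \<delta>" for y
    unfolding r_def using q[of y] \<delta> pmf_le_1[of p y] by (intro frac_le) auto
  define c where "c = (pmf p False - pmf q False)\<^sup>2 / (pmf q False * pmf q True)"
  have c0: "0 \<le> c" using qp by (auto simp: c_def intro!: divide_nonneg_nonneg mult_nonneg_nonneg less_imp_le)
  have b1: "bexp q r = 1" unfolding r_def by (rule bexp_ratio[OF qp])
  have b2: "bexp q (\<lambda>y. (r y)\<^sup>2) = 1 + c" unfolding r_def c_def by (rule bexp_ratio_sq[OF qp])
  have b0: "pmf q True + pmf q False = 1" by (simp add: pmf_bool_True)
  have lin: "bexp q (\<lambda>y. x1 * (r y)\<^sup>2 + x2 * r y + x3) = x1 * (1 + c) + x2 + x3" for x1 x2 x3
  proof -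
    have "bexp q (\<lambda>y. x1 * (r y)\<^sup>2 + x2 * r y + x3) = x1 * bexp q (\<lambda>y. (r y)\<^sup>2) + x2 * bexp q r + x3 * (pmf q True + pmf q False)"
      by (simp add: bexp_def algebra_simps)
    then show ?thesis by (simp add: b0 b1 b2)
  qed
  \<comment> \<open>As \<open>r \<le> 1 / \<delta>\<close>, one has
    \<open>(r - 1)^3 \<le> (r - 1)^2 / \<delta>\<close>. In expectation this bounds the third moment
    by \<open>1 + (3 + 1 / \<delta>) * c\<close>, and mixing with weights \<open>1 - e\<close> and
    \<open>e\<close> yields the numerator of \<open>kap\<close>.\<close>
  have r3: "(r y) ^ 3 \<le> (3 + 1 / \<delta>) * (r y)\<^sup>2 + (- 3 - 2 / \<delta>) * r y + (1 + 1 / \<delta>)" for y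
  proof -
    have "(r y - 1) * (r y - 1)\<^sup>2 \<le> (1 / \<delta>) * (r y - 1)\<^sup>2"
      using rd[of y] by (intro mult_right_mono) auto
    then show ?thesis by (simp add: power2_eq_square power3_eq_cube algebra_simps)
  qed
  have bd: "bexp q (\<lambda>y. (r y) powr s) \<le> 1 + (1 + e * (2 + 1 / \<delta>)) * c"
    using s
  proof
    assume s: "s = 2 + e"
    have "bexp q (\<lambda>y. (r y) powr s) \<le> bexp q (\<lambda>y. ((1 - e) + e * (3 + 1 / \<delta>)) * (r y)\<^sup>2 + (e * (- 3 - 2 / \<delta>)) * r y + e * (1 + 1 / \<delta>))"
    proof (rule bexp_mono)
      fix y
      have "r y powr s \<le> (1 - e) * (r y)\<^sup>2 + e * (r y) ^ 3" using powr_bounds(1)[OF rp e] s by simp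
      also have "\<dots> \<le> (1 - e) * (r y)\<^sup>2 + e * ((3 + 1 / \<delta>) * (r y)\<^sup>2 + (- 3 - 2 / \<delta>) * r y + (1 + 1 / \<delta>))"
        using r3[of y] e by (intro add_left_mono mult_left_mono) auto
      finally show "r y powr s \<le> ((1 - e) + e * (3 + 1 / \<delta>)) * (r y)\<^sup>2 + (e * (- 3 - 2 / \<delta>)) * r y + e * (1 + 1 / \<delta>)"
        by (simp add: algebra_simps)
    qed
    also have "\<dots> = 1 + (1 + e * (2 + 1 / \<delta>)) * c" unfolding lin by (simp add: algebra_simps add_divide_distrib)
    finally show ?thesis .
  next
    assume s: "s = 2 - e"
    have "bexp q (\<lambda>y. (r y) powr s) \<le> bexp q (\<lambda>y. (1 - e) * (r y)\<^sup>2 + e * r y + 0)"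
      using powr_bounds(2)[OF rp e] s by (intro bexp_mono) simp
    also have "\<dots> = 1 + (1 - e) * c" unfolding lin by (simp add: algebra_simps)
    also have "\<dots> \<le> 1 + (1 + e * (2 + 1 / \<delta>)) * c"
    proof -
      have "0 \<le> e * (2 + 1 / \<delta>)" using e \<delta> by simp
      then show ?thesis using e c0 by (intro add_left_mono mult_right_mono) auto
    qed
    finally show ?thesis .
  qed
  \<comment> \<open>On [\<delta>, 1 - \<delta>] the variance q (1 - q) is smallest at the end
    points.\<close>
  have "\<delta> * (1 - \<delta>) \<le> pmf q False * pmf q True"
  proof -
    have "0 \<le> (pmf q False - \<delta>) * (pmf q True - \<delta>)" using q by simp
    then show ?thesis by (simp add: pmf_bool_True algebra_simps)
  qed
  then have "c \<le> (pmf p False - pmf q False)\<^sup>2 / (\<delta> * (1 - \<delta>))"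
    unfolding c_def using \<delta> by (intro divide_left_mono) (auto intro!: mult_pos_pos qp)
  then have "(1 + e * (2 + 1 / \<delta>)) * c \<le> (1 + e * (2 + 1 / \<delta>)) * ((pmf p False - pmf q False)\<^sup>2 / (\<delta> * (1 - \<delta>)))"
    using e \<delta> by (intro mult_left_mono) auto
  then show ?thesis using bd by (simp add: r_def kap_def)
qed

context bernoulli
begin

lemma \<delta>_lt_1: "\<delta> < 1"
  using marginal[OF one_closed] \<delta>_pos by auto

lemma kap_nonneg: "0 < e \<Longrightarrow> 0 \<le> kap \<delta> e"
  unfolding kap_def using \<delta>_pos \<delta>_lt_1 by (intro divide_nonneg_pos) auto

text \<open>Fatou's lemma reduces this to finite products and hence to \<open>two_point_powr\<close>
  in each coordinate, applied to the marginals of the two translates. Since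
  \<open>(x - y)^2 \<le> 2 * x^2 + 2 * y^2\<close>, both weights enter with the factor 2; this is
  the origin of the 4 in the hypothesis on the series.\<close>

lemma dens_moment:
  assumes g: "g \<in> carrier G" and k: "k \<in> carrier G"
    and e: "0 < e" "e \<le> 1" and s: "s = 2 + e \<or> s = 2 - e"
  shows "(\<integral>\<^sup>+z. ennreal (dens k z * (dens g z / dens k z) powr s) \<partial>M) \<le> ennreal (exp (kap \<delta> e * (2 * wt g + 2 * wt k)))"
proof -
  define R where "R h n i y = (if i \<in> dens_fin h n then ratio h i y else 1)" for h n i y
  define S where "S n = dens_fin g n \<union> dens_fin k n" for n
  define f where "f n i y = R k n i y * (R g n i y / R k n i y) powr s" for n i y
  have S: "finite (S n)" "S n \<subseteq> carrier G" for n using dens_fin[OF g] dens_fin[OF k] by (auto simp: S_def)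
  have Rp: "0 < R h n i y" if "h \<in> carrier G" "i \<in> carrier G" for h n i y
    using ratio_pos that by (simp add: R_def)
  have PR: "(\<Prod>i\<in>dens_fin h n. ratio h i (z i)) = (\<Prod>i\<in>S n. R h n i (z i))" if "h = g \<or> h = k" for h n z
    unfolding R_def using that S(1)[of n]
    by (subst prod.If_cases) (auto simp: S_def Int_absorb1 Int_absorb2 intro!: prod.cong)
  have prodf: "(\<Prod>i\<in>S n. f n i (z i)) = (\<Prod>i\<in>S n. R k n i (z i)) * ((\<Prod>i\<in>S n. R g n i (z i)) / (\<Prod>i\<in>S n. R k n i (z i))) powr s" for n z
  proof -
    have "(\<Prod>i\<in>S n. (R g n i (z i) / R k n i (z i)) powr s) = (\<Prod>i\<in>S n. R g n i (z i) / R k n i (z i)) powr s"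
      by (rule prod_powr_distrib[symmetric])
    then show ?thesis by (simp add: f_def prod.distrib prod_dividef)
  qed
  have lim: "AE z in M. (\<lambda>n. ennreal (\<Prod>i\<in>S n. f n i (z i))) \<longlonglongrightarrow> ennreal (dens k z * (dens g z / dens k z) powr s)"
    using dens_lim[OF g] dens_lim[OF k] dens_pos[OF g] dens_pos[OF k]
  proof eventually_elim
    case (elim z)
    show ?case unfolding prodf using elim
      by (intro tendsto_ennrealI tendsto_intros) (auto simp: PR)
  qed
  have Sm: "(\<lambda>z. \<Prod>i\<in>S n. f n i (z i)) \<in> borel_measurable M" for n
    using S by (intro prod_bits_measurable) auto
  have "(\<integral>\<^sup>+z. ennreal (dens k z * (dens g z / dens k z) powr s) \<partial>M) = (\<integral>\<^sup>+z. liminf (\<lambda>n. ennreal (\<Prod>i\<in>S n. f n i (z i))) \<partial>M)"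
    by (rule nn_integral_cong_AE, use lim in eventually_elim) (rule lim_imp_Liminf[OF sequentially_bot, symmetric])
  also have "\<dots> \<le> liminf (\<lambda>n. \<integral>\<^sup>+z. ennreal (\<Prod>i\<in>S n. f n i (z i)) \<partial>M)"
    by (intro nn_integral_liminf measurable_compose[OF Sm measurable_ennreal])
  also have "\<dots> \<le> liminf (\<lambda>n::nat. ennreal (exp (kap \<delta> e * (2 * wt g + 2 * wt k))))"
  proof (rule Liminf_mono, rule always_eventually, rule allI)
    fix n
    have fp: "0 \<le> f n i y" if "i \<in> carrier G" for i y
      unfolding f_def using Rp[OF k that, of n y] by (intro mult_nonneg_nonneg) auto
    have "(\<integral>\<^sup>+z. ennreal (\<Prod>i\<in>S n. f n i (z i)) \<partial>M) = ennreal (\<integral>z. (\<Prod>i\<in>S n. f n i (z i)) \<partial>M)"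
    proof (rule nn_integral_eq_integral)
      show "integrable M (\<lambda>z. \<Prod>i\<in>S n. f n i (z i))" by (rule integrable_prod_bits[OF S marg_pos])
      show "AE z in M. 0 \<le> (\<Prod>i\<in>S n. f n i (z i))" by (intro AE_I2 prod_nonneg fp subsetD[OF S(2)[of n]])
    qed
    also have "(\<integral>z. (\<Prod>i\<in>S n. f n i (z i)) \<partial>M) = (\<Prod>i\<in>S n. bexp (\<mu> i) (f n i))"
      by (intro integral_prod_bits S marg_pos) auto
    also have "\<dots> \<le> exp (\<Sum>i\<in>S n. kap \<delta> e * (2 * (coc g i)\<^sup>2 + 2 * (coc k i)\<^sup>2))"
    proof (rule exp_bound_prod[OF S(1)])
      fix i assume "i \<in> S n"
      then have i: "i \<in> carrier G" using S by auto
      show "0 \<le> bexp (\<mu> i) (f n i)" unfolding bexp_def using fp[OF i] by simp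
      \<comment> \<open>Outside the finite set of \<open>g\<close> at stage \<open>n\<close> the
        factor of the partial product is 1, the likelihood ratio of \<open>\<mu> i\<close> to
        itself. So in all cases two genuine two-point measures are compared.\<close>
      define p where "p = (if i \<in> dens_fin g n then sh g i else \<mu> i)"
      define q where "q = (if i \<in> dens_fin k n then sh k i else \<mu> i)"
      have Rg: "R g n i y = pmf p y / pmf (\<mu> i) y" and Rk: "R k n i y = pmf q y / pmf (\<mu> i) y" for y
        using marg_pos[OF i, of y] by (auto simp: R_def p_def q_def ratio_def)
      have pq: "\<delta> \<le> pmf p y" "\<delta> \<le> pmf q y" for y
        using sh_marg_ge[OF g i] sh_marg_ge[OF k i] marg_ge[OF i] by (auto simp: p_def q_def)
      have pp: "0 < pmf p y" for y using pq[of y] \<delta>_pos by linarith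
      have "pmf (\<mu> i) y * f n i y = pmf q y * (pmf p y / pmf q y) powr s" for y
        using marg_pos[OF i, of y] unfolding f_def Rg Rk by simp
      then have "bexp (\<mu> i) (f n i) = bexp q (\<lambda>y. (pmf p y / pmf q y) powr s)" by (simp add: bexp_def)
      also have "\<dots> \<le> 1 + kap \<delta> e * (pmf p False - pmf q False)\<^sup>2"
        by (rule two_point_powr[OF \<delta>_pos \<delta>_lt_1 pq(2) pp e s])
      also have "(pmf p False - pmf q False)\<^sup>2 \<le> 2 * (coc g i)\<^sup>2 + 2 * (coc k i)\<^sup>2"
      proof -
        define x where "x = (if i \<in> dens_fin g n then coc g i else 0)"
        define y where "y = (if i \<in> dens_fin k n then coc k i else 0)"
        have "pmf p False - pmf q False = y + (- x)" by (auto simp: x_def y_def p_def q_def coc_alt)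
        then have "(pmf p False - pmf q False)\<^sup>2 \<le> 2 * y\<^sup>2 + 2 * x\<^sup>2" using sq_add_le[of 1 y "- x"] by simp
        moreover have "x\<^sup>2 \<le> (coc g i)\<^sup>2" "y\<^sup>2 \<le> (coc k i)\<^sup>2" by (auto simp: x_def y_def)
        ultimately show ?thesis by linarith
      qed
      finally show "bexp (\<mu> i) (f n i) \<le> 1 + kap \<delta> e * (2 * (coc g i)\<^sup>2 + 2 * (coc k i)\<^sup>2)"
        using kap_nonneg[OF e(1)] by (simp add: mult_left_mono)
    qed
    also have "(\<Sum>i\<in>S n. kap \<delta> e * (2 * (coc g i)\<^sup>2 + 2 * (coc k i)\<^sup>2)) = kap \<delta> e * (2 * (\<Sum>i\<in>S n. (coc g i)\<^sup>2) + 2 * (\<Sum>i\<in>S n. (coc k i)\<^sup>2))"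
      by (simp add: sum.distrib sum_distrib_left[symmetric])
    also have "exp \<dots> \<le> exp (kap \<delta> e * (2 * wt g + 2 * wt k))"
      using kap_nonneg[OF e(1)] wt_sum[OF g S, of n] wt_sum[OF k S, of n] by (simp add: mult_left_mono)
    finally show "(\<integral>\<^sup>+z. ennreal (\<Prod>i\<in>S n. f n i (z i)) \<partial>M) \<le> ennreal (exp (kap \<delta> e * (2 * wt g + 2 * wt k)))"
      by (simp add: ennreal_leI)
  qed
  also have "\<dots> = ennreal (exp (kap \<delta> e * (2 * wt g + 2 * wt k)))" by (simp add: Liminf_const)
  finally show ?thesis .
qed

end

section \<open>Normalised weights under perturbation\<close>

lemma abs_le_sq_div:
  fixes V J c :: real
  assumes "\<bar>V\<bar> \<le> J" "0 < c"
  shows "\<bar>V\<bar> \<le> (1 / (2 * c)) * (V\<^sup>2 / J) + (c / 2) * J"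
proof (cases "J = 0")
  case False
  then have J: "0 < J" using assms by linarith
  have "0 \<le> (\<bar>V\<bar> - c * J)\<^sup>2" by simp
  then have "2 * c * J * \<bar>V\<bar> \<le> V\<^sup>2 + c\<^sup>2 * J\<^sup>2" by (simp add: power2_diff power_mult_distrib algebra_simps)
  then have "\<bar>V\<bar> \<le> (V\<^sup>2 + c\<^sup>2 * J\<^sup>2) / (2 * c * J)" using J assms(2) by (simp add: field_simps)
  also have "\<dots> = (1 / (2 * c)) * (V\<^sup>2 / J) + (c / 2) * J" using J assms(2) by (simp add: field_simps power2_eq_square)
  finally show ?thesis .
qed (use assms in auto)

text \<open>The quotient changes through its numerator, by \<open>E h\<close>, and through the
  total, by the mean of \<open>E\<close> under the normalised weights. The factor \<open>K\<close>
  prevents the perturbed total from collapsing.\<close>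

lemma weight_perturbation:
  fixes \<theta> \<theta>' E :: "'g \<Rightarrow> real"
  assumes F: "finite F" and \<theta>0: "\<And>k. k \<in> F \<Longrightarrow> 0 \<le> \<theta> k" and \<theta>'0: "\<And>k. k \<in> F \<Longrightarrow> 0 \<le> \<theta>' k"
    and E: "\<And>k. k \<in> F \<Longrightarrow> 0 \<le> E k" and d: "\<And>k. k \<in> F \<Longrightarrow> \<bar>\<theta>' k - \<theta> k\<bar> \<le> E k * \<theta> k"
    and K: "\<And>k. k \<in> F \<Longrightarrow> \<theta> k \<le> K * \<theta>' k" and h: "h \<in> F"
  shows "\<bar>\<theta> h / sum \<theta> F - \<theta>' h / sum \<theta>' F\<bar> \<le> K * (E h * (\<theta> h / sum \<theta> F) + (\<theta> h / sum \<theta> F) * (\<Sum>k\<in>F. E k * (\<theta> k / sum \<theta> F)))"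
proof (cases "sum \<theta> F = 0")
  case True
  then have "\<theta> k = 0" if "k \<in> F" for k using F \<theta>0 that by (simp add: sum_nonneg_eq_0_iff)
  then have "\<theta>' h = 0" using d[OF h] h by auto
  then show ?thesis using True by simp
next
  case False
  let ?J = "sum \<theta> F" and ?J' = "sum \<theta>' F"
  have J: "0 < ?J" using False sum_nonneg[of F \<theta>] \<theta>0 by (metis less_eq_real_def)
  have JK: "?J \<le> K * ?J'" using K by (simp add: sum_distrib_left sum_mono)
  have J'0: "0 \<le> ?J'" using \<theta>'0 by (rule sum_nonneg)
  have J': "0 < ?J'" using J JK J'0 by (metis less_eq_real_def mult_zero_right not_le)
  have iv: "1 / ?J' \<le> K / ?J" using J J' JK by (simp add: field_simps)
  \<comment> \<open>The change of the numerator and the change of the denominator are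
    separated.\<close>
  have "\<theta> h / ?J - \<theta>' h / ?J' = (\<theta> h - \<theta>' h) * (1 / ?J') + (\<theta> h / ?J) * (?J' - ?J) * (1 / ?J')"
    using J J' by (simp add: field_simps)
  also have "\<bar>\<dots>\<bar> \<le> \<bar>\<theta> h - \<theta>' h\<bar> * (1 / ?J') + (\<theta> h / ?J) * \<bar>?J' - ?J\<bar> * (1 / ?J')"
    using J J' \<theta>0[OF h] by (intro order_trans[OF abs_triangle_ineq]) (simp add: abs_mult)
  also have "\<dots> \<le> (E h * \<theta> h) * (K / ?J) + (\<theta> h / ?J) * (\<Sum>k\<in>F. E k * \<theta> k) * (K / ?J)"
  proof (intro add_mono mult_mono iv)
    show "\<bar>\<theta> h - \<theta>' h\<bar> \<le> E h * \<theta> h" using d[OF h] by (simp add: abs_minus_commute)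
    have "\<bar>?J' - ?J\<bar> = \<bar>\<Sum>k\<in>F. \<theta>' k - \<theta> k\<bar>" by (simp add: sum_subtractf)
    also have "\<dots> \<le> (\<Sum>k\<in>F. E k * \<theta> k)" using d by (intro order_trans[OF sum_abs] sum_mono)
    finally show "\<bar>?J' - ?J\<bar> \<le> (\<Sum>k\<in>F. E k * \<theta> k)" .
  qed (use J J' \<theta>0 E h in \<open>auto intro!: sum_nonneg mult_nonneg_nonneg divide_nonneg_pos\<close>)
  also have "\<dots> = K * (E h * (\<theta> h / ?J) + (\<theta> h / ?J) * (\<Sum>k\<in>F. E k * (\<theta> k / ?J)))"
    by (simp add: sum_divide_distrib[symmetric] algebra_simps)
  finally show ?thesis .
qed

text \<open>Only the column sums of squares of \<open>E\<close> are under control. The inequality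
  \<open>2 * E * q \<le> t * q^2 + E^2 / t\<close> separates them from the normalised weights, with
  a free parameter \<open>t\<close> to balance the two parts.\<close>

lemma weight_sum_bound:
  fixes \<theta> :: "'g \<Rightarrow> real" and E :: "'g \<Rightarrow> 'g \<Rightarrow> real"
  assumes F: "finite F" and \<theta>0: "\<And>k. k \<in> F \<Longrightarrow> 0 \<le> \<theta> k"
    and E: "\<And>g k. g \<in> F \<Longrightarrow> k \<in> F \<Longrightarrow> 0 \<le> E g k" and EL: "\<And>k. k \<in> F \<Longrightarrow> (\<Sum>g\<in>F. (E g k)\<^sup>2) \<le> L"
    and t: "0 < t"
  defines "q \<equiv> \<lambda>h. \<theta> h / sum \<theta> F"
  shows "(\<Sum>g\<in>F. \<Sum>h\<in>F. \<theta> g * (E g h * q h + q h * (\<Sum>k\<in>F. E g k * q k))) \<le> t * (\<Sum>g\<in>F. \<theta> g * q g) + (L / t) * sum \<theta> F"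
proof -
  define J where "J = sum \<theta> F"
  have qJ: "q h = \<theta> h / J" for h by (simp add: q_def J_def)
  have J0: "0 \<le> J" unfolding J_def using \<theta>0 by (rule sum_nonneg)
  have q0: "0 \<le> q k" if "k \<in> F" for k using \<theta>0[OF that] J0 by (simp add: qJ)
  have q1: "sum q F \<le> 1" by (simp add: q_def sum_divide_distrib[symmetric])
  have \<theta>q: "\<theta> g = J * q g" if "g \<in> F" for g
    using F \<theta>0 that by (cases "J = 0") (auto simp: qJ J_def sum_nonneg_eq_0_iff)
  have "(\<Sum>g\<in>F. \<Sum>h\<in>F. \<theta> g * (E g h * q h + q h * (\<Sum>k\<in>F. E g k * q k))) = (\<Sum>g\<in>F. \<theta> g * ((\<Sum>h\<in>F. E g h * q h) + sum q F * (\<Sum>k\<in>F. E g k * q k)))"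
    by (simp add: sum_distrib_left[symmetric] sum_distrib_right[symmetric] sum.distrib)
  also have "\<dots> \<le> (\<Sum>g\<in>F. \<theta> g * ((\<Sum>h\<in>F. E g h * q h) + 1 * (\<Sum>k\<in>F. E g k * q k)))"
    using \<theta>0 q1 E q0 by (intro sum_mono mult_left_mono add_left_mono mult_right_mono sum_nonneg mult_nonneg_nonneg) auto
  also have "\<dots> = (\<Sum>g\<in>F. \<Sum>k\<in>F. J * q k * (2 * (E g k * q g)))"
  proof (intro sum.cong refl)
    fix g assume "g \<in> F"
    then have "\<theta> g * ((\<Sum>h\<in>F. E g h * q h) + 1 * (\<Sum>k\<in>F. E g k * q k)) = (2 * (J * q g)) * (\<Sum>h\<in>F. E g h * q h)"
      using \<theta>q by simp
    also have "\<dots> = (\<Sum>k\<in>F. J * q k * (2 * (E g k * q g)))"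
      unfolding sum_distrib_left by (intro sum.cong refl) (simp add: mult_ac)
    finally show "\<theta> g * ((\<Sum>h\<in>F. E g h * q h) + 1 * (\<Sum>k\<in>F. E g k * q k)) = (\<Sum>k\<in>F. J * q k * (2 * (E g k * q g)))" .
  qed
  also have "\<dots> \<le> (\<Sum>g\<in>F. \<Sum>k\<in>F. J * q k * (t * (q g)\<^sup>2 + (E g k)\<^sup>2 / t))"
  proof (intro sum_mono mult_left_mono)
    fix g k assume gk: "g \<in> F" "k \<in> F"
    have "0 \<le> (t * q g - E g k)\<^sup>2 / t" using t by simp
    then show "2 * (E g k * q g) \<le> t * (q g)\<^sup>2 + (E g k)\<^sup>2 / t" using t by (simp add: power2_eq_square field_simps)
    show "0 \<le> J * q k" using J0 q0[OF gk(2)] by simp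
  qed
  also have "\<dots> = t * ((\<Sum>g\<in>F. J * (q g)\<^sup>2) * sum q F) + (\<Sum>k\<in>F. J * q k * ((\<Sum>g\<in>F. (E g k)\<^sup>2) / t))"
  proof -
    have "(\<Sum>g\<in>F. \<Sum>k\<in>F. J * q k * (t * (q g)\<^sup>2 + (E g k)\<^sup>2 / t)) = (\<Sum>g\<in>F. \<Sum>k\<in>F. t * (J * (q g)\<^sup>2 * q k)) + (\<Sum>g\<in>F. \<Sum>k\<in>F. J * q k * ((E g k)\<^sup>2 / t))"
      by (simp add: sum.distrib[symmetric] algebra_simps)
    also have "(\<Sum>g\<in>F. \<Sum>k\<in>F. t * (J * (q g)\<^sup>2 * q k)) = t * ((\<Sum>g\<in>F. J * (q g)\<^sup>2) * sum q F)"
      unfolding sum_product by (simp add: sum_distrib_left)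
    also have "(\<Sum>g\<in>F. \<Sum>k\<in>F. J * q k * ((E g k)\<^sup>2 / t)) = (\<Sum>k\<in>F. J * q k * ((\<Sum>g\<in>F. (E g k)\<^sup>2) / t))"
      by (subst sum.swap) (simp add: sum_distrib_left sum_divide_distrib)
    finally show ?thesis .
  qed
  also have "\<dots> \<le> t * ((\<Sum>g\<in>F. J * (q g)\<^sup>2) * 1) + (\<Sum>k\<in>F. J * q k * (L / t))"
    using t J0 q0 q1 EL by (intro add_mono mult_left_mono sum_mono divide_right_mono sum_nonneg mult_nonneg_nonneg) auto
  also have "(\<Sum>g\<in>F. J * (q g)\<^sup>2) = (\<Sum>g\<in>F. \<theta> g * q g)"
    by (intro sum.cong refl) (simp add: \<theta>q power2_eq_square)
  also have "(\<Sum>k\<in>F. J * q k * (L / t)) = (L / t) * J"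
  proof -
    have "(\<Sum>k\<in>F. J * q k * (L / t)) = (\<Sum>k\<in>F. \<theta> k * (L / t))" by (intro sum.cong refl) (simp add: \<theta>q)
    also have "\<dots> = (\<Sum>k\<in>F. \<theta> k) * (L / t)" by (rule sum_distrib_right[symmetric])
    finally show ?thesis by (simp add: J_def)
  qed
  finally show ?thesis by (simp add: J_def)
qed

section \<open>Averaging\<close>

text \<open>With \<open>V\<close> the sum under the integral, \<open>\<bar>V\<bar> \<le> V\<^sup>2 / (2 c J) + c J / 2\<close>. The pairs that are not \<open>bad\<close> contribute to
  \<open>V\<^sup>2 / J\<close> only through the difference between \<open>\<Theta> h / J\<close> at \<open>w\<close> and at \<open>U g w\<close>.\<close>
lemma averaging_estimate:
  fixes \<Theta> a :: "'g \<Rightarrow> 'w \<Rightarrow> real" and U :: "'g \<Rightarrow> 'w \<Rightarrow> 'w" and E :: "'g \<Rightarrow> 'g \<Rightarrow> real" and f :: "'g \<Rightarrow> real" and C K L m S t c :: real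
  defines "J \<equiv> \<lambda>F w. \<Sum>g\<in>F. \<Theta> g w"
  assumes F: "finite F"
    and int: "\<And>g. g \<in> F \<Longrightarrow> integrable P (\<Theta> g)" and \<Theta>0: "\<And>g w. g \<in> F \<Longrightarrow> 0 \<le> \<Theta> g w"
    and C: "\<And>g. g \<in> F \<Longrightarrow> (\<integral>w. \<Theta> g w \<partial>P) = C"
    and am: "\<And>g. g \<in> F \<Longrightarrow> a g \<in> borel_measurable P" and a1: "\<And>g w. g \<in> F \<Longrightarrow> \<bar>a g w\<bar> \<le> 1"
    and f1: "\<And>g. g \<in> F \<Longrightarrow> \<bar>f g\<bar> \<le> 1"
    and Um: "\<And>g. g \<in> F \<Longrightarrow> U g \<in> measurable P P"
    and E0: "\<And>g k. g \<in> F \<Longrightarrow> k \<in> F \<Longrightarrow> 0 \<le> E g k"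
    and up: "\<And>g k w. g \<in> F \<Longrightarrow> k \<in> F \<Longrightarrow> w \<in> space P \<Longrightarrow> \<bar>\<Theta> k (U g w) - \<Theta> k w\<bar> \<le> E g k * \<Theta> k w"
    and lo: "\<And>g k w. g \<in> F \<Longrightarrow> k \<in> F \<Longrightarrow> w \<in> space P \<Longrightarrow> \<Theta> k w \<le> K * \<Theta> k (U g w)" and K: "0 \<le> K"
    and EL: "\<And>k. k \<in> F \<Longrightarrow> (\<Sum>g\<in>F. (E g k)\<^sup>2) \<le> L"
    and good: "\<And>g h. g \<in> F \<Longrightarrow> h \<in> F \<Longrightarrow> \<not> bad g h \<Longrightarrow> (\<integral>w. a g w * \<Theta> g w * (a h w * (\<Theta> h (U g w) / J F (U g w))) \<partial>P) = 0"
    and bad1: "\<And>g. g \<in> F \<Longrightarrow> real (card {h \<in> F. bad g h}) \<le> m" and bad2: "\<And>h. h \<in> F \<Longrightarrow> real (card {g \<in> F. bad g h}) \<le> m"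
    and m0: "0 \<le> m"
    and S: "(\<integral>w. (\<Sum>g\<in>F. \<Theta> g w * (\<Theta> g w / J F w)) \<partial>P) \<le> S"
    and t: "0 < t" and c: "0 < c"
  shows "(\<integral>w. \<bar>\<Sum>g\<in>F. f g * a g w * \<Theta> g w\<bar> \<partial>P)
    \<le> (1 / (2 * c)) * (m * S + K * (t * S + (L / t) * (card F * C))) + (c / 2) * (card F * C)"
proof -
  define j where "j = J F"
  define q where "q g w = \<Theta> g w / j w" for g w
  have jd: "j w = sum (\<lambda>g. \<Theta> g w) F" for w by (simp add: j_def J_def)
  have \<Theta>m [measurable]: "g \<in> F \<Longrightarrow> \<Theta> g \<in> borel_measurable P" for g using int by auto
  have jm: "j \<in> borel_measurable P" unfolding jd[abs_def] by (intro borel_measurable_sum \<Theta>m)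
  have qm: "q g \<in> borel_measurable P" if "g \<in> F" for g
    unfolding q_def[abs_def] using jm \<Theta>m[OF that] by measurable
  have j0: "0 \<le> j w" for w unfolding jd by (intro sum_nonneg \<Theta>0)
  have q0: "0 \<le> q g w" if "g \<in> F" for g w using \<Theta>0[OF that] j0 by (simp add: q_def)
  have \<Theta>j: "\<Theta> g w \<le> j w" if "g \<in> F" for g w unfolding jd using F \<Theta>0 that by (intro member_le_sum) auto
  have q1: "q g w \<le> 1" if "g \<in> F" for g w using \<Theta>j[OF that, of w] j0[of w] by (auto simp: q_def divide_le_eq_1)
  have \<Theta>q: "\<Theta> g w = j w * q g w" if "g \<in> F" for g w
    using \<Theta>j[OF that, of w] \<Theta>0[OF that, of w] by (cases "j w = 0") (auto simp: q_def)
  have bint: "integrable P (\<lambda>w. \<Theta> g w * b w)" if "g \<in> F" "b \<in> borel_measurable P" "\<And>w. w \<in> space P \<Longrightarrow> \<bar>b w\<bar> \<le> B" for g b B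
  proof (rule Bochner_Integration.integrable_bound[of P "\<lambda>w. B * \<Theta> g w"])
    show "integrable P (\<lambda>w. B * \<Theta> g w)" using int[OF that(1)] by simp
    show "(\<lambda>w. \<Theta> g w * b w) \<in> borel_measurable P" using that \<Theta>m by measurable
    show "AE w in P. norm (\<Theta> g w * b w) \<le> norm (B * \<Theta> g w)"
    proof (rule AE_I2)
      fix w assume w: "w \<in> space P"
      have "norm (\<Theta> g w * b w) = \<bar>b w\<bar> * \<Theta> g w" using \<Theta>0[OF that(1)] by (simp add: abs_mult)
      also have "\<dots> \<le> B * \<Theta> g w" by (intro mult_right_mono that \<Theta>0 w)
      finally show "norm (\<Theta> g w * b w) \<le> norm (B * \<Theta> g w)" by simp
    qed
  qed
  have jint: "integrable P j" unfolding jd[abs_def] by (intro Bochner_Integration.integrable_sum int)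
  have jC: "(\<integral>w. j w \<partial>P) = card F * C" unfolding jd using C int by (simp add: Bochner_Integration.integral_sum)
  have qq: "integrable P (\<lambda>w. \<Theta> g w * q h w)" if "g \<in> F" "h \<in> F" for g h
    by (rule bint[OF that(1) qm[OF that(2)], of 1]) (use q0[OF that(2)] q1[OF that(2)] in simp)
  define V where "V w = (\<Sum>g\<in>F. f g * a g w * \<Theta> g w)" for w
  have Vj: "\<bar>V w\<bar> \<le> j w" for w
    unfolding V_def jd using a1 f1 \<Theta>0
    by (intro order_trans[OF sum_abs] sum_mono) (auto simp: abs_mult intro!: mult_left_le_one_le mult_le_one)
  have Vm: "V \<in> borel_measurable P"
    unfolding V_def[abs_def] using am by (intro borel_measurable_sum borel_measurable_times \<Theta>m) auto
  define X where "X g h w = \<Theta> g w * (E g h * q h w + q h w * (\<Sum>k\<in>F. E g k * q k w))" for g h w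
  have Xint: "integrable P (X g h)" if gh: "g \<in> F" "h \<in> F" for g h
    unfolding X_def[abs_def]
  proof (rule bint[OF gh(1), of _ "E g h * 1 + 1 * (\<Sum>k\<in>F. E g k * 1)"])
    show "(\<lambda>w. E g h * q h w + q h w * (\<Sum>k\<in>F. E g k * q k w)) \<in> borel_measurable P"
      using gh by (intro borel_measurable_add borel_measurable_times borel_measurable_sum qm) auto
    fix w
    have "0 \<le> E g h * q h w + q h w * (\<Sum>k\<in>F. E g k * q k w)"
      using gh by (intro add_nonneg_nonneg mult_nonneg_nonneg sum_nonneg q0 E0)
    moreover have "E g h * q h w + q h w * (\<Sum>k\<in>F. E g k * q k w) \<le> E g h * 1 + 1 * (\<Sum>k\<in>F. E g k * 1)"
      using gh by (intro add_mono mult_mono sum_mono mult_left_mono q1 q0 E0 sum_nonneg mult_nonneg_nonneg) auto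
    ultimately show "\<bar>E g h * q h w + q h w * (\<Sum>k\<in>F. E g k * q k w)\<bar> \<le> E g h * 1 + 1 * (\<Sum>k\<in>F. E g k * 1)" by simp
  qed
  define Tm where "Tm g h = (\<integral>w. \<Theta> g w * (a g w * a h w * q h w) \<partial>P)" for g h
  have aqint: "integrable P (\<lambda>w. \<Theta> g w * (a g w * a h w * q h w))" if "g \<in> F" "h \<in> F" for g h
  proof (rule bint[OF that(1), of _ 1])
    show "(\<lambda>w. a g w * a h w * q h w) \<in> borel_measurable P" using that by (intro borel_measurable_times am qm)
    fix w show "\<bar>a g w * a h w * q h w\<bar> \<le> 1"
      using a1[OF that(1), of w] a1[OF that(2), of w] q0[OF that(2), of w] q1[OF that(2), of w]
      by (simp add: abs_mult mult_le_one)
  qed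
  \<comment> \<open>The pairs are kept asymmetric: one factor remains the weight
    \<open>\<Theta> g\<close>, the other is normalised, so that \<open>q h\<close> is bounded by
    1.\<close>
  have V2: "(V w)\<^sup>2 / j w = (\<Sum>g\<in>F. \<Sum>h\<in>F. (f g * f h) * (\<Theta> g w * (a g w * a h w * q h w)))" for w
    unfolding V_def power2_eq_square sum_product sum_divide_distrib by (intro sum.cong refl) (simp add: q_def)
  have V2int: "integrable P (\<lambda>w. (V w)\<^sup>2 / j w)"
    unfolding V2 by (intro Bochner_Integration.integrable_sum integrable_mult_right aqint)
  \<comment> \<open>For bad pairs only the size matters:
    \<open>\<Theta> g * q h = j * q g * q h\<close>, and the product of the normalised weights is at
    most the mean of their squares.\<close>
  have Tbad: "\<bar>Tm g h\<bar> \<le> ((\<integral>w. \<Theta> g w * q g w \<partial>P) + (\<integral>w. \<Theta> h w * q h w \<partial>P)) / 2" if gh: "g \<in> F" "h \<in> F" for g h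
  proof -
    have "\<bar>Tm g h\<bar> \<le> (\<integral>w. \<bar>\<Theta> g w * (a g w * a h w * q h w)\<bar> \<partial>P)" unfolding Tm_def by (rule integral_abs_bound)
    also have "\<dots> \<le> (\<integral>w. (\<Theta> g w * q g w + \<Theta> h w * q h w) / 2 \<partial>P)"
    proof (rule integral_mono)
      fix w assume w: "w \<in> space P"
      have "\<bar>\<Theta> g w * (a g w * a h w * q h w)\<bar> = (\<bar>a g w\<bar> * \<bar>a h w\<bar>) * (\<Theta> g w * q h w)"
        using \<Theta>0[OF gh(1)] q0[OF gh(2)] by (simp add: abs_mult)
      also have "\<dots> \<le> 1 * (\<Theta> g w * q h w)"
        using a1[OF gh(1), of w] a1[OF gh(2), of w] \<Theta>0[OF gh(1)] q0[OF gh(2)] by (intro mult_right_mono mult_le_one) auto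
      also have "\<dots> = j w * (q g w * q h w)" using \<Theta>q[OF gh(1), of w] by simp
      also have "\<dots> \<le> j w * (((q g w)\<^sup>2 + (q h w)\<^sup>2) / 2)"
        using sum_squares_bound[of "q g w" "q h w"] j0 by (intro mult_left_mono) auto
      also have "\<dots> = (\<Theta> g w * q g w + \<Theta> h w * q h w) / 2"
        using \<Theta>q[OF gh(1), of w] \<Theta>q[OF gh(2), of w] by (simp add: power2_eq_square algebra_simps)
      finally show "\<bar>\<Theta> g w * (a g w * a h w * q h w)\<bar> \<le> (\<Theta> g w * q g w + \<Theta> h w * q h w) / 2" .
    qed (use aqint[OF gh] qq gh in auto)
    also have "\<dots> = ((\<integral>w. \<Theta> g w * q g w \<partial>P) + (\<integral>w. \<Theta> h w * q h w \<partial>P)) / 2" using qq gh by simp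
    finally show ?thesis .
  qed
  \<comment> \<open>Replacing \<open>q h\<close> by its value at \<open>U g w\<close> makes the
    integral vanish, by \<open>good\<close>. What remains is the change of the normalised weight
    under \<open>U g\<close>.\<close>
  have Tgood: "\<bar>Tm g h\<bar> \<le> K * (\<integral>w. X g h w \<partial>P)" if gh: "g \<in> F" "h \<in> F" "\<not> bad g h" for g h
  proof -
    have qUm: "(\<lambda>w. q h (U g w)) \<in> borel_measurable P" using measurable_compose[OF Um[OF gh(1)] qm[OF gh(2)]] .
    have i2: "integrable P (\<lambda>w. \<Theta> g w * (a g w * a h w * q h (U g w)))"
    proof (rule bint[OF gh(1), of _ 1])
      show "(\<lambda>w. a g w * a h w * q h (U g w)) \<in> borel_measurable P" using gh by (intro borel_measurable_times am qUm)
      fix w show "\<bar>a g w * a h w * q h (U g w)\<bar> \<le> 1"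
        using a1[OF gh(1), of w] a1[OF gh(2), of w] q0[OF gh(2), of "U g w"] q1[OF gh(2), of "U g w"]
        by (simp add: abs_mult mult_le_one)
    qed
    have "(\<integral>w. \<Theta> g w * (a g w * a h w * q h (U g w)) \<partial>P) = 0"
      using good[OF gh] by (simp add: q_def j_def mult_ac)
    then have "Tm g h = (\<integral>w. \<Theta> g w * (a g w * a h w * q h w) - \<Theta> g w * (a g w * a h w * q h (U g w)) \<partial>P)"
      unfolding Tm_def using aqint[OF gh(1,2)] i2 by simp
    also have "\<bar>\<dots>\<bar> \<le> (\<integral>w. \<bar>\<Theta> g w * (a g w * a h w * q h w) - \<Theta> g w * (a g w * a h w * q h (U g w))\<bar> \<partial>P)"
      by (rule integral_abs_bound)
    also have "\<dots> \<le> (\<integral>w. K * X g h w \<partial>P)"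
    proof (rule integral_mono)
      fix w assume w: "w \<in> space P"
      have "\<bar>\<Theta> g w * (a g w * a h w * q h w) - \<Theta> g w * (a g w * a h w * q h (U g w))\<bar> = \<Theta> g w * ((\<bar>a g w\<bar> * \<bar>a h w\<bar>) * \<bar>q h w - q h (U g w)\<bar>)"
        using \<Theta>0[OF gh(1)] by (simp add: abs_mult right_diff_distrib[symmetric])
      also have "\<dots> \<le> \<Theta> g w * (1 * \<bar>q h w - q h (U g w)\<bar>)"
        using a1[OF gh(1), of w] a1[OF gh(2), of w] \<Theta>0[OF gh(1)] by (intro mult_left_mono mult_right_mono mult_le_one) auto
      also have "\<dots> \<le> \<Theta> g w * (1 * (K * (E g h * q h w + q h w * (\<Sum>k\<in>F. E g k * q k w))))"
        unfolding q_def jd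
        by (intro mult_left_mono weight_perturbation F \<Theta>0 E0 up lo gh w) (auto simp: \<Theta>0 gh)
      finally show "\<bar>\<Theta> g w * (a g w * a h w * q h w) - \<Theta> g w * (a g w * a h w * q h (U g w))\<bar> \<le> K * X g h w"
        by (simp add: X_def mult_ac)
    qed (use aqint[OF gh(1,2)] i2 Xint[OF gh(1,2)] in auto)
    finally show ?thesis by simp
  qed
  have X0: "0 \<le> (\<integral>w. X g h w \<partial>P)" if "g \<in> F" "h \<in> F" for g h
    unfolding X_def using that by (intro integral_nonneg_AE AE_I2 mult_nonneg_nonneg add_nonneg_nonneg sum_nonneg \<Theta>0 q0 E0)
  have Q0: "0 \<le> (\<integral>w. \<Theta> g w * q g w \<partial>P)" if "g \<in> F" for g
    using that by (intro integral_nonneg_AE AE_I2 mult_nonneg_nonneg \<Theta>0 q0)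
  have Q: "(\<Sum>g\<in>F. \<integral>w. \<Theta> g w * q g w \<partial>P) \<le> S"
    using S qq by (subst (asm) Bochner_Integration.integral_sum) (auto simp: q_def j_def)
  have XS: "(\<Sum>g\<in>F. \<Sum>h\<in>F. \<integral>w. X g h w \<partial>P) \<le> t * S + (L / t) * (card F * C)"
  proof -
    have "(\<Sum>g\<in>F. \<Sum>h\<in>F. \<integral>w. X g h w \<partial>P) = (\<integral>w. (\<Sum>g\<in>F. \<Sum>h\<in>F. X g h w) \<partial>P)"
      using Xint by (simp add: Bochner_Integration.integral_sum Bochner_Integration.integrable_sum)
    also have "\<dots> \<le> (\<integral>w. t * (\<Sum>g\<in>F. \<Theta> g w * q g w) + (L / t) * j w \<partial>P)"
    proof (rule integral_mono)
      fix w
      show "(\<Sum>g\<in>F. \<Sum>h\<in>F. X g h w) \<le> t * (\<Sum>g\<in>F. \<Theta> g w * q g w) + (L / t) * j w"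
        unfolding X_def q_def jd by (rule weight_sum_bound[OF F \<Theta>0 E0 EL t])
    qed (use Xint qq jint in \<open>auto intro!: Bochner_Integration.integrable_add Bochner_Integration.integrable_sum\<close>)
    also have "\<dots> = t * (\<Sum>g\<in>F. \<integral>w. \<Theta> g w * q g w \<partial>P) + (L / t) * (card F * C)"
      using qq jint by (simp add: Bochner_Integration.integral_sum Bochner_Integration.integrable_sum jC)
    also have "\<dots> \<le> t * S + (L / t) * (card F * C)" using Q t by (intro add_right_mono mult_left_mono) auto
    finally show ?thesis .
  qed
  let ?Q = "\<lambda>g. \<integral>w. \<Theta> g w * q g w \<partial>P"
  have badS: "(\<Sum>g\<in>F. \<Sum>h\<in>F. if bad g h then (?Q g + ?Q h) / 2 else 0) \<le> m * S"
  proof -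
    have "(\<Sum>g\<in>F. \<Sum>h\<in>F. if bad g h then (?Q g + ?Q h) / 2 else 0)
      = (\<Sum>g\<in>F. \<Sum>h\<in>F. (if bad g h then ?Q g / 2 else 0)) + (\<Sum>g\<in>F. \<Sum>h\<in>F. (if bad g h then ?Q h / 2 else 0))"
      unfolding sum.distrib[symmetric] by (intro sum.cong refl) (simp add: add_divide_distrib)
    also have "(\<Sum>g\<in>F. \<Sum>h\<in>F. (if bad g h then ?Q h / 2 else 0)) = (\<Sum>h\<in>F. \<Sum>g\<in>F. (if bad g h then ?Q h / 2 else 0))"
      by (rule sum.swap)
    also have "\<dots> = (\<Sum>h\<in>F. card {g \<in> F. bad g h} * (?Q h / 2))"
      using F by (intro sum.cong refl) (simp add: sum.If_cases Int_def)
    also have "(\<Sum>g\<in>F. \<Sum>h\<in>F. (if bad g h then ?Q g / 2 else 0)) = (\<Sum>g\<in>F. card {h \<in> F. bad g h} * (?Q g / 2))"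
      using F by (intro sum.cong refl) (simp add: sum.If_cases Int_def)
    also have "(\<Sum>g\<in>F. card {h \<in> F. bad g h} * (?Q g / 2)) + (\<Sum>h\<in>F. card {g \<in> F. bad g h} * (?Q h / 2))
      \<le> (\<Sum>g\<in>F. m * (?Q g / 2)) + (\<Sum>g\<in>F. m * (?Q g / 2))"
      using bad1 bad2 Q0 by (intro add_mono sum_mono mult_right_mono) auto
    also have "\<dots> = m * (\<Sum>g\<in>F. ?Q g)" by (simp add: sum_distrib_left sum.distrib[symmetric])
    also have "\<dots> \<le> m * S" using Q m0 by (rule mult_left_mono)
    finally show ?thesis .
  qed
  have "(\<integral>w. (V w)\<^sup>2 / j w \<partial>P) = (\<Sum>g\<in>F. \<Sum>h\<in>F. (f g * f h) * Tm g h)"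
    unfolding V2 Tm_def using aqint by (simp add: Bochner_Integration.integral_sum Bochner_Integration.integrable_sum)
  also have "\<dots> \<le> (\<Sum>g\<in>F. \<Sum>h\<in>F. (if bad g h then (?Q g + ?Q h) / 2 else 0) + K * (\<integral>w. X g h w \<partial>P))"
  proof (intro sum_mono)
    fix g h assume gh: "g \<in> F" "h \<in> F"
    have "(f g * f h) * Tm g h \<le> \<bar>f g\<bar> * \<bar>f h\<bar> * \<bar>Tm g h\<bar>" by (metis abs_ge_self abs_mult)
    also have "\<dots> \<le> 1 * \<bar>Tm g h\<bar>" using f1 gh by (intro mult_right_mono mult_le_one) auto
    also have "\<dots> \<le> (if bad g h then (?Q g + ?Q h) / 2 else 0) + K * (\<integral>w. X g h w \<partial>P)"
    proof -
      have "0 \<le> K * (\<integral>w. X g h w \<partial>P)" using X0[OF gh] K by simp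
      moreover have "\<bar>Tm g h\<bar> \<le> (if bad g h then (?Q g + ?Q h) / 2 else K * (\<integral>w. X g h w \<partial>P))"
        using Tbad[OF gh] Tgood[OF gh] by simp
      ultimately show ?thesis by (cases "bad g h") (simp only: mult_1 if_True if_False simp_thms add_0; linarith)+
    qed
    finally show "(f g * f h) * Tm g h \<le> (if bad g h then (?Q g + ?Q h) / 2 else 0) + K * (\<integral>w. X g h w \<partial>P)" .
  qed
  also have "\<dots> = (\<Sum>g\<in>F. \<Sum>h\<in>F. if bad g h then (?Q g + ?Q h) / 2 else 0) + K * (\<Sum>g\<in>F. \<Sum>h\<in>F. \<integral>w. X g h w \<partial>P)"
    by (simp only: sum.distrib sum_distrib_left)
  also have "\<dots> \<le> m * S + K * (t * S + (L / t) * (card F * C))"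
    using badS XS K by (intro add_mono mult_left_mono)
  finally have V2b: "(\<integral>w. (V w)\<^sup>2 / j w \<partial>P) \<le> m * S + K * (t * S + (L / t) * (card F * C))" .
  have "(\<integral>w. \<bar>V w\<bar> \<partial>P) \<le> (\<integral>w. (1 / (2 * c)) * ((V w)\<^sup>2 / j w) + (c / 2) * j w \<partial>P)"
  proof (rule integral_mono)
    show "integrable P (\<lambda>w. \<bar>V w\<bar>)"
      by (rule Bochner_Integration.integrable_bound[OF jint]) (use Vm Vj j0 in \<open>auto intro!: AE_I2\<close>)
    show "\<bar>V w\<bar> \<le> (1 / (2 * c)) * ((V w)\<^sup>2 / j w) + (c / 2) * j w" for w by (rule abs_le_sq_div[OF Vj c])
  qed (intro Bochner_Integration.integrable_add integrable_mult_right V2int jint)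
  also have "\<dots> = (1 / (2 * c)) * (\<integral>w. (V w)\<^sup>2 / j w \<partial>P) + (c / 2) * (card F * C)"
    by (simp only: Bochner_Integration.integral_add[OF integrable_mult_right[OF V2int] integrable_mult_right[OF jint]] integral_mult_right_zero jC)
  also have "\<dots> \<le> (1 / (2 * c)) * (m * S + K * (t * S + (L / t) * (card F * C))) + (c / 2) * (card F * C)"
    using V2b c by (intro add_right_mono mult_left_mono) auto
  finally show ?thesis by (simp add: V_def)
qed

section \<open>The Laplace kernel on the real line\<close>

lemma nn_laplace:
  fixes e c :: real
  assumes e: "0 < e"
  shows "(\<integral>\<^sup>+s. ennreal (exp (- (e * \<bar>s + c\<bar>))) \<partial>lborel) = ennreal (2 / e)"
proof -
  let ?h = "\<lambda>s::real. ennreal (exp (- (e * s))) * indicator {0..} s"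
  have h: "(\<integral>\<^sup>+s. ?h s \<partial>lborel) = ennreal (1 / e)"
  proof -
    have lim: "((\<lambda>s. - exp (- (e * s)) / e) \<longlongrightarrow> 0) at_top" using e by real_asymp
    have d: "DERIV (\<lambda>s. - exp (- (e * s)) / e) x :> exp (- (e * x))" for x
      using e by (auto intro!: derivative_eq_intros)
    have "(\<integral>\<^sup>+s. ?h s \<partial>lborel) = ennreal (0 - (- exp (- (e * 0)) / e))"
      by (rule nn_integral_FTC_atLeast[OF _ d _ lim]) auto
    then show ?thesis by simp
  qed
  have "(\<integral>\<^sup>+s. ennreal (exp (- (e * \<bar>s\<bar>))) \<partial>lborel) = (\<integral>\<^sup>+s. ?h s + ?h (- s) \<partial>lborel)"
  proof (rule nn_integral_cong_AE)
    show "AE s in lborel. ennreal (exp (- (e * \<bar>s\<bar>))) = ?h s + ?h (- s)"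
      using AE_lborel_singleton[of "0::real"] by eventually_elim (auto simp: indicator_def abs_if)
  qed
  also have "\<dots> = (\<integral>\<^sup>+s. ?h s \<partial>lborel) + (\<integral>\<^sup>+s. ?h (- s) \<partial>lborel)" by (rule nn_integral_add) auto
  also have "(\<integral>\<^sup>+s. ?h (- s) \<partial>lborel) = (\<integral>\<^sup>+s. ?h s \<partial>lborel)"
    using nn_integral_real_affine[of ?h "-1" 0] by simp
  finally have 0: "(\<integral>\<^sup>+s. ennreal (exp (- (e * \<bar>s\<bar>))) \<partial>lborel) = ennreal (2 / e)"
    using e by (simp add: h ennreal_plus[symmetric] del: ennreal_plus)
  show ?thesis
    using nn_integral_real_affine[of "\<lambda>s. ennreal (exp (- (e * \<bar>s\<bar>)))" 1 c] 0 by (simp add: add.commute)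
qed

text \<open>The exponential kernel is chosen because a shift changes it by a bounded factor,
  uniformly on the line.\<close>

lemma nn_laplace_quotient:
  fixes e \<alpha> \<beta> :: real
  assumes e: "0 < e"
  shows "(\<integral>\<^sup>+s. ennreal (exp (- (e * \<bar>s + \<alpha>\<bar>)) * (exp (- (e * \<bar>s + \<alpha>\<bar>)) / exp (- (e * \<bar>s + \<beta>\<bar>)))) \<partial>lborel) \<le> ennreal (2 / e * exp (e * \<bar>\<alpha> - \<beta>\<bar>))"
proof -
  have "(\<integral>\<^sup>+s. ennreal (exp (- (e * \<bar>s + \<alpha>\<bar>)) * (exp (- (e * \<bar>s + \<alpha>\<bar>)) / exp (- (e * \<bar>s + \<beta>\<bar>)))) \<partial>lborel)
    \<le> (\<integral>\<^sup>+s. ennreal (exp (e * \<bar>\<alpha> - \<beta>\<bar>)) * ennreal (exp (- (e * \<bar>s + \<alpha>\<bar>))) \<partial>lborel)"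
  proof (rule nn_integral_mono)
    fix s
    have "\<bar>s + \<beta>\<bar> \<le> \<bar>s + \<alpha>\<bar> + \<bar>\<alpha> - \<beta>\<bar>" by linarith
    then have "e * \<bar>s + \<beta>\<bar> \<le> e * (\<bar>s + \<alpha>\<bar> + \<bar>\<alpha> - \<beta>\<bar>)" using e by simp
    then have "exp (- (e * \<bar>s + \<alpha>\<bar>)) / exp (- (e * \<bar>s + \<beta>\<bar>)) \<le> exp (e * \<bar>\<alpha> - \<beta>\<bar>)"
      by (simp add: exp_diff[symmetric] algebra_simps)
    then have "exp (- (e * \<bar>s + \<alpha>\<bar>)) * (exp (- (e * \<bar>s + \<alpha>\<bar>)) / exp (- (e * \<bar>s + \<beta>\<bar>))) \<le> exp (- (e * \<bar>s + \<alpha>\<bar>)) * exp (e * \<bar>\<alpha> - \<beta>\<bar>)"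
      by (intro mult_left_mono) auto
    then show "ennreal (exp (- (e * \<bar>s + \<alpha>\<bar>)) * (exp (- (e * \<bar>s + \<alpha>\<bar>)) / exp (- (e * \<bar>s + \<beta>\<bar>)))) \<le> ennreal (exp (e * \<bar>\<alpha> - \<beta>\<bar>)) * ennreal (exp (- (e * \<bar>s + \<alpha>\<bar>)))"
      by (simp add: ennreal_mult[symmetric] ennreal_leI mult.commute)
  qed
  also have "\<dots> = ennreal (exp (e * \<bar>\<alpha> - \<beta>\<bar>)) * ennreal (2 / e)"
    by (subst nn_integral_cmult) (auto simp: nn_laplace[OF e])
  also have "\<dots> = ennreal (2 / e * exp (e * \<bar>\<alpha> - \<beta>\<bar>))" using e by (simp add: ennreal_mult[symmetric] mult.commute)
  finally show ?thesis .
qed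

lemma exp_abs_ln:
  assumes r: "0 < (r::real)" shows "exp \<bar>ln r\<bar> = max r (1 / r)"
proof (cases "1 \<le> r")
  case True
  then have "1 / r \<le> 1" "0 \<le> ln r" using r by (simp_all add: divide_le_eq)
  then have "1 / r \<le> r" using True by linarith
  then show ?thesis using r \<open>0 \<le> ln r\<close> by (simp add: max.absorb1)
next
  case False
  have "ln r < 0" using False r by simp
  then have "exp \<bar>ln r\<bar> = 1 / r" using r by (simp add: exp_minus inverse_eq_divide)
  moreover have "1 \<le> 1 / r" using False r by (simp add: le_divide_eq)
  ultimately show ?thesis using False by (simp add: max_def)
qed

text \<open>Here \<open>x\<close> is the factor by which \<open>Th\<close> changes when one
  coordinate is altered: \<open>r\<close> comes from the density and the exponential from the shift
  of the kernel by \<open>ln r'\<close>. Since \<open>e \<le> 1\<close>, that shift costs at most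
  the factor \<open>max r' (1 / r')\<close>.\<close>

lemma theta_perturb:
  fixes e c r r' A :: real
  assumes e: "0 < e" "e \<le> 1" and c: "0 < c" "c \<le> 1" and r: "c \<le> r" "r \<le> 1 / c" and r': "r' = 1 \<or> r' = r"
  defines "x \<equiv> r * exp (- (e * \<bar>A + ln r'\<bar>) + e * \<bar>A\<bar>)"
  shows "\<bar>x - 1\<bar> \<le> (1 / c\<^sup>2 + 1) * \<bar>r - 1\<bar>" "c\<^sup>2 \<le> x"
proof -
  have r'c: "c \<le> r'" "r' \<le> 1 / c" "0 < r'" "0 < r" using r r' c by (auto simp: divide_simps)
  define q where "q = exp (- (e * \<bar>A + ln r'\<bar>) + e * \<bar>A\<bar>)"
  define m where "m = max r' (1 / r')"
  have "\<bar>- (e * \<bar>A + ln r'\<bar>) + e * \<bar>A\<bar>\<bar> = e * \<bar>\<bar>A\<bar> - \<bar>A + ln r'\<bar>\<bar>"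
  proof -
    have "- (e * \<bar>A + ln r'\<bar>) + e * \<bar>A\<bar> = e * (\<bar>A\<bar> - \<bar>A + ln r'\<bar>)" by (simp add: algebra_simps)
    then show ?thesis using e by (simp add: abs_mult)
  qed
  also have "\<dots> \<le> 1 * \<bar>ln r'\<bar>" using e by (intro mult_mono) auto
  finally have ex: "\<bar>- (e * \<bar>A + ln r'\<bar>) + e * \<bar>A\<bar>\<bar> \<le> \<bar>ln r'\<bar>" by simp
  have qm: "q \<le> m" "1 / m \<le> q"
  proof -
    have m: "m = exp \<bar>ln r'\<bar>" using exp_abs_ln[OF r'c(3)] by (simp add: m_def)
    show "q \<le> m" using ex unfolding m q_def by (simp add: abs_le_iff)
    have "1 / m = exp (- \<bar>ln r'\<bar>)" unfolding m by (simp add: exp_minus inverse_eq_divide)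
    then show "1 / m \<le> q" using ex unfolding q_def by (simp add: abs_le_iff)
  qed
  have "1 / r' \<le> 1 / c" using r'c c by (intro divide_left_mono) auto
  moreover have "1 \<le> r' \<or> 1 \<le> 1 / r'" using r'c by (auto simp: le_divide_eq)
  ultimately have m1: "1 \<le> m" "m \<le> 1 / c" using r'c(2) unfolding m_def le_max_iff_disj by simp_all
  have mr: "m - 1 \<le> \<bar>r' - 1\<bar> / c"
  proof (cases "1 / r' \<le> r'")
    case True
    then have "m - 1 \<le> \<bar>r' - 1\<bar>" by (simp add: m_def)
    also have "\<dots> \<le> \<bar>r' - 1\<bar> / c" using c by (simp add: le_divide_eq mult_left_le)
    finally show ?thesis .
  next
    case False
    then have "m - 1 = (1 - r') / r'" using r'c by (simp add: m_def field_simps)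
    also have "\<dots> \<le> \<bar>r' - 1\<bar> / c" using r'c c by (intro frac_le) auto
    finally show ?thesis .
  qed
  have "\<bar>q - 1\<bar> \<le> m - 1"
  proof -
    have "1 - 1 / m \<le> m - 1"
    proof -
      have "0 \<le> (m - 1)\<^sup>2 / m" using m1 by simp
      also have "\<dots> = m - 2 + 1 / m" using m1 by (simp add: power2_eq_square field_simps)
      finally show ?thesis by simp
    qed
    then show ?thesis using qm by linarith
  qed
  also note mr
  also have "\<bar>r' - 1\<bar> / c \<le> \<bar>r - 1\<bar> / c" using r' c by (auto simp: divide_right_mono)
  finally have q1: "\<bar>q - 1\<bar> \<le> \<bar>r - 1\<bar> / c" .
  have "x - 1 = r * (q - 1) + (r - 1)" by (simp add: x_def q_def algebra_simps)
  then have "\<bar>x - 1\<bar> \<le> r * \<bar>q - 1\<bar> + \<bar>r - 1\<bar>" using abs_triangle_ineq[of "r * (q - 1)" "r - 1"] r'c by (simp add: abs_mult)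
  also have "\<dots> \<le> (1 / c) * (\<bar>r - 1\<bar> / c) + \<bar>r - 1\<bar>" using q1 r c r'c by (intro add_right_mono mult_mono) auto
  also have "\<dots> = (1 / c\<^sup>2 + 1) * \<bar>r - 1\<bar>" using c by (simp add: power2_eq_square field_simps)
  finally show "\<bar>x - 1\<bar> \<le> (1 / c\<^sup>2 + 1) * \<bar>r - 1\<bar>" .
  have "c \<le> 1 / m" using m1 c by (simp add: field_simps)
  then have "c * c \<le> r * q" using qm(2) r c by (intro mult_mono) auto
  then show "c\<^sup>2 \<le> x" by (simp add: x_def q_def power2_eq_square)
qed

text \<open>If every finite set with \<open>w \<le> W\<close> had at most
  \<open>X * exp (A' * W)\<close> elements, sorting by the integer part of \<open>w\<close> would
  dominate the series by a geometric one with ratio \<open>exp (A' - A)\<close>.\<close>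

lemma large_level_sets:
  fixes w :: "'g \<Rightarrow> real"
  assumes w: "\<And>g. g \<in> S \<Longrightarrow> 0 \<le> w g" and A: "0 \<le> A'" "A' < A" and X: "0 < X"
    and ns: "\<not> (\<lambda>g. exp (- A * w g)) summable_on S"
  obtains W F where "0 \<le> W" "finite F" "F \<subseteq> S" "\<And>g. g \<in> F \<Longrightarrow> w g \<le> W" "X * exp (A' * W) \<le> real (card F)"
proof (rule ccontr)
  note hyp = that
  assume neg: "\<not> thesis"
  have small: "real (card F) \<le> X * exp (A' * W)" if "0 \<le> W" "finite F" "F \<subseteq> S" "\<And>g. g \<in> F \<Longrightarrow> w g \<le> W" for W F
  proof (rule ccontr)
    assume "\<not> ?thesis"
    then have "X * exp (A' * W) \<le> real (card F)" by simp
    from hyp[OF that this] neg show False by simp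
  qed
  let ?r = "exp (A' - A)"
  have r: "0 < ?r" "?r < 1" using A by auto
  have "(\<lambda>g. exp (- A * w g)) summable_on S"
  proof (rule nonneg_bdd_above_summable_on)
    show "bdd_above (sum (\<lambda>g. exp (- A * w g)) ` {F. F \<subseteq> S \<and> finite F})"
    proof (rule bdd_aboveI2[where M = "X * exp A' * (1 / (1 - ?r))"])
      fix F assume "F \<in> {F. F \<subseteq> S \<and> finite F}"
      then have F: "F \<subseteq> S" "finite F" by auto
      let ?n = "\<lambda>g. nat \<lfloor>w g\<rfloor>"
      have "(\<Sum>g\<in>F. exp (- A * w g)) = (\<Sum>n\<in>?n ` F. \<Sum>g\<in>{g \<in> F. ?n g = n}. exp (- A * w g))"
        by (rule sum.image_gen[OF F(2)])
      also have "\<dots> \<le> (\<Sum>n\<in>?n ` F. X * exp A' * ?r ^ n)"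
      proof (rule sum_mono)
        fix n assume "n \<in> ?n ` F"
        have wn: "real n \<le> w g \<and> w g \<le> real n + 1" if "g \<in> F" "?n g = n" for g
          using w[of g] F that by (auto simp: le_nat_iff)
        have "(\<Sum>g\<in>{g \<in> F. ?n g = n}. exp (- A * w g)) \<le> (\<Sum>g\<in>{g \<in> F. ?n g = n}. exp (- A * real n))"
          using wn A by (intro sum_mono) (auto intro!: mult_left_mono)
        also have "\<dots> = real (card {g \<in> F. ?n g = n}) * exp (- A * real n)" by simp
        also have "\<dots> \<le> (X * exp (A' * (real n + 1))) * exp (- A * real n)"
          using F wn by (intro mult_right_mono small) auto
        also have "\<dots> = X * exp A' * ?r ^ n"
          by (simp add: exp_of_nat_mult[symmetric] mult_exp_exp algebra_simps)
        finally show "(\<Sum>g\<in>{g \<in> F. ?n g = n}. exp (- A * w g)) \<le> X * exp A' * ?r ^ n" .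
      qed
      also have "\<dots> = X * exp A' * (\<Sum>n\<in>?n ` F. ?r ^ n)" by (simp add: sum_distrib_left)
      also have "\<dots> \<le> X * exp A' * (1 / (1 - ?r))"
      proof (rule mult_left_mono)
        have "(\<Sum>n\<in>?n ` F. ?r ^ n) \<le> (\<Sum>n. ?r ^ n)"
          using r F by (intro sum_le_suminf summable_geometric) auto
        also have "\<dots> = 1 / (1 - ?r)" using r by (intro suminf_geometric) auto
        finally show "(\<Sum>n\<in>?n ` F. ?r ^ n) \<le> 1 / (1 - ?r)" .
      qed (use X in auto)
      finally show "(\<Sum>g\<in>F. exp (- A * w g)) \<le> X * exp A' * (1 / (1 - ?r))" .
    qed
  qed auto
  then show False using ns by simp
qed

context bernoulli
begin

text \<open>Compactness of [\<delta>, 1 - \<delta>]: if each value had a neighbourhood with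
  convergent partial series, finitely many of these would cover all marginals and the whole series
  would converge.\<close>

lemma exists_recurrent_value:
  assumes ns: "\<not> (\<lambda>g. exp (- A * wt g)) summable_on carrier G"
  obtains l where "l \<in> {\<delta>..1 - \<delta>}"
    "\<And>\<eta>. 0 < \<eta> \<Longrightarrow> \<not> (\<lambda>g. exp (- A * wt g)) summable_on {g \<in> carrier G. \<bar>pmf (\<mu> g) False - l\<bar> < \<eta>}"
proof (rule ccontr)
  let ?s = "\<lambda>g. exp (- A * wt g)"
  let ?B = "\<lambda>l \<eta>. {g \<in> carrier G. \<bar>pmf (\<mu> g) False - l\<bar> < \<eta>}"
  note hyp = that
  assume neg: "\<not> thesis"
  have "\<forall>l\<in>{\<delta>..1 - \<delta>}. \<exists>\<eta>. 0 < \<eta> \<and> ?s summable_on ?B l \<eta>"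
    using neg hyp by blast
  from bchoice[OF this] obtain \<eta> where \<eta>: "\<And>l. l \<in> {\<delta>..1 - \<delta>} \<Longrightarrow> 0 < \<eta> l \<and> ?s summable_on ?B l (\<eta> l)" by blast
  obtain C where C: "C \<subseteq> {\<delta>..1 - \<delta>}" "finite C" "{\<delta>..1 - \<delta>} \<subseteq> (\<Union>l\<in>C. ball l (\<eta> l))"
  proof (rule compactE_image[of "{\<delta>..1 - \<delta>}" "{\<delta>..1 - \<delta>}" "\<lambda>l. ball l (\<eta> l)"])
    show "{\<delta>..1 - \<delta>} \<subseteq> (\<Union>l\<in>{\<delta>..1 - \<delta>}. ball l (\<eta> l))" using \<eta> by (meson UN_I centre_in_ball subsetI)
  qed auto
  have "?s summable_on (\<Union>l\<in>C. ?B l (\<eta> l))" using C(2,1)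
  proof (induction C rule: finite_induct)
    case (insert l C)
    then have "?s summable_on (?B l (\<eta> l) \<union> (\<Union>l\<in>C. ?B l (\<eta> l)))" using \<eta> by (intro summable_on_union) auto
    then show ?case by simp
  qed simp
  moreover have "carrier G \<subseteq> (\<Union>l\<in>C. ?B l (\<eta> l))"
  proof
    fix g assume g: "g \<in> carrier G"
    then obtain l where "l \<in> C" "pmf (\<mu> g) False \<in> ball l (\<eta> l)" using C(3) marginal[OF g] by blast
    then show "g \<in> (\<Union>l\<in>C. ?B l (\<eta> l))" using g by (auto simp: dist_real_def abs_minus_commute)
  qed
  ultimately show False using ns summable_on_subset by blast
qed

text \<open>Right translation by \<open>b\<close> changes the weight only within the limits of
  \<open>wt_mult\<close>; passing from \<open>A\<close> to any smaller \<open>A'\<close> pays for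
  the factor \<open>1 + t\<close> there.\<close>

lemma translate_not_summable:
  assumes A: "0 < A'" "A' < A" and b: "b \<in> carrier G"
    and ns: "\<not> (\<lambda>g. exp (- A * wt g)) summable_on {g \<in> carrier G. P g}"
  shows "\<not> (\<lambda>g. exp (- A' * wt g)) summable_on {g \<in> carrier G. P (g \<otimes> b)}"
proof
  assume s: "(\<lambda>g. exp (- A' * wt g)) summable_on {g \<in> carrier G. P (g \<otimes> b)}"
  \<comment> \<open>This makes \<open>A' * (1 + t)\<close> equal to \<open>A\<close>; the weight of
    \<open>inv b\<close> then contributes only a constant factor.\<close>
  define t where "t = A / A' - 1"
  have t: "0 < t" "A' * (1 + t) = A" using A by (auto simp: t_def)
  let ?K = "A' * (1 + 1 / t) * wt (inv b)"
  have s': "(\<lambda>g. exp (- A' * wt (g \<otimes> inv b))) summable_on {g \<in> carrier G. P g}"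
  proof (subst summable_on_reindex_bij_witness[where i = "\<lambda>g. g \<otimes> b" and j = "\<lambda>g. g \<otimes> inv b" and T = "{g \<in> carrier G. P (g \<otimes> b)}" and h = "\<lambda>g. exp (- A' * wt g)"])
    show "(\<lambda>g. exp (- A' * wt g)) summable_on {g \<in> carrier G. P (g \<otimes> b)}" by (rule s)
  qed (use b in \<open>auto simp: m_assoc\<close>)
  have "(\<lambda>g. exp (- A * wt g)) summable_on {g \<in> carrier G. P g}"
  proof (rule summable_on_comparison_test[OF summable_on_cmult_right[OF s', of "exp ?K"]])
    fix g assume "g \<in> {g \<in> carrier G. P g}"
    then have g: "g \<in> carrier G" by simp
    have "A' * wt (g \<otimes> inv b) \<le> A' * ((1 + t) * wt g + (1 + 1 / t) * wt (inv b))"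
      using wt_mult[OF g _ t(1), of "inv b"] b A by (intro mult_left_mono) auto
    also have "\<dots> = A * wt g + ?K" using t(2) by (simp only: distrib_left mult.assoc[symmetric])
    finally show "exp (- A * wt g) \<le> exp ?K * exp (- A' * wt (g \<otimes> inv b))" by (simp add: mult_exp_exp)
  qed simp
  then show False using ns by simp
qed

text \<open>The factor of \<open>dens g\<close> at the coordinate \<open>g b\<close> is divided out, so that \<open>exp\<close> below is not affected by resampling
  this coordinate.\<close>
definition fl where "fl b g z = dens g z / ratio g (g \<otimes> b) (z (g \<otimes> b))"

text \<open>The density times a kernel in a real variable; integrating that variable out returns a
  multiple of \<open>dens g\<close>. For weak mixing this marginal suffices, whereas on the Maharam
  extension \<open>Th\<close> is what smoothing by \<open>Phi\<close> produces.\<close>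

definition Th :: "real \<Rightarrow> 'a \<Rightarrow> 'a \<Rightarrow> ('a \<Rightarrow> bool) \<times> real \<Rightarrow> real" where
  "Th e b g w = dens g (fst w) * exp (- (e * \<bar>snd w + ln (fl b g (fst w))\<bar>))"

lemma dens_upd_quot:
  assumes "g \<in> carrier G" "z \<in> carrier G \<rightarrow>\<^sub>E UNIV" "j \<in> carrier G"
  shows "dens g (z(j := y)) = dens g z * (ratio g j y / ratio g j (z j))"
  using dens_upd[OF assms, of y] ratio_pos[OF assms(1,3), of "z j"] by (simp add: field_simps)

lemma fl_upd:
  assumes g: "g \<in> carrier G" and b: "b \<in> carrier G" and z: "z \<in> carrier G \<rightarrow>\<^sub>E UNIV" and j: "j \<in> carrier G"
  shows "fl b g (z(j := y)) = fl b g z * (if g \<otimes> b = j then 1 else ratio g j y / ratio g j (z j))"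
proof (cases "g \<otimes> b = j")
  case True
  have "ratio g j (z j) \<noteq> 0" "ratio g j y \<noteq> 0" using ratio_pos[OF g j] by (metis less_irrefl)+
  then show ?thesis unfolding fl_def True dens_upd_quot[OF g z j] by simp
next
  case False
  then have "(z(j := y)) (g \<otimes> b) = z (g \<otimes> b)" by simp
  then show ?thesis unfolding fl_def dens_upd_quot[OF g z j] using False by simp
qed

lemma ratio_quot:
  assumes k: "k \<in> carrier G" and j: "j \<in> carrier G"
  shows "\<bar>ratio k j y / ratio k j y' - 1\<bar> \<le> \<bar>coc k j\<bar> / \<delta>\<^sup>2" "\<delta>\<^sup>2 \<le> ratio k j y / ratio k j y'" "ratio k j y / ratio k j y' \<le> 1 / \<delta>\<^sup>2"
proof -
  let ?p = "\<lambda>y. pmf (sh k j) y" and ?q = "\<lambda>y. pmf (\<mu> j) y"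
  have pq: "\<delta> \<le> ?p y" "\<delta> \<le> ?q y" "0 < ?p y" "0 < ?q y" "?p y \<le> 1" "?q y \<le> 1" for y
    using sh_marg_ge[OF k j, of y] marg_ge[OF j, of y] \<delta>_pos by (auto simp: pmf_le_1)
  have eq: "ratio k j y / ratio k j y' = (?p y * ?q y') / (?q y * ?p y')"
    by (simp add: ratio_def)
  have den: "\<delta>\<^sup>2 \<le> ?q y * ?p y'" "\<delta>\<^sup>2 \<le> ?p y * ?q y'"
    unfolding power2_eq_square using pq(1,2) less_imp_le[OF \<delta>_pos] by (auto intro!: mult_mono intro: order_trans)
  have d2: "0 < \<delta>\<^sup>2" using \<delta>_pos by simp
  have n1: "?p y * ?q y' \<le> 1" "?q y * ?p y' \<le> 1" by (auto intro!: mult_le_one pq(5,6) less_imp_le[OF pq(3)] less_imp_le[OF pq(4)])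
  have "(?p y * ?q y') / 1 \<le> (?p y * ?q y') / (?q y * ?p y')" using n1 pq d2 den by (intro divide_left_mono) (auto intro: less_imp_le)
  then show "\<delta>\<^sup>2 \<le> ratio k j y / ratio k j y'" unfolding eq using den by simp
  show "ratio k j y / ratio k j y' \<le> 1 / \<delta>\<^sup>2" unfolding eq using n1 den d2 pq by (intro frac_le) (auto intro: less_imp_le)
  have "\<bar>?p y * ?q y' - ?q y * ?p y'\<bar> \<le> \<bar>coc k j\<bar>"
    by (cases y; cases y'; simp add: pmf_bool_True coc_alt algebra_simps)
  moreover have "ratio k j y / ratio k j y' - 1 = (?p y * ?q y' - ?q y * ?p y') / (?q y * ?p y')"
    unfolding eq using pq[of y] pq[of y'] by (simp add: field_simps)
  ultimately show "\<bar>ratio k j y / ratio k j y' - 1\<bar> \<le> \<bar>coc k j\<bar> / \<delta>\<^sup>2"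
    using den d2 by (simp add: abs_divide) (intro frac_le; auto)
qed

lemma Th_nonneg: "g \<in> carrier G \<Longrightarrow> 0 \<le> Th e b g w"
  unfolding Th_def by (intro mult_nonneg_nonneg dens_nonneg) auto

text \<open>The constant of \<open>theta_perturb\<close> for \<open>c = \<delta>\<^sup>2\<close>,
  times the \<open>1 / \<delta>\<^sup>2\<close> of \<open>ratio_quot\<close>.\<close>

definition Kl where "Kl = (1 / (\<delta>\<^sup>2)\<^sup>2 + 1) / \<delta>\<^sup>2"

text \<open>The density changes by \<open>r\<close> and the argument of the kernel by
  \<open>ln r'\<close>, where \<open>r'\<close> is 1 at the coordinate whose factor was divided out
  of \<open>fl\<close>; then \<open>theta_perturb\<close> applies. The relative error is
  proportional to the cocycle, whose squares are summable.\<close>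

lemma Th_perturb:
  assumes k: "k \<in> carrier G" and b: "b \<in> carrier G" and j: "j \<in> carrier G" and z: "z \<in> carrier G \<rightarrow>\<^sub>E UNIV"
    and e: "0 < e" "e \<le> 1"
  shows "\<bar>Th e b k (z(j := y), s) - Th e b k (z, s)\<bar> \<le> (Kl * \<bar>coc k j\<bar>) * Th e b k (z, s)"
    "Th e b k (z, s) \<le> (1 / (\<delta>\<^sup>2)\<^sup>2) * Th e b k (z(j := y), s)"
proof -
  define r where "r = ratio k j y / ratio k j (z j)"
  define r' where "r' = (if k \<otimes> b = j then 1 else r)"
  have d: "dens k (z(j := y)) = dens k z * r" unfolding r_def by (rule dens_upd_quot[OF k z j])
  have f: "fl b k (z(j := y)) = fl b k z * r'" unfolding r'_def r_def by (rule fl_upd[OF k b z j])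
  have c: "0 < \<delta>\<^sup>2" "\<delta>\<^sup>2 \<le> 1" using \<delta>_pos \<delta>_lt_1 by (auto simp: power_le_one)
  have r: "\<delta>\<^sup>2 \<le> r" "r \<le> 1 / \<delta>\<^sup>2" "\<bar>r - 1\<bar> \<le> \<bar>coc k j\<bar> / \<delta>\<^sup>2" unfolding r_def using ratio_quot[OF k j] by auto
  have "0 < r" using r c by linarith
  then have r'p: "0 < r'" by (simp add: r'_def)
  define A where "A = s + ln (fl b k z)"
  define x where "x = r * exp (- (e * \<bar>A + ln r'\<bar>) + e * \<bar>A\<bar>)"
  have x: "\<bar>x - 1\<bar> \<le> (1 / (\<delta>\<^sup>2)\<^sup>2 + 1) * \<bar>r - 1\<bar>" "(\<delta>\<^sup>2)\<^sup>2 \<le> x"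
    unfolding x_def by (rule theta_perturb[OF e c r(1,2)], simp add: r'_def)+
  \<comment> \<open>Where the density vanishes it also vanishes after the update, and both sides are
    0. Elsewhere \<open>fl\<close> is positive and its logarithm is additive.\<close>
  have eq: "Th e b k (z(j := y), s) = x * Th e b k (z, s)"
  proof (cases "dens k z = 0")
    case False
    then have "0 < fl b k z" unfolding fl_def using dens_nonneg[OF k, of z] ratio_pos[OF k, of "k \<otimes> b"] k b
      by (intro divide_pos_pos) (auto simp: less_le)
    then have "ln (fl b k (z(j := y))) = ln (fl b k z) + ln r'" unfolding f using r'p by (simp add: ln_mult)
    then show ?thesis unfolding Th_def x_def A_def fst_conv snd_conv d by (simp add: mult_exp_exp exp_add exp_minus field_simps)
  qed (simp add: Th_def d)
  have T0: "0 \<le> Th e b k (z, s)" by (rule Th_nonneg[OF k])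
  have "Th e b k (z(j := y), s) - Th e b k (z, s) = (x - 1) * Th e b k (z, s)" unfolding eq by (simp add: algebra_simps)
  then have "\<bar>Th e b k (z(j := y), s) - Th e b k (z, s)\<bar> = \<bar>x - 1\<bar> * Th e b k (z, s)" using T0 by (simp add: abs_mult)
  also have "\<dots> \<le> ((1 / (\<delta>\<^sup>2)\<^sup>2 + 1) * (\<bar>coc k j\<bar> / \<delta>\<^sup>2)) * Th e b k (z, s)"
    using r(3) T0 by (intro mult_right_mono order_trans[OF x(1)] mult_left_mono) auto
  finally show "\<bar>Th e b k (z(j := y), s) - Th e b k (z, s)\<bar> \<le> (Kl * \<bar>coc k j\<bar>) * Th e b k (z, s)" by (simp add: Kl_def)
  have "1 * Th e b k (z, s) \<le> ((1 / (\<delta>\<^sup>2)\<^sup>2) * x) * Th e b k (z, s)"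
    using x(2) c T0 by (intro mult_right_mono) (auto simp: field_simps)
  then show "Th e b k (z, s) \<le> (1 / (\<delta>\<^sup>2)\<^sup>2) * Th e b k (z(j := y), s)" unfolding eq by simp
qed

lemma fl_measurable: "g \<in> carrier G \<Longrightarrow> b \<in> carrier G \<Longrightarrow> fl b g \<in> borel_measurable M"
  unfolding fl_def[abs_def] by (intro borel_measurable_divide dens_measurable measurable_bits_fun) auto

lemma Th_measurable:
  assumes g: "g \<in> carrier G" and b: "b \<in> carrier G"
  shows "Th e b g \<in> borel_measurable (M \<Otimes>\<^sub>M lborel)"
proof -
  have [measurable]: "(\<lambda>w. dens g (fst w)) \<in> borel_measurable (M \<Otimes>\<^sub>M lborel)" "(\<lambda>w. fl b g (fst w)) \<in> borel_measurable (M \<Otimes>\<^sub>M lborel)"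
    using measurable_compose[OF measurable_fst dens_measurable[OF g]] measurable_compose[OF measurable_fst fl_measurable[OF g b]] by auto
  show ?thesis unfolding Th_def[abs_def] by measurable
qed

lemma Th_nn:
  assumes g: "g \<in> carrier G" and b: "b \<in> carrier G" and e: "0 < e"
  shows "(\<integral>\<^sup>+s. ennreal (Th e b g (z, s)) \<partial>lborel) = ennreal (dens g z * (2 / e))"
proof -
  have "(\<integral>\<^sup>+s. ennreal (Th e b g (z, s)) \<partial>lborel) = (\<integral>\<^sup>+s. ennreal (dens g z) * ennreal (exp (- (e * \<bar>s + ln (fl b g z)\<bar>))) \<partial>lborel)"
    unfolding Th_def fst_conv snd_conv using dens_nonneg[OF g] by (intro nn_integral_cong) (simp add: ennreal_mult)
  also have "\<dots> = ennreal (dens g z) * ennreal (2 / e)" by (subst nn_integral_cmult) (auto simp: nn_laplace[OF e])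
  also have "\<dots> = ennreal (dens g z * (2 / e))" using dens_nonneg[OF g] e by (intro ennreal_mult[symmetric]) auto
  finally show ?thesis .
qed

lemma Th_integral:
  assumes g: "g \<in> carrier G" and b: "b \<in> carrier G" and e: "0 < e"
  shows "integrable (M \<Otimes>\<^sub>M lborel) (Th e b g)" "(\<integral>w. Th e b g w \<partial>(M \<Otimes>\<^sub>M lborel)) = 2 / e"
proof -
  note m [measurable] = Th_measurable[OF g b, of e]
  have "(\<integral>\<^sup>+w. ennreal (Th e b g w) \<partial>(M \<Otimes>\<^sub>M lborel)) = (\<integral>\<^sup>+z. \<integral>\<^sup>+s. ennreal (Th e b g (z, s)) \<partial>lborel \<partial>M)"
    by (rule lborel.nn_integral_fst[symmetric]) measurable
  also have "\<dots> = (\<integral>\<^sup>+z. ennreal (dens g z) * ennreal (2 / e) \<partial>M)"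
    unfolding Th_nn[OF g b e] using dens_nonneg[OF g] e by (intro nn_integral_cong ennreal_mult) auto
  also have "\<dots> = (\<integral>\<^sup>+z. ennreal (dens g z) \<partial>M) * ennreal (2 / e)" using g by (intro nn_integral_multc) auto
  also have "(\<integral>\<^sup>+z. ennreal (dens g z) \<partial>M) = 1" using nn_change[OF g, of "\<lambda>_. 1"] emeasure_space_1 by simp
  finally have "(\<integral>\<^sup>+w. ennreal (Th e b g w) \<partial>(M \<Otimes>\<^sub>M lborel)) = ennreal (2 / e)" by simp
  then have "has_bochner_integral (M \<Otimes>\<^sub>M lborel) (Th e b g) (2 / e)"
    using e by (intro has_bochner_integral_nn_integral m) (auto simp: Th_nonneg[OF g])
  then show "integrable (M \<Otimes>\<^sub>M lborel) (Th e b g)" "(\<integral>w. Th e b g w \<partial>(M \<Otimes>\<^sub>M lborel)) = 2 / e" by (auto simp: has_bochner_integral_iff)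
qed

text \<open>Integrating the real variable first leaves \<open>dens g ^ 2 / dens k\<close> times an
  exponential of the distance of the two shifts. That distance is the absolute log quotient of the
  densities up to a bounded term, so the exponential is at most a constant times the sum of the
  powers \<open>e\<close> and \<open>- e\<close> of the quotient. Hence the exponents 2 + e and 2 -
  e in \<open>dens_moment\<close>.\<close>

lemma Th_quotient:
  assumes g: "g \<in> carrier G" and k: "k \<in> carrier G" and b: "b \<in> carrier G" and e: "0 < e" "e \<le> 1"
    and W: "wt g \<le> W" "wt k \<le> W"
  shows "(\<integral>\<^sup>+w. ennreal (Th e b g w * (Th e b g w / Th e b k w)) \<partial>(M \<Otimes>\<^sub>M lborel)) \<le> ennreal (4 / (e * \<delta>\<^sup>2) * exp (4 * kap \<delta> e * W))"
proof -
  have [measurable]: "Th e b g \<in> borel_measurable (M \<Otimes>\<^sub>M lborel)" "Th e b k \<in> borel_measurable (M \<Otimes>\<^sub>M lborel)"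
    using Th_measurable b g k by auto
  have [measurable]: "dens g \<in> borel_measurable M" "dens k \<in> borel_measurable M" using g k by auto
  let ?m = "\<lambda>s z. dens k z * (dens g z / dens k z) powr s"
  have "(\<integral>\<^sup>+w. ennreal (Th e b g w * (Th e b g w / Th e b k w)) \<partial>(M \<Otimes>\<^sub>M lborel))
    = (\<integral>\<^sup>+z. \<integral>\<^sup>+s. ennreal (Th e b g (z, s) * (Th e b g (z, s) / Th e b k (z, s))) \<partial>lborel \<partial>M)"
    by (rule lborel.nn_integral_fst[symmetric]) measurable
  also have "\<dots> \<le> (\<integral>\<^sup>+z. ennreal (2 / (e * \<delta>\<^sup>2)) * (ennreal (?m (2 + e) z) + ennreal (?m (2 - e) z)) \<partial>M)"
  proof (rule nn_integral_mono_AE)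
    show "AE z in M. (\<integral>\<^sup>+s. ennreal (Th e b g (z, s) * (Th e b g (z, s) / Th e b k (z, s))) \<partial>lborel)
      \<le> ennreal (2 / (e * \<delta>\<^sup>2)) * (ennreal (?m (2 + e) z) + ennreal (?m (2 - e) z))"
      using dens_pos[OF g] dens_pos[OF k]
    proof eventually_elim
      case (elim z)
      let ?a = "fl b g z" and ?c = "fl b k z"
      let ?rg = "ratio g (g \<otimes> b) (z (g \<otimes> b))" and ?rk = "ratio k (k \<otimes> b) (z (k \<otimes> b))"
      have rb: "\<delta> \<le> ?rg" "\<delta> \<le> ?rk" "?rg \<le> 1 / \<delta>" "?rk \<le> 1 / \<delta>"
      proof -
        have "\<delta> \<le> ratio h j y \<and> ratio h j y \<le> 1 / \<delta>" if "h \<in> carrier G" "j \<in> carrier G" for h j y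
        proof -
          have "pmf (sh h j) y / 1 \<le> ratio h j y" unfolding ratio_def
            using marg_pos[OF that(2)] pmf_le_1[of "\<mu> j" y] by (intro divide_left_mono) (auto intro: pmf_nonneg)
          moreover have "ratio h j y \<le> 1 / \<delta>" unfolding ratio_def
            using marg_ge[OF that(2), of y] \<delta>_pos pmf_le_1 by (intro frac_le) auto
          ultimately show ?thesis using sh_marg_ge[OF that, of y] by simp
        qed
        then show "\<delta> \<le> ?rg" "\<delta> \<le> ?rk" "?rg \<le> 1 / \<delta>" "?rk \<le> 1 / \<delta>" using g k b by auto
      qed
      have rp: "0 < ?rg" "0 < ?rk" using rb \<delta>_pos by linarith+
      have ap: "0 < ?a" "0 < ?c" using elim rp by (auto simp: fl_def)
      let ?x = "dens g z / dens k z"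
      have xp: "0 < ?x" using elim by simp
      have q: "(?rk / ?rg) \<le> 1 / \<delta>\<^sup>2" "(?rg / ?rk) \<le> 1 / \<delta>\<^sup>2"
      proof -
        have "?rk / ?rg \<le> (1 / \<delta>) / \<delta>" "?rg / ?rk \<le> (1 / \<delta>) / \<delta>" using rb rp \<delta>_pos by (intro frac_le; simp)+
        then show "(?rk / ?rg) \<le> 1 / \<delta>\<^sup>2" "(?rg / ?rk) \<le> 1 / \<delta>\<^sup>2" by (auto simp: power2_eq_square)
      qed
      have pw: "r powr e \<le> 1 / \<delta>\<^sup>2" if r: "0 < r" "r \<le> 1 / \<delta>\<^sup>2" for r
      proof (cases "1 \<le> r")
        case True
        then have "r powr e \<le> r powr 1" using e by (intro powr_mono) auto
        then show ?thesis using r by simp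
      next
        case False
        then have "r powr e \<le> 1" using r e by (intro powr_le1) auto
        also have "1 \<le> 1 / \<delta>\<^sup>2" using \<delta>_pos \<delta>_lt_1 by (simp add: power_le_one)
        finally show ?thesis .
      qed
      \<comment> \<open>An exponential of an absolute value is at most the sum over both signs; the
        ratios that \<open>fl\<close> divides out cost only the factor
        \<open>1 / \<delta>\<^sup>2\<close>.\<close>
      have ex: "exp (e * \<bar>ln ?a - ln ?c\<bar>) \<le> (1 / \<delta>\<^sup>2) * (?x powr e + ?x powr (- e))"
      proof -
        have l: "ln ?a - ln ?c = ln ?x + ln (?rk / ?rg)"
          using elim rp by (simp add: fl_def ln_div)
        have 1: "exp (e * (ln ?a - ln ?c)) = ?x powr e * (?rk / ?rg) powr e"
          unfolding l using elim xp rp by (simp add: powr_def mult_exp_exp algebra_simps)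
        have 2: "exp (e * - (ln ?a - ln ?c)) = ?x powr (- e) * (?rg / ?rk) powr e"
          unfolding l using elim xp rp by (simp add: powr_def mult_exp_exp ln_div algebra_simps)
        have "exp (e * \<bar>ln ?a - ln ?c\<bar>) \<le> exp (e * (ln ?a - ln ?c)) + exp (e * - (ln ?a - ln ?c))"
          by (cases "0 \<le> ln ?a - ln ?c") (simp_all only: abs_of_nonneg abs_of_neg not_le, simp_all)
        also have "\<dots> \<le> ?x powr e * (1 / \<delta>\<^sup>2) + ?x powr (- e) * (1 / \<delta>\<^sup>2)"
          unfolding 1 2 using rp q by (intro add_mono mult_left_mono pw) auto
        finally show ?thesis by (simp add: algebra_simps)
      qed
      have "(\<integral>\<^sup>+s. ennreal (Th e b g (z, s) * (Th e b g (z, s) / Th e b k (z, s))) \<partial>lborel)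
        = (\<integral>\<^sup>+s. ennreal (dens g z * ?x) * ennreal (exp (- (e * \<bar>s + ln ?a\<bar>)) * (exp (- (e * \<bar>s + ln ?a\<bar>)) / exp (- (e * \<bar>s + ln ?c\<bar>)))) \<partial>lborel)"
        unfolding Th_def fst_conv snd_conv using elim by (intro nn_integral_cong) (simp add: ennreal_mult[symmetric] mult_ac)
      also have "\<dots> = ennreal (dens g z * ?x) * (\<integral>\<^sup>+s. ennreal (exp (- (e * \<bar>s + ln ?a\<bar>)) * (exp (- (e * \<bar>s + ln ?a\<bar>)) / exp (- (e * \<bar>s + ln ?c\<bar>)))) \<partial>lborel)"
        by (rule nn_integral_cmult) auto
      also have "\<dots> \<le> ennreal (dens g z * ?x) * ennreal (2 / e * ((1 / \<delta>\<^sup>2) * (?x powr e + ?x powr (- e))))"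
        using ex e by (intro mult_left_mono order_trans[OF nn_laplace_quotient[OF e(1)]] ennreal_leI) auto
      also have "\<dots> = ennreal (2 / (e * \<delta>\<^sup>2) * (?m (2 + e) z + ?m (2 - e) z))"
      proof -
        have dg: "dens g z = dens k z * ?x" using elim by simp
        have "dens g z * ?x * (?x powr e) = ?m (2 + e) z" "dens g z * ?x * (?x powr (- e)) = ?m (2 - e) z"
          using xp by (subst dg, simp add: powr_add powr_diff powr_minus powr_numeral power2_eq_square divide_inverse mult_ac)+
        moreover have "X * (2 / e * ((1 / \<delta>\<^sup>2) * (P + Q))) = 2 / (e * \<delta>\<^sup>2) * (X * P + X * Q)" for X P Q :: real
          using e \<delta>_pos by (simp add: field_simps)
        ultimately have "dens g z * ?x * (2 / e * ((1 / \<delta>\<^sup>2) * (?x powr e + ?x powr (- e)))) = 2 / (e * \<delta>\<^sup>2) * (?m (2 + e) z + ?m (2 - e) z)"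
          by presburger
        then show ?thesis using elim e by (subst ennreal_mult[symmetric]) auto
      qed
      also have "\<dots> = ennreal (2 / (e * \<delta>\<^sup>2)) * (ennreal (?m (2 + e) z) + ennreal (?m (2 - e) z))"
        using elim e \<delta>_pos by (subst ennreal_mult) (auto simp: ennreal_plus)
      finally show ?case .
    qed
  qed
  also have "\<dots> = ennreal (2 / (e * \<delta>\<^sup>2)) * ((\<integral>\<^sup>+z. ennreal (?m (2 + e) z) \<partial>M) + (\<integral>\<^sup>+z. ennreal (?m (2 - e) z) \<partial>M))"
    by (subst nn_integral_cmult, measurable, subst nn_integral_add) auto
  also have "\<dots> \<le> ennreal (2 / (e * \<delta>\<^sup>2)) * (ennreal (exp (4 * kap \<delta> e * W)) + ennreal (exp (4 * kap \<delta> e * W)))"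
  proof (intro mult_left_mono add_mono)
    have "kap \<delta> e * (2 * wt g + 2 * wt k) \<le> kap \<delta> e * (4 * W)" using W kap_nonneg[OF e(1)] by (intro mult_left_mono) auto
    then have x: "ennreal (exp (kap \<delta> e * (2 * wt g + 2 * wt k))) \<le> ennreal (exp (4 * kap \<delta> e * W))" by (intro ennreal_leI) (simp add: mult_ac)
    show "(\<integral>\<^sup>+z. ennreal (?m (2 + e) z) \<partial>M) \<le> ennreal (exp (4 * kap \<delta> e * W))"
      using dens_moment[OF g k e, of "2 + e"] x by (auto intro: order_trans)
    show "(\<integral>\<^sup>+z. ennreal (?m (2 - e) z) \<partial>M) \<le> ennreal (exp (4 * kap \<delta> e * W))"
      using dens_moment[OF g k e, of "2 - e"] x by (auto intro: order_trans)
  qed auto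
  also have "\<dots> = ennreal (4 / (e * \<delta>\<^sup>2) * exp (4 * kap \<delta> e * W))"
    using e \<delta>_pos by (simp add: ennreal_plus[symmetric] ennreal_mult[symmetric] del: ennreal_plus)
  finally show ?thesis .
qed

end

text \<open>Cauchy-Schwarz. The inverse of a sum of weights is replaced by inverses of single
  weights, for which moments are available, and the square of \<open>card F\<close> is
  gained.\<close>

lemma AM_HM_sum:
  fixes \<theta> :: "'g \<Rightarrow> real"
  assumes F: "finite F" "F \<noteq> {}" and p: "\<And>k. k \<in> F \<Longrightarrow> 0 < \<theta> k"
  shows "1 / sum \<theta> F \<le> (\<Sum>k\<in>F. 1 / \<theta> k) / (real (card F))\<^sup>2"
proof -
  have J: "0 < sum \<theta> F" using F p by (intro sum_pos) auto
  have "(\<Sum>k\<in>F. sqrt (\<theta> k) * (1 / sqrt (\<theta> k)))\<^sup>2 \<le> (\<Sum>k\<in>F. (sqrt (\<theta> k))\<^sup>2) * (\<Sum>k\<in>F. (1 / sqrt (\<theta> k))\<^sup>2)"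
    by (rule Cauchy_Schwarz_ineq_sum)
  also have "(\<Sum>k\<in>F. sqrt (\<theta> k) * (1 / sqrt (\<theta> k))) = (\<Sum>k\<in>F. 1)" using p by (intro sum.cong refl) (metis less_irrefl mult.commute nonzero_eq_divide_eq real_sqrt_eq_zero_cancel_iff)
  also have "(\<Sum>k\<in>F. (sqrt (\<theta> k))\<^sup>2) = sum \<theta> F" using p by (intro sum.cong refl) (simp add: less_imp_le)
  also have "(\<Sum>k\<in>F. (1 / sqrt (\<theta> k))\<^sup>2) = (\<Sum>k\<in>F. 1 / \<theta> k)" using p by (intro sum.cong refl) (simp add: power_divide less_imp_le)
  finally have "(real (card F))\<^sup>2 \<le> sum \<theta> F * (\<Sum>k\<in>F. 1 / \<theta> k)" by simp
  moreover have "0 < (real (card F))\<^sup>2" using F by (simp add: card_gt_0_iff)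
  ultimately show ?thesis using J by (simp add: field_simps)
qed

context bernoulli
begin

text \<open>Test functions with mean zero in the coordinate \<open>b\<close>, and their translates by \<open>g\<close>.\<close>
definition ts :: "'a \<Rightarrow> bool \<Rightarrow> 'a set \<Rightarrow> ('a \<Rightarrow> bool) \<Rightarrow> ('a \<Rightarrow> bool) \<Rightarrow> real" where
  "ts b y0 B ys x = (of_bool (x b = y0) - pmf (\<mu> b) y0) * of_bool (\<forall>i\<in>B. x i = ys i)"

definition tg :: "'a \<Rightarrow> bool \<Rightarrow> 'a set \<Rightarrow> ('a \<Rightarrow> bool) \<Rightarrow> 'a \<Rightarrow> ('a \<Rightarrow> bool) \<Rightarrow> real" where
  "tg b y0 B ys g z = (of_bool (z (g \<otimes> b) = y0) - pmf (\<mu> b) y0) * of_bool (\<forall>i\<in>B. z (g \<otimes> i) = ys i)"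

lemma of_bool_prod: "finite B \<Longrightarrow> (of_bool (\<forall>i\<in>B. P i) :: real) = (\<Prod>i\<in>B. of_bool (P i))"
  by (induction B rule: finite_induct) auto

lemma tg_measurable:
  assumes g: "g \<in> carrier G" and b: "b \<in> carrier G" and B: "finite B" "B \<subseteq> carrier G"
  shows "tg b y0 B ys g \<in> borel_measurable M"
  unfolding tg_def[abs_def] of_bool_prod[OF B(1)] using g b B(2)
  by (intro borel_measurable_times borel_measurable_diff borel_measurable_prod measurable_bits_fun[where f = "\<lambda>u. of_bool (u = _)"]) auto

lemma tg_act:
  assumes "g \<in> carrier G" "b \<in> carrier G" "B \<subseteq> carrier G" "z \<in> carrier G \<rightarrow>\<^sub>E UNIV"
  shows "ts b y0 B ys (act (inv g) z) = tg b y0 B ys g z"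
proof -
  have "act (inv g) z i = z (g \<otimes> i)" if "i \<in> carrier G" for i using that assms by (simp add: act_apply)
  moreover have "(\<forall>i\<in>B. act (inv g) z i = ys i) = (\<forall>i\<in>B. z (g \<otimes> i) = ys i)"
    using calculation assms(3) by auto
  ultimately show ?thesis using assms(2) by (simp add: ts_def tg_def)
qed

lemma tg_one: "b \<in> carrier G \<Longrightarrow> B \<subseteq> carrier G \<Longrightarrow> tg b y0 B ys \<one> x = ts b y0 B ys x"
proof -
  assume a: "b \<in> carrier G" "B \<subseteq> carrier G"
  then have "x (\<one> \<otimes> i) = x i" if "i \<in> B" for i using that by (simp add: subset_iff)
  then have "(\<forall>i\<in>B. x (\<one> \<otimes> i) = ys i) = (\<forall>i\<in>B. x i = ys i)" by simp
  then show ?thesis using a by (simp add: tg_def ts_def)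
qed

lemma ts_measurable: "b \<in> carrier G \<Longrightarrow> finite B \<Longrightarrow> B \<subseteq> carrier G \<Longrightarrow> ts b y0 B ys \<in> borel_measurable M"
  using tg_measurable[OF one_closed, of b B y0 ys] tg_one[of b B y0 ys] by (simp add: fun_eq_iff[symmetric] cong: measurable_cong)

lemma tg_le_1: "\<bar>tg b y0 B ys g z\<bar> \<le> 1"
  using pmf_le_1[of "\<mu> b" y0] pmf_nonneg[of "\<mu> b" y0] by (auto simp: tg_def of_bool_def)

lemma ts_le_1: "\<bar>ts b y0 B ys z\<bar> \<le> 1"
  using pmf_le_1[of "\<mu> b" y0] pmf_nonneg[of "\<mu> b" y0] by (auto simp: ts_def of_bool_def)

text \<open>At coordinate \<open>g \<otimes> b\<close> the marginal times the ratio is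
  \<open>\<mu> b\<close>, and the test function has mean zero for \<open>\<mu> b\<close>. The kernel
  does not interfere because \<open>fl\<close> is independent of this coordinate.\<close>

lemma translate_test_cancel:
  assumes g: "g \<in> carrier G" and b: "b \<in> carrier G" and z: "z \<in> carrier G \<rightarrow>\<^sub>E UNIV"
    and B: "B \<subseteq> carrier G" "b \<notin> B"
  shows "pmf (\<mu> (g \<otimes> b)) True * (tg b y0 B ys g (z(g \<otimes> b := True)) * Th e b g (z(g \<otimes> b := True), s))
    + pmf (\<mu> (g \<otimes> b)) False * (tg b y0 B ys g (z(g \<otimes> b := False)) * Th e b g (z(g \<otimes> b := False), s)) = 0"
proof -
  let ?j = "g \<otimes> b"
  have j: "?j \<in> carrier G" using g b by simp
  have shj: "sh g ?j = \<mu> b" unfolding sh_def using g b by (simp add: m_assoc[symmetric])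
  have ne: "g \<otimes> i \<noteq> ?j" if "i \<in> B" for i using that B g b by auto
  let ?c = "of_bool (\<forall>i\<in>B. z (g \<otimes> i) = ys i) :: real"
  let ?x = "dens g z / ratio g ?j (z ?j) * exp (- (e * \<bar>s + ln (fl b g z)\<bar>))"
  have t: "tg b y0 B ys g (z(?j := y)) = (of_bool (y = y0) - pmf (\<mu> b) y0) * ?c" for y
    using ne by (simp add: tg_def)
  have T: "Th e b g (z(?j := y), s) = ratio g ?j y * ?x" for y
    unfolding Th_def fst_conv snd_conv dens_upd_quot[OF g z j] fl_upd[OF g b z j] by simp
  have r: "pmf (\<mu> ?j) y * ratio g ?j y = pmf (\<mu> b) y" for y
    using marg_pos[OF j, of y] unfolding ratio_def shj by simp
  define cx where "cx = ?c * ?x"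
  have H: "pmf (\<mu> ?j) y * (tg b y0 B ys g (z(?j := y)) * Th e b g (z(?j := y), s)) = pmf (\<mu> b) y * (of_bool (y = y0) - pmf (\<mu> b) y0) * cx" for y
    unfolding t T r[symmetric, of y] cx_def by (simp add: mult_ac)
  show ?thesis unfolding H by (cases y0) (simp_all add: pmf_bool_True algebra_simps)
qed

lemma Th_AE_pos:
  assumes g: "g \<in> carrier G" and b: "b \<in> carrier G"
  shows "AE w in M \<Otimes>\<^sub>M lborel. 0 < Th e b g w"
proof -
  interpret pair_sigma_finite M "lborel :: real measure" ..
  have [measurable]: "Th e b g \<in> borel_measurable (M \<Otimes>\<^sub>M lborel)" by (rule Th_measurable[OF g b])
  have "{w \<in> space (M \<Otimes>\<^sub>M lborel). 0 < Th e b g w} \<in> sets (M \<Otimes>\<^sub>M lborel)" by measurable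
  moreover have "AE z in M. AE s in lborel. 0 < Th e b g (z, s)"
    using dens_pos[OF g] by eventually_elim (simp add: Th_def)
  ultimately show ?thesis by (rule AE_pair_measure)
qed

text \<open>A pair \<open>(g, h)\<close> is bad if the coordinate \<open>g \<otimes> b\<close> is
  read by the test function of \<open>h\<close>; cancellation in the group bounds the number of
  partners on either side by \<open>card (insert b B)\<close>. The bound \<open>S\<close> for the
  diagonal does not grow with \<open>card F\<close>.\<close>

lemma averaging_step:
  fixes F :: "'a set" and c e t W :: real
  assumes F: "finite F" "F \<noteq> {}" "F \<subseteq> carrier G" and W: "\<And>g. g \<in> F \<Longrightarrow> wt g \<le> W"
    and b: "b \<in> carrier G" and B: "finite B" "B \<subseteq> carrier G" "b \<notin> B"
    and e: "0 < e" "e \<le> 1" and f: "\<And>g. g \<in> F \<Longrightarrow> \<bar>f g\<bar> \<le> 1" and t: "0 < t" and c: "0 < c"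
  defines "S \<equiv> 4 / (e * \<delta>\<^sup>2) * exp (4 * kap \<delta> e * W)"
  shows "(\<integral>w. \<bar>\<Sum>g\<in>F. f g * tg b y0 B ys g (fst w) * Th e b g w\<bar> \<partial>(M \<Otimes>\<^sub>M lborel))
    \<le> (1 / (2 * c)) * (real (card (insert b B)) * S + 1 / (\<delta>\<^sup>2)\<^sup>2 * (t * S + (Kl\<^sup>2 * W / t) * (card F * (2 / e)))) + (c / 2) * (card F * (2 / e))"
proof -
  let ?P = "M \<Otimes>\<^sub>M lborel :: (('a \<Rightarrow> bool) \<times> real) measure"
  let ?bad = "\<lambda>g h. g \<otimes> b \<in> (\<lambda>i. h \<otimes> i) ` insert b B"
  have Fc: "g \<in> F \<Longrightarrow> g \<in> carrier G" for g using F by auto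
  have spP: "w \<in> space ?P \<Longrightarrow> fst w \<in> carrier G \<rightarrow>\<^sub>E UNIV" for w by (auto simp: space_pair_measure)
  have res: "resamples ?P (\<mu> j) (\<lambda>y w. ((fst w)(j := y), snd w))" if "j \<in> carrier G" for j
    using resamples_fst[OF resamples_bits[OF that, of \<mu>], of lborel] sigma_finite_lborel
    by (simp add: sigma_finite_measure_axioms)
  have Kl0: "0 \<le> Kl" unfolding Kl_def by simp
  have Tm: "g \<in> F \<Longrightarrow> Th e b g \<in> borel_measurable ?P" for g by (rule Th_measurable[OF Fc b])
  have tm: "g \<in> F \<Longrightarrow> (\<lambda>w. tg b y0 B ys g (fst w)) \<in> borel_measurable ?P" for g
    by (rule measurable_compose[OF measurable_fst tg_measurable[OF Fc b B(1,2)]])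
  \<comment> \<open>The map \<open>U\<close> of the estimate sets coordinate
    \<open>g \<otimes> b\<close> to a fixed value, for which \<open>False\<close> is an arbitrary
    choice. The normalised weight at the new point no longer depends on this coordinate, so
    \<open>resamples_cancel\<close> applies to good pairs.\<close>
  show ?thesis
  proof (rule averaging_estimate[where a = "\<lambda>g w. tg b y0 B ys g (fst w)" and U = "\<lambda>g w. ((fst w)(g \<otimes> b := False), snd w)"
      and E = "\<lambda>g k. Kl * \<bar>coc k (g \<otimes> b)\<bar>" and bad = ?bad])
    show "finite F" by fact
    fix g assume g: "g \<in> F"
    note gc = Fc[OF g]
    have j: "g \<otimes> b \<in> carrier G" using gc b by simp
    show "integrable ?P (Th e b g)" "(\<integral>w. Th e b g w \<partial>?P) = 2 / e" by (rule Th_integral[OF gc b e(1)])+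
    show "0 \<le> Th e b g w" for w by (rule Th_nonneg[OF gc])
    show "(\<lambda>w. tg b y0 B ys g (fst w)) \<in> borel_measurable ?P" by (rule tm[OF g])
    show "\<bar>tg b y0 B ys g (fst w)\<bar> \<le> 1" for w :: "('a \<Rightarrow> bool) \<times> real" by (rule tg_le_1)
    show "\<bar>f g\<bar> \<le> 1" by (rule f[OF g])
    show "(\<lambda>w. ((fst w)(g \<otimes> b := False), snd w)) \<in> measurable ?P ?P" by (rule resamples_meas[OF res[OF j]])
    show "real (card {h \<in> F. ?bad g h}) \<le> real (card (insert b B))"
    proof -
      have "{h \<in> F. ?bad g h} \<subseteq> (\<lambda>i. g \<otimes> b \<otimes> inv i) ` insert b B"
      proof
        fix h assume "h \<in> {h \<in> F. ?bad g h}"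
        then obtain i where i: "h \<in> F" "i \<in> insert b B" "g \<otimes> b = h \<otimes> i" by auto
        then have "i \<in> carrier G" "h \<in> carrier G" using b B Fc by auto
        then have "h = g \<otimes> b \<otimes> inv i" using i(3) by (simp add: m_assoc)
        then show "h \<in> (\<lambda>i. g \<otimes> b \<otimes> inv i) ` insert b B" using i by blast
      qed
      then have "card {h \<in> F. ?bad g h} \<le> card (insert b B)"
        using B(1) by (meson card_image_le card_mono finite_imageI finite_insert order_trans)
      then show ?thesis by simp
    qed
    show "real (card {h \<in> F. ?bad h g}) \<le> real (card (insert b B))"
    proof -
      have "{h \<in> F. ?bad h g} \<subseteq> (\<lambda>i. g \<otimes> i \<otimes> inv b) ` insert b B"
      proof
        fix h assume "h \<in> {h \<in> F. ?bad h g}"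
        then obtain i where i: "h \<in> F" "i \<in> insert b B" "h \<otimes> b = g \<otimes> i" by auto
        then have "h = g \<otimes> i \<otimes> inv b" using b Fc[OF i(1)] by (metis inv_solve_right m_closed)
        then show "h \<in> (\<lambda>i. g \<otimes> i \<otimes> inv b) ` insert b B" using i by blast
      qed
      then have "card {h \<in> F. ?bad h g} \<le> card (insert b B)"
        using B(1) by (meson card_image_le card_mono finite_imageI finite_insert order_trans)
      then show ?thesis by simp
    qed
    show "(\<Sum>h\<in>F. (Kl * \<bar>coc g (h \<otimes> b)\<bar>)\<^sup>2) \<le> Kl\<^sup>2 * W"
    proof -
      have "(\<Sum>h\<in>F. (Kl * \<bar>coc g (h \<otimes> b)\<bar>)\<^sup>2) = Kl\<^sup>2 * (\<Sum>h\<in>F. (coc g (h \<otimes> b))\<^sup>2)"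
        by (simp add: power_mult_distrib sum_distrib_left)
      also have "(\<Sum>h\<in>F. (coc g (h \<otimes> b))\<^sup>2) = (\<Sum>k\<in>(\<lambda>h. h \<otimes> b) ` F. (coc g k)\<^sup>2)"
        using b Fc by (subst sum.reindex) (auto intro!: inj_onI)
      also have "\<dots> \<le> wt g" using F b Fc by (intro wt_sum gc) auto
      finally show ?thesis using W[OF g] by (meson mult_left_mono order_trans zero_le_power2)
    qed
    fix k assume k: "k \<in> F"
    note kc = Fc[OF k]
    show "0 \<le> Kl * \<bar>coc k (g \<otimes> b)\<bar>" using Kl0 by simp
    show "\<bar>Th e b k ((fst w)(g \<otimes> b := False), snd w) - Th e b k w\<bar> \<le> Kl * \<bar>coc k (g \<otimes> b)\<bar> * Th e b k w" if "w \<in> space ?P" for w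
      using Th_perturb(1)[OF kc b j spP[OF that] e, of False "snd w"] by simp
    show "Th e b k w \<le> 1 / (\<delta>\<^sup>2)\<^sup>2 * Th e b k ((fst w)(g \<otimes> b := False), snd w)" if "w \<in> space ?P" for w
      using Th_perturb(2)[OF kc b j spP[OF that] e, of "snd w" False] by simp
    assume nb: "\<not> ?bad g k"
    let ?q = "\<lambda>w. Th e b k ((fst w)(g \<otimes> b := False), snd w) / (\<Sum>h\<in>F. Th e b h ((fst w)(g \<otimes> b := False), snd w))"
    let ?v = "\<lambda>w. tg b y0 B ys g (fst w) * Th e b g w * (tg b y0 B ys k (fst w) * ?q w)"
    show "(\<integral>w. ?v w \<partial>?P) = 0"
    proof (rule resamples_cancel[OF res[OF j] marg_pos[OF j]])
      have q01: "0 \<le> ?q w \<and> ?q w \<le> 1" for w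
      proof -
        have "Th e b k ((fst w)(g \<otimes> b := False), snd w) \<le> (\<Sum>h\<in>F. Th e b h ((fst w)(g \<otimes> b := False), snd w))"
          using F k by (intro member_le_sum Th_nonneg Fc) auto
        moreover have "0 \<le> Th e b k ((fst w)(g \<otimes> b := False), snd w)" by (rule Th_nonneg[OF kc])
        ultimately show ?thesis by (auto simp: divide_le_eq_1)
      qed
      have qm: "?q \<in> borel_measurable ?P"
        by (intro borel_measurable_divide borel_measurable_sum measurable_compose[OF resamples_meas[OF res[OF j]] Tm] k) auto
      show "integrable ?P ?v"
      proof (rule Bochner_Integration.integrable_bound[OF Th_integral(1)[OF gc b e(1)]])
        show "?v \<in> borel_measurable ?P" by (intro borel_measurable_times tm Tm qm g k)
        show "AE w in ?P. norm (?v w) \<le> norm (Th e b g w)"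
        proof (rule AE_I2)
          fix w
          have qa: "\<bar>?q w\<bar> = ?q w" using q01[of w] by (intro abs_of_nonneg) simp
          have "norm (?v w) = \<bar>tg b y0 B ys g (fst w)\<bar> * (\<bar>tg b y0 B ys k (fst w)\<bar> * ?q w) * Th e b g w"
            by (simp only: real_norm_def abs_mult qa abs_of_nonneg[OF Th_nonneg[OF gc]] mult_ac)
          also have "\<dots> \<le> 1 * Th e b g w"
            by (intro mult_right_mono mult_le_one tg_le_1 Th_nonneg[OF gc] mult_nonneg_nonneg abs_ge_zero conjunct1[OF q01] conjunct2[OF q01])
          finally show "norm (?v w) \<le> norm (Th e b g w)" using Th_nonneg[OF gc, of e b w] by simp
        qed
      qed
      fix w assume w: "w \<in> space ?P"
      have ktg: "tg b y0 B ys k ((fst w)(g \<otimes> b := y)) = tg b y0 B ys k (fst w)" for y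
      proof -
        have ne: "k \<otimes> i \<noteq> g \<otimes> b" if "i \<in> insert b B" for i
        proof
          assume eq: "k \<otimes> i = g \<otimes> b"
          have "g \<otimes> b \<in> (\<lambda>i. k \<otimes> i) ` insert b B" using imageI[OF that, of "\<lambda>i. k \<otimes> i"] unfolding eq .
          with nb show False by simp
        qed
        then have "(\<forall>i\<in>B. ((fst w)(g \<otimes> b := y)) (k \<otimes> i) = ys i) = (\<forall>i\<in>B. (fst w) (k \<otimes> i) = ys i)" by simp
        then show ?thesis using ne[of b] by (simp add: tg_def)
      qed
      let ?r = "tg b y0 B ys k (fst w) * ?q w"
      have "pmf (\<mu> (g \<otimes> b)) y * ?v ((fst w)(g \<otimes> b := y), snd w)
        = (pmf (\<mu> (g \<otimes> b)) y * (tg b y0 B ys g ((fst w)(g \<otimes> b := y)) * Th e b g ((fst w)(g \<otimes> b := y), snd w))) * ?r" for y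
        unfolding fst_conv snd_conv ktg fun_upd_upd by (simp only: mult_ac)
      then show "pmf (\<mu> (g \<otimes> b)) True * ?v ((fst w)(g \<otimes> b := True), snd w) + pmf (\<mu> (g \<otimes> b)) False * ?v ((fst w)(g \<otimes> b := False), snd w) = 0"
        using translate_test_cancel[OF gc b spP[OF w] B(2,3), of y0 ys e "snd w"]
        by (simp only: distrib_right[symmetric] mult_zero_left)
    qed
  next
    let ?J = "\<lambda>w. \<Sum>g\<in>F. Th e b g w"
    let ?N2 = "(real (card F))\<^sup>2"
    have N2: "0 < ?N2" using F by (simp add: card_gt_0_iff)
    \<comment> \<open>By \<open>AM_HM_sum\<close> this is at most the average over all pairs of the
      integrals of the squared weight of \<open>g\<close> divided by the weight of \<open>k\<close>,
      each of which is at most \<open>S\<close>.\<close>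
    show "(\<integral>w. (\<Sum>g\<in>F. Th e b g w * (Th e b g w / ?J w)) \<partial>?P) \<le> S"
    proof (rule integral_real_bounded)
      show "0 \<le> S" unfolding S_def using e by simp
      have "AE w in ?P. \<forall>g\<in>F. 0 < Th e b g w"
        using F(1) Th_AE_pos[OF Fc b] by (subst AE_finite_all) auto
      then have "(\<integral>\<^sup>+w. ennreal (\<Sum>g\<in>F. Th e b g w * (Th e b g w / ?J w)) \<partial>?P)
        \<le> (\<integral>\<^sup>+w. (\<Sum>g\<in>F. \<Sum>k\<in>F. ennreal (1 / ?N2) * ennreal (Th e b g w * (Th e b g w / Th e b k w))) \<partial>?P)"
      proof (intro nn_integral_mono_AE, eventually_elim)
        case (elim w)
        have "(\<Sum>g\<in>F. Th e b g w * (Th e b g w / ?J w)) = (\<Sum>g\<in>F. (Th e b g w)\<^sup>2 * (1 / ?J w))" by (simp add: power2_eq_square)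
        also have "\<dots> \<le> (\<Sum>g\<in>F. (Th e b g w)\<^sup>2 * ((\<Sum>k\<in>F. 1 / Th e b k w) / ?N2))"
          using elim by (intro sum_mono mult_left_mono AM_HM_sum F) auto
        also have "\<dots> = (\<Sum>g\<in>F. \<Sum>k\<in>F. (1 / ?N2) * (Th e b g w * (Th e b g w / Th e b k w)))"
          by (simp add: sum_distrib_left sum_divide_distrib power2_eq_square mult_ac)
        finally have "ennreal (\<Sum>g\<in>F. Th e b g w * (Th e b g w / ?J w)) \<le> ennreal (\<Sum>g\<in>F. \<Sum>k\<in>F. (1 / ?N2) * (Th e b g w * (Th e b g w / Th e b k w)))"
          by (rule ennreal_leI)
        also have "\<dots> = (\<Sum>g\<in>F. \<Sum>k\<in>F. ennreal ((1 / ?N2) * (Th e b g w * (Th e b g w / Th e b k w))))"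
        proof -
          define x where "x g k = (1 / ?N2) * (Th e b g w * (Th e b g w / Th e b k w))" for g k
          have x0: "0 \<le> x g k" if "g \<in> F" "k \<in> F" for g k
            unfolding x_def using that by (intro mult_nonneg_nonneg divide_nonneg_nonneg Th_nonneg Fc) auto
          have "(\<Sum>g\<in>F. \<Sum>k\<in>F. ennreal (x g k)) = (\<Sum>g\<in>F. ennreal (\<Sum>k\<in>F. x g k))"
            by (intro sum.cong refl sum_ennreal x0)
          also have "\<dots> = ennreal (\<Sum>g\<in>F. \<Sum>k\<in>F. x g k)" by (intro sum_ennreal sum_nonneg x0)
          finally show ?thesis by (simp only: x_def)
        qed
        also have "\<dots> = (\<Sum>g\<in>F. \<Sum>k\<in>F. ennreal (1 / ?N2) * ennreal (Th e b g w * (Th e b g w / Th e b k w)))"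
          by (intro sum.cong refl ennreal_mult mult_nonneg_nonneg divide_nonneg_nonneg Th_nonneg Fc) auto
        finally show ?case .
      qed
      also have "\<dots> = (\<Sum>g\<in>F. \<Sum>k\<in>F. ennreal (1 / ?N2) * (\<integral>\<^sup>+w. ennreal (Th e b g w * (Th e b g w / Th e b k w)) \<partial>?P))"
      proof -
        have m: "(\<lambda>w. ennreal (Th e b g w * (Th e b g w / Th e b k w))) \<in> borel_measurable ?P" if "g \<in> F" "k \<in> F" for g k
          using Tm that by (intro measurable_compose[OF _ measurable_ennreal] borel_measurable_times borel_measurable_divide)
        show ?thesis using m by (simp add: nn_integral_sum nn_integral_cmult)
      qed
      also have "\<dots> \<le> (\<Sum>g\<in>F. \<Sum>k\<in>F. ennreal (1 / ?N2) * ennreal S)"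
        unfolding S_def by (intro sum_mono mult_left_mono Th_quotient Fc b e W) auto
      also have "\<dots> = ennreal S"
      proof -
        have S0: "0 \<le> S" unfolding S_def using e by simp
        have "(\<Sum>g\<in>F. \<Sum>k\<in>F. ennreal (1 / ?N2) * ennreal S) = (\<Sum>g\<in>F. \<Sum>k\<in>F. ennreal (1 / ?N2 * S))"
          using S0 by (intro sum.cong refl ennreal_mult[symmetric]) auto
        also have "\<dots> = (\<Sum>g\<in>F. ennreal (\<Sum>k\<in>F. 1 / ?N2 * S))"
          by (intro sum.cong refl sum_ennreal mult_nonneg_nonneg S0) auto
        also have "\<dots> = ennreal (\<Sum>g\<in>F. \<Sum>k\<in>F. 1 / ?N2 * S)"
          by (intro sum_ennreal sum_nonneg mult_nonneg_nonneg S0) auto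
        also have "(\<Sum>g\<in>F. \<Sum>k\<in>F. 1 / ?N2 * S) = S"
        proof -
          have "real (card F) \<noteq> 0" using N2 by auto
          then show ?thesis by (simp add: power2_eq_square)
        qed
        finally show ?thesis .
      qed
      finally show "(\<integral>\<^sup>+w. ennreal (\<Sum>g\<in>F. Th e b g w * (Th e b g w / ?J w)) \<partial>?P) \<le> ennreal S" .
    qed
    show "0 < t" "0 < c" by fact+
    show "0 \<le> 1 / (\<delta>\<^sup>2)\<^sup>2" by simp
    show "0 \<le> real (card (insert b B))" by simp
  qed
qed

text \<open>The total mass grows like \<open>card F\<close>, the diagonal only like
  \<open>exp (4 * kap \<delta> e * W)\<close>, so a level set from \<open>large_level_sets\<close>
  is large enough. The bound is uniform in the coefficients \<open>f\<close>; for weak mixing these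
  will depend on a further variable.\<close>

lemma averaging:
  fixes err \<eta> A e :: real
  assumes b: "b \<in> carrier G" and B: "finite B" "B \<subseteq> carrier G" "b \<notin> B"
    and e: "0 < e" "e \<le> 1" and A: "4 * kap \<delta> e < A" and err: "0 < err"
    and ns: "\<not> (\<lambda>g. exp (- A * wt g)) summable_on {g \<in> carrier G. Q g}"
  obtains F where "finite F" "F \<subseteq> carrier G" "F \<noteq> {}" "\<And>g. g \<in> F \<Longrightarrow> Q g"
    "\<And>f. (\<And>g. g \<in> F \<Longrightarrow> \<bar>f g\<bar> \<le> 1) \<Longrightarrow>
      (\<integral>w. \<bar>\<Sum>g\<in>F. f g * tg b y0 B ys g (fst w) * Th e b g w\<bar> \<partial>(M \<Otimes>\<^sub>M lborel)) \<le> err * card F"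
proof -
  define m where "m = real (card (insert b B))"
  define K where "K = 1 / (\<delta>\<^sup>2)\<^sup>2"
  \<comment> \<open>\<open>c\<close> gives half of the error to the last term of
    \<open>averaging_step\<close>; \<open>a1\<close> is the slope of \<open>t\<close> in
    \<open>W\<close> for which the perturbation term takes a quarter; \<open>X\<close> is large
    enough for the remaining quarter.\<close>
  define c where "c = err * e / 2"
  define a1 where "a1 = 4 * K * Kl\<^sup>2 / (c * e * err)"
  define A' where "A' = (4 * kap \<delta> e + A) / 2"
  define \<zeta> where "\<zeta> = A' - 4 * kap \<delta> e"
  define s0 where "s0 = 4 / (e * \<delta>\<^sup>2)"
  define s1 where "s1 = s0 * (m + K + K * a1 / \<zeta>)"
  define X where "X = 2 * s1 / (c * err) + 1"
  have c: "0 < c" using err e by (simp add: c_def)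
  have K0: "0 \<le> K" and m0: "0 \<le> m" by (auto simp: K_def m_def)
  have a1: "0 \<le> a1" unfolding a1_def using K0 c e err by auto
  have A': "0 \<le> A'" "A' < A" "0 < \<zeta>" using A kap_nonneg[OF e(1)] by (auto simp: A'_def \<zeta>_def)
  have s0: "0 < s0" unfolding s0_def using e \<delta>_pos by simp
  have s1: "0 \<le> s1" unfolding s1_def using s0 m0 K0 a1 A' by (auto intro!: mult_nonneg_nonneg add_nonneg_nonneg divide_nonneg_pos)
  have X: "0 < X" unfolding X_def using s1 c err by (intro add_nonneg_pos) auto
  obtain W F where WF: "0 \<le> W" "finite F" "F \<subseteq> {g \<in> carrier G. Q g}" "\<And>g. g \<in> F \<Longrightarrow> wt g \<le> W" "X * exp (A' * W) \<le> real (card F)"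
    using large_level_sets[OF _ A'(1,2) X ns] wt_nonneg by blast
  have "0 < X * exp (A' * W)" using X by simp
  then have N: "0 < real (card F)" using WF(5) by linarith
  then have Fne: "F \<noteq> {}" by auto
  define S where "S = s0 * exp (4 * kap \<delta> e * W)"
  define t where "t = a1 * W + 1"
  have t: "0 < t" unfolding t_def using a1 WF(1) by (intro add_nonneg_pos) auto
  have main: "(1 / (2 * c)) * (m * S + K * (t * S + (Kl\<^sup>2 * W / t) * (card F * (2 / e)))) + (c / 2) * (card F * (2 / e)) \<le> err * card F"
  proof -
    have 1: "(c / 2) * (card F * (2 / e)) = err * card F / 2" using e by (simp add: c_def)
    have 2: "(1 / (2 * c)) * (K * ((Kl\<^sup>2 * W / t) * (card F * (2 / e)))) \<le> err * card F / 4"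
    proof -
      have "(1 / (2 * c)) * (K * ((Kl\<^sup>2 * W / t) * (card F * (2 / e)))) = (K * Kl\<^sup>2 * W / (c * e * t)) * card F"
        using c e t by (simp add: field_simps)
      also have "K * Kl\<^sup>2 * W / (c * e * t) \<le> err / 4"
      proof -
        have "4 * (K * Kl\<^sup>2 * W) = a1 * W * (c * e * err)" using c e err by (simp add: a1_def field_simps)
        also have "\<dots> \<le> t * (c * e * err)" using c e err by (intro mult_right_mono) (auto simp: t_def)
        finally show ?thesis using c e t by (simp add: field_simps)
      qed
      finally show ?thesis using N by simp
    qed
    have 3: "(1 / (2 * c)) * (m * S + K * (t * S)) \<le> err * card F / 4"
    proof -
      have ex: "1 \<le> exp (\<zeta> * W)" using A'(3) WF(1) by simp
      \<comment> \<open>The factor \<open>W\<close> contained in \<open>t\<close> is paid for by the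
        gap \<open>\<zeta>\<close> between \<open>A'\<close> and
        \<open>4 * kap \<delta> e\<close>.\<close>
      have "\<zeta> * W \<le> exp (\<zeta> * W)" using exp_ge_add_one_self[of "\<zeta> * W"] by linarith
      then have wx: "W \<le> exp (\<zeta> * W) / \<zeta>" using A'(3) by (simp add: field_simps)
      have "m * S + K * (t * S) = S * ((m + K) * 1 + K * a1 * W)" by (simp add: t_def algebra_simps)
      also have "\<dots> \<le> S * ((m + K) * exp (\<zeta> * W) + K * a1 * (exp (\<zeta> * W) / \<zeta>))"
        using ex wx m0 K0 a1 s0 by (intro mult_left_mono add_mono) (auto simp: S_def)
      also have "\<dots> = s1 * (exp (4 * kap \<delta> e * W) * exp (\<zeta> * W))" by (simp add: S_def s1_def algebra_simps)
      also have "exp (4 * kap \<delta> e * W) * exp (\<zeta> * W) = exp (A' * W)" by (simp add: \<zeta>_def mult_exp_exp algebra_simps)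
      finally have "m * S + K * (t * S) \<le> s1 * exp (A' * W)" .
      then have "(1 / (2 * c)) * (m * S + K * (t * S)) \<le> (1 / (2 * c)) * (s1 * exp (A' * W))" using c by (intro mult_left_mono) auto
      also have "\<dots> = (err / 4) * ((2 * s1 / (c * err)) * exp (A' * W))" using c err by (simp add: field_simps)
      also have "\<dots> \<le> (err / 4) * (X * exp (A' * W))" using err by (intro mult_left_mono mult_right_mono) (auto simp: X_def)
      also have "\<dots> \<le> (err / 4) * card F" using WF(5) err by (intro mult_left_mono) auto
      finally show ?thesis by simp
    qed
    have "(1 / (2 * c)) * (m * S + K * (t * S + (Kl\<^sup>2 * W / t) * (card F * (2 / e))))
      = (1 / (2 * c)) * (m * S + K * (t * S)) + (1 / (2 * c)) * (K * ((Kl\<^sup>2 * W / t) * (card F * (2 / e))))"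
      by (simp only: distrib_left add.assoc)
    then show ?thesis using 1 2 3 by linarith
  qed
  have Fc: "F \<subseteq> carrier G" and FQ: "\<And>g. g \<in> F \<Longrightarrow> Q g" using WF(3) by auto
  have fin: "(\<integral>w. \<bar>\<Sum>g\<in>F. f g * tg b y0 B ys g (fst w) * Th e b g w\<bar> \<partial>(M \<Otimes>\<^sub>M lborel)) \<le> err * card F"
    if f: "\<And>g. g \<in> F \<Longrightarrow> \<bar>f g\<bar> \<le> 1" for f :: "'a \<Rightarrow> real"
  proof -
    note st = averaging_step[OF WF(2) Fne Fc WF(4) b B e f t c]
    show ?thesis
      using order_trans[OF st main[unfolded m_def K_def S_def s0_def]] by simp
  qed
  show thesis
    by (rule that[OF WF(2) Fc Fne FQ fin])
qed

text \<open>The condition on \<open>b\<close> is the hypothesis of \<open>averaging\<close> for the predicate that the marginal at \<open>g b\<close> is close to \<open>l\<close>.\<close>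
definition good_value :: "real \<Rightarrow> real \<Rightarrow> bool" where
  "good_value e l \<longleftrightarrow> 0 < e \<and> e \<le> 1 \<and> l \<in> {\<delta>..1 - \<delta>} \<and>
    (\<forall>b\<in>carrier G. \<exists>A>4 * kap \<delta> e. \<forall>\<eta>>0. \<not> (\<lambda>g. exp (- A * wt g)) summable_on {g \<in> carrier G. \<bar>pmf (\<mu> (g \<otimes> b)) False - l\<bar> < \<eta>})"

lemma exists_good_value:
  assumes \<kappa>: "inverse \<delta> * inverse (1 - \<delta>) < \<kappa>" and ns: "\<not> (\<lambda>g. exp (- 4 * \<kappa> * wt g)) summable_on carrier G"
  shows "\<exists>e l. good_value e l"
proof -
  have d: "0 < \<delta> * (1 - \<delta>)" using \<delta>_pos \<delta>_lt_1 by simp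
  define u where "u = \<kappa> * (\<delta> * (1 - \<delta>)) - 1"
  have u: "0 < u" using \<kappa> d by (simp add: u_def inverse_mult_distrib[symmetric] inverse_eq_divide divide_less_eq)
  \<comment> \<open>Small enough for \<open>kap \<delta> e < \<kappa>\<close>: the term
    \<open>e * (2 + 1 / \<delta>)\<close> is then at most half of the margin
    \<open>u\<close>.\<close>
  define e where "e = min 1 (u / (2 * (2 + 1 / \<delta>)))"
  have v: "0 < 2 + 1 / \<delta>" using \<delta>_pos by (simp add: add_pos_pos)
  have e: "0 < e" "e \<le> 1" using u v by (auto simp: e_def)
  have "e * (2 + 1 / \<delta>) \<le> u / 2"
  proof -
    have "e * (2 + 1 / \<delta>) \<le> u / (2 * (2 + 1 / \<delta>)) * (2 + 1 / \<delta>)" using v by (intro mult_right_mono) (auto simp: e_def)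
    moreover have "u / (2 * x) * x = u / 2" if "0 < x" for x :: real using that by simp
    ultimately show ?thesis using v by metis
  qed
  then have "1 + e * (2 + 1 / \<delta>) \<le> 1 + u / 2" by simp
  also have "\<dots> < 1 + u" using u by simp
  also have "1 + u = \<kappa> * (\<delta> * (1 - \<delta>))" by (simp add: u_def)
  finally have "1 + e * (2 + 1 / \<delta>) < \<kappa> * (\<delta> * (1 - \<delta>))" .
  then have k: "kap \<delta> e < \<kappa>" unfolding kap_def using d by (simp add: divide_less_eq)
  have ns': "\<not> (\<lambda>g. exp (- (4 * \<kappa>) * wt g)) summable_on carrier G" using ns by simp
  obtain l where l: "l \<in> {\<delta>..1 - \<delta>}"
    "\<And>\<eta>. 0 < \<eta> \<Longrightarrow> \<not> (\<lambda>g. exp (- (4 * \<kappa>) * wt g)) summable_on {g \<in> carrier G. \<bar>pmf (\<mu> g) False - l\<bar> < \<eta>}"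
    using exists_recurrent_value[OF ns'] by blast
  \<comment> \<open>The midpoint of \<open>4 * kap \<delta> e\<close> and
    \<open>4 * \<kappa>\<close> leaves room on both sides: below for \<open>averaging\<close>, above
    for \<open>translate_not_summable\<close>.\<close>
  let ?A = "2 * (kap \<delta> e + \<kappa>)"
  have A: "0 < ?A" "?A < 4 * \<kappa>" "4 * kap \<delta> e < ?A" using k kap_nonneg[OF e(1)] by auto
  have "good_value e l" unfolding good_value_def
    using e l(1) A(3) translate_not_summable[OF A(1,2) _ l(2)] by blast
  then show ?thesis by blast
qed

lemma Th_section:
  assumes g: "g \<in> carrier G" and b: "b \<in> carrier G" and e: "0 < e"
  shows "integrable lborel (\<lambda>s. Th e b g (z, s))" "(\<integral>s. Th e b g (z, s) \<partial>lborel) = dens g z * (2 / e)"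
proof -
  have "(\<lambda>s. Th e b g (z, s)) \<in> borel_measurable lborel" unfolding Th_def fst_conv snd_conv by measurable
  then have "has_bochner_integral lborel (\<lambda>s. Th e b g (z, s)) (dens g z * (2 / e))"
    using Th_nn[OF g b e, of z] dens_nonneg[OF g, of z] e
    by (intro has_bochner_integral_nn_integral) (auto simp: Th_nonneg[OF g])
  then show "integrable lborel (\<lambda>s. Th e b g (z, s))" "(\<integral>s. Th e b g (z, s) \<partial>lborel) = dens g z * (2 / e)"
    by (auto simp: has_bochner_integral_iff)
qed

lemma tgTh_integrable:
  assumes g: "g \<in> carrier G" and b: "b \<in> carrier G" and B: "finite B" "B \<subseteq> carrier G" and e: "0 < e"
  shows "integrable (M \<Otimes>\<^sub>M lborel) (\<lambda>w. tg b y0 B ys g (fst w) * Th e b g w)"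
proof (rule Bochner_Integration.integrable_bound[OF Th_integral(1)[OF g b e]])
  show "(\<lambda>w. tg b y0 B ys g (fst w) * Th e b g w) \<in> borel_measurable (M \<Otimes>\<^sub>M lborel)"
    by (intro borel_measurable_times measurable_compose[OF measurable_fst tg_measurable[OF g b B]] Th_measurable[OF g b])
  show "AE w in M \<Otimes>\<^sub>M lborel. norm (tg b y0 B ys g (fst w) * Th e b g w) \<le> norm (Th e b g w)"
    using tg_le_1 by (intro AE_I2) (simp add: abs_mult mult_left_le_one_le)
qed

lemma tgdens_integrable:
  assumes g: "g \<in> carrier G" and b: "b \<in> carrier G" and B: "finite B" "B \<subseteq> carrier G"
  shows "integrable M (\<lambda>z. tg b y0 B ys g z * dens g z)"
proof (rule Bochner_Integration.integrable_bound[OF integrable_dens(1)[OF g]])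
  show "(\<lambda>z. tg b y0 B ys g z * dens g z) \<in> borel_measurable M"
    by (intro borel_measurable_times tg_measurable[OF g b B] dens_measurable[OF g])
  show "AE z in M. norm (tg b y0 B ys g z * dens g z) \<le> norm (dens g z)"
    using tg_le_1 by (intro AE_I2) (simp add: abs_mult mult_left_le_one_le)
qed

text \<open>Integrating out the real variable turns \<open>Th\<close> into \<open>2 / e\<close>
  times the density, and the absolute value can only decrease when taken after this
  integration.\<close>

lemma averaging_dens:
  assumes F: "F \<subseteq> carrier G" and b: "b \<in> carrier G" and B: "finite B" "B \<subseteq> carrier G" and e: "0 < e"
    and X: "(\<integral>w. \<bar>\<Sum>g\<in>F. f g * tg b y0 B ys g (fst w) * Th e b g w\<bar> \<partial>(M \<Otimes>\<^sub>M lborel)) \<le> X"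
  shows "(\<integral>z. \<bar>\<Sum>g\<in>F. f g * tg b y0 B ys g z * dens g z\<bar> \<partial>M) \<le> (e / 2) * X"
proof -
  interpret P: pair_sigma_finite M "lborel :: real measure" ..
  have Fc: "g \<in> F \<Longrightarrow> g \<in> carrier G" for g using F by auto
  let ?h = "\<lambda>w. \<Sum>g\<in>F. f g * tg b y0 B ys g (fst w) * Th e b g w"
  have hi: "integrable (M \<Otimes>\<^sub>M lborel) ?h"
    using tgTh_integrable[OF Fc b B e, where ?y0.0 = y0 and ys = ys] by (intro Bochner_Integration.integrable_sum) (simp add: mult.assoc)
  then have ha: "integrable (M \<Otimes>\<^sub>M lborel) (\<lambda>w. \<bar>?h w\<bar>)" by simp
  have sec: "integrable lborel (\<lambda>s. ?h (z, s))" "(\<integral>s. ?h (z, s) \<partial>lborel) = (2 / e) * (\<Sum>g\<in>F. f g * tg b y0 B ys g z * dens g z)" for z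
  proof -
    show "integrable lborel (\<lambda>s. ?h (z, s))"
      using Th_section(1)[OF Fc b e, of _ z] by (intro Bochner_Integration.integrable_sum) auto
    show "(\<integral>s. ?h (z, s) \<partial>lborel) = (2 / e) * (\<Sum>g\<in>F. f g * tg b y0 B ys g z * dens g z)"
      using Th_section[OF Fc b e, of _ z]
      by (subst Bochner_Integration.integral_sum) (auto simp: sum_distrib_left mult_ac intro!: sum.cong)
  qed
  have "(2 / e) * (\<integral>z. \<bar>\<Sum>g\<in>F. f g * tg b y0 B ys g z * dens g z\<bar> \<partial>M) = (\<integral>z. \<bar>\<integral>s. ?h (z, s) \<partial>lborel\<bar> \<partial>M)"
    unfolding sec using e by (simp add: abs_mult)
  also have "\<dots> \<le> (\<integral>z. (\<integral>s. \<bar>?h (z, s)\<bar> \<partial>lborel) \<partial>M)"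
  proof (rule integral_mono)
    show "integrable M (\<lambda>z. \<bar>\<integral>s. ?h (z, s) \<partial>lborel\<bar>)" using P.integrable_fst'[OF hi] by simp
    show "integrable M (\<lambda>z. \<integral>s. \<bar>?h (z, s)\<bar> \<partial>lborel)" using P.integrable_fst'[OF ha] by simp
  qed (rule integral_abs_bound)
  also have "\<dots> = (\<integral>w. \<bar>?h w\<bar> \<partial>(M \<Otimes>\<^sub>M lborel))" using P.integral_fst'[OF ha] by simp
  also have "\<dots> \<le> X" by (rule X)
  finally show ?thesis using e by (simp add: field_simps)
qed

section \<open>Weak mixing\<close>

text \<open>A cylinder indicator is a product of conditions on single coordinates. Replacing the
  condition at \<open>b\<close> by its probability costs a test function \<open>ts b\<close>, whose
  integral vanishes; all coordinates of \<open>J\<close> are replaced in turn.\<close>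

lemma test_cyl:
  assumes \<phi>: "integrable M \<phi>"
    and 0: "\<And>b y0 B ys. b \<in> carrier G \<Longrightarrow> finite B \<Longrightarrow> B \<subseteq> carrier G \<Longrightarrow> b \<notin> B \<Longrightarrow> (\<integral>x. \<phi> x * ts b y0 B ys x \<partial>M) = 0"
    and J: "finite J" "J \<subseteq> carrier G"
  shows "(\<integral>x. \<phi> x * indicator (cyl (carrier G) J ys) x \<partial>M) = (\<Prod>i\<in>J. pmf (\<mu> i) (ys i)) * (\<integral>x. \<phi> x \<partial>M)"
  using J
proof (induction J rule: finite_induct)
  case empty
  have "(\<integral>x. \<phi> x * indicator (cyl (carrier G) {} ys) x \<partial>M) = (\<integral>x. \<phi> x \<partial>M)"
    by (rule Bochner_Integration.integral_cong) (auto simp: cyl_def)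
  then show ?case by simp
next
  case (insert b J)
  let ?c = "\<lambda>J x. indicator (cyl (carrier G) J ys) x :: real"
  have b: "b \<in> carrier G" "finite J" "J \<subseteq> carrier G" "b \<notin> J" using insert by auto
  have ci: "integrable M (\<lambda>x. \<phi> x * ?c J x)"
    by (rule integrable_real_mult_indicator[OF sets_cyl[OF b(2,3)] \<phi>])
  have ti: "integrable M (\<lambda>x. \<phi> x * ts b (ys b) J ys x)"
  proof (rule Bochner_Integration.integrable_bound[OF \<phi>])
    show "(\<lambda>x. \<phi> x * ts b (ys b) J ys x) \<in> borel_measurable M" using \<phi> b by (intro borel_measurable_times ts_measurable) auto
    show "AE x in M. norm (\<phi> x * ts b (ys b) J ys x) \<le> norm (\<phi> x)"
      using ts_le_1 by (intro AE_I2) (simp add: abs_mult mult_right_le_one_le)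
  qed
  have "(\<integral>x. \<phi> x * ?c (insert b J) x \<partial>M) = (\<integral>x. \<phi> x * ts b (ys b) J ys x + pmf (\<mu> b) (ys b) * (\<phi> x * ?c J x) \<partial>M)"
  proof (rule Bochner_Integration.integral_cong[OF refl])
    fix x assume "x \<in> space M"
    then have xs: "x \<in> carrier G \<rightarrow>\<^sub>E UNIV" by simp
    have c: "?c J x = of_bool (\<forall>i\<in>J. x i = ys i)" "?c (insert b J) x = of_bool (x b = ys b) * of_bool (\<forall>i\<in>J. x i = ys i)"
      using xs by (auto simp: cyl_def indicator_def)
    show "\<phi> x * ?c (insert b J) x = \<phi> x * ts b (ys b) J ys x + pmf (\<mu> b) (ys b) * (\<phi> x * ?c J x)"
      unfolding c ts_def by (simp add: algebra_simps)
  qed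
  also have "\<dots> = pmf (\<mu> b) (ys b) * (\<integral>x. \<phi> x * ?c J x \<partial>M)"
    using ci ti 0[OF b(1-4)] by simp
  finally show ?case using insert b by simp
qed

text \<open>By \<open>test_cyl\<close> the measure with density \<open>\<phi>\<close> and the one
  with constant density agree on all cylinders.\<close>

lemma test_const:
  assumes \<phi>: "integrable M \<phi>" and nn: "\<And>x. 0 \<le> \<phi> x"
    and 0: "\<And>b y0 B ys. b \<in> carrier G \<Longrightarrow> finite B \<Longrightarrow> B \<subseteq> carrier G \<Longrightarrow> b \<notin> B \<Longrightarrow> (\<integral>x. \<phi> x * ts b y0 B ys x \<partial>M) = 0"
  shows "AE x in M. \<phi> x = (\<integral>x. \<phi> x \<partial>M)"
proof -
  let ?c = "\<integral>x. \<phi> x \<partial>M"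
  have c0: "0 \<le> ?c" using nn by (intro integral_nonneg_AE) auto
  have m: "\<phi> \<in> borel_measurable M" using \<phi> by auto
  have "density M (\<lambda>x. ennreal (\<phi> x)) = density M (\<lambda>x. ennreal ?c)"
  proof (rule cyl_eqI[of _ "carrier G" \<mu>])
    show "finite_measure (density M (\<lambda>x. ennreal (\<phi> x)))"
    proof
      have "emeasure (density M (\<lambda>x. ennreal (\<phi> x))) (space (density M (\<lambda>x. ennreal (\<phi> x)))) = (\<integral>\<^sup>+x. ennreal (\<phi> x) * indicator (space M) x \<partial>M)"
        using m by (subst emeasure_density) (auto simp del: space_bits)
      also have "\<dots> = (\<integral>\<^sup>+x. ennreal (\<phi> x) \<partial>M)" by (rule nn_integral_cong) simp
      also have "\<dots> = ennreal ?c" using nn by (intro nn_integral_eq_integral \<phi>) auto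
      finally show "emeasure (density M (\<lambda>x. ennreal (\<phi> x))) (space (density M (\<lambda>x. ennreal (\<phi> x)))) \<noteq> \<infinity>" by simp
    qed
    fix J :: "'a set" and y assume J: "finite J" "J \<subseteq> carrier G"
    note C = sets_cyl[OF J, of y \<mu>]
    have "emeasure (density M (\<lambda>x. ennreal (\<phi> x))) (cyl (carrier G) J y) = (\<integral>\<^sup>+x. ennreal (\<phi> x * indicator (cyl (carrier G) J y) x) \<partial>M)"
      using m C by (subst emeasure_density) (auto intro!: nn_integral_cong simp: indicator_def)
    also have "\<dots> = ennreal (\<integral>x. \<phi> x * indicator (cyl (carrier G) J y) x \<partial>M)"
      using nn by (intro nn_integral_eq_integral integrable_real_mult_indicator[OF C \<phi>]) auto
    also have "\<dots> = ennreal ((\<Prod>i\<in>J. pmf (\<mu> i) (y i)) * ?c)" using test_cyl[OF \<phi> 0 J, of y] by simp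
    also have "\<dots> = ennreal ?c * ennreal (\<Prod>i\<in>J. pmf (\<mu> i) (y i))" using c0 by (simp add: ennreal_mult prod_nonneg mult.commute)
    also have "\<dots> = emeasure (density M (\<lambda>x. ennreal ?c)) (cyl (carrier G) J y)"
      using C emeasure_cyl[OF J, of \<mu> y] by (simp add: emeasure_density_const)
    finally show "emeasure (density M (\<lambda>x. ennreal (\<phi> x))) (cyl (carrier G) J y) = emeasure (density M (\<lambda>x. ennreal ?c)) (cyl (carrier G) J y)" .
  qed simp_all
  then have "AE x in M. ennreal (\<phi> x) = ennreal ?c" using m by (subst (asm) density_unique_iff) auto
  then show ?thesis by eventually_elim (use nn c0 in simp)
qed

text \<open>Change of variables by \<open>g\<close> together with the invariance of \<open>A\<close>
  and of \<open>N\<close> moves the action onto \<open>D\<close>: the integral becomes one of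
  \<open>indicator A (z, y)\<close> times \<open>indicator D (\<beta> (inv g) y)\<close>, the
  translated test function and the density. Averaging over \<open>g\<close> leaves a sum as in
  \<open>averaging\<close>.\<close>

lemma diagonal_test_zero:
  fixes N :: "'y measure"
  assumes gv: "good_value e l" and N: "prob_space N"
    and \<beta>m: "\<And>g. g \<in> carrier G \<Longrightarrow> \<beta> g \<in> measurable N N" and \<beta>p: "\<And>g. g \<in> carrier G \<Longrightarrow> distr N N (\<beta> g) = N"
    and \<beta>i: "\<And>g y. g \<in> carrier G \<Longrightarrow> y \<in> space N \<Longrightarrow> \<beta> (inv g) (\<beta> g y) = y"
    and A: "A \<in> sets (M \<Otimes>\<^sub>M N)"
    and inv: "\<And>g x y. g \<in> carrier G \<Longrightarrow> x \<in> space M \<Longrightarrow> y \<in> space N \<Longrightarrow> (act g x, \<beta> g y) \<in> A \<longleftrightarrow> (x, y) \<in> A"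
    and D: "D \<in> sets N" and b: "b \<in> carrier G" and B: "finite B" "B \<subseteq> carrier G" "b \<notin> B"
  shows "(\<integral>x. (\<integral>y. indicator A (x, y) * indicator D y \<partial>N) * ts b y0 B ys x \<partial>M) = 0"
proof -
  interpret N: prob_space N by fact
  interpret P: pair_sigma_finite M N ..
  let ?\<phi> = "\<lambda>x. \<integral>y. indicator A (x, y) * indicator D y \<partial>N :: real"
  let ?I = "\<integral>x. ?\<phi> x * ts b y0 B ys x \<partial>M"
  have e: "0 < e" "e \<le> 1" using gv by (auto simp: good_value_def)
  have AD: "(\<lambda>(x, y). indicator A (x, y) * indicator D y :: real) \<in> borel_measurable (M \<Otimes>\<^sub>M N)"
    unfolding case_prod_beta prod.collapse
    by (intro borel_measurable_times borel_measurable_indicator A measurable_compose[OF measurable_snd borel_measurable_indicator[OF D]])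
  have \<phi>m: "?\<phi> \<in> borel_measurable M"
    by (rule N.borel_measurable_lebesgue_integral[OF AD])
  have tr: "?\<phi> (act (inv g) z) = (\<integral>y. indicator A (z, y) * indicator D (\<beta> (inv g) y) \<partial>N)" if g: "g \<in> carrier G" and z: "z \<in> space M" for g z
  proof -
    have ig: "inv g \<in> carrier G" using g by simp
    have zs: "z \<in> carrier G \<rightarrow>\<^sub>E UNIV" and az: "act (inv g) z \<in> space M" using z act_space by simp_all
    have Am: "(\<lambda>y. indicator A (z, y) :: real) \<in> borel_measurable N" using A z by measurable
    have Dm: "(\<lambda>y. indicator D (\<beta> (inv g) y) :: real) \<in> borel_measurable N"
      by (rule measurable_compose[OF \<beta>m[OF ig] borel_measurable_indicator[OF D]])
    have "(\<integral>y. indicator A (z, y) * indicator D (\<beta> (inv g) y) \<partial>N) = (\<integral>y. (indicator A (z, y) * indicator D (\<beta> (inv g) y) :: real) \<partial>distr N N (\<beta> g))"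
      by (simp only: \<beta>p[OF g])
    also have "\<dots> = (\<integral>y. indicator A (z, \<beta> g y) * indicator D (\<beta> (inv g) (\<beta> g y)) \<partial>N)"
      by (rule integral_distr[OF \<beta>m[OF g], of "\<lambda>y. indicator A (z, y) * indicator D (\<beta> (inv g) y) :: real"]) (intro borel_measurable_times Am Dm)
    also have "\<dots> = ?\<phi> (act (inv g) z)"
    proof (rule Bochner_Integration.integral_cong[OF refl])
      fix y assume y: "y \<in> space N"
      have "(z, \<beta> g y) \<in> A \<longleftrightarrow> (act (inv g) z, y) \<in> A"
        using inv[OF g az y] act_inv(2)[OF zs g] by simp
      then show "indicator A (z, \<beta> g y) * indicator D (\<beta> (inv g) (\<beta> g y)) = indicator A (act (inv g) z, y) * (indicator D y :: real)"
        using \<beta>i[OF g y] by (simp add: indicator_def)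
    qed
    finally show ?thesis by simp
  qed
  have small: "\<bar>?I\<bar> \<le> (e / 2) * err" if err: "0 < err" for err
  proof -
    obtain Ax where Ax: "4 * kap \<delta> e < Ax" "\<not> (\<lambda>g. exp (- Ax * wt g)) summable_on {g \<in> carrier G. \<bar>pmf (\<mu> (g \<otimes> b)) False - l\<bar> < 1}"
      using gv b unfolding good_value_def by (meson zero_less_one)
    obtain F where F: "finite F" "F \<subseteq> carrier G" "F \<noteq> {}" "\<And>g. g \<in> F \<Longrightarrow> \<bar>pmf (\<mu> (g \<otimes> b)) False - l\<bar> < 1"
      "\<And>f. (\<And>g. g \<in> F \<Longrightarrow> \<bar>f g\<bar> \<le> 1) \<Longrightarrow>
        (\<integral>w. \<bar>\<Sum>g\<in>F. f g * tg b y0 B ys g (fst w) * Th e b g w\<bar> \<partial>(M \<Otimes>\<^sub>M lborel)) \<le> err * card F"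
      by (rule averaging[OF b B e Ax(1) err Ax(2), where ?y0.0 = y0 and ys = ys]) (rule that; blast)
    have Fc: "g \<in> F \<Longrightarrow> g \<in> carrier G" for g using F(2) by auto
    have Np: "0 < real (card F)" using F by (simp add: card_gt_0_iff)
    let ?k = "\<lambda>g z y. indicator A (z, y) * indicator D (\<beta> (inv g) y) * (tg b y0 B ys g z * dens g z)"
    have km: "(\<lambda>w. ?k g (fst w) (snd w)) \<in> borel_measurable (M \<Otimes>\<^sub>M N)" if g: "g \<in> F" for g
    proof -
      have ig: "inv g \<in> carrier G" using Fc[OF g] by simp
      have "(\<lambda>w. indicator D (\<beta> (inv g) (snd w)) :: real) \<in> borel_measurable (M \<Otimes>\<^sub>M N)"
        by (rule measurable_compose[OF measurable_compose[OF measurable_snd \<beta>m[OF ig]] borel_measurable_indicator[OF D]])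
      moreover have "(\<lambda>w. tg b y0 B ys g (fst w) * dens g (fst w)) \<in> borel_measurable (M \<Otimes>\<^sub>M N)"
        by (rule measurable_compose[OF measurable_fst borel_measurable_integrable[OF tgdens_integrable[OF Fc[OF g] b B(1,2)]]])
      moreover have "(\<lambda>w. indicator A (fst w, snd w) :: real) \<in> borel_measurable (M \<Otimes>\<^sub>M N)"
        unfolding prod.collapse by (rule borel_measurable_indicator[OF A])
      ultimately show ?thesis by (rule_tac borel_measurable_times[OF borel_measurable_times])
    qed
    have dint: "integrable (M \<Otimes>\<^sub>M N) (\<lambda>w. dens g (fst w))" if g: "g \<in> F" for g
    proof -
      have "integrable M (\<lambda>z. \<integral>y. norm (dens g z) \<partial>N)" using integrable_dens(1)[OF Fc[OF g]] dens_nonneg[OF Fc[OF g]] by (simp add: N.prob_space)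
      then show ?thesis
        by (intro P.Fubini_integrable measurable_compose[OF measurable_fst dens_measurable[OF Fc[OF g]]]) auto
    qed
    have ki: "integrable (M \<Otimes>\<^sub>M N) (\<lambda>w. ?k g (fst w) (snd w))" if g: "g \<in> F" for g
    proof (rule Bochner_Integration.integrable_bound[OF dint[OF g] km[OF g]])
      show "AE w in M \<Otimes>\<^sub>M N. norm (?k g (fst w) (snd w)) \<le> norm (dens g (fst w))"
        using tg_le_1[of b y0 B ys g] dens_nonneg[OF Fc[OF g]]
        by (intro AE_I2) (auto simp: abs_mult indicator_def intro!: mult_left_le_one_le)
    qed
    have I1: "?I = (\<integral>w. ?k g (fst w) (snd w) \<partial>(M \<Otimes>\<^sub>M N))" if g: "g \<in> F" for g
    proof -
      have "?I = (\<integral>z. dens g z * (?\<phi> (act (inv g) z) * ts b y0 B ys (act (inv g) z)) \<partial>M)"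
        by (rule integral_change[OF Fc[OF g], symmetric]) (intro borel_measurable_times \<phi>m ts_measurable b B)
      also have "\<dots> = (\<integral>z. (\<integral>y. ?k g z y \<partial>N) \<partial>M)"
      proof (rule Bochner_Integration.integral_cong[OF refl])
        fix z assume z: "z \<in> space M"
        then have zs: "z \<in> carrier G \<rightarrow>\<^sub>E UNIV" by simp
        show "dens g z * (?\<phi> (act (inv g) z) * ts b y0 B ys (act (inv g) z)) = (\<integral>y. ?k g z y \<partial>N)"
          unfolding tr[OF Fc[OF g] z] tg_act[OF Fc[OF g] b B(2) zs] integral_mult_left_zero by (simp only: mult_ac)
      qed
      also have "\<dots> = (\<integral>w. ?k g (fst w) (snd w) \<partial>(M \<Otimes>\<^sub>M N))" using P.integral_fst'[OF ki[OF g]] by simp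
      finally show ?thesis .
    qed
    \<comment> \<open>For fixed \<open>y\<close> the indicators of \<open>D\<close> are admissible
      coefficients. The indicator of \<open>A\<close> does not depend on \<open>g\<close> and is
      bounded by 1 after the summation.\<close>
    let ?s = "\<lambda>z y. \<Sum>g\<in>F. indicator D (\<beta> (inv g) y) * tg b y0 B ys g z * dens g z"
    have H: "(\<Sum>g\<in>F. ?k g z y) = indicator A (z, y) * ?s z y" for z y by (simp add: sum_distrib_left mult_ac)
    have Hi: "integrable (M \<Otimes>\<^sub>M N) (\<lambda>w. \<Sum>g\<in>F. ?k g (fst w) (snd w))" by (intro Bochner_Integration.integrable_sum ki)
    have "card F * ?I = (\<Sum>g\<in>F. ?I)" by simp
    also have "\<dots> = (\<Sum>g\<in>F. \<integral>w. ?k g (fst w) (snd w) \<partial>(M \<Otimes>\<^sub>M N))" using I1 by (rule sum.cong[OF refl])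
    also have "\<dots> = (\<integral>w. (\<Sum>g\<in>F. ?k g (fst w) (snd w)) \<partial>(M \<Otimes>\<^sub>M N))" by (rule Bochner_Integration.integral_sum[OF ki, symmetric])
    also have "\<dots> = (\<integral>y. (\<integral>z. (\<Sum>g\<in>F. ?k g z y) \<partial>M) \<partial>N)" 
    proof -
      have "integrable (M \<Otimes>\<^sub>M N) (\<lambda>(z, y). \<Sum>g\<in>F. ?k g z y)" using Hi unfolding case_prod_beta .
      from P.integral_snd[OF this] show ?thesis unfolding case_prod_beta by (rule sym)
    qed
    finally have eq: "card F * ?I = (\<integral>y. (\<integral>z. (\<Sum>g\<in>F. ?k g z y) \<partial>M) \<partial>N)" .
    have "\<bar>\<integral>y. (\<integral>z. (\<Sum>g\<in>F. ?k g z y) \<partial>M) \<partial>N\<bar> \<le> (e / 2) * (err * card F)"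
    proof -
      have bd: "\<bar>\<integral>z. (\<Sum>g\<in>F. ?k g z y) \<partial>M\<bar> \<le> (e / 2) * (err * card F)" for y
      proof -
        have si: "integrable M (\<lambda>z. ?s z y)"
          using tgdens_integrable[OF Fc b B(1,2), where ?y0.0 = y0 and ys = ys] by (intro Bochner_Integration.integrable_sum) (simp add: mult.assoc)
        have "\<bar>\<integral>z. (\<Sum>g\<in>F. ?k g z y) \<partial>M\<bar> \<le> (\<integral>z. \<bar>\<Sum>g\<in>F. ?k g z y\<bar> \<partial>M)" by (rule integral_abs_bound)
        also have "\<dots> \<le> (\<integral>z. \<bar>?s z y\<bar> \<partial>M)"
        proof (rule integral_mono')
          show "integrable M (\<lambda>z. \<bar>?s z y\<bar>)" using si by simp
          show "\<bar>\<Sum>g\<in>F. ?k g z y\<bar> \<le> \<bar>?s z y\<bar>" for z unfolding H by (simp add: abs_mult indicator_def)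
        qed simp
        also have "\<dots> \<le> (e / 2) * (err * card F)"
          by (rule averaging_dens[OF F(2) b B(1,2) e(1) F(5)]) (simp add: indicator_def)
        finally show ?thesis .
      qed
      have "\<bar>\<integral>y. (\<integral>z. (\<Sum>g\<in>F. ?k g z y) \<partial>M) \<partial>N\<bar> \<le> (\<integral>y. \<bar>\<integral>z. (\<Sum>g\<in>F. ?k g z y) \<partial>M\<bar> \<partial>N)" by (rule integral_abs_bound)
      also have "\<dots> \<le> (\<integral>y. (e / 2) * (err * card F) \<partial>N)"
        using e err by (intro integral_mono' bd) auto
      finally show ?thesis by (simp add: N.prob_space)
    qed
    then have "card F * \<bar>?I\<bar> \<le> card F * ((e / 2) * err)" unfolding eq[symmetric] by (simp add: abs_mult mult_ac)
    then show ?thesis using Np by simp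
  qed
  have "\<bar>?I\<bar> \<le> 0 + \<epsilon>" if "0 < \<epsilon>" for \<epsilon>
    using small[of "2 * \<epsilon> / e"] that e by simp
  then have "\<bar>?I\<bar> \<le> 0" by (rule field_le_epsilon)
  then show ?thesis by simp
qed

text \<open>For every \<open>D\<close>, the measure of the part in \<open>D\<close> of the section
  over \<open>x\<close> is constant in \<open>x\<close>, by \<open>test_const\<close>; so
  \<open>A\<close> and the function \<open>\<phi>\<close> of \<open>y\<close> alone give the same
  mass to rectangles. Hence \<open>indicator A\<close> equals \<open>\<phi>\<close> almost
  everywhere, \<open>\<phi>\<close> is 0 or 1, and ergodicity on \<open>N\<close> decides between
  the two.\<close>

lemma diagonal_ergodic:
  fixes N :: "'y measure"
  assumes gv: "good_value e l" and N: "prob_space N"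
    and \<beta>m: "\<And>g. g \<in> carrier G \<Longrightarrow> \<beta> g \<in> measurable N N" and \<beta>p: "\<And>g. g \<in> carrier G \<Longrightarrow> distr N N (\<beta> g) = N"
    and \<beta>i: "\<And>g y. g \<in> carrier G \<Longrightarrow> y \<in> space N \<Longrightarrow> \<beta> (inv g) (\<beta> g y) = y"
    and erg: "\<And>D. D \<in> sets N \<Longrightarrow> (\<And>g y. g \<in> carrier G \<Longrightarrow> y \<in> space N \<Longrightarrow> \<beta> g y \<in> D \<longleftrightarrow> y \<in> D) \<Longrightarrow> emeasure N D = 0 \<or> emeasure N D = 1"
    and A: "A \<in> sets (M \<Otimes>\<^sub>M N)"
    and inv: "\<And>g x y. g \<in> carrier G \<Longrightarrow> x \<in> space M \<Longrightarrow> y \<in> space N \<Longrightarrow> (act g x, \<beta> g y) \<in> A \<longleftrightarrow> (x, y) \<in> A"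
  shows "emeasure (M \<Otimes>\<^sub>M N) A = 0 \<or> emeasure (M \<Otimes>\<^sub>M N) A = 1"
proof -
  interpret N: prob_space N by fact
  interpret P: pair_prob_space M N ..
  let ?P = "M \<Otimes>\<^sub>M N"
  define \<phi> where "\<phi> y = emeasure M ((\<lambda>x. (x, y)) -` A)" for y
  have sec: "(\<lambda>x. (x, y)) -` A \<in> sets M" for y using A by (rule sets_Pair2)
  have \<phi>m [measurable]: "\<phi> \<in> borel_measurable N" unfolding \<phi>_def[abs_def] using A by (rule P.measurable_emeasure_Pair2)
  have \<phi>1: "\<phi> y \<le> 1" for y unfolding \<phi>_def by (rule emeasure_le_1)
  have PA: "emeasure ?P A = (\<integral>\<^sup>+y. \<phi> y \<partial>N)" unfolding \<phi>_def by (rule P.emeasure_pair_measure_alt2[OF A])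
  have rect: "emeasure (density ?P (indicator A)) (C \<times> D) = emeasure (density ?P (\<lambda>w. \<phi> (snd w))) (C \<times> D)"
    if C: "C \<in> sets M" and D: "D \<in> sets N" for C D
  proof -
    let ?\<phi> = "\<lambda>x. \<integral>y. indicator A (x, y) * indicator D y \<partial>N :: real"
    have CD: "C \<times> D \<in> sets ?P" using C D by simp
    have AD: "A \<inter> (space M \<times> D) \<in> sets ?P" using A D sets.top[of M] by (intro sets.Int pair_measureI) auto
    have \<phi>e: "ennreal (?\<phi> x) = emeasure N (Pair x -` (A \<inter> (space M \<times> D)))" and \<phi>le: "?\<phi> x \<le> 1" "0 \<le> ?\<phi> x" if x: "x \<in> space M" for x
    proof -
      have s: "Pair x -` (A \<inter> (space M \<times> D)) \<in> sets N" using AD by (rule sets_Pair1)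
      have "?\<phi> x = (\<integral>y. indicator (Pair x -` (A \<inter> (space M \<times> D))) y \<partial>N)"
        using x by (intro Bochner_Integration.integral_cong refl) (simp add: indicator_def)
      also have "\<dots> = measure N (Pair x -` (A \<inter> (space M \<times> D)))" using s N.emeasure_eq_measure by simp
      finally have *: "?\<phi> x = measure N (Pair x -` (A \<inter> (space M \<times> D)))" .
      show "ennreal (?\<phi> x) = emeasure N (Pair x -` (A \<inter> (space M \<times> D)))" unfolding * by (simp add: N.emeasure_eq_measure)
      show "?\<phi> x \<le> 1" "0 \<le> ?\<phi> x" unfolding * by auto
    qed
    have AD': "(\<lambda>(x, y). indicator A (x, y) * indicator D y :: real) \<in> borel_measurable (M \<Otimes>\<^sub>M N)"
    unfolding case_prod_beta prod.collapse
    by (intro borel_measurable_times borel_measurable_indicator A measurable_compose[OF measurable_snd borel_measurable_indicator[OF D]])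
    have \<phi>m': "?\<phi> \<in> borel_measurable M"
      by (rule N.borel_measurable_lebesgue_integral[OF AD'])
    have \<phi>i: "integrable M ?\<phi>" 
    proof (rule integrable_const_bound[where B = 1])
      show "AE x in M. norm (?\<phi> x) \<le> 1" by (rule AE_I2) (simp only: real_norm_def abs_of_nonneg[OF \<phi>le(2)] \<phi>le(1))
    qed (rule \<phi>m')
    have ae: "AE x in M. ?\<phi> x = (\<integral>x. ?\<phi> x \<partial>M)"
    proof (rule test_const[OF \<phi>i])
      show "0 \<le> ?\<phi> x" for x by (intro integral_nonneg_AE) auto
      fix b y0 B ys assume "b \<in> carrier G" "finite B" "B \<subseteq> carrier G" "b \<notin> B"
      then show "(\<integral>x. ?\<phi> x * ts b y0 B ys x \<partial>M) = 0"
        by (intro diagonal_test_zero[OF gv N \<beta>m \<beta>p \<beta>i A inv D])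
    qed
    let ?c = "\<integral>x. ?\<phi> x \<partial>M"
    have rhs: "(\<integral>\<^sup>+y. \<phi> y * indicator D y \<partial>N) = ennreal ?c"
    proof -
      have "ennreal ?c = (\<integral>\<^sup>+x. ennreal (?\<phi> x) \<partial>M)" using \<phi>le \<phi>i by (intro nn_integral_eq_integral[symmetric]) (auto simp del: space_bits)
      also have "\<dots> = (\<integral>\<^sup>+x. emeasure N (Pair x -` (A \<inter> (space M \<times> D))) \<partial>M)" using \<phi>e by (rule nn_integral_cong)
      also have "\<dots> = emeasure ?P (A \<inter> (space M \<times> D))" by (rule N.emeasure_pair_measure_alt[OF AD, symmetric])
      also have "\<dots> = (\<integral>\<^sup>+y. emeasure M ((\<lambda>x. (x, y)) -` (A \<inter> (space M \<times> D))) \<partial>N)" by (rule P.emeasure_pair_measure_alt2[OF AD])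
      also have "\<dots> = (\<integral>\<^sup>+y. \<phi> y * indicator D y \<partial>N)"
      proof (rule nn_integral_cong)
        fix y
        have "(\<lambda>x. (x, y)) -` (A \<inter> (space M \<times> D)) = (if y \<in> D then (\<lambda>x. (x, y)) -` A else {})"
          using sets.sets_into_space[OF sec, of y] by auto
        then show "emeasure M ((\<lambda>x. (x, y)) -` (A \<inter> (space M \<times> D))) = \<phi> y * indicator D y" by (simp add: \<phi>_def)
      qed
      finally show ?thesis by simp
    qed
    have "emeasure (density ?P (indicator A)) (C \<times> D) = (\<integral>\<^sup>+w. indicator A w * indicator (C \<times> D) w \<partial>?P)"
      using A CD by (intro emeasure_density) auto
    also have "\<dots> = (\<integral>\<^sup>+x. (\<integral>\<^sup>+y. indicator A (x, y) * indicator (C \<times> D) (x, y) \<partial>N) \<partial>M)"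
      using A CD by (intro N.nn_integral_fst[symmetric] borel_measurable_times_ennreal borel_measurable_indicator)
    also have "\<dots> = (\<integral>\<^sup>+x. ennreal (?\<phi> x) * indicator C x \<partial>M)"
    proof (rule nn_integral_cong)
      fix x assume x: "x \<in> space M"
      have s: "Pair x -` (A \<inter> (space M \<times> D)) \<in> sets N" using AD by (rule sets_Pair1)
      have "(\<integral>\<^sup>+y. indicator A (x, y) * indicator (C \<times> D) (x, y) \<partial>N) = (\<integral>\<^sup>+y. indicator (Pair x -` (A \<inter> (space M \<times> D))) y * indicator C x \<partial>N)"
        using x by (intro nn_integral_cong) (simp add: indicator_def)
      also have "\<dots> = emeasure N (Pair x -` (A \<inter> (space M \<times> D))) * indicator C x" using s by (subst nn_integral_multc) auto
      finally show "(\<integral>\<^sup>+y. indicator A (x, y) * indicator (C \<times> D) (x, y) \<partial>N) = ennreal (?\<phi> x) * indicator C x" using \<phi>e[OF x] by simp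
    qed
    also have "\<dots> = (\<integral>\<^sup>+x. ennreal ?c * indicator C x \<partial>M)" by (rule nn_integral_cong_AE) (use ae in eventually_elim, simp)
    also have "\<dots> = ennreal ?c * emeasure M C" using C by (simp add: nn_integral_cmult_indicator)
    also have "\<dots> = (\<integral>\<^sup>+y. (\<phi> y * indicator D y) * emeasure M C \<partial>N)" unfolding rhs[symmetric]
      by (rule nn_integral_multc[symmetric]) (intro borel_measurable_times_ennreal \<phi>m borel_measurable_indicator D)
    also have "\<dots> = (\<integral>\<^sup>+y. (\<integral>\<^sup>+x. \<phi> y * indicator (C \<times> D) (x, y) \<partial>M) \<partial>N)"
    proof (rule nn_integral_cong)
      fix y
      have "(\<integral>\<^sup>+x. \<phi> y * indicator (C \<times> D) (x, y) \<partial>M) = (\<integral>\<^sup>+x. (\<phi> y * indicator D y) * indicator C x \<partial>M)"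
        by (intro nn_integral_cong) (simp add: indicator_def)
      also have "\<dots> = (\<phi> y * indicator D y) * emeasure M C" using C by (simp add: nn_integral_cmult_indicator)
      finally show "(\<phi> y * indicator D y) * emeasure M C = (\<integral>\<^sup>+x. \<phi> y * indicator (C \<times> D) (x, y) \<partial>M)" by simp
    qed
    also have "\<dots> = (\<integral>\<^sup>+w. \<phi> (snd w) * indicator (C \<times> D) w \<partial>?P)"
      using CD by (subst P.nn_integral_snd[symmetric]) (auto intro!: borel_measurable_times_ennreal)
    also have "\<dots> = emeasure (density ?P (\<lambda>w. \<phi> (snd w))) (C \<times> D)"
      using CD by (intro emeasure_density[symmetric]) auto
    finally show ?thesis .
  qed
  have "density ?P (indicator A) = density ?P (\<lambda>w. \<phi> (snd w))"
  proof (rule measure_eqI_generator_eq[OF Int_stable_pair_measure_generator[of M N], where A = "\<lambda>_. space M \<times> space N"])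
    show "{a \<times> b |a b. a \<in> sets M \<and> b \<in> sets N} \<subseteq> Pow (space M \<times> space N)" by (rule pair_measure_closed)
    show "range (\<lambda>_::nat. space M \<times> space N) \<subseteq> {a \<times> b |a b. a \<in> sets M \<and> b \<in> sets N}" by blast
    show "(\<Union>i::nat. space M \<times> space N) = space M \<times> space N" by simp
    show "emeasure (density ?P (indicator A)) (space M \<times> space N) \<noteq> \<infinity>"
    proof -
      have t: "space M \<times> space N \<in> sets ?P" by (metis sets.top space_pair_measure)
      have "emeasure (density ?P (indicator A)) (space M \<times> space N) = emeasure ?P (A \<inter> (space M \<times> space N))"
        using A t by (subst emeasure_density) (auto simp: indicator_inter_arith[symmetric])
      then show ?thesis by (simp add: P.emeasure_eq_measure)
    qed
    fix X assume "X \<in> {a \<times> b |a b. a \<in> sets M \<and> b \<in> sets N}"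
    then show "emeasure (density ?P (indicator A)) X = emeasure (density ?P (\<lambda>w. \<phi> (snd w))) X" using rect by auto
  qed (simp_all only: sets_density sets_pair_measure)
  then have "AE w in ?P. indicator A w = \<phi> (snd w)"
    using A by (subst (asm) P.density_unique_iff) auto
  then have "AE w in ?P. \<phi> (snd w) = 0 \<or> \<phi> (snd w) = 1" by eventually_elim (auto simp: indicator_def split: if_splits dest: sym)
  then have \<phi>01: "AE y in N. \<phi> y = 0 \<or> \<phi> y = 1"
  proof -
    assume ae: "AE w in ?P. \<phi> (snd w) = 0 \<or> \<phi> (snd w) = 1"
    have "AE y in distr ?P N snd. \<phi> y = 0 \<or> \<phi> y = 1" using ae by (subst AE_distr_iff) auto
    moreover have "distr ?P N snd = N"
    proof (rule measure_eqI)
      fix D assume "D \<in> sets (distr ?P N snd)"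
      then have D: "D \<in> sets N" by simp
      have "emeasure (distr ?P N snd) D = emeasure ?P (snd -` D \<inter> space ?P)" using D by (intro emeasure_distr) auto
      also have "snd -` D \<inter> space ?P = space M \<times> D" using sets.sets_into_space[OF D] unfolding space_pair_measure by auto
      also have "emeasure ?P (space M \<times> D) = emeasure N D" using D sets.top[of M] by (subst N.emeasure_pair_measure_Times) (auto simp: emeasure_space_1 simp del: space_bits)
      finally show "emeasure (distr ?P N snd) D = emeasure N D" .
    qed simp
    ultimately show ?thesis by metis
  qed
  define D where "D = {y \<in> space N. \<phi> y = 0}"
  have D: "D \<in> sets N" unfolding D_def by measurable
  \<comment> \<open>The ergodicity hypothesis concerns strictly invariant sets. The zero set of
    \<open>\<phi>\<close> is one: null sections stay null under the nonsingular action on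
    \<open>M\<close>, at every \<open>y\<close> and not only almost everywhere.\<close>
  have \<phi>0: "\<phi> y = 0" if g: "g \<in> carrier G" and y: "y \<in> space N" and z: "\<phi> (\<beta> g y) = 0" for g y
  proof -
    let ?S = "(\<lambda>x. (x, y)) -` A" and ?S' = "(\<lambda>x. (x, \<beta> g y)) -` A"
    have "AE x in M. x \<notin> ?S'" using z sec[of "\<beta> g y"] unfolding \<phi>_def by (intro AE_not_in) (simp add: null_sets_def)
    then have "AE x in M. act g x \<notin> ?S'" by (rule AE_act[OF g])
    then have "AE x in M. x \<notin> ?S"
      by (rule AE_mp) (use inv[OF g _ y] in \<open>auto intro!: AE_I2 simp del: space_bits\<close>)
    then show ?thesis unfolding \<phi>_def using sec[of y] by (subst (asm) AE_iff_measurable[OF sec[of y]]) (use sets.sets_into_space[OF sec[of y]] in auto)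
  qed
  have "\<beta> g y \<in> D \<longleftrightarrow> y \<in> D" if g: "g \<in> carrier G" and y: "y \<in> space N" for g y
  proof -
    have gy: "\<beta> g y \<in> space N" using measurable_space[OF \<beta>m[OF g] y] .
    show ?thesis
    proof
      assume "\<beta> g y \<in> D" then show "y \<in> D" using \<phi>0[OF g y] y by (simp add: D_def)
    next
      assume "y \<in> D"
      then have "\<phi> (\<beta> (inv g) (\<beta> g y)) = 0" using \<beta>i[OF g y] by (simp add: D_def)
      then have "\<phi> (\<beta> g y) = 0" using \<phi>0[OF _ gy, of "inv g"] g by simp
      then show "\<beta> g y \<in> D" using gy by (simp add: D_def)
    qed
  qed
  from erg[OF D this] show ?thesis
  proof
    assume "emeasure N D = 0"
    then have "AE y in N. y \<notin> D" using D by (intro AE_not_in) (simp add: null_sets_def)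
    then have "AE y in N. \<phi> y = 1" using \<phi>01 AE_space[of N] by eventually_elim (auto simp: D_def)
    then have "(\<integral>\<^sup>+y. \<phi> y \<partial>N) = (\<integral>\<^sup>+y. 1 \<partial>N)" by (rule nn_integral_cong_AE)
    then show ?thesis using PA N.emeasure_space_1 by simp
  next
    assume "emeasure N D = 1"
    then have "AE y in N. y \<in> D" using D by (subst N.AE_in_set_eq_1) (auto simp: N.emeasure_eq_measure)
    then have "AE y in N. \<phi> y = 0" by eventually_elim (simp add: D_def)
    then have "(\<integral>\<^sup>+y. \<phi> y \<partial>N) = (\<integral>\<^sup>+y. 0 \<partial>N)" by (rule nn_integral_cong_AE)
    then show ?thesis using PA by simp
  qed
qed

end

lemma laplace_integral:
  fixes e c :: real
  assumes e: "0 < e"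
  shows "integrable lborel (\<lambda>s. exp (- (e * \<bar>s + c\<bar>)))" "(\<integral>s. exp (- (e * \<bar>s + c\<bar>)) \<partial>lborel) = 2 / e"
proof -
  have "has_bochner_integral lborel (\<lambda>s. exp (- (e * \<bar>s + c\<bar>))) (2 / e)"
    using nn_laplace[OF e, of c] e by (intro has_bochner_integral_nn_integral) auto
  then show "integrable lborel (\<lambda>s. exp (- (e * \<bar>s + c\<bar>)))" "(\<integral>s. exp (- (e * \<bar>s + c\<bar>)) \<partial>lborel) = 2 / e"
    by (auto simp: has_bochner_integral_iff)
qed

section \<open>The Maharam extension\<close>

text \<open>The modulus of continuity of \<open>Phi\<close> below.\<close>
definition lm :: "real \<Rightarrow> real \<Rightarrow> real" where "lm e h = 2 / e * (exp (e * h) - 1)"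

lemma lm_mono: "0 < e \<Longrightarrow> h \<le> h' \<Longrightarrow> lm e h \<le> lm e h'"
  unfolding lm_def by (intro mult_left_mono) auto

lemma lm_le: assumes "0 < e" "e \<le> 1" "0 \<le> h" "h \<le> 1" shows "lm e h \<le> 4 * h"
proof -
  have eh: "0 \<le> e * h" "e * h \<le> 1" using assms by (auto intro: mult_le_one)
  have "exp (e * h) \<le> 1 + e * h + (e * h)\<^sup>2" using eh by (rule exp_bound)
  also have "(e * h)\<^sup>2 \<le> e * h" using eh by (simp add: power2_eq_square mult_left_le)
  finally have "exp (e * h) - 1 \<le> 2 * (e * h)" by simp
  then have "lm e h \<le> 2 / e * (2 * (e * h))" unfolding lm_def using assms by (intro mult_left_mono) auto
  then show ?thesis using assms by simp
qed

lemma laplace_shift: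
  fixes e a b s :: real
  assumes e: "0 < e"
  shows "\<bar>exp (- (e * \<bar>s - a\<bar>)) - exp (- (e * \<bar>s - b\<bar>))\<bar> \<le> (exp (e * \<bar>a - b\<bar>) - 1) * exp (- (e * \<bar>s - a\<bar>))"
proof -
  define x where "x = exp (- (e * \<bar>s - a\<bar>))"
  define y where "y = exp (- (e * \<bar>s - b\<bar>))"
  define E where "E = exp (e * \<bar>a - b\<bar>)"
  have E1: "1 \<le> E" using e by (simp add: E_def)
  have x0: "0 < x" by (simp add: x_def)
  have "e * \<bar>s - a\<bar> \<le> e * (\<bar>s - b\<bar> + \<bar>a - b\<bar>)" "e * \<bar>s - b\<bar> \<le> e * (\<bar>s - a\<bar> + \<bar>a - b\<bar>)"
    using e by (auto intro!: mult_left_mono)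
  then have yx: "y \<le> E * x" "x \<le> E * y" by (simp_all add: x_def y_def E_def mult_exp_exp algebra_simps)
  have "\<bar>x - y\<bar> \<le> (E - 1) * x"
  proof (cases "x \<le> y")
    case True then show ?thesis using yx by (simp add: algebra_simps)
  next
    case False
    have "E * (x - y) \<le> E * x - x" using yx by (simp add: algebra_simps)
    moreover have "x - y \<le> E * (x - y)" using E1 False mult_right_mono[of 1 E "x - y"] by simp
    ultimately show ?thesis using False by (simp add: algebra_simps)
  qed
  then show ?thesis by (simp only: x_def y_def E_def)
qed

context bernoulli
begin

definition lam :: "real \<Rightarrow> bool \<Rightarrow> real" where "lam l y = (if y then 1 - l else l)"
definition dd :: "real \<Rightarrow> 'a \<Rightarrow> real" where "dd l b = ln (pmf (\<mu> b) False / l) - ln (pmf (\<mu> b) True / (1 - l))"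
text \<open>Convolution with the kernel of \<open>Th\<close>. The same \<open>e\<close> occurs in
  both, so that a translate of \<open>Phi\<close> becomes an integral against \<open>Th\<close>, see
  \<open>Phi_change\<close>.\<close>

definition Phi :: "real \<Rightarrow> (('a \<Rightarrow> bool) \<Rightarrow> real \<Rightarrow> real) \<Rightarrow> ('a \<Rightarrow> bool) \<Rightarrow> real \<Rightarrow> real" where
  "Phi e F x t = (\<integral>s. F x s * exp (- (e * \<bar>s - t\<bar>)) \<partial>lborel)"

text \<open>\<open>F\<close> represents a function on \<open>X \<times> \<real>\<close> that is invariant under the Maharam extension of the action.\<close>
definition maharam :: "(('a \<Rightarrow> bool) \<Rightarrow> real \<Rightarrow> real) \<Rightarrow> bool" where
  "maharam F \<longleftrightarrow> (\<lambda>w. F (fst w) (snd w)) \<in> borel_measurable (M \<Otimes>\<^sub>M lborel) \<and> (\<forall>x s. 0 \<le> F x s \<and> F x s \<le> 1) \<and>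
     (\<forall>g\<in>carrier G. AE z in M. \<forall>s. F (act (inv g) z) s = F z (s - ln (dens g z)))"

lemma maharam_section:
  assumes F: "maharam F" and x: "x \<in> space M" shows "F x \<in> borel_measurable lborel"
  using measurable_compose[OF measurable_Pair1'[OF x], of "\<lambda>w. F (fst w) (snd w)" lborel borel] F by (simp add: maharam_def)

lemma maharam_bd: "maharam F \<Longrightarrow> 0 \<le> F x s" "maharam F \<Longrightarrow> F x s \<le> 1"
  by (auto simp: maharam_def)

lemma Phi_int:
  assumes F: "maharam F" and x: "x \<in> space M" and e: "0 < e"
  shows "integrable lborel (\<lambda>s. F x (s + u) * exp (- (e * \<bar>s + c\<bar>)))"
proof (rule Bochner_Integration.integrable_bound[OF laplace_integral(1)[OF e, of c]])
  have [measurable]: "F x \<in> borel_measurable borel" using maharam_section[OF F x] by simp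
  show "(\<lambda>s. F x (s + u) * exp (- (e * \<bar>s + c\<bar>))) \<in> borel_measurable lborel" by measurable
  show "AE s in lborel. norm (F x (s + u) * exp (- (e * \<bar>s + c\<bar>))) \<le> norm (exp (- (e * \<bar>s + c\<bar>)))"
    using maharam_bd[OF F] by (intro AE_I2) (simp add: abs_mult mult_left_le_one_le)
qed

lemma Phi_bd:
  assumes F: "maharam F" and x: "x \<in> space M" and e: "0 < e"
  shows "0 \<le> Phi e F x t" "Phi e F x t \<le> 2 / e"
proof -
  show "0 \<le> Phi e F x t" unfolding Phi_def using maharam_bd[OF F] by (intro integral_nonneg_AE) auto
  have "Phi e F x t \<le> (\<integral>s. exp (- (e * \<bar>s + - t\<bar>)) \<partial>lborel)"
    unfolding Phi_def
  proof (rule integral_mono)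
    show "integrable lborel (\<lambda>s. F x s * exp (- (e * \<bar>s - t\<bar>)))" using Phi_int[OF F x e, of 0 "- t"] by simp
    show "integrable lborel (\<lambda>s. exp (- (e * \<bar>s + - t\<bar>)))" by (rule laplace_integral(1)[OF e])
    show "F x s * exp (- (e * \<bar>s - t\<bar>)) \<le> exp (- (e * \<bar>s + - t\<bar>))" for s
      using maharam_bd[OF F] by (simp add: mult_left_le_one_le)
  qed
  then show "Phi e F x t \<le> 2 / e" by (simp only: laplace_integral[OF e])
qed

lemma Phi_meas:
  assumes F: "maharam F" shows "(\<lambda>x. Phi e F x t) \<in> borel_measurable M"
proof -
  have Fm [measurable]: "(\<lambda>w. F (fst w) (snd w)) \<in> borel_measurable (M \<Otimes>\<^sub>M lborel)" using F by (simp add: maharam_def)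
  have "(\<lambda>(x, s). F x s * exp (- (e * \<bar>s - t\<bar>))) \<in> borel_measurable (M \<Otimes>\<^sub>M lborel)"
    unfolding case_prod_beta
  proof (rule borel_measurable_times[OF Fm])
    have "(\<lambda>s. exp (- (e * \<bar>s - t\<bar>))) \<in> borel_measurable lborel" by measurable
    from measurable_compose[OF measurable_snd this]
    show "(\<lambda>w. exp (- (e * \<bar>snd w - t\<bar>))) \<in> borel_measurable (M \<Otimes>\<^sub>M lborel)" .
  qed
  from lborel.borel_measurable_lebesgue_integral[OF this] show ?thesis by (simp add: Phi_def)
qed

lemma Phi_shift:
  assumes F: "maharam F" and x: "x \<in> space M" and e: "0 < e"
  shows "\<bar>Phi e F x t - Phi e F x t'\<bar> \<le> lm e \<bar>t - t'\<bar>"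
proof -
  have i: "integrable lborel (\<lambda>s. F x s * exp (- (e * \<bar>s - t\<bar>)))" for t using Phi_int[OF F x e, of 0 "- t"] by simp
  have eq: "Phi e F x t - Phi e F x t' = (\<integral>s. F x s * exp (- (e * \<bar>s - t\<bar>)) - F x s * exp (- (e * \<bar>s - t'\<bar>)) \<partial>lborel)"
    unfolding Phi_def by (rule Bochner_Integration.integral_diff[OF i i, symmetric])
  have "\<bar>Phi e F x t - Phi e F x t'\<bar> \<le> (\<integral>s. \<bar>F x s * exp (- (e * \<bar>s - t\<bar>)) - F x s * exp (- (e * \<bar>s - t'\<bar>))\<bar> \<partial>lborel)"
    unfolding eq by (rule integral_abs_bound)
  also have "\<dots> \<le> (\<integral>s. (exp (e * \<bar>t - t'\<bar>) - 1) * exp (- (e * \<bar>s + - t\<bar>)) \<partial>lborel)"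
  proof (rule integral_mono)
    show "integrable lborel (\<lambda>s. \<bar>F x s * exp (- (e * \<bar>s - t\<bar>)) - F x s * exp (- (e * \<bar>s - t'\<bar>))\<bar>)" using i by simp
    show "integrable lborel (\<lambda>s. (exp (e * \<bar>t - t'\<bar>) - 1) * exp (- (e * \<bar>s + - t\<bar>)))"
      using laplace_integral(1)[OF e, of "- t"] by (rule integrable_mult_right)
    fix s
    have "\<bar>F x s * exp (- (e * \<bar>s - t\<bar>)) - F x s * exp (- (e * \<bar>s - t'\<bar>))\<bar> = F x s * \<bar>exp (- (e * \<bar>s - t\<bar>)) - exp (- (e * \<bar>s - t'\<bar>))\<bar>"
      using maharam_bd[OF F] by (simp add: abs_mult right_diff_distrib[symmetric])
    also have "\<dots> \<le> 1 * ((exp (e * \<bar>t - t'\<bar>) - 1) * exp (- (e * \<bar>s - t\<bar>)))"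
      using maharam_bd[OF F] laplace_shift[OF e] by (intro mult_mono) auto
    finally show "\<bar>F x s * exp (- (e * \<bar>s - t\<bar>)) - F x s * exp (- (e * \<bar>s - t'\<bar>))\<bar> \<le> (exp (e * \<bar>t - t'\<bar>) - 1) * exp (- (e * \<bar>s + - t\<bar>))" by simp
  qed
  also have "\<dots> = lm e \<bar>t - t'\<bar>" by (simp only: integral_mult_right_zero laplace_integral(2)[OF e] lm_def mult.commute)
  finally show ?thesis .
qed

lemma Phi_comp_meas:
  assumes F: "maharam F" and b: "b \<in> carrier G"
  shows "(\<lambda>x. Phi e F x (u (x b))) \<in> borel_measurable M"
proof -
  have "(\<lambda>x. of_bool (x b) * Phi e F x (u True) + of_bool (\<not> x b) * Phi e F x (u False)) \<in> borel_measurable M"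
    using b by (intro borel_measurable_add borel_measurable_times Phi_meas[OF F] measurable_bits_fun) auto
  moreover have "of_bool (x b) * Phi e F x (u True) + of_bool (\<not> x b) * Phi e F x (u False) = Phi e F x (u (x b))" for x
    by (cases "x b") auto
  ultimately show ?thesis by simp
qed

text \<open>Invariance shifts the real variable by \<open>ln (dens g z)\<close>. The term added to
  \<open>t\<close> is the logarithm of the factor at \<open>g \<otimes> b\<close>; it removes this
  factor from the shift and leaves \<open>ln (fl b g z)\<close>, the shift in
  \<open>Th\<close>.\<close>

lemma Phi_change:
  assumes F: "maharam F" and g: "g \<in> carrier G" and b: "b \<in> carrier G" and e: "0 < e"
  shows "AE z in M. dens g z * Phi e F (act (inv g) z) (t + ln (pmf (\<mu> b) (z (g \<otimes> b)) / pmf (\<mu> (g \<otimes> b)) (z (g \<otimes> b))))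
    = (\<integral>s. F z (s + t) * Th e b g (z, s) \<partial>lborel)"
proof -
  have inv: "AE z in M. \<forall>s. F (act (inv g) z) s = F z (s - ln (dens g z))" using F g by (simp add: maharam_def)
  show ?thesis using inv dens_pos[OF g]
  proof eventually_elim
    case (elim z)
    let ?j = "g \<otimes> b"
    have j: "?j \<in> carrier G" using g b by simp
    have shj: "sh g ?j = \<mu> b" unfolding sh_def using g b by (simp add: m_assoc[symmetric])
    let ?r = "ratio g ?j (z ?j)"
    have r: "?r = pmf (\<mu> b) (z ?j) / pmf (\<mu> ?j) (z ?j)" by (simp add: ratio_def shj)
    have rp: "0 < ?r" by (rule ratio_pos[OF g j])
    have fl: "ln (fl b g z) = ln (dens g z) - ln ?r" unfolding fl_def using elim(2) rp by (simp add: ln_div)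
    have "Phi e F (act (inv g) z) (t + ln ?r) = (\<integral>s. F z (s - ln (dens g z)) * exp (- (e * \<bar>s - (t + ln ?r)\<bar>)) \<partial>lborel)"
      unfolding Phi_def using elim(1) by simp
    also have "\<dots> = (\<integral>s. F z (s + t) * exp (- (e * \<bar>s + ln (fl b g z)\<bar>)) \<partial>lborel)"
      by (subst lborel_integral_real_affine[of 1 _ "t + ln (dens g z)"]) (simp_all add: fl algebra_simps)
    finally have "dens g z * Phi e F (act (inv g) z) (t + ln ?r) = (\<integral>s. dens g z * (F z (s + t) * exp (- (e * \<bar>s + ln (fl b g z)\<bar>))) \<partial>lborel)"
      by simp
    then show ?case unfolding r by (simp add: Th_def mult_ac)
  qed
qed

text \<open>For \<open>g\<close> in the averaging set the marginal at \<open>g \<otimes> b\<close>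
  is within \<eta> of \<open>l\<close>, so it may replace \<open>lam l\<close> at the cost
  \<open>lm e (\<eta> / \<delta>)\<close>. With that marginal the integral is, by
  \<open>Phi_change\<close>, one against \<open>tg\<close> and \<open>Th\<close>, and the average
  over \<open>g\<close> is small. A limit \<open>l\<close> common to all \<open>g\<close> is what
  makes the averaged integrals nearly equal.\<close>

lemma maharam_test_zero:
  assumes gv: "good_value e l" and F: "maharam F" and b: "b \<in> carrier G" and B: "finite B" "B \<subseteq> carrier G" "b \<notin> B"
  shows "(\<integral>x. ts b y0 B ys x * Phi e F x (t + ln (pmf (\<mu> b) (x b) / lam l (x b))) \<partial>M) = 0" (is "?T = 0")
proof -
  interpret P: pair_sigma_finite M "lborel :: real measure" ..
  have e: "0 < e" "e \<le> 1" and l: "\<delta> \<le> l" "l \<le> 1 - \<delta>" using gv by (auto simp: good_value_def)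
  have bint: "integrable M (\<lambda>x. ts b y0 B ys x * Phi e F x (u (x b)))" for u
  proof (rule integrable_const_bound[where B = "2 / e"])
    show "(\<lambda>x. ts b y0 B ys x * Phi e F x (u (x b))) \<in> borel_measurable M"
      by (intro borel_measurable_times ts_measurable[OF b B(1,2)] Phi_comp_meas[OF F b])
    show "AE x in M. norm (ts b y0 B ys x * Phi e F x (u (x b))) \<le> 2 / e"
    proof (rule AE_I2)
      fix x assume x: "x \<in> space M"
      have "norm (ts b y0 B ys x * Phi e F x (u (x b))) \<le> 1 * (2 / e)"
        unfolding norm_mult using Phi_bd[OF F x e(1)] ts_le_1 by (intro mult_mono) auto
      then show "norm (ts b y0 B ys x * Phi e F x (u (x b))) \<le> 2 / e" by simp
    qed
  qed
  have bd: "\<bar>?T\<bar> \<le> err + lm e (\<eta> / \<delta>)" if err: "0 < err" and \<eta>: "0 < \<eta>" for err \<eta>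
  proof -
    obtain Ax where Ax: "4 * kap \<delta> e < Ax" "\<not> (\<lambda>g. exp (- Ax * wt g)) summable_on {g \<in> carrier G. \<bar>pmf (\<mu> (g \<otimes> b)) False - l\<bar> < \<eta>}"
      using gv b \<eta> unfolding good_value_def by blast
    obtain H where H: "finite H" "H \<subseteq> carrier G" "H \<noteq> {}" "\<And>g. g \<in> H \<Longrightarrow> \<bar>pmf (\<mu> (g \<otimes> b)) False - l\<bar> < \<eta>"
      "\<And>f. (\<And>g. g \<in> H \<Longrightarrow> \<bar>f g\<bar> \<le> 1) \<Longrightarrow>
        (\<integral>w. \<bar>\<Sum>g\<in>H. f g * tg b y0 B ys g (fst w) * Th e b g w\<bar> \<partial>(M \<Otimes>\<^sub>M lborel)) \<le> err * card H"
      by (rule averaging[OF b B e Ax(1) err Ax(2), where ?y0.0 = y0 and ys = ys]) (rule that; blast)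
    have Hc: "g \<in> H \<Longrightarrow> g \<in> carrier G" for g using H(2) by auto
    have Np: "0 < real (card H)" using H by (simp add: card_gt_0_iff)
    define \<psi> where "\<psi> g = (\<integral>x. ts b y0 B ys x * Phi e F x (t + ln (pmf (\<mu> b) (x b) / pmf (\<mu> (g \<otimes> b)) (x b))) \<partial>M)" for g
    have near: "\<bar>\<psi> g - ?T\<bar> \<le> lm e (\<eta> / \<delta>)" if g: "g \<in> H" for g
    proof -
      let ?u = "\<lambda>y. t + ln (pmf (\<mu> b) y / pmf (\<mu> (g \<otimes> b)) y)" and ?v = "\<lambda>y. t + ln (pmf (\<mu> b) y / lam l y)"
      have j: "g \<otimes> b \<in> carrier G" using Hc[OF g] b by simp
      have uv: "\<bar>?u y - ?v y\<bar> \<le> \<eta> / \<delta>" for y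
      proof -
        let ?p = "pmf (\<mu> (g \<otimes> b)) y"
        have p: "\<delta> \<le> ?p" "\<delta> \<le> lam l y" "\<bar>?p - lam l y\<bar> < \<eta>"
          using marg_ge[OF j, of y] l H(4)[OF g] by (auto simp: lam_def pmf_bool_True)
        have pos: "0 < ?p" "0 < lam l y" "0 < pmf (\<mu> b) y" using p \<delta>_pos marg_pos[OF b] by (auto intro: less_le_trans)
        have lnle: "ln x - ln y \<le> \<bar>x - y\<bar> / \<delta>" if "\<delta> \<le> x" "\<delta> \<le> y" for x y :: real
        proof -
          have xy: "0 < x" "0 < y" using that \<delta>_pos by auto
          have "ln x - ln y = ln (x / y)" using xy by (simp add: ln_div)
          also have "\<dots> \<le> x / y - 1" using xy by (intro ln_le_minus_one) auto
          also have "\<dots> = (x - y) / y" using xy by (simp add: field_simps)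
          also have "\<dots> \<le> \<bar>x - y\<bar> / \<delta>" using xy that \<delta>_pos by (intro frac_le) auto
          finally show ?thesis .
        qed
        have "?u y - ?v y = ln (lam l y) - ln ?p" using pos by (simp add: ln_div)
        moreover have "\<bar>ln (lam l y) - ln ?p\<bar> \<le> \<bar>?p - lam l y\<bar> / \<delta>"
          using lnle[OF p(1,2)] lnle[OF p(2,1)] by (simp add: abs_le_iff abs_minus_commute)
        moreover have "\<bar>?p - lam l y\<bar> / \<delta> \<le> \<eta> / \<delta>" using p \<delta>_pos by (intro divide_right_mono) auto
        ultimately show ?thesis by linarith
      qed
      have eq: "\<psi> g - ?T = (\<integral>x. ts b y0 B ys x * Phi e F x (?u (x b)) - ts b y0 B ys x * Phi e F x (?v (x b)) \<partial>M)"
        unfolding \<psi>_def by (rule Bochner_Integration.integral_diff[OF bint[of ?u] bint[of ?v], symmetric])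
      have "\<bar>\<psi> g - ?T\<bar> \<le> (\<integral>x. \<bar>ts b y0 B ys x * Phi e F x (?u (x b)) - ts b y0 B ys x * Phi e F x (?v (x b))\<bar> \<partial>M)"
        unfolding eq by (rule integral_abs_bound)
      also have "\<dots> \<le> (\<integral>x. lm e (\<eta> / \<delta>) \<partial>M)"
      proof (rule integral_mono)
        show "integrable M (\<lambda>x. \<bar>ts b y0 B ys x * Phi e F x (?u (x b)) - ts b y0 B ys x * Phi e F x (?v (x b))\<bar>)"
          using Bochner_Integration.integrable_diff[OF bint[of ?u] bint[of ?v]] by (rule integrable_abs)
        fix x assume x: "x \<in> space M"
        have "\<bar>ts b y0 B ys x * Phi e F x (?u (x b)) - ts b y0 B ys x * Phi e F x (?v (x b))\<bar> = \<bar>ts b y0 B ys x\<bar> * \<bar>Phi e F x (?u (x b)) - Phi e F x (?v (x b))\<bar>"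
          by (simp add: abs_mult[symmetric] right_diff_distrib del: abs_mult)
        also have "\<dots> \<le> 1 * lm e \<bar>?u (x b) - ?v (x b)\<bar>" by (intro mult_mono ts_le_1 Phi_shift[OF F x e(1)]) auto
        also have "\<dots> \<le> lm e (\<eta> / \<delta>)" using lm_mono[OF e(1) uv[of "x b"]] by simp
        finally show "\<bar>ts b y0 B ys x * Phi e F x (?u (x b)) - ts b y0 B ys x * Phi e F x (?v (x b))\<bar> \<le> lm e (\<eta> / \<delta>)" .
      qed simp
      also have "\<dots> = lm e (\<eta> / \<delta>)" using prob_space by simp
      finally show ?thesis .
    qed
    let ?k = "\<lambda>g z s. F z (s + t) * (tg b y0 B ys g z * Th e b g (z, s))"
    have psi: "\<psi> g = (\<integral>z. (\<integral>s. ?k g z s \<partial>lborel) \<partial>M)" if g: "g \<in> H" for g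
    proof -
      let ?u = "\<lambda>y. t + ln (pmf (\<mu> b) y / pmf (\<mu> (g \<otimes> b)) y)"
      have "\<psi> g = (\<integral>z. dens g z * (ts b y0 B ys (act (inv g) z) * Phi e F (act (inv g) z) (?u (act (inv g) z b))) \<partial>M)"
        unfolding \<psi>_def by (rule integral_change[OF Hc[OF g], symmetric]) (rule borel_measurable_integrable[OF bint[of ?u]])
      also have "\<dots> = (\<integral>z. (\<integral>s. ?k g z s \<partial>lborel) \<partial>M)"
      proof (rule integral_cong_AE)
        have gi: "inv g \<in> carrier G" using Hc[OF g] by simp
        show "(\<lambda>z. dens g z * (ts b y0 B ys (act (inv g) z) * Phi e F (act (inv g) z) (?u (act (inv g) z b)))) \<in> borel_measurable M"
          by (intro borel_measurable_times dens_measurable[OF Hc[OF g]] measurable_compose[OF act_measurable[OF gi] borel_measurable_integrable[OF bint[of ?u]]])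
        have Fm: "(\<lambda>w. F (fst w) (snd w + t)) \<in> borel_measurable (M \<Otimes>\<^sub>M lborel)"
        proof -
          have "(\<lambda>w. (fst w, snd w + t)) \<in> measurable (M \<Otimes>\<^sub>M lborel) (M \<Otimes>\<^sub>M (lborel :: real measure))" by measurable
          from measurable_compose[OF this, of "\<lambda>w. F (fst w) (snd w)" borel] F show ?thesis by (simp add: maharam_def)
        qed
        have "(\<lambda>(z, s). ?k g z s) \<in> borel_measurable (M \<Otimes>\<^sub>M lborel)"
          unfolding case_prod_beta prod.collapse
          by (intro borel_measurable_times[OF Fm] borel_measurable_integrable[OF tgTh_integrable[OF Hc[OF g] b B(1,2) e(1)]])
        from lborel.borel_measurable_lebesgue_integral[OF this] show "(\<lambda>z. \<integral>s. ?k g z s \<partial>lborel) \<in> borel_measurable M" by simp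
        show "AE z in M. dens g z * (ts b y0 B ys (act (inv g) z) * Phi e F (act (inv g) z) (?u (act (inv g) z b))) = (\<integral>s. ?k g z s \<partial>lborel)"
          using Phi_change[OF F Hc[OF g] b e(1), of t] AE_space[of M]
        proof eventually_elim
          case (elim z)
          have zs: "z \<in> carrier G \<rightarrow>\<^sub>E UNIV" using elim(2) by simp
          have zb: "act (inv g) z b = z (g \<otimes> b)" using act_apply[OF zs b, of "inv g"] Hc[OF g] by simp
          have "(\<integral>s. ?k g z s \<partial>lborel) = (\<integral>s. tg b y0 B ys g z * (F z (s + t) * Th e b g (z, s)) \<partial>lborel)" by (simp only: mult_ac)
          also have "\<dots> = tg b y0 B ys g z * (dens g z * Phi e F (act (inv g) z) (?u (z (g \<otimes> b))))" using elim(1) by simp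
          finally show ?case unfolding tg_act[OF Hc[OF g] b B(2) zs] zb by (simp only: mult_ac)
        qed
      qed
      finally show ?thesis .
    qed
    let ?h = "\<lambda>w. \<Sum>g\<in>H. 1 * tg b y0 B ys g (fst w) * Th e b g w"
    have hi: "integrable (M \<Otimes>\<^sub>M lborel) ?h"
      using tgTh_integrable[OF Hc b B(1,2) e(1), where ?y0.0 = y0 and ys = ys] by (intro Bochner_Integration.integrable_sum) simp
    have ha: "integrable (M \<Otimes>\<^sub>M lborel) (\<lambda>w. \<bar>?h w\<bar>)" using hi by (rule integrable_abs)
    have kint: "integrable lborel (?k g z)" if g: "g \<in> H" and z: "z \<in> space M" for g z
    proof -
      have "integrable lborel (\<lambda>s. (tg b y0 B ys g z * dens g z) * (F z (s + t) * exp (- (e * \<bar>s + ln (fl b g z)\<bar>))))"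
        by (rule integrable_mult_right[OF Phi_int[OF F z e(1)]])
      then show ?thesis by (simp only: Th_def fst_conv snd_conv mult_ac)
    qed
    have inner: "\<bar>\<Sum>g\<in>H. \<integral>s. ?k g z s \<partial>lborel\<bar> \<le> (\<integral>s. \<bar>?h (z, s)\<bar> \<partial>lborel)" if z: "z \<in> space M" for z
    proof -
      have hs: "integrable lborel (\<lambda>s. ?h (z, s))" using Th_section(1)[OF Hc b e(1), of _ z] by (intro Bochner_Integration.integrable_sum) auto
      have "(\<Sum>g\<in>H. \<integral>s. ?k g z s \<partial>lborel) = (\<integral>s. (\<Sum>g\<in>H. ?k g z s) \<partial>lborel)"
        by (rule Bochner_Integration.integral_sum[symmetric]) (rule kint[OF _ z])
      also have "\<bar>\<dots>\<bar> \<le> (\<integral>s. \<bar>\<Sum>g\<in>H. ?k g z s\<bar> \<partial>lborel)" by (rule integral_abs_bound)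
      also have "\<dots> \<le> (\<integral>s. \<bar>?h (z, s)\<bar> \<partial>lborel)"
      proof (rule integral_mono')
        show "integrable lborel (\<lambda>s. \<bar>?h (z, s)\<bar>)" using hs by (rule integrable_abs)
        fix s
        have "(\<Sum>g\<in>H. ?k g z s) = F z (s + t) * ?h (z, s)" by (simp add: sum_distrib_left)
        then show "\<bar>\<Sum>g\<in>H. ?k g z s\<bar> \<le> \<bar>?h (z, s)\<bar>" using maharam_bd[OF F, of z "s + t"] by (simp add: abs_mult mult_left_le_one_le)
      qed simp
      finally show ?thesis .
    qed
    have zint: "integrable M (\<lambda>z. \<integral>s. ?k g z s \<partial>lborel)" if g: "g \<in> H" for g
    proof (rule Bochner_Integration.integrable_bound[OF integrable_mult_right[OF integrable_dens(1)[OF Hc[OF g]], of "2 / e"]])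
      have Fm: "(\<lambda>w. F (fst w) (snd w + t)) \<in> borel_measurable (M \<Otimes>\<^sub>M lborel)"
      proof -
        have "(\<lambda>w. (fst w, snd w + t)) \<in> measurable (M \<Otimes>\<^sub>M lborel) (M \<Otimes>\<^sub>M (lborel :: real measure))" by measurable
        from measurable_compose[OF this, of "\<lambda>w. F (fst w) (snd w)" borel] F show ?thesis by (simp add: maharam_def)
      qed
      have "(\<lambda>(z, s). ?k g z s) \<in> borel_measurable (M \<Otimes>\<^sub>M lborel)"
        unfolding case_prod_beta prod.collapse
        by (intro borel_measurable_times[OF Fm] borel_measurable_integrable[OF tgTh_integrable[OF Hc[OF g] b B(1,2) e(1)]])
      from lborel.borel_measurable_lebesgue_integral[OF this] show "(\<lambda>z. \<integral>s. ?k g z s \<partial>lborel) \<in> borel_measurable M" by simp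
      show "AE z in M. norm (\<integral>s. ?k g z s \<partial>lborel) \<le> norm (2 / e * dens g z)"
      proof (rule AE_I2)
        fix z assume z: "z \<in> space M"
        have "norm (\<integral>s. ?k g z s \<partial>lborel) \<le> (\<integral>s. norm (?k g z s) \<partial>lborel)" by (rule integral_norm_bound)
        also have "\<dots> \<le> (\<integral>s. Th e b g (z, s) \<partial>lborel)"
        proof (rule integral_mono')
          show "integrable lborel (\<lambda>s. Th e b g (z, s))" by (rule Th_section(1)[OF Hc[OF g] b e(1)])
          fix s
          have "norm (?k g z s) = (F z (s + t) * \<bar>tg b y0 B ys g z\<bar>) * Th e b g (z, s)"
            using maharam_bd[OF F] Th_nonneg[OF Hc[OF g]] by (simp add: abs_mult)
          also have "\<dots> \<le> 1 * Th e b g (z, s)"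
            using maharam_bd[OF F] tg_le_1 by (intro mult_right_mono mult_le_one Th_nonneg[OF Hc[OF g]]) auto
          finally show "norm (?k g z s) \<le> Th e b g (z, s)" by simp
        qed (rule Th_nonneg[OF Hc[OF g]])
        also have "\<dots> = norm (2 / e * dens g z)" using Th_section(2)[OF Hc[OF g] b e(1), of z] dens_nonneg[OF Hc[OF g]] e by (simp add: abs_mult)
        finally show "norm (\<integral>s. ?k g z s \<partial>lborel) \<le> norm (2 / e * dens g z)" .
      qed
    qed
    have "(\<Sum>g\<in>H. \<psi> g) = (\<Sum>g\<in>H. \<integral>z. (\<integral>s. ?k g z s \<partial>lborel) \<partial>M)" using psi by (rule sum.cong[OF refl])
    also have "\<dots> = (\<integral>z. (\<Sum>g\<in>H. \<integral>s. ?k g z s \<partial>lborel) \<partial>M)" by (rule Bochner_Integration.integral_sum[symmetric]) (rule zint)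
    also have "\<bar>\<dots>\<bar> \<le> (\<integral>z. \<bar>\<Sum>g\<in>H. \<integral>s. ?k g z s \<partial>lborel\<bar> \<partial>M)" by (rule integral_abs_bound)
    also have "\<dots> \<le> (\<integral>z. (\<integral>s. \<bar>?h (z, s)\<bar> \<partial>lborel) \<partial>M)"
    proof (rule integral_mono)
      show "integrable M (\<lambda>z. \<bar>\<Sum>g\<in>H. \<integral>s. ?k g z s \<partial>lborel\<bar>)" by (intro integrable_abs Bochner_Integration.integrable_sum zint)
      show "integrable M (\<lambda>z. \<integral>s. \<bar>?h (z, s)\<bar> \<partial>lborel)" using P.integrable_fst'[OF ha] .
    qed (rule inner)
    also have "\<dots> = (\<integral>w. \<bar>?h w\<bar> \<partial>(M \<Otimes>\<^sub>M lborel))" by (rule P.integral_fst'[OF ha])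
    also have "\<dots> \<le> err * card H" using H(5)[of "\<lambda>_. 1"] by simp
    finally have sum: "\<bar>\<Sum>g\<in>H. \<psi> g\<bar> \<le> err * card H" .
    have "\<bar>card H * ?T\<bar> \<le> \<bar>\<Sum>g\<in>H. \<psi> g\<bar> + \<bar>\<Sum>g\<in>H. (\<psi> g - ?T)\<bar>" by (simp add: sum_subtractf)
    also have "\<bar>\<Sum>g\<in>H. (\<psi> g - ?T)\<bar> \<le> (\<Sum>g\<in>H. lm e (\<eta> / \<delta>))" using near by (intro order_trans[OF sum_abs] sum_mono)
    finally have "card H * \<bar>?T\<bar> \<le> card H * (err + lm e (\<eta> / \<delta>))" using sum by (simp add: abs_mult algebra_simps)
    then show ?thesis using Np by simp
  qed
  have "\<bar>?T\<bar> \<le> 0 + \<epsilon>" if \<epsilon>: "0 < \<epsilon>" for \<epsilon>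
  proof -
    define h where "h = min 1 (\<epsilon> / 8)"
    have h: "0 < h" "h \<le> 1" "h \<le> \<epsilon> / 8" using \<epsilon> by (auto simp: h_def)
    have "\<bar>?T\<bar> \<le> \<epsilon> / 2 + lm e ((h * \<delta>) / \<delta>)" using h \<epsilon> \<delta>_pos by (intro bd) auto
    also have "(h * \<delta>) / \<delta> = h" using \<delta>_pos by simp
    also have "lm e h \<le> 4 * h" using h e by (intro lm_le) auto
    finally show ?thesis using h by linarith
  qed
  then have "\<bar>?T\<bar> \<le> 0" by (rule field_le_epsilon)
  then show ?thesis by simp
qed

section \<open>Flipping one coordinate\<close>

lemma integrable_bounded:
  fixes w :: "('a \<Rightarrow> bool) \<Rightarrow> real"
  assumes "w \<in> borel_measurable M" "\<And>x. x \<in> space M \<Longrightarrow> \<bar>w x\<bar> \<le> C"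
  shows "integrable M w"
  by (rule integrable_const_bound[where B = C, OF AE_I2]) (use assms in \<open>simp_all del: space_bits\<close>)

lemma cyl_upd_other: "b \<in> carrier G \<Longrightarrow> b \<notin> J \<Longrightarrow> x \<in> space M \<Longrightarrow> x(b := y) \<in> cyl (carrier G) J ys \<longleftrightarrow> x \<in> cyl (carrier G) J ys"
proof -
  assume a: "b \<in> carrier G" "b \<notin> J" "x \<in> space M"
  have "x \<in> carrier G \<rightarrow>\<^sub>E UNIV" using a by simp
  moreover have "x(b := y) \<in> carrier G \<rightarrow>\<^sub>E UNIV" by (rule upd_in_bits[OF a(1) calculation])
  moreover have "(\<forall>i\<in>J. (x(b := y)) i = ys i) = (\<forall>i\<in>J. x i = ys i)" using a(2) by (intro ball_cong refl) auto
  ultimately show ?thesis unfolding cyl_def by simp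
qed

lemma cyl_upd_same: "b \<in> carrier G \<Longrightarrow> b \<notin> J \<Longrightarrow> x \<in> space M \<Longrightarrow> x(b := y) \<in> cyl (carrier G) (insert b J) ys \<longleftrightarrow> y = ys b \<and> x \<in> cyl (carrier G) J ys"
proof -
  assume a: "b \<in> carrier G" "b \<notin> J" "x \<in> space M"
  have "x(b := y) \<in> cyl (carrier G) (insert b J) ys \<longleftrightarrow> y = ys b \<and> x(b := y) \<in> cyl (carrier G) J ys"
    unfolding cyl_def by auto
  then show ?thesis using cyl_upd_other[OF a] by simp
qed

text \<open>The average \<open>v\<close> of \<open>w\<close> over coordinate \<open>b\<close> has
  the same integral as \<open>w\<close> on cylinders that do not read \<open>b\<close>; the
  vanishing tests at \<open>b\<close> extend this to all cylinders. So \<open>w = v\<close> almost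
  everywhere, and \<open>v\<close> ignores \<open>b\<close>.\<close>

lemma flip_invariant:
  fixes w :: "('a \<Rightarrow> bool) \<Rightarrow> real"
  assumes wm: "w \<in> borel_measurable M" and w0: "\<And>x. x \<in> space M \<Longrightarrow> 0 \<le> w x" and wC: "\<And>x. x \<in> space M \<Longrightarrow> w x \<le> C"
    and b: "b \<in> carrier G"
    and 0: "\<And>y0 B ys. finite B \<Longrightarrow> B \<subseteq> carrier G \<Longrightarrow> b \<notin> B \<Longrightarrow> (\<integral>x. ts b y0 B ys x * w x \<partial>M) = 0"
  shows "AE x in M. w (x(b := True)) = w (x(b := False))"
proof -
  define v where "v x = pmf (\<mu> b) True * w (x(b := True)) + pmf (\<mu> b) False * w (x(b := False))" for x
  have um: "(\<lambda>x. x(b := y)) \<in> measurable M M" for y by (rule measurable_upd[OF b])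
  have us: "x(b := y) \<in> space M" if "x \<in> space M" for x y using measurable_space[OF um that] .
  have wum: "(\<lambda>x. w (x(b := y))) \<in> borel_measurable M" for y by (rule measurable_compose[OF um wm])
  have vm: "v \<in> borel_measurable M" unfolding v_def[abs_def] by (intro borel_measurable_add borel_measurable_times wum) auto
  have v0: "0 \<le> v x" and vC: "v x \<le> C" if "x \<in> space M" for x
  proof -
    show "0 \<le> v x" unfolding v_def using w0 us that by (intro add_nonneg_nonneg mult_nonneg_nonneg) auto
    have "v x \<le> pmf (\<mu> b) True * C + pmf (\<mu> b) False * C" unfolding v_def using wC us that by (intro add_mono mult_left_mono) auto
    then show "v x \<le> C" by (simp add: pmf_bool_True algebra_simps)
  qed
  have vu: "v (x(b := y)) = v x" for x y by (simp add: v_def)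
  have wi: "integrable M w" by (rule integrable_bounded[OF wm, where C = C]) (use w0 wC in \<open>simp del: space_bits\<close>)
  have vi: "integrable M v" by (rule integrable_bounded[OF vm, where C = C]) (use v0 vC in \<open>simp del: space_bits\<close>)
  have res: "resamples M (\<mu> b) (\<lambda>y z. z(b := y))" by (rule resamples_bits[OF b])
  note RI = resamples_integral[OF res marg_pos[OF b]]
  let ?c = "\<lambda>J ys x. indicator (cyl (carrier G) J ys) x :: real"
  have ci: "integrable M (\<lambda>x. f x * ?c J ys x)" if "integrable M f" "finite J" "J \<subseteq> carrier G" for f J ys
    by (rule integrable_real_mult_indicator[OF sets_cyl[OF that(2,3)] that(1)])
  have c1: "(\<integral>x. w x * ?c J ys x \<partial>M) = (\<integral>x. v x * ?c J ys x \<partial>M)" if J: "finite J" "J \<subseteq> carrier G" "b \<notin> J" for J ys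
  proof -
    have iu: "integrable M (\<lambda>x. w (x(b := y)) * ?c J ys x)" for y
      by (rule ci[OF integrable_bounded[OF wum, where C = C] J(1,2)]) (use w0 wC us in \<open>simp del: space_bits\<close>)
    have "(\<integral>x. w x * ?c J ys x \<partial>M) = pmf (\<mu> b) True * (\<integral>x. w (x(b := True)) * ?c J ys (x(b := True)) \<partial>M) + pmf (\<mu> b) False * (\<integral>x. w (x(b := False)) * ?c J ys (x(b := False)) \<partial>M)"
      by (rule RI[OF ci[OF wi J(1,2)]])
    also have "(\<integral>x. w (x(b := True)) * ?c J ys (x(b := True)) \<partial>M) = (\<integral>x. w (x(b := True)) * ?c J ys x \<partial>M)"
      by (rule Bochner_Integration.integral_cong[OF refl]) (simp only: indicator_def cyl_upd_other[OF b J(3)])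
    also have "(\<integral>x. w (x(b := False)) * ?c J ys (x(b := False)) \<partial>M) = (\<integral>x. w (x(b := False)) * ?c J ys x \<partial>M)"
      by (rule Bochner_Integration.integral_cong[OF refl]) (simp only: indicator_def cyl_upd_other[OF b J(3)])
    also have "pmf (\<mu> b) True * (\<integral>x. w (x(b := True)) * ?c J ys x \<partial>M) + pmf (\<mu> b) False * (\<integral>x. w (x(b := False)) * ?c J ys x \<partial>M)
      = (\<integral>x. pmf (\<mu> b) True * (w (x(b := True)) * ?c J ys x) + pmf (\<mu> b) False * (w (x(b := False)) * ?c J ys x) \<partial>M)"
      using iu by simp
    also have "\<dots> = (\<integral>x. v x * ?c J ys x \<partial>M)"
      by (rule Bochner_Integration.integral_cong[OF refl]) (simp add: v_def algebra_simps)
    finally show ?thesis .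
  qed
  have c2: "(\<integral>x. w x * ?c J ys x \<partial>M) = (\<integral>x. v x * ?c J ys x \<partial>M)" if J: "finite J" "J \<subseteq> carrier G" for J ys
  proof (cases "b \<in> J")
    case False then show ?thesis by (rule c1[OF J])
  next
    case True
    define J' where "J' = J - {b}"
    have J': "finite J'" "J' \<subseteq> carrier G" "b \<notin> J'" "J = insert b J'" using J True by (auto simp: J'_def)
    have ti: "integrable M (\<lambda>x. ts b (ys b) J' ys x * w x)"
    proof (rule integrable_bounded[where C = C])
      show "(\<lambda>x. ts b (ys b) J' ys x * w x) \<in> borel_measurable M" by (intro borel_measurable_times ts_measurable[OF b J'(1,2)] wm)
      fix x assume x: "x \<in> space M"
      have "\<bar>ts b (ys b) J' ys x * w x\<bar> \<le> 1 * C" unfolding abs_mult using ts_le_1 w0[OF x] wC[OF x] by (intro mult_mono) auto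
      then show "\<bar>ts b (ys b) J' ys x * w x\<bar> \<le> C" by simp
    qed
    have "(\<integral>x. w x * ?c J ys x \<partial>M) = (\<integral>x. ts b (ys b) J' ys x * w x + pmf (\<mu> b) (ys b) * (w x * ?c J' ys x) \<partial>M)"
    proof (rule Bochner_Integration.integral_cong[OF refl])
      fix x assume "x \<in> space M"
      then have xs: "x \<in> carrier G \<rightarrow>\<^sub>E UNIV" by simp
      have c: "?c J' ys x = of_bool (\<forall>i\<in>J'. x i = ys i)" "?c J ys x = of_bool (x b = ys b) * of_bool (\<forall>i\<in>J'. x i = ys i)"
        using xs unfolding J'(4) by (auto simp: cyl_def indicator_def)
      show "w x * ?c J ys x = ts b (ys b) J' ys x * w x + pmf (\<mu> b) (ys b) * (w x * ?c J' ys x)"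
        unfolding c ts_def by (simp add: algebra_simps)
    qed
    also have "\<dots> = pmf (\<mu> b) (ys b) * (\<integral>x. w x * ?c J' ys x \<partial>M)"
      using ti ci[OF wi J'(1,2)] 0[OF J'(1-3)] by simp
    also have "\<dots> = pmf (\<mu> b) (ys b) * (\<integral>x. v x * ?c J' ys x \<partial>M)" using c1[OF J'(1-3)] by simp
    also have "\<dots> = (\<integral>x. v x * ?c J ys x \<partial>M)"
    proof -
      have "(\<integral>x. v x * ?c J ys x \<partial>M) = pmf (\<mu> b) True * (\<integral>x. v (x(b := True)) * ?c J ys (x(b := True)) \<partial>M) + pmf (\<mu> b) False * (\<integral>x. v (x(b := False)) * ?c J ys (x(b := False)) \<partial>M)"
        by (rule RI[OF ci[OF vi J]])
      moreover have "(\<integral>x. v (x(b := y)) * ?c J ys (x(b := y)) \<partial>M) = of_bool (y = ys b) * (\<integral>x. v x * ?c J' ys x \<partial>M)" for y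
      proof -
        have "(\<integral>x. v (x(b := y)) * ?c J ys (x(b := y)) \<partial>M) = (\<integral>x. of_bool (y = ys b) * (v x * ?c J' ys x) \<partial>M)"
          by (rule Bochner_Integration.integral_cong[OF refl]) (simp add: vu J'(4) indicator_def cyl_upd_same[OF b J'(3)] del: space_bits)
        then show ?thesis by simp
      qed
      ultimately show ?thesis by (cases "ys b") simp_all
    qed
    finally show ?thesis .
  qed
  have dens: "emeasure (density M (\<lambda>x. ennreal (f x))) (cyl (carrier G) J ys) = ennreal (\<integral>x. f x * ?c J ys x \<partial>M)"
    if f: "integrable M f" "\<And>x. x \<in> space M \<Longrightarrow> 0 \<le> f x" and J: "finite J" "J \<subseteq> carrier G" for f J ys
  proof -
    have "emeasure (density M (\<lambda>x. ennreal (f x))) (cyl (carrier G) J ys) = (\<integral>\<^sup>+x. ennreal (f x) * indicator (cyl (carrier G) J ys) x \<partial>M)"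
      using f(1) by (intro emeasure_density sets_cyl[OF J]) auto
    also have "\<dots> = (\<integral>\<^sup>+x. ennreal (f x * ?c J ys x) \<partial>M)" by (intro nn_integral_cong) (simp add: indicator_def)
    also have "\<dots> = ennreal (\<integral>x. f x * ?c J ys x \<partial>M)"
      by (intro nn_integral_eq_integral ci f(1) J AE_I2 mult_nonneg_nonneg f(2)) auto
    finally show ?thesis .
  qed
  have "density M (\<lambda>x. ennreal (w x)) = density M (\<lambda>x. ennreal (v x))"
  proof (rule cyl_eqI[of _ "carrier G" \<mu>])
    show "finite_measure (density M (\<lambda>x. ennreal (w x)))"
    proof
      have "emeasure (density M (\<lambda>x. ennreal (w x))) (space (density M (\<lambda>x. ennreal (w x)))) = emeasure (density M (\<lambda>x. ennreal (w x))) (cyl (carrier G) {} (\<lambda>_. True))"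
        by (simp add: cyl_def)
      then show "emeasure (density M (\<lambda>x. ennreal (w x))) (space (density M (\<lambda>x. ennreal (w x)))) \<noteq> \<infinity>"
        using dens[OF wi w0, of "{}"] by simp
    qed
    fix J :: "'a set" and y assume J: "finite J" "J \<subseteq> carrier G"
    show "emeasure (density M (\<lambda>x. ennreal (w x))) (cyl (carrier G) J y) = emeasure (density M (\<lambda>x. ennreal (v x))) (cyl (carrier G) J y)"
      using dens[OF wi w0 J] dens[OF vi v0 J] c2[OF J] by simp
  qed simp_all
  then have "AE x in M. ennreal (w x) = ennreal (v x)" using wm vm by (subst (asm) density_unique_iff) auto
  then have ae: "AE x in M. w x = v x" using AE_space[of M] by eventually_elim (use w0 v0 in \<open>simp del: space_bits\<close>)
  show ?thesis
    using resamples_AE[OF res marg_pos[OF b] ae, of True] resamples_AE[OF res marg_pos[OF b] ae, of False]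
    by eventually_elim (simp add: vu)
qed

text \<open>By \<open>maharam_test_zero\<close> and \<open>flip_invariant\<close>,
  \<open>Phi\<close> with its argument shifted by the log ratio of \<open>\<mu> b\<close> and
  \<open>lam l\<close> at \<open>x b\<close> ignores the coordinate \<open>b\<close>;
  \<open>dd l b\<close> is the difference of the two possible shifts.\<close>

lemma flip_one:
  assumes gv: "good_value e l" and F: "maharam F" and b: "b \<in> carrier G"
  shows "AE x in M. \<forall>t. Phi e F (x(b := False)) (t + dd l b) = Phi e F (x(b := True)) t"
proof -
  have e: "0 < e" "e \<le> 1" using gv by (auto simp: good_value_def)
  have fix1: "AE x in M. Phi e F (x(b := False)) (t + dd l b) = Phi e F (x(b := True)) t" for t
  proof -
    \<comment> \<open>Normalised so that the shifted argument for the value \<open>True\<close> is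
      exactly \<open>t\<close>.\<close>
    define t0 where "t0 = t - ln (pmf (\<mu> b) True / lam l True)"
    let ?u = "\<lambda>y. t0 + ln (pmf (\<mu> b) y / lam l y)"
    have "AE x in M. Phi e F (x(b := True)) (?u ((x(b := True)) b)) = Phi e F (x(b := False)) (?u ((x(b := False)) b))"
    proof (rule flip_invariant[where w = "\<lambda>x. Phi e F x (?u (x b))", OF Phi_comp_meas[OF F b] Phi_bd(1)[OF F _ e(1)] Phi_bd(2)[OF F _ e(1)] b])
      fix y0 B ys assume "finite B" "B \<subseteq> carrier G" "b \<notin> B"
      then show "(\<integral>x. ts b y0 B ys x * Phi e F x (?u (x b)) \<partial>M) = 0" by (intro maharam_test_zero[OF gv F b])
    qed
    then show ?thesis by eventually_elim (simp add: t0_def dd_def lam_def algebra_simps)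
  qed
  \<comment> \<open>The exceptional null set depends on \<open>t\<close>; countably many rational
    values share one, and \<open>Phi_shift\<close> passes to all \<open>t\<close> by
    continuity.\<close>
  have "AE x in M. \<forall>q::rat. Phi e F (x(b := False)) (of_rat q + dd l b) = Phi e F (x(b := True)) (of_rat q)"
    using fix1 by (subst AE_all_countable) auto
  then show ?thesis using AE_space[of M]
  proof eventually_elim
    case (elim x)
    have us: "x(b := y) \<in> space M" for y using measurable_space[OF measurable_upd[OF b] elim(2)] .
    show ?case
    proof
      fix t
      let ?a = "Phi e F (x(b := False)) (t + dd l b)" and ?c = "Phi e F (x(b := True)) t"
      have "\<bar>?a - ?c\<bar> \<le> 0 + \<epsilon>" if \<epsilon>: "0 < \<epsilon>" for \<epsilon>
      proof -
        define h where "h = min 1 (\<epsilon> / 8)"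
        have h: "0 < h" "h \<le> 1" "h \<le> \<epsilon> / 8" using \<epsilon> by (auto simp: h_def)
        obtain q where q: "t < of_rat q" "of_rat q < t + h" using of_rat_dense[of t "t + h"] h by auto
        have "\<bar>?a - Phi e F (x(b := False)) (of_rat q + dd l b)\<bar> \<le> lm e \<bar>(t + dd l b) - (of_rat q + dd l b)\<bar>" by (rule Phi_shift[OF F us e(1)])
        also have "\<dots> \<le> lm e h" using q by (intro lm_mono e) auto
        finally have 1: "\<bar>?a - Phi e F (x(b := False)) (of_rat q + dd l b)\<bar> \<le> lm e h" .
        have "\<bar>Phi e F (x(b := True)) (of_rat q) - ?c\<bar> \<le> lm e \<bar>of_rat q - t\<bar>" by (rule Phi_shift[OF F us e(1)])
        also have "\<dots> \<le> lm e h" using q by (intro lm_mono e) auto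
        finally have 2: "\<bar>Phi e F (x(b := True)) (of_rat q) - ?c\<bar> \<le> lm e h" .
        have "lm e h \<le> 4 * h" using h e by (intro lm_le) auto
        moreover have "Phi e F (x(b := False)) (of_rat q + dd l b) = Phi e F (x(b := True)) (of_rat q)" using elim(1) by blast
        ultimately show ?thesis using 1 2 h(3) by linarith
      qed
      then have "\<bar>?a - ?c\<bar> \<le> 0" by (rule field_le_epsilon)
      then show "?a = ?c" by simp
    qed
  qed
qed

section \<open>Merging with an independent copy\<close>

definition mg :: "'a set \<Rightarrow> ('a \<Rightarrow> bool) \<times> ('a \<Rightarrow> bool) \<Rightarrow> 'a \<Rightarrow> bool" where
  "mg S p = (\<lambda>i. if i \<in> S then snd p i else fst p i)"

abbreviation M2 where "M2 \<equiv> M \<Otimes>\<^sub>M M"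

lemma mg_insert: "mg (insert j S) p = (mg S p)(j := snd p j)"
  by (rule ext) (auto simp: mg_def)

lemma space_M2: "p \<in> space M2 \<Longrightarrow> fst p \<in> space M" "p \<in> space M2 \<Longrightarrow> snd p \<in> space M"
  by (auto simp: space_pair_measure simp del: space_bits)

lemma mg_measurable: assumes "finite S" "S \<subseteq> carrier G" shows "mg S \<in> measurable M2 M"
  using assms
proof (induction S rule: finite_induct)
  case empty
  have "mg {} = fst" by (auto simp: mg_def)
  then show ?case by simp
next
  case (insert j S)
  have j: "j \<in> carrier G" and mS: "mg S \<in> measurable M2 M" using insert by auto
  have pj: "{p \<in> space M2. snd p j} \<in> sets M2"
  proof -
    have "(\<lambda>p. snd p j) -` {True} \<inter> space M2 \<in> sets M2"
      by (rule measurable_sets[OF measurable_compose[OF measurable_snd measurable_bits_coord[OF j]]]) simp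
    also have "(\<lambda>p. snd p j) -` {True} \<inter> space M2 = {p \<in> space M2. snd p j}" by auto
    finally show ?thesis .
  qed
  have "(\<lambda>p. if snd p j then (mg S p)(j := True) else (mg S p)(j := False)) \<in> measurable M2 M"
    by (rule measurable_If[OF measurable_compose[OF mS measurable_upd[OF j]] measurable_compose[OF mS measurable_upd[OF j]] pj])
  moreover have "(\<lambda>p. if snd p j then (mg S p)(j := True) else (mg S p)(j := False)) = mg (insert j S)"
    by (rule ext) (simp add: mg_insert)
  ultimately show ?case by simp
qed

lemma resamples_M2:
  assumes j: "j \<in> carrier G"
  shows "resamples M2 (\<mu> j) (\<lambda>y w. ((fst w)(j := y), snd w))" "resamples M2 (\<mu> j) (\<lambda>y w. (fst w, (snd w)(j := y)))"
proof -
  have sf: "sigma_finite_measure M" by (rule sigma_finite_measure_axioms)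
  show "resamples M2 (\<mu> j) (\<lambda>y w. ((fst w)(j := y), snd w))" by (rule resamples_fst[OF resamples_bits[OF j] sf sf])
  show "resamples M2 (\<mu> j) (\<lambda>y w. (fst w, (snd w)(j := y)))" by (rule resamples_snd[OF resamples_bits[OF j] sf sf])
qed

text \<open>Merging in one more coordinate amounts to resampling it, hence a merged point again has
  the law \<open>M\<close>.\<close>

lemma mg_nn:
  assumes "finite S" "S \<subseteq> carrier G" "f \<in> borel_measurable M"
  shows "(\<integral>\<^sup>+p. f (mg S p) \<partial>M2) = (\<integral>\<^sup>+x. f x \<partial>M)"
  using assms
proof (induction S arbitrary: f rule: finite_induct)
  case empty
  have "(\<integral>\<^sup>+p. f (mg {} p) \<partial>M2) = (\<integral>\<^sup>+x. \<integral>\<^sup>+y. f x \<partial>M \<partial>M)"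
    using empty measurable_compose[OF measurable_fst, of f M borel M] by (subst nn_integral_fst[symmetric]) (auto simp: mg_def)
  also have "\<dots> = (\<integral>\<^sup>+x. f x \<partial>M)" using emeasure_space_1 by simp
  finally show ?case .
next
  case (insert j S)
  have j: "j \<in> carrier G" and S: "S \<subseteq> carrier G" using insert by auto
  note f = insert.prems(2)
  have e: "f (mg (insert j S) (fst w, (snd w)(j := y))) = f ((mg S w)(j := y))" for w y
  proof -
    have "mg (insert j S) (fst w, (snd w)(j := y)) = (mg S w)(j := y)" by (rule ext) (use insert.hyps in \<open>auto simp: mg_def\<close>)
    then show ?thesis by simp
  qed
  have fu: "(\<lambda>x. f (x(j := y))) \<in> borel_measurable M" for y by (rule measurable_compose[OF measurable_upd[OF j] f])
  have "(\<integral>\<^sup>+p. f (mg (insert j S) p) \<partial>M2)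
    = ennreal (pmf (\<mu> j) True) * (\<integral>\<^sup>+p. f ((mg S p)(j := True)) \<partial>M2) + ennreal (pmf (\<mu> j) False) * (\<integral>\<^sup>+p. f ((mg S p)(j := False)) \<partial>M2)"
    using resamples_nn[OF resamples_M2(2)[OF j] measurable_compose[OF mg_measurable[of "insert j S"] f]] insert.hyps insert.prems(1) unfolding e by simp
  also have "\<dots> = ennreal (pmf (\<mu> j) True) * (\<integral>\<^sup>+x. f (x(j := True)) \<partial>M) + ennreal (pmf (\<mu> j) False) * (\<integral>\<^sup>+x. f (x(j := False)) \<partial>M)"
    unfolding insert.IH[OF S fu[of True]] insert.IH[OF S fu[of False]] ..
  also have "\<dots> = (\<integral>\<^sup>+x. f x \<partial>M)" by (rule resamples_nn[OF resamples_bits[OF j] f, symmetric])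
  finally show ?case .
qed

lemma mg_distr:
  assumes S: "finite S" "S \<subseteq> carrier G" shows "distr M2 M (mg S) = M"
proof (rule measure_eqI)
  fix A assume "A \<in> sets (distr M2 M (mg S))"
  then have A: "A \<in> sets M" by simp
  have "emeasure (distr M2 M (mg S)) A = (\<integral>\<^sup>+x. indicator A x \<partial>distr M2 M (mg S))" using A by simp
  also have "\<dots> = (\<integral>\<^sup>+p. indicator A (mg S p) \<partial>M2)" by (rule nn_integral_distr[OF mg_measurable[OF S]]) (use A in auto)
  also have "\<dots> = (\<integral>\<^sup>+x. indicator A x \<partial>M)" by (rule mg_nn[OF S]) (use A in auto)
  finally show "emeasure (distr M2 M (mg S)) A = emeasure M A" using A by simp
qed simp

lemma mg_AE:
  assumes S: "finite S" "S \<subseteq> carrier G" and P: "AE x in M. P x" shows "AE p in M2. P (mg S p)"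
  by (rule AE_distrD[OF mg_measurable[OF S]]) (use P mg_distr[OF S] in metis)

lemma mg_integral:
  fixes f :: "('a \<Rightarrow> bool) \<Rightarrow> real"
  assumes S: "finite S" "S \<subseteq> carrier G" and f: "integrable M f"
  shows "integrable M2 (\<lambda>p. f (mg S p))" "(\<integral>p. f (mg S p) \<partial>M2) = (\<integral>x. f x \<partial>M)"
proof -
  have fm: "f \<in> borel_measurable M" using f by auto
  have d: "integrable (distr M2 M (mg S)) f" unfolding mg_distr[OF S] by (rule f)
  show "integrable M2 (\<lambda>p. f (mg S p))" using integrable_distr[OF mg_measurable[OF S] d] .
  show "(\<integral>p. f (mg S p) \<partial>M2) = (\<integral>x. f x \<partial>M)" using integral_distr[OF mg_measurable[OF S] fm] unfolding mg_distr[OF S] by simp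
qed

lemma mg_empty: "mg {} p = fst p" by (simp add: mg_def)

text \<open>\<open>Zs\<close> is the translation of the real variable caused by merging the coordinates in \<open>S\<close>.\<close>
definition xi :: "'a \<Rightarrow> ('a \<Rightarrow> bool) \<times> ('a \<Rightarrow> bool) \<Rightarrow> real" where
  "xi j p = of_bool (\<not> snd p j) - of_bool (\<not> fst p j)"

definition Zs :: "real \<Rightarrow> 'a set \<Rightarrow> ('a \<Rightarrow> bool) \<times> ('a \<Rightarrow> bool) \<Rightarrow> real" where
  "Zs l S p = (\<Sum>j\<in>S. dd l j * xi j p)"

text \<open>The coordinates of \<open>S\<close> are replaced one at a time by
  \<open>flip_one\<close>. A change from \<open>True\<close> to \<open>False\<close> contributes
  \<open>dd l j\<close>, the reverse change \<open>- dd l j\<close>, no change 0; this is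
  \<open>dd l j * xi j p\<close>.\<close>

lemma mg_flow:
  assumes gv: "good_value e l" and F: "maharam F" and S: "finite S" "S \<subseteq> carrier G"
  shows "AE p in M2. \<forall>t. Phi e F (mg S p) (t + Zs l S p) = Phi e F (fst p) t"
  using S
proof (induction S rule: finite_induct)
  case empty then show ?case by (simp add: mg_empty Zs_def)
next
  case (insert j S)
  have j: "j \<in> carrier G" and S: "S \<subseteq> carrier G" using insert by auto
  have "AE p in M2. \<forall>t. Phi e F ((mg S p)(j := False)) (t + dd l j) = Phi e F ((mg S p)(j := True)) t"
    by (rule mg_AE[OF insert.hyps(1) S flip_one[OF gv F j]])
  then show ?case using insert.IH[OF S]
  proof eventually_elim
    case (elim p)
    have mj: "mg S p j = fst p j" using insert.hyps by (simp add: mg_def)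
    have mm: "(mg S p)(j := fst p j) = mg S p" using fun_upd_triv[of "mg S p" j] mj by simp
    have step: "Phi e F ((mg S p)(j := snd p j)) (t + dd l j * xi j p) = Phi e F (mg S p) t" for t
    proof (cases "fst p j"; cases "snd p j")
      assume a: "fst p j" "snd p j"
      then have "(mg S p)(j := snd p j) = mg S p" using mm by simp
      then show ?thesis using a by (simp add: xi_def)
    next
      assume a: "fst p j" "\<not> snd p j"
      then have "(mg S p)(j := True) = mg S p" using mm by simp
      then show ?thesis using a elim(1) by (simp add: xi_def)
    next
      assume a: "\<not> fst p j" "snd p j"
      then have m: "(mg S p)(j := False) = mg S p" using mm by simp
      have "Phi e F ((mg S p)(j := True)) (t - dd l j) = Phi e F ((mg S p)(j := False)) ((t - dd l j) + dd l j)" using elim(1) by metis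
      then show ?thesis using a m by (simp add: xi_def)
    next
      assume a: "\<not> fst p j" "\<not> snd p j"
      then have "(mg S p)(j := snd p j) = mg S p" using mm by simp
      then show ?thesis using a by (simp add: xi_def)
    qed
    show ?case
    proof
      fix t
      have "Phi e F (mg (insert j S) p) (t + Zs l (insert j S) p) = Phi e F ((mg S p)(j := snd p j)) ((t + Zs l S p) + dd l j * xi j p)"
        using insert.hyps by (simp add: mg_insert Zs_def add.commute add.left_commute)
      also have "\<dots> = Phi e F (mg S p) (t + Zs l S p)" by (rule step)
      finally show "Phi e F (mg (insert j S) p) (t + Zs l (insert j S) p) = Phi e F (fst p) t" using elim(2) by simp
    qed
  qed
qed

text \<open>Resampling every coordinate of \<open>S\<close> in both factors leaves \<open>h\<close>
  unchanged and makes \<open>f\<close> constant, so that it comes out of the integral.\<close>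

lemma block_independent:
  assumes S: "finite S" "S \<subseteq> carrier G" and h: "h \<in> borel_measurable M" and f: "f \<in> borel_measurable M2"
    and hd: "\<And>x y j. x \<in> space M \<Longrightarrow> j \<in> S \<Longrightarrow> h (x(j := y)) = (h x :: ennreal)"
    and fd: "\<And>p p'. p \<in> space M2 \<Longrightarrow> p' \<in> space M2 \<Longrightarrow> (\<forall>i\<in>S. fst p i = fst p' i \<and> snd p i = snd p' i) \<Longrightarrow> f p = (f p' :: ennreal)"
  shows "(\<integral>\<^sup>+p. f p * h (fst p) \<partial>M2) = (\<integral>\<^sup>+p. f p \<partial>M2) * (\<integral>\<^sup>+x. h x \<partial>M)"
  using S f hd fd
proof (induction S arbitrary: f rule: finite_induct)
  case empty
  interpret P2: pair_prob_space M M ..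
  have hm: "(\<lambda>p. h (fst p)) \<in> borel_measurable M2" by (rule measurable_compose[OF measurable_fst h])
  obtain p0 where p0: "p0 \<in> space M2" using P2.P.not_empty by blast
  have fc: "f p = f p0" if "p \<in> space M2" for p by (rule empty.prems(4)[OF that p0]) simp
  have "(\<integral>\<^sup>+p. f p * h (fst p) \<partial>M2) = (\<integral>\<^sup>+p. f p0 * h (fst p) \<partial>M2)" by (rule nn_integral_cong) (simp only: fc)
  also have "\<dots> = f p0 * (\<integral>\<^sup>+p. h (fst p) \<partial>M2)" by (rule nn_integral_cmult[OF hm])
  also have "(\<integral>\<^sup>+p. h (fst p) \<partial>M2) = (\<integral>\<^sup>+x. h x \<partial>M)" using mg_nn[of "{}" h] h by (simp add: mg_empty)
  also have "f p0 = (\<integral>\<^sup>+p. f p0 \<partial>M2)" using P2.P.emeasure_space_1 by simp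
  also have "\<dots> = (\<integral>\<^sup>+p. f p \<partial>M2)" by (rule nn_integral_cong) (simp only: fc)
  finally show ?case .
next
  case (insert j S)
  have j: "j \<in> carrier G" and S: "S \<subseteq> carrier G" using insert by auto
  note f = insert.prems(2)
  let ?U = "\<lambda>y w. ((fst w)(j := y), snd w)" and ?V = "\<lambda>y w. (fst w, (snd w)(j := y))"
  note r1 = resamples_M2(1)[OF j] and r2 = resamples_M2(2)[OF j]
  have hm: "(\<lambda>p. h (fst p)) \<in> borel_measurable M2" by (rule measurable_compose[OF measurable_fst h])
  have fU: "(\<lambda>w. f (?U y w)) \<in> borel_measurable M2" if "f \<in> borel_measurable M2" for f y by (rule measurable_compose[OF resamples_meas[OF r1] that])
  have fV: "(\<lambda>w. f (?V y w)) \<in> borel_measurable M2" if "f \<in> borel_measurable M2" for f y by (rule measurable_compose[OF resamples_meas[OF r2] that])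
  have hU: "h (fst (?U y w)) = h (fst w)" if "w \<in> space M2" for y w unfolding fst_conv by (rule insert.prems(3)[OF space_M2(1)[OF that]]) simp
  \<comment> \<open>Conditioning on both values at \<open>j\<close>. With \<open>h\<close> replaced
    by 1 the same formula reassembles the integral of \<open>f\<close> at the end.\<close>
  have two: "(\<integral>\<^sup>+p. f p * h (fst p) \<partial>M2) = (\<Sum>y\<in>UNIV. \<Sum>y'\<in>UNIV. ennreal (pmf (\<mu> j) y) * (ennreal (pmf (\<mu> j) y') * (\<integral>\<^sup>+p. f (?V y' (?U y p)) * h (fst p) \<partial>M2)))"
    if f: "f \<in> borel_measurable M2" and h: "(\<lambda>p. h (fst p)) \<in> borel_measurable M2" and hU: "\<And>w y. w \<in> space M2 \<Longrightarrow> h (fst (?U y w)) = h (fst w)" for f h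
  proof -
    have A: "(\<integral>\<^sup>+p. f p * h (fst p) \<partial>M2) = (\<Sum>y\<in>UNIV. ennreal (pmf (\<mu> j) y) * (\<integral>\<^sup>+p. f (?V y p) * h (fst p) \<partial>M2))"
      if f: "f \<in> borel_measurable M2" for f
      using resamples_nn[OF r2, of "\<lambda>p. f p * h (fst p)"] f h by (simp add: UNIV_bool add.commute)
    have B: "(\<integral>\<^sup>+p. f p * h (fst p) \<partial>M2) = (\<Sum>y\<in>UNIV. ennreal (pmf (\<mu> j) y) * (\<integral>\<^sup>+p. f (?U y p) * h (fst p) \<partial>M2))"
      if f: "f \<in> borel_measurable M2" for f
    proof -
      have "(\<integral>\<^sup>+p. f p * h (fst p) \<partial>M2) = (\<Sum>y\<in>UNIV. ennreal (pmf (\<mu> j) y) * (\<integral>\<^sup>+p. f (?U y p) * h (fst (?U y p)) \<partial>M2))"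
        using resamples_nn[OF r1, of "\<lambda>p. f p * h (fst p)"] f h by (simp add: UNIV_bool add.commute)
      also have "\<dots> = (\<Sum>y\<in>UNIV. ennreal (pmf (\<mu> j) y) * (\<integral>\<^sup>+p. f (?U y p) * h (fst p) \<partial>M2))"
        by (intro sum.cong refl arg_cong2[where f = "(*)"] nn_integral_cong) (simp only: hU)
      finally show ?thesis .
    qed
    have "(\<integral>\<^sup>+p. f p * h (fst p) \<partial>M2) = (\<Sum>y'\<in>UNIV. ennreal (pmf (\<mu> j) y') * (\<Sum>y\<in>UNIV. ennreal (pmf (\<mu> j) y) * (\<integral>\<^sup>+p. f (?V y' (?U y p)) * h (fst p) \<partial>M2)))"
      unfolding A[OF f] by (intro sum.cong refl arg_cong2[where f = "(*)"]) (rule B[OF fV[OF f]])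
    also have "\<dots> = (\<Sum>y\<in>UNIV. \<Sum>y'\<in>UNIV. ennreal (pmf (\<mu> j) y) * (ennreal (pmf (\<mu> j) y') * (\<integral>\<^sup>+p. f (?V y' (?U y p)) * h (fst p) \<partial>M2)))"
      unfolding sum_distrib_left by (subst sum.swap) (intro sum.cong refl, simp only: mult_ac)
    finally show ?thesis .
  qed
  have IH: "(\<integral>\<^sup>+p. f (?V y' (?U y p)) * h (fst p) \<partial>M2) = (\<integral>\<^sup>+p. f (?V y' (?U y p)) \<partial>M2) * (\<integral>\<^sup>+x. h x \<partial>M)" for y y'
  proof (rule insert.IH[OF S fU[OF fV[OF f]]])
    show "h (x(i := z)) = h x" if "x \<in> space M" "i \<in> S" for x z i by (rule insert.prems(3)[OF that(1)]) (simp add: that(2))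
    fix p p' assume p: "p \<in> space M2" "p' \<in> space M2" "\<forall>i\<in>S. fst p i = fst p' i \<and> snd p i = snd p' i"
    have sp: "?V y' (?U y p) \<in> space M2" if "p \<in> space M2" for p
      using measurable_space[OF resamples_meas[OF r2] measurable_space[OF resamples_meas[OF r1] that]] .
    show "f (?V y' (?U y p)) = f (?V y' (?U y p'))"
      by (rule insert.prems(4)[OF sp[OF p(1)] sp[OF p(2)]]) (use p(3) in auto)
  qed
  note two[OF f hm hU]
  also have "(\<Sum>y\<in>UNIV. \<Sum>y'\<in>UNIV. ennreal (pmf (\<mu> j) y) * (ennreal (pmf (\<mu> j) y') * (\<integral>\<^sup>+p. f (?V y' (?U y p)) * h (fst p) \<partial>M2))) = (\<Sum>y\<in>UNIV. \<Sum>y'\<in>UNIV. ennreal (pmf (\<mu> j) y) * (ennreal (pmf (\<mu> j) y') * ((\<integral>\<^sup>+p. f (?V y' (?U y p)) \<partial>M2) * (\<integral>\<^sup>+x. h x \<partial>M))))"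
    by (intro sum.cong refl arg_cong2[where f = "(*)"] IH)
  also have "\<dots> = (\<Sum>y\<in>UNIV. \<Sum>y'\<in>UNIV. ennreal (pmf (\<mu> j) y) * (ennreal (pmf (\<mu> j) y') * (\<integral>\<^sup>+p. f (?V y' (?U y p)) \<partial>M2))) * (\<integral>\<^sup>+x. h x \<partial>M)"
    by (simp only: sum_distrib_right mult.assoc)
  also have "(\<Sum>y\<in>UNIV. \<Sum>y'\<in>UNIV. ennreal (pmf (\<mu> j) y) * (ennreal (pmf (\<mu> j) y') * (\<integral>\<^sup>+p. f (?V y' (?U y p)) \<partial>M2))) = (\<integral>\<^sup>+p. f p \<partial>M2)"
    using two[OF f, of "\<lambda>_. 1"] by simp
  finally show ?case .
qed

section \<open>Approximation by cylinder functions\<close>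

definition depends_on :: "'a set \<Rightarrow> (('a \<Rightarrow> bool) \<Rightarrow> 'z) \<Rightarrow> bool" where
  "depends_on B f \<longleftrightarrow> finite B \<and> B \<subseteq> carrier G \<and> (\<forall>x\<in>space M. \<forall>x'\<in>space M. (\<forall>i\<in>B. x i = x' i) \<longrightarrow> f x = f x')"

lemma depends_on_mono: "depends_on B f \<Longrightarrow> B \<subseteq> C \<Longrightarrow> finite C \<Longrightarrow> C \<subseteq> carrier G \<Longrightarrow> depends_on C f"
  unfolding depends_on_def by blast

lemma depends_on_comp2: "depends_on B f \<Longrightarrow> depends_on B f' \<Longrightarrow> depends_on B (\<lambda>x. h (f x) (f' x))"
  unfolding depends_on_def by metis

text \<open>The sets that can be approximated in measure contain the generators and are closed under
  complements and countable unions: a union is cut off at a finite stage, and the error is shared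
  equally among the sets that remain.\<close>

lemma cylinder_approx_set:
  assumes A: "A \<in> sets M"
  shows "\<forall>\<epsilon>>0. \<exists>B C. C \<in> sets M \<and> depends_on B (\<lambda>x. x \<in> C) \<and> measure M (sym_diff A C) \<le> \<epsilon>"
proof -
  have "A \<in> sigma_sets (\<Pi>\<^sub>E i\<in>carrier G. space (measure_pmf (\<mu> i))) (prod_algebra (carrier G) (\<lambda>i. measure_pmf (\<mu> i)))"
    using A unfolding sets_PiM .
  then show ?thesis
  proof (induction A rule: sigma_sets.induct)
    case (Basic A)
    have "\<exists>J E. A = prod_emb (carrier G) (\<lambda>i. measure_pmf (\<mu> i)) J (\<Pi>\<^sub>E j\<in>J. E j) \<and> finite J \<and> J \<subseteq> carrier G"
      using Basic by (elim prod_algebraE) blast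
    then obtain J E where JE: "A = prod_emb (carrier G) (\<lambda>i. measure_pmf (\<mu> i)) J (\<Pi>\<^sub>E j\<in>J. E j)" "finite J" "J \<subseteq> carrier G" by blast
    have "A \<in> sets M" unfolding sets_PiM using Basic by (rule sigma_sets.Basic)
    moreover have "depends_on J (\<lambda>x. x \<in> A)"
      unfolding depends_on_def
    proof (intro conjI JE ballI impI)
      fix x x' assume x: "x \<in> space M" "x' \<in> space M" "\<forall>i\<in>J. x i = x' i"
      then have "restrict x J = restrict x' J" by (auto simp: restrict_def)
      then show "(x \<in> A) = (x' \<in> A)" using x unfolding JE(1) prod_emb_iff by (simp add: PiE_iff)
    qed
    ultimately show ?case by (metis Diff_cancel Un_empty measure_empty order_less_imp_le)
  next
    case Empty
    have "depends_on {} (\<lambda>x. x \<in> ({} :: ('a \<Rightarrow> bool) set))" by (simp add: depends_on_def)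
    then show ?case by (metis Diff_cancel Un_empty measure_empty order_less_imp_le sets.empty_sets)
  next
    case (Compl A)
    have As: "A \<in> sets M" unfolding sets_PiM using Compl(1) .
    show ?case
    proof (intro allI impI)
      fix \<epsilon> :: real assume "0 < \<epsilon>"
      then obtain B C where C: "C \<in> sets M" "depends_on B (\<lambda>x. x \<in> C)" "measure M (sym_diff A C) \<le> \<epsilon>" using Compl(2) by blast
      have "sym_diff (space M - A) (space M - C) = sym_diff A C"
        using sets.sets_into_space[OF As] sets.sets_into_space[OF C(1)] by blast
      moreover have "depends_on B (\<lambda>x. x \<in> space M - C)" using C(2) unfolding depends_on_def by blast
      moreover have "space M - C \<in> sets M" using C(1) by (rule sets.compl_sets)
      ultimately show "\<exists>B C. C \<in> sets M \<and> depends_on B (\<lambda>x. x \<in> C) \<and> measure M (sym_diff ((\<Pi>\<^sub>E i\<in>carrier G. space (measure_pmf (\<mu> i))) - A) C) \<le> \<epsilon>"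
        using C(3) unfolding space_PiM[symmetric] by metis
    qed
  next
    case (Union A)
    have As: "A i \<in> sets M" for i unfolding sets_PiM using Union(1) .
    show ?case
    proof (intro allI impI)
      fix \<epsilon> :: real assume \<epsilon>: "0 < \<epsilon>"
      let ?U = "\<Union>i. A i"
      have Us: "?U \<in> sets M" using As by blast
      have "(\<lambda>n. measure M (\<Union>i<n. A i)) \<longlonglongrightarrow> measure M (\<Union>n. \<Union>i<n. A i)"
        proof (rule finite_Lim_measure_incseq)
          show "range (\<lambda>n. \<Union>i<n. A i) \<subseteq> sets M" using As by blast
          show "incseq (\<lambda>n. \<Union>i<n. A i)" by (rule incseq_SucI) (intro UN_mono, simp_all add: lessThan_Suc subset_insertI)
        qed
      also have "(\<Union>n. \<Union>i<n. A i) = ?U" by blast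
      finally have lim: "(\<lambda>n. measure M (\<Union>i<n. A i)) \<longlonglongrightarrow> measure M ?U" .
      obtain n where n: "\<bar>measure M (\<Union>i<n. A i) - measure M ?U\<bar> < \<epsilon> / 2"
        using LIMSEQ_D[OF lim, of "\<epsilon> / 2"] \<epsilon> by auto
      have "\<forall>i. \<exists>B C. C \<in> sets M \<and> depends_on B (\<lambda>x. x \<in> C) \<and> measure M (sym_diff (A i) C) \<le> \<epsilon> / (2 * (n + 1))"
        using Union(2) \<epsilon> by (auto intro!: divide_pos_pos)
      then obtain B C where BC: "\<And>i. C i \<in> sets M" "\<And>i. depends_on (B i) (\<lambda>x. x \<in> C i)" "\<And>i. measure M (sym_diff (A i) (C i)) \<le> \<epsilon> / (2 * (n + 1))"
        by metis
      let ?C = "\<Union>i<n. C i" and ?B = "\<Union>i<n. B i"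
      have "depends_on ?B (\<lambda>x. x \<in> ?C)"
        unfolding depends_on_def
      proof (intro conjI ballI impI)
        show "finite ?B" "?B \<subseteq> carrier G" using BC(2) unfolding depends_on_def by blast+
        fix x x' assume x: "x \<in> space M" "x' \<in> space M" "\<forall>i\<in>?B. x i = x' i"
        have "(x \<in> C i) = (x' \<in> C i)" if "i < n" for i
        proof -
          have "\<forall>j\<in>B i. x j = x' j" using x(3) that by blast
          then show ?thesis using BC(2)[of i] x(1,2) unfolding depends_on_def by blast
        qed
        then show "(x \<in> ?C) = (x' \<in> ?C)" by blast
      qed
      moreover have Cs: "?C \<in> sets M" using BC(1) by blast
      moreover have "measure M (sym_diff ?U ?C) \<le> \<epsilon>"
      proof -
        have "sym_diff ?U ?C \<subseteq> (?U - (\<Union>i<n. A i)) \<union> (\<Union>i<n. sym_diff (A i) (C i))" by blast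
        then have "measure M (sym_diff ?U ?C) \<le> measure M ((?U - (\<Union>i<n. A i)) \<union> (\<Union>i<n. sym_diff (A i) (C i)))"
          using As BC(1) Us by (intro finite_measure_mono) auto
        also have "\<dots> \<le> measure M (?U - (\<Union>i<n. A i)) + measure M (\<Union>i<n. sym_diff (A i) (C i))"
          using As BC(1) Us by (intro measure_Un_le) auto
        also have "measure M (?U - (\<Union>i<n. A i)) = measure M ?U - measure M (\<Union>i<n. A i)"
          using As Us by (intro finite_measure_Diff) auto
        also have "\<dots> \<le> \<epsilon> / 2" using n by linarith
        also have "measure M (\<Union>i<n. sym_diff (A i) (C i)) \<le> (\<Sum>i<n. measure M (sym_diff (A i) (C i)))"
          using As BC(1) by (intro measure_UNION_le) auto
        also have "\<dots> \<le> (\<Sum>i<n. \<epsilon> / (2 * (n + 1)))" by (intro sum_mono BC(3))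
        also have "\<dots> \<le> \<epsilon> / 2" using \<epsilon> by (simp add: field_simps)
        finally show ?thesis by simp
      qed
      ultimately show "\<exists>B C. C \<in> sets M \<and> depends_on B (\<lambda>x. x \<in> C) \<and> measure M (sym_diff (\<Union>i. A i) C) \<le> \<epsilon>" by blast
    qed
  qed
qed

lemma cylinder_approx:
  fixes f :: "('a \<Rightarrow> bool) \<Rightarrow> real"
  assumes f: "integrable M f"
  shows "\<forall>\<epsilon>>0. \<exists>B A. depends_on B A \<and> integrable M A \<and> (\<integral>x. \<bar>f x - A x\<bar> \<partial>M) \<le> \<epsilon>"
  using f
proof (induction f rule: integrable_induct)
  case (base A c)
  show ?case
  proof (intro allI impI)
    fix \<epsilon> :: real assume \<epsilon>: "0 < \<epsilon>"
    have "0 < \<epsilon> / (\<bar>c\<bar> + 1)" using \<epsilon> by (intro divide_pos_pos) auto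
    then obtain B C where C: "C \<in> sets M" "depends_on B (\<lambda>x. x \<in> C)" "measure M (sym_diff A C) \<le> \<epsilon> / (\<bar>c\<bar> + 1)"
      using cylinder_approx_set[OF base(1)] by blast
    have d: "depends_on B (\<lambda>x. indicator C x *\<^sub>R c)" 
      using depends_on_comp2[OF C(2) C(2), of "\<lambda>a b. of_bool a *\<^sub>R c"] by (simp only: indicator_def)
    have i: "integrable M (\<lambda>x. indicator C x *\<^sub>R c)" using C(1) by (simp add: less_top[symmetric])
    have s: "sym_diff A C \<in> sets M" using base C by auto
    have "(\<integral>x. \<bar>indicator A x *\<^sub>R c - indicator C x *\<^sub>R c\<bar> \<partial>M) = (\<integral>x. \<bar>c\<bar> * indicator (sym_diff A C) x \<partial>M)"
      by (intro Bochner_Integration.integral_cong refl) (auto simp: indicator_def)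
    also have "\<dots> = \<bar>c\<bar> * measure M (sym_diff A C)" using sets.Int_space_eq2[OF s] by simp
    also have "\<dots> \<le> (\<bar>c\<bar> + 1) * (\<epsilon> / (\<bar>c\<bar> + 1))" using C(3) \<epsilon> by (intro mult_mono) auto
    also have "\<dots> = \<epsilon>" by (simp add: add_nonneg_eq_0_iff)
    finally show "\<exists>B A'. depends_on B A' \<and> integrable M A' \<and> (\<integral>x. \<bar>indicator A x *\<^sub>R c - A' x\<bar> \<partial>M) \<le> \<epsilon>" using d i by blast
  qed
next
  case (add f g)
  show ?case
  proof (intro allI impI)
    fix \<epsilon> :: real assume \<epsilon>: "0 < \<epsilon>"
    then have \<epsilon>2: "0 < \<epsilon> / 2" by simp
    obtain B A where A: "depends_on B A" "integrable M A" "(\<integral>x. \<bar>f x - A x\<bar> \<partial>M) \<le> \<epsilon> / 2" using add.IH(1) \<epsilon>2 by blast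
    obtain B' A' where A': "depends_on B' A'" "integrable M A'" "(\<integral>x. \<bar>g x - A' x\<bar> \<partial>M) \<le> \<epsilon> / 2" using add.IH(2) \<epsilon>2 by blast
    have BB: "finite (B \<union> B')" "B \<union> B' \<subseteq> carrier G" using A(1) A'(1) by (auto simp: depends_on_def)
    have "depends_on (B \<union> B') (\<lambda>x. A x + A' x)"
      by (rule depends_on_comp2[OF depends_on_mono[OF A(1) Un_upper1 BB] depends_on_mono[OF A'(1) Un_upper2 BB]])
    moreover have "(\<integral>x. \<bar>(f x + g x) - (A x + A' x)\<bar> \<partial>M) \<le> \<epsilon>"
    proof -
      have "(\<integral>x. \<bar>(f x + g x) - (A x + A' x)\<bar> \<partial>M) \<le> (\<integral>x. \<bar>f x - A x\<bar> + \<bar>g x - A' x\<bar> \<partial>M)"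
      proof (rule integral_mono)
        show "integrable M (\<lambda>x. \<bar>(f x + g x) - (A x + A' x)\<bar>)"
          by (intro integrable_abs Bochner_Integration.integrable_diff Bochner_Integration.integrable_add add.hyps A(2) A'(2))
        show "integrable M (\<lambda>x. \<bar>f x - A x\<bar> + \<bar>g x - A' x\<bar>)"
          by (intro integrable_abs Bochner_Integration.integrable_diff Bochner_Integration.integrable_add add.hyps A(2) A'(2))
      qed linarith
      also have "\<dots> = (\<integral>x. \<bar>f x - A x\<bar> \<partial>M) + (\<integral>x. \<bar>g x - A' x\<bar> \<partial>M)" using add.hyps A(2) A'(2) by simp
      finally show ?thesis using A(3) A'(3) by simp
    qed
    ultimately show "\<exists>B A. depends_on B A \<and> integrable M A \<and> (\<integral>x. \<bar>f x + g x - A x\<bar> \<partial>M) \<le> \<epsilon>"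
      using Bochner_Integration.integrable_add[OF A(2) A'(2)] by blast
  qed
next
  case (lim f s)
  show ?case
  proof (intro allI impI)
    fix \<epsilon> :: real assume \<epsilon>: "0 < \<epsilon>"
    have fm: "f \<in> borel_measurable M" and sm: "s i \<in> borel_measurable M" for i using lim(1,4) by auto
    have "(\<lambda>i. \<integral>x. \<bar>f x - s i x\<bar> \<partial>M) \<longlonglongrightarrow> (\<integral>x. 0 \<partial>M)"
    proof (rule integral_dominated_convergence[where w = "\<lambda>x. 3 * \<bar>f x\<bar>"])
      show "AE x in M. (\<lambda>i. \<bar>f x - s i x\<bar>) \<longlonglongrightarrow> 0"
      proof (rule AE_I2)
        fix x assume "x \<in> space M"
        from lim(2)[OF this] have "(\<lambda>i. f x - s i x) \<longlonglongrightarrow> f x - f x" by (intro tendsto_intros)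
        then show "(\<lambda>i. \<bar>f x - s i x\<bar>) \<longlonglongrightarrow> 0" using tendsto_rabs_zero by simp
      qed
      show "AE x in M. norm \<bar>f x - s i x\<bar> \<le> 3 * \<bar>f x\<bar>" for i
      proof (rule AE_I2)
        fix x assume "x \<in> space M"
        from lim(3)[OF this, of i] show "norm \<bar>f x - s i x\<bar> \<le> 3 * \<bar>f x\<bar>" by simp
      qed
    qed (use lim(4) fm sm in auto)
    then have "\<forall>\<^sub>F i in sequentially. (\<integral>x. \<bar>f x - s i x\<bar> \<partial>M) < \<epsilon> / 2"
      by (rule order_tendstoD(2)) (use \<epsilon> in simp)
    then obtain i where i: "(\<integral>x. \<bar>f x - s i x\<bar> \<partial>M) < \<epsilon> / 2" by (meson eventually_happens trivial_limit_sequentially)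
    obtain B A where A: "depends_on B A" "integrable M A" "(\<integral>x. \<bar>s i x - A x\<bar> \<partial>M) \<le> \<epsilon> / 2" using lim(5)[of i] \<epsilon> by (meson half_gt_zero)
    have "(\<integral>x. \<bar>f x - A x\<bar> \<partial>M) \<le> (\<integral>x. \<bar>f x - s i x\<bar> + \<bar>s i x - A x\<bar> \<partial>M)"
      using lim(1)[of i] lim(4) A(2) by (intro integral_mono) auto
    also have "\<dots> = (\<integral>x. \<bar>f x - s i x\<bar> \<partial>M) + (\<integral>x. \<bar>s i x - A x\<bar> \<partial>M)" using lim(1)[of i] lim(4) A(2) by simp
    finally show "\<exists>B A. depends_on B A \<and> integrable M A \<and> (\<integral>x. \<bar>f x - A x\<bar> \<partial>M) \<le> \<epsilon>" using A i by (intro exI[of _ B] exI[of _ A]) auto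
  qed
qed

section \<open>Moments of the random translation\<close>

lemma xi_measurable: assumes j: "j \<in> carrier G" shows "xi j \<in> borel_measurable M2"
proof -
  have m: "(\<lambda>x. of_bool (\<not> x j) :: real) \<in> borel_measurable M" by (rule measurable_bits_fun[OF j])
  show ?thesis unfolding xi_def[abs_def]
    by (rule borel_measurable_diff[OF measurable_compose[OF measurable_snd m] measurable_compose[OF measurable_fst m]])
qed

lemma Zs_measurable: "S \<subseteq> carrier G \<Longrightarrow> Zs l S \<in> borel_measurable M2"
  unfolding Zs_def[abs_def] by (intro borel_measurable_sum borel_measurable_times xi_measurable) auto

lemma M2_prob: "prob_space M2"
proof -
  interpret P2: pair_prob_space M M ..
  show ?thesis by (rule P2.P.prob_space_axioms)
qed

lemma Zs_bound: "\<bar>Zs l S p\<bar> \<le> (\<Sum>j\<in>S. \<bar>dd l j\<bar>)"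
proof -
  have "\<bar>Zs l S p\<bar> \<le> (\<Sum>j\<in>S. \<bar>dd l j * xi j p\<bar>)" unfolding Zs_def by (rule sum_abs)
  also have "\<dots> \<le> (\<Sum>j\<in>S. \<bar>dd l j\<bar>)" by (rule sum_mono) (auto simp: abs_mult xi_def)
  finally show ?thesis .
qed

lemma Zs_integrable: assumes S: "S \<subseteq> carrier G" shows "integrable M2 (\<lambda>p. (Zs l S p + c) ^ n)"
proof -
  interpret P2: prob_space M2 by (rule M2_prob)
  show ?thesis
  proof (rule P2.integrable_const_bound[where B = "((\<Sum>j\<in>S. \<bar>dd l j\<bar>) + \<bar>c\<bar>) ^ n", OF AE_I2])
    fix p
    have "\<bar>Zs l S p + c\<bar> \<le> (\<Sum>j\<in>S. \<bar>dd l j\<bar>) + \<bar>c\<bar>" using Zs_bound[of l S p] by linarith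
    then show "norm ((Zs l S p + c) ^ n) \<le> ((\<Sum>j\<in>S. \<bar>dd l j\<bar>) + \<bar>c\<bar>) ^ n" by (simp add: power_abs power_mono)
    show "(\<lambda>p. (Zs l S p + c) ^ n) \<in> borel_measurable M2" using Zs_measurable[OF S] by (intro borel_measurable_power borel_measurable_add) auto
  qed
qed

text \<open>The increment at \<open>j\<close> is \<open>dd l j\<close> or \<open>- dd l j\<close>
  with probability \<open>s\<close> each and 0 otherwise, independently of the sum over
  \<open>S\<close>. It is symmetric because the old and the new value have the same law, so the
  translation has no drift.\<close>

lemma Zs_insert_integral:
  assumes j: "j \<in> carrier G" "j \<notin> S" and S: "finite S" "S \<subseteq> carrier G"
  defines "s \<equiv> pmf (\<mu> j) True * pmf (\<mu> j) False"
  shows "(\<integral>p. (Zs l (insert j S) p) ^ n \<partial>M2) = (1 - 2 * s) * (\<integral>p. (Zs l S p) ^ n \<partial>M2)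
    + s * (\<integral>p. (Zs l S p + dd l j) ^ n + (Zs l S p - dd l j) ^ n \<partial>M2)"
proof -
  let ?U = "\<lambda>y w. ((fst w)(j := y), snd w)" and ?V = "\<lambda>y w. (fst w, (snd w)(j := y))"
  note r1 = resamples_M2(1)[OF j(1)] and r2 = resamples_M2(2)[OF j(1)]
  have I: "integrable M2 (\<lambda>p. (Zs l (insert j S) p) ^ n)" using Zs_integrable[of "insert j S" l 0 n] j S by simp
  have IV: "integrable M2 (\<lambda>p. (Zs l (insert j S) (?V y p)) ^ n)" for y by (rule resamples_integrable[OF r2 marg_pos[OF j(1)] I])
  have Z: "Zs l (insert j S) (?V y (?U y' p)) = Zs l S p + dd l j * (of_bool (\<not> y) - of_bool (\<not> y'))" for y y' p
  proof -
    have "xi i (?V y (?U y' p)) = xi i p" if "i \<in> S" for i using that j(2) by (auto simp: xi_def)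
    then have "Zs l S (?V y (?U y' p)) = Zs l S p" unfolding Zs_def by (intro sum.cong refl) simp
    moreover have "Zs l (insert j S) q = Zs l S q + dd l j * xi j q" for q using j(2) S by (simp add: Zs_def)
    ultimately show ?thesis by (simp add: xi_def)
  qed
  let ?A = "\<lambda>c. \<integral>p. (Zs l S p + c) ^ n \<partial>M2"
  have e: "(\<integral>p. (Zs l (insert j S) (?V y p)) ^ n \<partial>M2) = pmf (\<mu> j) True * ?A (dd l j * (of_bool (\<not> y) - 0)) + pmf (\<mu> j) False * ?A (dd l j * (of_bool (\<not> y) - 1))" for y
    using resamples_integral[OF r1 marg_pos[OF j(1)] IV[of y]] unfolding Z by simp
  have "(\<integral>p. (Zs l (insert j S) p) ^ n \<partial>M2) = pmf (\<mu> j) True * (\<integral>p. (Zs l (insert j S) (?V True p)) ^ n \<partial>M2) + pmf (\<mu> j) False * (\<integral>p. (Zs l (insert j S) (?V False p)) ^ n \<partial>M2)"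
    by (rule resamples_integral[OF r2 marg_pos[OF j(1)] I])
  also have "\<dots> = ((pmf (\<mu> j) True)\<^sup>2 + (pmf (\<mu> j) False)\<^sup>2) * ?A 0 + s * (?A (dd l j) + ?A (- dd l j))"
    unfolding e s_def by (simp add: algebra_simps power2_eq_square)
  also have "(pmf (\<mu> j) True)\<^sup>2 + (pmf (\<mu> j) False)\<^sup>2 = 1 - 2 * s"
    by (simp add: s_def pmf_bool_True power2_eq_square algebra_simps)
  also have "?A (dd l j) + ?A (- dd l j) = (\<integral>p. (Zs l S p + dd l j) ^ n + (Zs l S p - dd l j) ^ n \<partial>M2)"
    using Zs_integrable[OF S(2), of l "dd l j" n] Zs_integrable[OF S(2), of l "- dd l j" n] by simp
  finally show ?thesis by simp
qed

text \<open>The variance of \<open>dd l j * xi j\<close>.\<close>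

definition vs :: "real \<Rightarrow> 'a \<Rightarrow> real" where "vs l j = 2 * (pmf (\<mu> j) True * pmf (\<mu> j) False) * (dd l j)\<^sup>2"

text \<open>By symmetry only even powers of an increment survive, so both moments obey a recursion
  in \<open>S\<close>. The fourth moment is at most three times the squared variance, as for a
  Gaussian, plus the fourth moments of the single increments.\<close>

lemma Zs_moments:
  assumes S: "finite S" "S \<subseteq> carrier G"
  shows "(\<integral>p. (Zs l S p)\<^sup>2 \<partial>M2) = (\<Sum>j\<in>S. vs l j)"
    and "(\<integral>p. (Zs l S p) ^ 4 \<partial>M2) \<le> 3 * (\<Sum>j\<in>S. vs l j)\<^sup>2 + (\<Sum>j\<in>S. vs l j * (dd l j)\<^sup>2)"
proof -
  interpret P2: prob_space M2 by (rule M2_prob)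
  have "(\<integral>p. (Zs l S p)\<^sup>2 \<partial>M2) = (\<Sum>j\<in>S. vs l j) \<and> (\<integral>p. (Zs l S p) ^ 4 \<partial>M2) \<le> 3 * (\<Sum>j\<in>S. vs l j)\<^sup>2 + (\<Sum>j\<in>S. vs l j * (dd l j)\<^sup>2)"
    using S
  proof (induction S rule: finite_induct)
    case empty then show ?case by (simp add: Zs_def)
  next
    case (insert j S)
    have j: "j \<in> carrier G" and S: "S \<subseteq> carrier G" using insert by auto
    note IH = insert.IH[OF S]
    define s d where "s = pmf (\<mu> j) True * pmf (\<mu> j) False" and "d = dd l j"
    have s: "0 \<le> s" by (simp add: s_def)
    have vj: "vs l j = 2 * s * d\<^sup>2" by (simp add: vs_def s_def d_def)
    have i2: "integrable M2 (\<lambda>p. (Zs l S p)\<^sup>2)" and i4: "integrable M2 (\<lambda>p. (Zs l S p) ^ 4)"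
      using Zs_integrable[OF S, of l 0 2] Zs_integrable[OF S, of l 0 4] by simp_all
    note E = Zs_insert_integral[OF j insert.hyps(2,1) S, of l, folded s_def d_def]
    define m2 m4 v where "m2 = (\<integral>p. (Zs l S p)\<^sup>2 \<partial>M2)" and "m4 = (\<integral>p. (Zs l S p) ^ 4 \<partial>M2)" and "v = (\<Sum>j\<in>S. vs l j)"
    have IHs: "m2 = v" "m4 \<le> 3 * v\<^sup>2 + (\<Sum>j\<in>S. vs l j * (dd l j)\<^sup>2)" using IH by (simp_all add: m2_def m4_def v_def)
    have "(\<integral>p. (Zs l S p + d)\<^sup>2 + (Zs l S p - d)\<^sup>2 \<partial>M2) = (\<integral>p. 2 * (Zs l S p)\<^sup>2 + 2 * d\<^sup>2 \<partial>M2)"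
      by (intro Bochner_Integration.integral_cong refl) (simp add: power2_eq_square algebra_simps)
    also have "\<dots> = 2 * m2 + 2 * d\<^sup>2" using i2 by (simp add: m2_def P2.prob_space)
    finally have 2: "(\<integral>p. (Zs l (insert j S) p)\<^sup>2 \<partial>M2) = v + vs l j"
      unfolding E[of 2] m2_def[symmetric] vj IHs(1)[symmetric] by (simp add: algebra_simps)
    have "(\<integral>p. (Zs l S p + d) ^ 4 + (Zs l S p - d) ^ 4 \<partial>M2) = (\<integral>p. 2 * (Zs l S p) ^ 4 + 12 * d\<^sup>2 * (Zs l S p)\<^sup>2 + 2 * d ^ 4 \<partial>M2)"
      by (intro Bochner_Integration.integral_cong refl) (simp add: power2_eq_square power4_eq_xxxx algebra_simps)
    also have "\<dots> = 2 * m4 + 12 * d\<^sup>2 * m2 + 2 * d ^ 4" using i2 i4 by (simp add: m2_def m4_def P2.prob_space)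
    finally have "(\<integral>p. (Zs l (insert j S) p) ^ 4 \<partial>M2) = m4 + 12 * s * d\<^sup>2 * v + 2 * s * d ^ 4"
      unfolding E[of 4] m4_def[symmetric] IHs(1)[symmetric] by (simp add: algebra_simps)
    \<comment> \<open>The added square of the new variance completes
      \<open>3 * (v + vs l j)\<^sup>2\<close>.\<close>
    also have "\<dots> \<le> 3 * v\<^sup>2 + (\<Sum>j\<in>S. vs l j * (dd l j)\<^sup>2) + 12 * s * d\<^sup>2 * v + 2 * s * d ^ 4 + 3 * (2 * s * d\<^sup>2)\<^sup>2"
      using IHs(2) zero_le_power2[of "2 * s * d\<^sup>2"] by linarith
    also have "\<dots> = 3 * (v + vs l j)\<^sup>2 + ((\<Sum>j\<in>S. vs l j * (dd l j)\<^sup>2) + vs l j * d\<^sup>2)"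
      unfolding vj by (simp add: power2_eq_square power4_eq_xxxx algebra_simps)
    finally show ?case using 2 insert.hyps by (simp add: v_def d_def add.commute)
  qed
  then show "(\<integral>p. (Zs l S p)\<^sup>2 \<partial>M2) = (\<Sum>j\<in>S. vs l j)" "(\<integral>p. (Zs l S p) ^ 4 \<partial>M2) \<le> 3 * (\<Sum>j\<in>S. vs l j)\<^sup>2 + (\<Sum>j\<in>S. vs l j * (dd l j)\<^sup>2)" by auto
qed

text \<open>The quadratic \<open>(u - v / 2) * (2 * K * v - u)\<close> in \<open>u = Z\<^sup>2\<close> is positive only between its roots,
  so its expectation bounds from below the probability that \<open>u\<close> lies there.\<close>
lemma block_prob:
  assumes S: "finite S" "S \<subseteq> carrier G" and r: "0 < r"
    and d: "\<And>j. j \<in> S \<Longrightarrow> \<bar>dd l j\<bar> \<le> 3 * r" and lo: "r\<^sup>2 \<le> (\<Sum>j\<in>S. (dd l j)\<^sup>2)" and hi: "(\<Sum>j\<in>S. (dd l j)\<^sup>2) \<le> 20 * r\<^sup>2"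
  defines "\<sigma> \<equiv> 2 * \<delta>\<^sup>2"
  defines "K \<equiv> 3 + 9 / \<sigma>"
  shows "1 / (2 * K\<^sup>2) \<le> measure M2 {p \<in> space M2. \<sigma> / 2 * r\<^sup>2 \<le> (Zs l S p)\<^sup>2 \<and> (Zs l S p)\<^sup>2 \<le> 80 * K * r\<^sup>2}"
proof -
  interpret P2: prob_space M2 by (rule M2_prob)
  have \<sigma>: "0 < \<sigma>" using \<delta>_pos by (simp add: \<sigma>_def)
  have K: "3 \<le> K" using \<sigma> by (simp add: K_def)
  \<comment> \<open>\<open>K\<close> will bound the quotient of the fourth moment by
    \<open>v\<^sup>2\<close>, and \<open>\<sigma>\<close> compares the variance with the squares of
    \<open>dd\<close>. Neither depends on \<open>r\<close>, so the resulting probability is the same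
    at all scales.\<close>
  define v where "v = (\<Sum>j\<in>S. vs l j)"
  have vl: "\<sigma> * (dd l j)\<^sup>2 \<le> vs l j" and vh: "vs l j \<le> 2 * (dd l j)\<^sup>2" if "j \<in> S" for j
  proof -
    have j: "j \<in> carrier G" using that S by auto
    have "\<delta> * \<delta> \<le> pmf (\<mu> j) True * pmf (\<mu> j) False" using marg_ge[OF j] \<delta>_pos by (intro mult_mono) auto
    then show "\<sigma> * (dd l j)\<^sup>2 \<le> vs l j" unfolding vs_def \<sigma>_def by (intro mult_right_mono) (auto simp: power2_eq_square)
    have "pmf (\<mu> j) True * pmf (\<mu> j) False \<le> 1" by (intro mult_le_one) (auto simp: pmf_le_1)
    then show "vs l j \<le> 2 * (dd l j)\<^sup>2" unfolding vs_def by (intro mult_right_mono) auto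
  qed
  have "\<sigma> * r\<^sup>2 \<le> \<sigma> * (\<Sum>j\<in>S. (dd l j)\<^sup>2)" using lo \<sigma> by (intro mult_left_mono) auto
  also have "\<dots> \<le> v" unfolding v_def sum_distrib_left by (intro sum_mono vl)
  finally have v_lo: "\<sigma> * r\<^sup>2 \<le> v" .
  have "v \<le> 2 * (\<Sum>j\<in>S. (dd l j)\<^sup>2)" unfolding v_def sum_distrib_left by (intro sum_mono vh)
  then have v_hi: "v \<le> 40 * r\<^sup>2" using hi by linarith
  have v: "0 < v" using v_lo \<sigma> r by (meson less_le_trans mult_pos_pos zero_less_power)
  have "(\<Sum>j\<in>S. vs l j * (dd l j)\<^sup>2) \<le> (\<Sum>j\<in>S. vs l j * (9 * r\<^sup>2))"
  proof (intro sum_mono mult_left_mono)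
    fix j assume j: "j \<in> S"
    have "(dd l j)\<^sup>2 \<le> (3 * r)\<^sup>2" using d[OF j] r by (intro abs_le_square_iff[THEN iffD1]) auto
    then show "(dd l j)\<^sup>2 \<le> 9 * r\<^sup>2" by (simp add: power_mult_distrib)
    show "0 \<le> vs l j" by (simp add: vs_def)
  qed
  also have "\<dots> = v * (9 * r\<^sup>2)" by (simp add: v_def sum_distrib_right)
  also have "\<dots> \<le> v * (9 / \<sigma> * v)" using v_lo v \<sigma> by (intro mult_left_mono) (auto simp: field_simps)
  finally have "(\<integral>p. (Zs l S p) ^ 4 \<partial>M2) \<le> 3 * v\<^sup>2 + v * (9 / \<sigma> * v)" using Zs_moments(2)[OF S, of l] unfolding v_def[symmetric] by linarith
  also have "\<dots> = K * v\<^sup>2" by (simp add: K_def power2_eq_square algebra_simps)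
  finally have m4: "(\<integral>p. (Zs l S p) ^ 4 \<partial>M2) \<le> K * v\<^sup>2" .
  have i2: "integrable M2 (\<lambda>p. (Zs l S p)\<^sup>2)" and i4: "integrable M2 (\<lambda>p. (Zs l S p) ^ 4)"
    using Zs_integrable[OF S(2), of l 0 2] Zs_integrable[OF S(2), of l 0 4] by simp_all
  let ?O = "{p \<in> space M2. v / 2 \<le> (Zs l S p)\<^sup>2 \<and> (Zs l S p)\<^sup>2 \<le> 2 * K * v}"
  have Zm [measurable]: "Zs l S \<in> borel_measurable M2" by (rule Zs_measurable[OF S(2)])
  have Om: "?O \<in> sets M2" by measurable
  have "v\<^sup>2 / 2 \<le> (1 / 2 + 2 * K) * v * v - K * v\<^sup>2 - K * v\<^sup>2" by (simp add: power2_eq_square algebra_simps)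
  also have "\<dots> \<le> (1 / 2 + 2 * K) * v * (\<integral>p. (Zs l S p)\<^sup>2 \<partial>M2) - (\<integral>p. (Zs l S p) ^ 4 \<partial>M2) - K * v\<^sup>2"
    using m4 Zs_moments(1)[OF S, of l] unfolding v_def[symmetric] by simp
  also have "\<dots> = (\<integral>p. (1 / 2 + 2 * K) * v * (Zs l S p)\<^sup>2 - (Zs l S p) ^ 4 - K * v\<^sup>2 \<partial>M2)"
    using i2 i4 by (simp add: P2.prob_space)
  also have "\<dots> \<le> (\<integral>p. (K * v)\<^sup>2 * indicator ?O p \<partial>M2)"
  proof (rule integral_mono)
    show "integrable M2 (\<lambda>p. (1 / 2 + 2 * K) * v * (Zs l S p)\<^sup>2 - (Zs l S p) ^ 4 - K * v\<^sup>2)" using i2 i4 by simp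
    show "integrable M2 (\<lambda>p. (K * v)\<^sup>2 * indicator ?O p)" by (intro integrable_mult_right integrable_real_indicator[OF Om]) (simp add: P2.emeasure_eq_measure)
    fix p assume p: "p \<in> space M2"
    define u where "u = (Zs l S p)\<^sup>2"
    have e: "(1 / 2 + 2 * K) * v * (Zs l S p)\<^sup>2 - (Zs l S p) ^ 4 - K * v\<^sup>2 = (u - v / 2) * (2 * K * v - u)"
      by (simp add: u_def power2_eq_square power4_eq_xxxx algebra_simps)
    show "(1 / 2 + 2 * K) * v * (Zs l S p)\<^sup>2 - (Zs l S p) ^ 4 - K * v\<^sup>2 \<le> (K * v)\<^sup>2 * indicator ?O p"
    proof (cases "p \<in> ?O")
      case True
      \<comment> \<open>Completing the square at \<open>u = K * v\<close> bounds the quadratic by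
        \<open>(K * v)\<^sup>2\<close> between its roots.\<close>
      have "0 \<le> (u - K * v)\<^sup>2" by simp
      moreover have "0 \<le> (v / 2) * (2 * K * v - u)" using True v by (simp add: u_def)
      moreover have "(u - v / 2) * (2 * K * v - u) = (K * v)\<^sup>2 - (u - K * v)\<^sup>2 - (v / 2) * (2 * K * v - u)"
        by (simp add: power2_eq_square algebra_simps)
      ultimately have "(u - v / 2) * (2 * K * v - u) \<le> (K * v)\<^sup>2" by linarith
      then show ?thesis unfolding e using True by simp
    next
      case False
      then have "u < v / 2 \<or> 2 * K * v < u" using p by (auto simp: u_def)
      moreover have "v / 2 \<le> 2 * K * v" using K v by simp
      ultimately have "(u - v / 2) * (2 * K * v - u) \<le> 0"
        by (elim disjE) (auto intro: mult_nonpos_nonneg mult_nonneg_nonpos)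
      then show ?thesis unfolding e using False by simp
    qed
  qed
  also have "\<dots> = (K * v)\<^sup>2 * measure M2 ?O" using sets.Int_space_eq2[OF Om] by simp
  finally have "v\<^sup>2 / 2 \<le> (K * v)\<^sup>2 * measure M2 ?O" .
  then have "v\<^sup>2 * (1 / 2) \<le> v\<^sup>2 * (K\<^sup>2 * measure M2 ?O)" by (simp add: power_mult_distrib mult_ac)
  then have "1 / 2 \<le> K\<^sup>2 * measure M2 ?O" using v by (simp add: mult_le_cancel_left_pos)
  then have "1 / (2 * K\<^sup>2) \<le> measure M2 ?O" using K by (simp add: field_simps)
  also have "\<dots> \<le> measure M2 {p \<in> space M2. \<sigma> / 2 * r\<^sup>2 \<le> (Zs l S p)\<^sup>2 \<and> (Zs l S p)\<^sup>2 \<le> 80 * K * r\<^sup>2}"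
  proof (rule P2.finite_measure_mono)
    have "2 * K * v \<le> 2 * K * (40 * r\<^sup>2)" using v_hi K by (intro mult_left_mono) auto
    then show "?O \<subseteq> {p \<in> space M2. \<sigma> / 2 * r\<^sup>2 \<le> (Zs l S p)\<^sup>2 \<and> (Zs l S p)\<^sup>2 \<le> 80 * K * r\<^sup>2}"
      using v_lo by auto
  qed measurable
  finally show ?thesis .
qed

text \<open>Both functions are close to cylinder functions. A block away from their coordinates does
  not change these, yet by \<open>mg_flow\<close> it moves the argument of \<open>Phi\<close> by
  nearly \<open>q\<close> with probability at least \<open>c\<close>. The difference of the cylinder
  functions is independent of this event, so that its mean is already determined there.\<close>

lemma block_shift:
  assumes gv: "good_value e l" and F: "maharam F" and \<eta>: "0 \<le> \<eta>" and c: "0 < c"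
    and blk: "\<And>B. finite B \<Longrightarrow> B \<subseteq> carrier G \<Longrightarrow> \<exists>S. finite S \<and> S \<subseteq> carrier G \<and> S \<inter> B = {} \<and> c \<le> measure M2 {p \<in> space M2. \<bar>Zs l S p - q\<bar> \<le> \<eta>}"
  shows "(\<integral>x. \<bar>Phi e F x (t + q) - Phi e F x t\<bar> \<partial>M) \<le> lm e \<eta>"
proof (rule field_le_epsilon)
  fix \<epsilon> :: real assume \<epsilon>: "0 < \<epsilon>"
  interpret P2: prob_space M2 by (rule M2_prob)
  have e: "0 < e" using gv by (simp add: good_value_def)
  \<comment> \<open>Four approximation errors occur, of which two are divided by the probability
    bound \<open>c\<close>; together they make \<open>\<epsilon>\<close>.\<close>
  define \<epsilon>1 where "\<epsilon>1 = \<epsilon> / (2 * (1 + 1 / c))"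
  have c1: "0 < 1 + 1 / c" using c by (intro add_pos_pos divide_pos_pos) auto
  have \<epsilon>1: "0 < \<epsilon>1" "2 * \<epsilon>1 * (1 + 1 / c) = \<epsilon>"
  proof -
    have "2 * (\<epsilon> / (2 * k)) * k = \<epsilon>" if "0 < k" for k :: real using that by simp
    from this[OF c1] show "2 * \<epsilon>1 * (1 + 1 / c) = \<epsilon>" unfolding \<epsilon>1_def .
    show "0 < \<epsilon>1" unfolding \<epsilon>1_def using \<epsilon> c1 by (intro divide_pos_pos mult_pos_pos) auto
  qed
  have pi: "integrable M (\<lambda>x. Phi e F x u)" for u
    by (rule integrable_bounded[OF Phi_meas[OF F], where C = "2 / e"]) (use Phi_bd[OF F _ e] in \<open>simp del: space_bits\<close>)
  obtain B A where A: "depends_on B A" "integrable M A" "(\<integral>x. \<bar>Phi e F x t - A x\<bar> \<partial>M) \<le> \<epsilon>1" using cylinder_approx[OF pi] \<epsilon>1(1) by blast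
  obtain B' A' where A': "depends_on B' A'" "integrable M A'" "(\<integral>x. \<bar>Phi e F x (t + q) - A' x\<bar> \<partial>M) \<le> \<epsilon>1" using cylinder_approx[OF pi] \<epsilon>1(1) by blast
  have BB: "finite (B \<union> B')" "B \<union> B' \<subseteq> carrier G" using A(1) A'(1) by (auto simp: depends_on_def)
  obtain S where S: "finite S" "S \<subseteq> carrier G" "S \<inter> (B \<union> B') = {}" and cS: "c \<le> measure M2 {p \<in> space M2. \<bar>Zs l S p - q\<bar> \<le> \<eta>}"
    using blk[OF BB] by blast
  define O' where "O' = {p \<in> space M2. \<bar>Zs l S p - q\<bar> \<le> \<eta>}"
  have Zm [measurable]: "Zs l S \<in> borel_measurable M2" by (rule Zs_measurable[OF S(2)])
  have Om: "O' \<in> sets M2" unfolding O'_def by measurable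
  define P where "P = measure M2 O'"
  have P: "c \<le> P" using cS by (simp add: P_def O'_def)
  have dA: "A x = A x'" if "x \<in> space M" "x' \<in> space M" "\<forall>i\<in>B \<union> B'. x i = x' i" for x x' using A(1) that unfolding depends_on_def by blast
  have dA': "A' x = A' x'" if "x \<in> space M" "x' \<in> space M" "\<forall>i\<in>B \<union> B'. x i = x' i" for x x' using A'(1) that unfolding depends_on_def by blast
  have fi: "integrable M2 (\<lambda>p. f (fst p))" "(\<integral>p. f (fst p) \<partial>M2) = (\<integral>x. f x \<partial>M)" if "integrable M f" for f :: "_ \<Rightarrow> real"
    using mg_integral[of "{}" f] that by (simp_all add: mg_empty)
  define D where "D x = \<bar>A' x - A x\<bar>" for x
  have Di: "integrable M D" unfolding D_def[abs_def] by (intro integrable_abs Bochner_Integration.integrable_diff A(2) A'(2))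
  have D0: "0 \<le> D x" for x by (simp add: D_def)
  have Dm: "D \<in> borel_measurable M" using Di by auto
  have OD: "integrable M2 (\<lambda>p. indicator O' p * D (fst p))"
    using integrable_real_mult_indicator[OF Om fi(1)[OF Di]] by (simp add: mult.commute)
  \<comment> \<open>\<open>D\<close> reads only coordinates outside \<open>S\<close>, the event
    \<open>O'\<close> only coordinates in \<open>S\<close>.\<close>
  have ind: "(\<integral>p. indicator O' p * D (fst p) \<partial>M2) = P * (\<integral>x. D x \<partial>M)"
  proof -
    have "(\<integral>\<^sup>+p. indicator O' p * ennreal (D (fst p)) \<partial>M2) = (\<integral>\<^sup>+p. indicator O' p \<partial>M2) * (\<integral>\<^sup>+x. ennreal (D x) \<partial>M)"
    proof (rule block_independent[OF S(1,2)])
      show "(\<lambda>x. ennreal (D x)) \<in> borel_measurable M" using Dm by simp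
      show "indicator O' \<in> borel_measurable M2" using Om by simp
      fix x y j assume x: "x \<in> space M" and j: "j \<in> S"
      have jG: "j \<in> carrier G" using j S by auto
      have us: "x(j := y) \<in> space M" using measurable_space[OF measurable_upd[OF jG] x] .
      have "\<forall>i\<in>B \<union> B'. (x(j := y)) i = x i" using j S(3) by auto
      then show "ennreal (D (x(j := y))) = ennreal (D x)" unfolding D_def using dA[OF us x] dA'[OF us x] by simp
    next
      fix p p' assume p: "p \<in> space M2" "p' \<in> space M2" "\<forall>i\<in>S. fst p i = fst p' i \<and> snd p i = snd p' i"
      have "Zs l S p = Zs l S p'" unfolding Zs_def xi_def using p(3) by (intro sum.cong refl) simp
      then have "p \<in> O' \<longleftrightarrow> p' \<in> O'" using p(1,2) by (simp add: O'_def)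
      then show "(indicator O' p :: ennreal) = indicator O' p'" by (simp add: indicator_def)
    qed
    also have "(\<integral>\<^sup>+p. indicator O' p \<partial>M2) = ennreal P" using Om by (simp add: P_def P2.emeasure_eq_measure)
    also have "(\<integral>\<^sup>+x. ennreal (D x) \<partial>M) = ennreal (\<integral>x. D x \<partial>M)" by (rule nn_integral_eq_integral[OF Di]) (simp add: D0)
    also have "ennreal P * ennreal (\<integral>x. D x \<partial>M) = ennreal (P * (\<integral>x. D x \<partial>M))" by (rule ennreal_mult[symmetric]) (auto simp: P_def D0 integral_nonneg_AE)
    also have "(\<integral>\<^sup>+p. indicator O' p * ennreal (D (fst p)) \<partial>M2) = (\<integral>\<^sup>+p. ennreal (indicator O' p * D (fst p)) \<partial>M2)"
      by (intro nn_integral_cong) (simp add: indicator_def)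
    also have "\<dots> = ennreal (\<integral>p. indicator O' p * D (fst p) \<partial>M2)" by (rule nn_integral_eq_integral[OF OD]) (simp add: D0)
    finally show ?thesis by (subst (asm) ennreal_inj) (auto simp: P_def D0 integral_nonneg_AE intro!: mult_nonneg_nonneg)
  qed
  let ?a = "\<lambda>x. \<bar>Phi e F x t - A x\<bar>" and ?a' = "\<lambda>x. \<bar>Phi e F x (t + q) - A' x\<bar>"
  have ai: "integrable M ?a" by (intro integrable_abs Bochner_Integration.integrable_diff pi A(2))
  have a'i: "integrable M ?a'" by (intro integrable_abs Bochner_Integration.integrable_diff pi A'(2))
  have "P * (\<integral>x. D x \<partial>M) \<le> (\<integral>p. ?a' (mg S p) + lm e \<eta> * indicator O' p + ?a (fst p) \<partial>M2)"
    unfolding ind[symmetric]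
  proof (rule integral_mono_AE[OF OD])
    have io: "integrable M2 (\<lambda>p. lm e \<eta> * indicator O' p)" by (intro integrable_mult_right integrable_real_indicator[OF Om]) (simp add: P2.emeasure_eq_measure)
    show "integrable M2 (\<lambda>p. ?a' (mg S p) + lm e \<eta> * indicator O' p + ?a (fst p))"
      by (intro Bochner_Integration.integrable_add io fi(1)[OF ai] mg_integral(1)[OF S(1,2) a'i])
    show "AE p in M2. indicator O' p * D (fst p) \<le> ?a' (mg S p) + lm e \<eta> * indicator O' p + ?a (fst p)"
      using mg_flow[OF gv F S(1,2)] AE_space[of M2]
    proof eventually_elim
      case (elim p)
      have fs: "fst p \<in> space M" and ms: "mg S p \<in> space M" using space_M2(1)[OF elim(2)] measurable_space[OF mg_measurable[OF S(1,2)] elim(2)] .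
      show ?case
      proof (cases "p \<in> O'")
        case True
        then have q: "\<bar>Zs l S p - q\<bar> \<le> \<eta>" by (simp add: O'_def)
        \<comment> \<open>Merging leaves the coordinates read by \<open>A'\<close> untouched, so
          \<open>A'\<close> may be evaluated at the merged point and compared with
          \<open>Phi\<close> there.\<close>
        have "\<forall>i\<in>B \<union> B'. fst p i = mg S p i" using S(3) by (auto simp: mg_def)
        then have "A' (fst p) = A' (mg S p)" by (rule dA'[OF fs ms])
        moreover have "\<bar>Phi e F (mg S p) (t + q) - Phi e F (mg S p) (t + Zs l S p)\<bar> \<le> lm e \<eta>"
        proof (rule order_trans[OF Phi_shift[OF F ms e] lm_mono[OF e]])
          show "\<bar>t + q - (t + Zs l S p)\<bar> \<le> \<eta>" using q by linarith
        qed
        moreover have "Phi e F (mg S p) (t + Zs l S p) = Phi e F (fst p) t" using elim(1) by blast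
        ultimately show ?thesis using True unfolding D_def by simp
      next
        case False then show ?thesis by simp
      qed
    qed
  qed
  also have "\<dots> = (\<integral>x. ?a' x \<partial>M) + lm e \<eta> * P + (\<integral>x. ?a x \<partial>M)"
  proof -
    have io: "integrable M2 (\<lambda>p. lm e \<eta> * indicator O' p)" by (intro integrable_mult_right integrable_real_indicator[OF Om]) (simp add: P2.emeasure_eq_measure)
    have iv: "(\<integral>p. lm e \<eta> * indicator O' p \<partial>M2) = lm e \<eta> * P" using sets.Int_space_eq2[OF Om] by (simp add: P_def)
    show ?thesis
      unfolding Bochner_Integration.integral_add[OF Bochner_Integration.integrable_add[OF mg_integral(1)[OF S(1,2) a'i] io] fi(1)[OF ai]]
        Bochner_Integration.integral_add[OF mg_integral(1)[OF S(1,2) a'i] io] mg_integral(2)[OF S(1,2) a'i] fi(2)[OF ai] iv ..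
  qed
  also have "\<dots> \<le> \<epsilon>1 + lm e \<eta> * P + \<epsilon>1" using A(3) A'(3) by simp
  finally have "P * (\<integral>x. D x \<partial>M) \<le> P * lm e \<eta> + 2 * \<epsilon>1" by (simp add: algebra_simps)
  also have "2 * \<epsilon>1 \<le> P * (2 * \<epsilon>1 / c)"
  proof -
    have "c * (2 * \<epsilon>1 / c) \<le> P * (2 * \<epsilon>1 / c)" using P c \<epsilon>1(1) by (intro mult_right_mono) auto
    then show ?thesis using c by simp
  qed
  finally have "P * (\<integral>x. D x \<partial>M) \<le> P * (lm e \<eta> + 2 * \<epsilon>1 / c)" by (simp add: distrib_left)
  then have DD: "(\<integral>x. D x \<partial>M) \<le> lm e \<eta> + 2 * \<epsilon>1 / c" using P c by (simp add: mult_le_cancel_left_pos)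
  have "(\<integral>x. \<bar>Phi e F x (t + q) - Phi e F x t\<bar> \<partial>M) \<le> (\<integral>x. ?a' x + D x + ?a x \<partial>M)"
    by (intro integral_mono integrable_abs Bochner_Integration.integrable_diff Bochner_Integration.integrable_add pi ai a'i Di) (simp add: D_def)
  also have "\<dots> = (\<integral>x. ?a' x \<partial>M) + (\<integral>x. D x \<partial>M) + (\<integral>x. ?a x \<partial>M)"
    unfolding Bochner_Integration.integral_add[OF Bochner_Integration.integrable_add[OF a'i Di] ai] Bochner_Integration.integral_add[OF a'i Di] ..
  also have "\<dots> \<le> lm e \<eta> + (2 * \<epsilon>1 + 2 * \<epsilon>1 / c)" using A(3) A'(3) DD by linarith
  also have "2 * \<epsilon>1 + 2 * \<epsilon>1 / c = \<epsilon>" unfolding \<epsilon>1(2)[symmetric] by (simp add: distrib_left)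
  finally show "(\<integral>x. \<bar>Phi e F x (t + q) - Phi e F x t\<bar> \<partial>M) \<le> lm e \<eta> + \<epsilon>" .
qed

end

section \<open>Translations at every scale\<close>

text \<open>Elements are discarded as long as the remaining sum stays at least \<open>R\<close>;
  when this stops, a single term separates the sum from a value below \<open>R\<close>.\<close>

lemma sum_subset_between:
  fixes w :: "'b \<Rightarrow> real"
  assumes "finite F" "\<And>x. x \<in> F \<Longrightarrow> 0 \<le> w x \<and> w x \<le> R" "R \<le> sum w F" and R: "0 \<le> R"
  shows "\<exists>S\<subseteq>F. R \<le> sum w S \<and> sum w S \<le> 2 * R"
  using assms(1-3)
proof (induction F rule: finite_induct)
  case empty then show ?case using R by auto
next
  case (insert x F)
  show ?case
  proof (cases "R \<le> sum w F")
    case True then show ?thesis using insert.IH insert.prems by (meson insertI2 subset_insertI2)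
  next
    case False
    then have "sum w (insert x F) \<le> 2 * R" using insert.hyps insert.prems(1)[of x] by simp
    then show ?thesis using insert.prems(2) by blast
  qed
qed

lemma finite_large_summable:
  fixes f :: "'b \<Rightarrow> real"
  assumes f: "f summable_on A" "\<And>x. x \<in> A \<Longrightarrow> 0 \<le> f x" and c: "0 < c"
  shows "finite {x \<in> A. c \<le> f x}"
proof (rule ccontr)
  assume "infinite {x \<in> A. c \<le> f x}"
  moreover define n where "n = nat \<lceil>infsum f A / c\<rceil> + 1"
  ultimately obtain F where F: "finite F" "card F = n" "F \<subseteq> {x \<in> A. c \<le> f x}" using infinite_arbitrarily_large by blast
  have "real n * c = (\<Sum>x\<in>F. c)" using F by simp
  also have "\<dots> \<le> sum f F" using F by (intro sum_mono) auto
  also have "\<dots> \<le> infsum f A" by (rule finite_sum_le_infsum[OF f(1) F(1)]) (use F f(2) in auto)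
  finally have "real n \<le> infsum f A / c" using c by (simp add: pos_le_divide_eq)
  then show False unfolding n_def by linarith
qed

lemma ln_diff_abs:
  assumes "0 < d" "d \<le> x" "d \<le> (y :: real)" shows "\<bar>ln x - ln y\<bar> \<le> \<bar>x - y\<bar> / d"
proof -
  have le: "ln u - ln w \<le> \<bar>u - w\<bar> / d" if "d \<le> u" "d \<le> w" for u w
  proof -
    have "ln u - ln w \<le> (u - w) / w" using that assms(1) by (intro ln_diff_le) auto
    also have "\<dots> \<le> \<bar>u - w\<bar> / w" using that assms(1) by (intro divide_right_mono) auto
    also have "\<dots> \<le> \<bar>u - w\<bar> / d" using that assms(1) by (intro divide_left_mono) auto
    finally show ?thesis .
  qed
  show ?thesis using le[of x y] le[of y x] assms by (simp add: abs_minus_commute abs_le_iff)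
qed

context bernoulli
begin

lemma dd_alt: "b \<in> carrier G \<Longrightarrow> 0 < l \<Longrightarrow> l < 1 \<Longrightarrow> dd l b = (ln (pmf (\<mu> b) False) - ln l) - (ln (1 - pmf (\<mu> b) False) - ln (1 - l))"
  using marg_pos[of b True] marg_pos[of b False] by (simp add: dd_def ln_div pmf_bool_True)

lemma dd_diff:
  assumes g: "g \<in> carrier G" and h: "h \<in> carrier G" and l: "0 < l" "l < 1"
  shows "\<bar>dd l g - dd l h\<bar> \<le> 2 / \<delta> * \<bar>pmf (\<mu> g) False - pmf (\<mu> h) False\<bar>"
proof -
  have 1: "\<bar>ln (pmf (\<mu> g) False) - ln (pmf (\<mu> h) False)\<bar> \<le> \<bar>pmf (\<mu> g) False - pmf (\<mu> h) False\<bar> / \<delta>"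
    by (rule ln_diff_abs[OF \<delta>_pos marg_ge[OF g] marg_ge[OF h]])
  have 2: "\<bar>ln (1 - pmf (\<mu> g) False) - ln (1 - pmf (\<mu> h) False)\<bar> \<le> \<bar>(1 - pmf (\<mu> g) False) - (1 - pmf (\<mu> h) False)\<bar> / \<delta>"
    using marg_le[OF g, of False] marg_le[OF h, of False] by (intro ln_diff_abs[OF \<delta>_pos]) auto
  have a: "\<bar>(1 - pmf (\<mu> g) False) - (1 - pmf (\<mu> h) False)\<bar> = \<bar>pmf (\<mu> g) False - pmf (\<mu> h) False\<bar>" by simp
  have "2 / \<delta> * \<bar>pmf (\<mu> g) False - pmf (\<mu> h) False\<bar> = \<bar>pmf (\<mu> g) False - pmf (\<mu> h) False\<bar> / \<delta> + \<bar>pmf (\<mu> g) False - pmf (\<mu> h) False\<bar> / \<delta>" by simp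
  then show ?thesis using 1 2[unfolded a] unfolding dd_alt[OF g l] dd_alt[OF h l] by linarith
qed

lemma dd_le:
  assumes g: "g \<in> carrier G" and l: "\<delta> \<le> l" "l \<le> 1 - \<delta>"
  shows "\<bar>dd l g\<bar> \<le> 2 / \<delta> * \<bar>pmf (\<mu> g) False - l\<bar>"
proof -
  have l': "0 < l" "l < 1" using l \<delta>_pos by auto
  have 1: "\<bar>ln (pmf (\<mu> g) False) - ln l\<bar> \<le> \<bar>pmf (\<mu> g) False - l\<bar> / \<delta>"
    by (rule ln_diff_abs[OF \<delta>_pos marg_ge[OF g] l(1)])
  have 2: "\<bar>ln (1 - pmf (\<mu> g) False) - ln (1 - l)\<bar> \<le> \<bar>(1 - pmf (\<mu> g) False) - (1 - l)\<bar> / \<delta>"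
    using marg_le[OF g, of False] l by (intro ln_diff_abs[OF \<delta>_pos]) auto
  have a: "\<bar>(1 - pmf (\<mu> g) False) - (1 - l)\<bar> = \<bar>pmf (\<mu> g) False - l\<bar>" by simp
  have "2 / \<delta> * \<bar>pmf (\<mu> g) False - l\<bar> = \<bar>pmf (\<mu> g) False - l\<bar> / \<delta> + \<bar>pmf (\<mu> g) False - l\<bar> / \<delta>" by simp
  then show ?thesis using 1 2[unfolded a] unfolding dd_alt[OF g l'] by linarith
qed

text \<open>The logarithm has slope at least 1 on (0, 1), and the two logarithms in
  \<open>dd\<close> move in opposite directions, so their difference does not cancel.\<close>

lemma dd_ge:
  assumes g: "g \<in> carrier G" and l: "0 < l" "l < 1"
  shows "\<bar>pmf (\<mu> g) False - l\<bar> \<le> \<bar>dd l g\<bar>"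
proof -
  let ?f = "pmf (\<mu> g) False"
  have f: "0 < ?f" "?f < 1" using marg_pos[OF g, of False] marg_le[OF g, of False] \<delta>_pos by auto
  have ln1: "u - w \<le> ln u - ln w" if "0 < w" "w \<le> u" "u < 1" for u w :: real
  proof -
    have "ln w - ln u \<le> (w - u) / u" using that by (intro ln_diff_le) auto
    moreover have "u - w \<le> (u - w) / u" using mult_left_mono[of 1 "1 / u" "u - w"] that by simp
    moreover have "(w - u) / u = - ((u - w) / u)" using that by (simp add: field_simps)
    ultimately show ?thesis by linarith
  qed
  show ?thesis
  proof (cases "l \<le> ?f")
    case True
    have "?f - l \<le> ln ?f - ln l" by (rule ln1) (use True l f in auto)
    moreover have "(1 - l) - (1 - ?f) \<le> ln (1 - l) - ln (1 - ?f)" by (rule ln1) (use True l f in auto)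
    ultimately show ?thesis using True unfolding dd_alt[OF g l] by linarith
  next
    case False
    have "l - ?f \<le> ln l - ln ?f" by (rule ln1) (use False l f in auto)
    moreover have "(1 - ?f) - (1 - l) \<le> ln (1 - ?f) - ln (1 - l)" by (rule ln1) (use False l f in auto)
    ultimately show ?thesis using False unfolding dd_alt[OF g l] by linarith
  qed
qed

text \<open>At \<open>b = \<one>\<close> the divergence in \<open>good_value\<close> concerns the
  marginals themselves, and a sum over a finite set cannot diverge.\<close>

lemma good_value_limit_point:
  assumes gv: "good_value e l" and \<eta>: "0 < \<eta>"
  shows "infinite {g \<in> carrier G. \<bar>pmf (\<mu> g) False - l\<bar> < \<eta>}"
proof
  assume "finite {g \<in> carrier G. \<bar>pmf (\<mu> g) False - l\<bar> < \<eta>}"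
  moreover have "{g \<in> carrier G. \<bar>pmf (\<mu> (g \<otimes> \<one>)) False - l\<bar> < \<eta>} = {g \<in> carrier G. \<bar>pmf (\<mu> g) False - l\<bar> < \<eta>}" by auto
  ultimately have "f summable_on {g \<in> carrier G. \<bar>pmf (\<mu> (g \<otimes> \<one>)) False - l\<bar> < \<eta>}" for f :: "'a \<Rightarrow> real" by simp
  moreover have "\<exists>A>4 * kap \<delta> e. \<forall>\<eta>>0. \<not> (\<lambda>g. exp (- A * wt g)) summable_on {g \<in> carrier G. \<bar>pmf (\<mu> (g \<otimes> \<one>)) False - l\<bar> < \<eta>}"
    using gv one_closed unfolding good_value_def by blast
  ultimately show False using \<eta> by blast
qed

text \<open>If the log odds \<open>dd\<close> avoid the annulus \<open>[r, 3 r]\<close> outside a finite set, then \<open>{\<bar>dd\<bar> > 3 r}\<close> is almost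
  invariant, because \<open>dd\<close> changes little under translation far away; so it is finite.\<close>
lemma exists_block:
  assumes ends: "\<not> more_than_one_end G" and gv: "good_value e l"
    and ns: "\<not> (\<lambda>g. (pmf (\<mu> g) False - l)\<^sup>2) summable_on carrier G"
    and r: "0 < r" and B: "finite B" "B \<subseteq> carrier G"
  shows "\<exists>S. finite S \<and> S \<subseteq> carrier G \<and> S \<inter> B = {} \<and> (\<forall>j\<in>S. \<bar>dd l j\<bar> \<le> 3 * r) \<and> r\<^sup>2 \<le> (\<Sum>j\<in>S. (dd l j)\<^sup>2) \<and> (\<Sum>j\<in>S. (dd l j)\<^sup>2) \<le> 20 * r\<^sup>2"
proof -
  have l: "\<delta> \<le> l" "l \<le> 1 - \<delta>" using gv by (auto simp: good_value_def)
  have l': "0 < l" "l < 1" using l \<delta>_pos by auto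
  define T where "T = {b \<in> carrier G. r \<le> \<bar>dd l b\<bar> \<and> \<bar>dd l b\<bar> \<le> 3 * r}"
  show ?thesis
  proof (cases "finite T")
    \<comment> \<open>With infinitely many coordinates in the annulus, a single one outside
      \<open>B\<close> is already a block.\<close>
    case False
    then have "infinite (T - B)" using B(1) by (rule Diff_infinite_finite[rotated])
    then obtain b where b: "b \<in> T" "b \<notin> B" by (metis Diff_iff ex_in_conv finite.emptyI)
    have "\<bar>r\<bar> \<le> \<bar>dd l b\<bar>" "\<bar>dd l b\<bar> \<le> \<bar>3 * r\<bar>" using b(1) r by (auto simp: T_def)
    then have "r\<^sup>2 \<le> (dd l b)\<^sup>2" "(dd l b)\<^sup>2 \<le> (3 * r)\<^sup>2" by (simp_all only: abs_le_square_iff)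
    then show ?thesis using b r by (intro exI[of _ "{b}"]) (auto simp: T_def power_mult_distrib)
  next
    case T: True
    define W where "W = {b \<in> carrier G. 3 * r < \<bar>dd l b\<bar>}"
    have "almost_invariant G W"
      unfolding almost_invariant_def
    proof (intro conjI ballI)
      show "W \<subseteq> carrier G" by (auto simp: W_def)
      fix g assume g: "g \<in> carrier G"
      have fin: "finite {h \<in> carrier G. (r * \<delta>)\<^sup>2 \<le> (coc g h)\<^sup>2}"
        by (rule finite_large_summable[OF square_summable[OF g]]) (use r \<delta>_pos in auto)
      \<comment> \<open>If \<open>h\<close> and \<open>inv g \<otimes> h\<close> lie on different
        sides of the annulus, their log odds differ by more than \<open>2 * r\<close>, hence
        \<open>\<bar>coc g h\<bar>\<close> exceeds \<open>r * \<delta>\<close>; square summability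
        allows this only finitely often.\<close>
      have key: "h \<in> T \<union> (\<lambda>w. g \<otimes> w) ` T \<union> {h \<in> carrier G. (r * \<delta>)\<^sup>2 \<le> (coc g h)\<^sup>2}"
        if h: "h \<in> carrier G" and ne: "(h \<in> W) \<noteq> (inv g \<otimes> h \<in> W)" for h
      proof (rule ccontr)
        assume n: "h \<notin> T \<union> (\<lambda>w. g \<otimes> w) ` T \<union> {h \<in> carrier G. (r * \<delta>)\<^sup>2 \<le> (coc g h)\<^sup>2}"
        have gh: "inv g \<otimes> h \<in> carrier G" using g h by simp
        have eq: "g \<otimes> (inv g \<otimes> h) = h" using g h by (simp add: m_assoc[symmetric])
        have nT: "h \<notin> T" using n by blast
        have nT': "inv g \<otimes> h \<notin> T"
        proof
          assume "inv g \<otimes> h \<in> T"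
          then have "g \<otimes> (inv g \<otimes> h) \<in> (\<lambda>w. g \<otimes> w) ` T" by (rule imageI)
          then show False using n unfolding eq by blast
        qed
        have "2 * r < \<bar>dd l h - dd l (inv g \<otimes> h)\<bar>"
          using ne nT nT' h gh r unfolding W_def T_def by auto
        also have "\<dots> \<le> 2 / \<delta> * \<bar>coc g h\<bar>" using dd_diff[OF h gh l'] by (simp add: bernoulli_cocycle_def)
        finally have "r * \<delta> < \<bar>coc g h\<bar>" using \<delta>_pos by (simp add: field_simps)
        then have "(r * \<delta>)\<^sup>2 \<le> (coc g h)\<^sup>2" using r \<delta>_pos by (intro abs_le_square_iff[THEN iffD1]) auto
        then show False using n h by blast
      qed
      have "sym_diff (g <# W) W \<subseteq> T \<union> (\<lambda>w. g \<otimes> w) ` T \<union> {h \<in> carrier G. (r * \<delta>)\<^sup>2 \<le> (coc g h)\<^sup>2}"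
      proof
        fix h assume h: "h \<in> sym_diff (g <# W) W"
        have hg: "h \<in> carrier G" using h g by (auto simp: l_coset_def W_def)
        have "h \<in> g <# W \<longleftrightarrow> inv g \<otimes> h \<in> W"
        proof
          assume "h \<in> g <# W"
          then obtain w where "w \<in> W" "h = g \<otimes> w" by (auto simp: l_coset_def)
          then show "inv g \<otimes> h \<in> W" using g by (simp add: W_def m_assoc[symmetric])
        next
          assume w: "inv g \<otimes> h \<in> W"
          have "h = g \<otimes> (inv g \<otimes> h)" using g hg by (simp add: m_assoc[symmetric])
          then show "h \<in> g <# W" using w unfolding l_coset_def by blast
        qed
        then show "h \<in> T \<union> (\<lambda>w. g \<otimes> w) ` T \<union> {h \<in> carrier G. (r * \<delta>)\<^sup>2 \<le> (coc g h)\<^sup>2}" using h by (intro key[OF hg]) blast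
      qed
      then show "finite (sym_diff (g <# W) W)" by (rule finite_subset) (use T fin in blast)
    qed
    \<comment> \<open>\<open>l\<close> is a limit point of the marginals, so infinitely many log
      odds are small. It is therefore \<open>W\<close>, not its complement, that is finite.\<close>
    moreover have "infinite (carrier G - W)"
    proof
      assume "finite (carrier G - W)"
      moreover have "{g \<in> carrier G. \<bar>pmf (\<mu> g) False - l\<bar> < r * \<delta>} \<subseteq> carrier G - W"
      proof
        fix g assume "g \<in> {g \<in> carrier G. \<bar>pmf (\<mu> g) False - l\<bar> < r * \<delta>}"
        then have g: "g \<in> carrier G" "\<bar>pmf (\<mu> g) False - l\<bar> < r * \<delta>" by auto
        have "\<bar>dd l g\<bar> \<le> 2 / \<delta> * \<bar>pmf (\<mu> g) False - l\<bar>" by (rule dd_le[OF g(1) l])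
        also have "\<dots> \<le> 2 / \<delta> * (r * \<delta>)" using g(2) \<delta>_pos by (intro mult_left_mono) auto
        also have "\<dots> = 2 * r" using \<delta>_pos by simp
        finally show "g \<in> carrier G - W" using g(1) r by (simp add: W_def)
      qed
      ultimately show False using good_value_limit_point[OF gv, of "r * \<delta>"] r \<delta>_pos by (meson finite_subset mult_pos_pos)
    qed
    ultimately have W: "finite W" using ends unfolding more_than_one_end_def by blast
    \<comment> \<open>All remaining log odds are below \<open>r\<close> in absolute value, but their
      squares are not summable, so a finite block can be trimmed to a sum of squares between
      \<open>r\<^sup>2\<close> and \<open>2 * r\<^sup>2\<close>.\<close>
    define A where "A = carrier G - (B \<union> T \<union> W)"
    have Ad: "\<bar>dd l b\<bar> < r" if "b \<in> A" for b using that r unfolding A_def T_def W_def by auto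
    have nsA: "\<not> (\<lambda>b. (dd l b)\<^sup>2) summable_on A"
    proof
      assume s: "(\<lambda>b. (dd l b)\<^sup>2) summable_on A"
      have "(\<lambda>b. (dd l b)\<^sup>2) summable_on (A \<union> (B \<union> T \<union> W))"
        by (rule summable_on_Un_disjoint[OF s summable_on_finite]) (use B T W in \<open>auto simp: A_def\<close>)
      moreover have "A \<union> (B \<union> T \<union> W) = carrier G" using B by (auto simp: A_def T_def W_def)
      ultimately have "(\<lambda>b. (dd l b)\<^sup>2) summable_on carrier G" by simp
      then have "(\<lambda>g. (pmf (\<mu> g) False - l)\<^sup>2) summable_on carrier G"
      proof (rule summable_on_comparison_test)
        fix g assume "g \<in> carrier G"
        from dd_ge[OF this l'] show "(pmf (\<mu> g) False - l)\<^sup>2 \<le> (dd l g)\<^sup>2" by (rule abs_le_square_iff[THEN iffD1])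
      qed simp
      then show False using ns by contradiction
    qed
    have "\<exists>F. finite F \<and> F \<subseteq> A \<and> r\<^sup>2 \<le> (\<Sum>b\<in>F. (dd l b)\<^sup>2)"
    proof (rule ccontr)
      assume "\<not> ?thesis"
      then have "bdd_above (sum (\<lambda>b. (dd l b)\<^sup>2) ` {F. F \<subseteq> A \<and> finite F})" by (intro bdd_aboveI2[of _ _ "r\<^sup>2"]) (auto intro: less_imp_le simp: not_le)
      then have "(\<lambda>b. (dd l b)\<^sup>2) summable_on A" by (intro nonneg_bdd_above_summable_on) auto
      then show False using nsA by contradiction
    qed
    then obtain F where F: "finite F" "F \<subseteq> A" "r\<^sup>2 \<le> (\<Sum>b\<in>F. (dd l b)\<^sup>2)" by blast
    have "\<exists>S\<subseteq>F. r\<^sup>2 \<le> (\<Sum>b\<in>S. (dd l b)\<^sup>2) \<and> (\<Sum>b\<in>S. (dd l b)\<^sup>2) \<le> 2 * r\<^sup>2"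
    proof (rule sum_subset_between[OF F(1) _ F(3)])
      fix x assume "x \<in> F"
      then have "\<bar>dd l x\<bar> \<le> \<bar>r\<bar>" using Ad F(2) r by fastforce
      then show "0 \<le> (dd l x)\<^sup>2 \<and> (dd l x)\<^sup>2 \<le> r\<^sup>2" by (simp add: abs_le_square_iff)
    qed simp
    then obtain S where S: "S \<subseteq> F" "r\<^sup>2 \<le> (\<Sum>b\<in>S. (dd l b)\<^sup>2)" "(\<Sum>b\<in>S. (dd l b)\<^sup>2) \<le> 2 * r\<^sup>2" by blast
    have SA: "S \<subseteq> A" using S(1) F(2) by blast
    have d3: "\<forall>j\<in>S. \<bar>dd l j\<bar> \<le> 3 * r"
    proof
      fix j assume "j \<in> S"
      then have "\<bar>dd l j\<bar> < r" using SA Ad by blast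
      then show "\<bar>dd l j\<bar> \<le> 3 * r" using r by linarith
    qed
    have "2 * r\<^sup>2 \<le> 20 * r\<^sup>2" by simp
    then have "(\<Sum>b\<in>S. (dd l b)\<^sup>2) \<le> 20 * r\<^sup>2" using S(3) by linarith
    moreover have "S \<subseteq> carrier G" "S \<inter> B = {}" using SA by (auto simp: A_def)
    ultimately show ?thesis using S(2) d3 finite_subset[OF S(1) F(1)] by blast
  qed
qed

text \<open>With a fixed probability \<open>block_prob\<close> confines the random translation to
  absolute values between \<open>\<delta> * r\<close> and \<open>\<beta> * r\<close>, but leaves
  open where. The pigeonhole principle on a grid of mesh \<eta> finds a likely value for each block,
  and a second application finds one \<open>q\<close> that serves for blocks avoiding any finite
  set.\<close>

lemma exists_shift:
  assumes ends: "\<not> more_than_one_end G" and gv: "good_value e l" and F: "maharam F"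
    and ns: "\<not> (\<lambda>g. (pmf (\<mu> g) False - l)\<^sup>2) summable_on carrier G"
    and r: "0 < r" and \<eta>: "0 < \<eta>"
  defines "\<beta> \<equiv> sqrt (80 * (3 + 9 / (2 * \<delta>\<^sup>2)))"
  shows "\<exists>q. \<delta> * r - \<eta> \<le> \<bar>q\<bar> \<and> \<bar>q\<bar> \<le> \<beta> * r + \<eta> \<and> (\<forall>t. (\<integral>x. \<bar>Phi e F x (t + q) - Phi e F x t\<bar> \<partial>M) \<le> lm e \<eta>)"
proof -
  interpret P2: prob_space M2 by (rule M2_prob)
  define K where "K = 3 + 9 / (2 * \<delta>\<^sup>2)"
  have K: "3 \<le> K" by (simp add: K_def)
  have \<beta>: "0 \<le> \<beta>" "\<beta>\<^sup>2 = 80 * K" using K by (auto simp: \<beta>_def K_def[symmetric])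
  \<comment> \<open>The grid must reach beyond \<open>\<beta> * r\<close>; the \<open>+ 1\<close>
    covers the rounding by the floor function for negative values.\<close>
  define N where "N = \<lceil>\<beta> * r / \<eta>\<rceil> + 1"
  define Q where "Q = {q \<in> (\<lambda>k. \<eta> * real_of_int k) ` {- N..N}. \<delta> * r - \<eta> \<le> \<bar>q\<bar> \<and> \<bar>q\<bar> \<le> \<beta> * r + \<eta>}"
  have fQ: "finite Q" by (simp add: Q_def)
  let ?E = "\<lambda>S q. {p \<in> space M2. \<bar>Zs l S p - q\<bar> \<le> \<eta>}"
  define c where "c = 1 / (2 * K\<^sup>2) / (real (card Q) + 1)"
  have c: "0 < c" using K by (simp add: c_def)
  have one: "\<exists>S. finite S \<and> S \<subseteq> carrier G \<and> S \<inter> B = {} \<and> (\<exists>q\<in>Q. c \<le> measure M2 (?E S q))" if B: "finite B" "B \<subseteq> carrier G" for B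
  proof -
    obtain S where S: "finite S" "S \<subseteq> carrier G" "S \<inter> B = {}" "\<forall>j\<in>S. \<bar>dd l j\<bar> \<le> 3 * r" "r\<^sup>2 \<le> (\<Sum>j\<in>S. (dd l j)\<^sup>2)" "(\<Sum>j\<in>S. (dd l j)\<^sup>2) \<le> 20 * r\<^sup>2"
      using exists_block[OF ends gv ns r B] by blast
    have Zm [measurable]: "Zs l S \<in> borel_measurable M2" by (rule Zs_measurable[OF S(2)])
    let ?O = "{p \<in> space M2. 2 * \<delta>\<^sup>2 / 2 * r\<^sup>2 \<le> (Zs l S p)\<^sup>2 \<and> (Zs l S p)\<^sup>2 \<le> 80 * K * r\<^sup>2}"
    have "1 / (2 * K\<^sup>2) \<le> measure M2 ?O"
      unfolding K_def using S(4) by (intro block_prob[OF S(1,2) r _ S(5,6)]) blast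
    also have "\<dots> \<le> measure M2 (\<Union>q\<in>Q. ?E S q)"
    proof (rule P2.finite_measure_mono)
      show "?O \<subseteq> (\<Union>q\<in>Q. ?E S q)"
      proof
        fix p assume p: "p \<in> ?O"
        define z k where "z = Zs l S p" and "k = \<lfloor>z / \<eta>\<rfloor>"
        have "(\<delta> * r)\<^sup>2 \<le> z\<^sup>2" using p by (simp add: z_def power_mult_distrib)
        then have z1: "\<delta> * r \<le> \<bar>z\<bar>" using r \<delta>_pos by (simp add: abs_le_square_iff[symmetric])
        have "z\<^sup>2 \<le> (\<beta> * r)\<^sup>2" using p by (simp add: z_def power_mult_distrib \<beta>(2))
        then have z2: "\<bar>z\<bar> \<le> \<beta> * r" using r \<beta>(1) by (simp add: abs_le_square_iff[symmetric])
        have k: "real_of_int k \<le> z / \<eta>" "z / \<eta> < real_of_int k + 1" unfolding k_def by linarith+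
        then have kz: "\<eta> * k \<le> z" "z < \<eta> * k + \<eta>" using \<eta> by (simp_all add: field_simps)
        have zN: "\<bar>z / \<eta>\<bar> \<le> \<beta> * r / \<eta>" using z2 \<eta> by (simp add: abs_divide divide_right_mono)
        then have "k \<in> {- N..N}" using k unfolding N_def by (auto, linarith+)
        moreover have "\<delta> * r - \<eta> \<le> \<bar>\<eta> * k\<bar>" "\<bar>\<eta> * k\<bar> \<le> \<beta> * r + \<eta>" using kz z1 z2 by linarith+
        ultimately have "\<eta> * k \<in> Q" unfolding Q_def by blast
        moreover have "p \<in> ?E S (\<eta> * k)" using p kz unfolding z_def[symmetric] by (simp add: z_def[symmetric])
        ultimately show "p \<in> (\<Union>q\<in>Q. ?E S q)" by blast
      qed
      show "(\<Union>q\<in>Q. ?E S q) \<in> sets M2" using fQ by (intro sets.finite_UN) measurable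
    qed
    also have "\<dots> \<le> (\<Sum>q\<in>Q. measure M2 (?E S q))" by (rule measure_UNION_le[OF fQ]) measurable
    finally have sum: "1 / (2 * K\<^sup>2) \<le> (\<Sum>q\<in>Q. measure M2 (?E S q))" .
    have "\<exists>q\<in>Q. c \<le> measure M2 (?E S q)"
    proof (rule ccontr)
      assume "\<not> ?thesis"
      then have "(\<Sum>q\<in>Q. measure M2 (?E S q)) \<le> (\<Sum>q\<in>Q. c)" by (intro sum_mono) (auto simp: not_le intro: less_imp_le)
      also have "\<dots> = real (card Q) * c" by simp
      also have "\<dots> < (real (card Q) + 1) * c" using c by simp
      also have "\<dots> = 1 / (2 * K\<^sup>2)" by (simp add: c_def add_nonneg_eq_0_iff)
      finally show False using sum by linarith
    qed
    then show ?thesis using S(1-3) by blast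
  qed
  define ok where "ok q B \<longleftrightarrow> (\<exists>S. finite S \<and> S \<subseteq> carrier G \<and> S \<inter> B = {} \<and> c \<le> measure M2 (?E S q))" for q B
  \<comment> \<open>If each of the finitely many \<open>q\<close> failed for some \<open>B\<close>,
    all would fail for the union of these sets, since a block avoiding the union avoids each of
    them.\<close>
  have "\<exists>q\<in>Q. \<forall>B. finite B \<longrightarrow> B \<subseteq> carrier G \<longrightarrow> ok q B"
  proof (rule ccontr)
    assume "\<not> ?thesis"
    then have "\<forall>q\<in>Q. \<exists>B. finite B \<and> B \<subseteq> carrier G \<and> \<not> ok q B" by blast
    from bchoice[OF this] obtain Bq where Bq: "\<forall>q\<in>Q. finite (Bq q) \<and> Bq q \<subseteq> carrier G \<and> \<not> ok q (Bq q)" by blast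
    have "finite (\<Union>q\<in>Q. Bq q)" "(\<Union>q\<in>Q. Bq q) \<subseteq> carrier G" using fQ Bq by blast+
    from one[OF this] obtain S q where S: "finite S" "S \<subseteq> carrier G" "S \<inter> (\<Union>q\<in>Q. Bq q) = {}" "q \<in> Q" "c \<le> measure M2 (?E S q)" by blast
    have "S \<inter> Bq q = {}" using S(3,4) by blast
    then have "ok q (Bq q)" unfolding ok_def using S(1,2,5) by (intro exI[of _ S] conjI)
    then show False using Bq S(4) by blast
  qed
  then obtain q where q: "q \<in> Q" and ok: "\<And>B. finite B \<Longrightarrow> B \<subseteq> carrier G \<Longrightarrow> ok q B" by blast
  have "(\<integral>x. \<bar>Phi e F x (t + q) - Phi e F x t\<bar> \<partial>M) \<le> lm e \<eta>" for t
    by (rule block_shift[OF gv F _ c ok[unfolded ok_def]]) (use \<eta> in auto)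
  then show ?thesis using q unfolding Q_def by blast
qed

text \<open>A translation by some \<open>q\<close> with \<open>\<bar>q\<bar>\<close> of order
  \<open>r\<close> moves \<open>Phi\<close> by at most \<open>4 * \<eta>\<close> in mean, where
  \<eta> is a small fraction of \<open>r\<close>. A fixed \<open>p\<close> is reached by about
  \<open>\<bar>p / q\<bar>\<close> such steps, with a total error that is a small multiple of
  \<open>\<bar>p\<bar>\<close>; the remainder is at most one step long and is handled by
  continuity.\<close>

lemma Phi_shift_zero:
  assumes ends: "\<not> more_than_one_end G" and gv: "good_value e l" and F: "maharam F"
    and ns: "\<not> (\<lambda>g. (pmf (\<mu> g) False - l)\<^sup>2) summable_on carrier G"
  shows "AE x in M. Phi e F x (t + p) = Phi e F x t"
proof -
  have e: "0 < e" "e \<le> 1" using gv by (auto simp: good_value_def)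
  define \<beta> where "\<beta> = sqrt (80 * (3 + 9 / (2 * \<delta>\<^sup>2)))"
  have \<beta>: "0 \<le> \<beta>" by (simp add: \<beta>_def)
  have pi: "integrable M (\<lambda>x. Phi e F x u)" for u
    by (rule integrable_bounded[OF Phi_meas[OF F], where C = "2 / e"]) (use Phi_bd[OF F _ e(1)] in \<open>simp del: space_bits\<close>)
  define D where "D t p = (\<integral>x. \<bar>Phi e F x (t + p) - Phi e F x t\<bar> \<partial>M)" for t p
  have di: "integrable M (\<lambda>x. \<bar>Phi e F x u - Phi e F x w\<bar>)" for u w by (intro integrable_abs Bochner_Integration.integrable_diff pi)
  have Dadd: "D t (a + b) \<le> D t a + D (t + a) b" for t a b
  proof -
    have "D t (a + b) \<le> (\<integral>x. \<bar>Phi e F x (t + a) - Phi e F x t\<bar> + \<bar>Phi e F x (t + a + b) - Phi e F x (t + a)\<bar> \<partial>M)"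
      unfolding D_def by (intro integral_mono di Bochner_Integration.integrable_add) (simp add: add.assoc)
    also have "\<dots> = D t a + D (t + a) b" unfolding D_def by (rule Bochner_Integration.integral_add[OF di di])
    finally show ?thesis .
  qed
  have Dneg: "D t (- a) = D (t - a) a" for t a unfolding D_def by (simp add: abs_minus_commute)
  have Dlm: "D t a \<le> 4 * \<bar>a\<bar>" if a: "\<bar>a\<bar> \<le> 1" for t a
  proof -
    have "D t a \<le> (\<integral>x. 4 * \<bar>a\<bar> \<partial>M)"
      unfolding D_def
    proof (rule integral_mono[OF di])
      fix x assume x: "x \<in> space M"
      have "\<bar>Phi e F x (t + a) - Phi e F x t\<bar> \<le> lm e \<bar>t + a - t\<bar>" by (rule Phi_shift[OF F x e(1)])
      also have "\<dots> = lm e \<bar>a\<bar>" by simp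
      also have "\<dots> \<le> 4 * \<bar>a\<bar>" by (rule lm_le[OF e _ a]) simp
      finally show "\<bar>Phi e F x (t + a) - Phi e F x t\<bar> \<le> 4 * \<bar>a\<bar>" .
    qed simp
    also have "\<dots> = 4 * \<bar>a\<bar>" using lebesgue_integral_const[of M "4 * \<bar>a\<bar>"] by (simp add: prob_space del: space_bits)
    finally show ?thesis .
  qed
  have "D t p \<le> 0 + \<epsilon>" if \<epsilon>: "0 < \<epsilon>" for \<epsilon>
  proof -
    define \<tau> where "\<tau> = min (1 / 2) (\<epsilon> / (16 * (\<bar>p\<bar> + 1)))"
    have \<tau>: "0 < \<tau>" "\<tau> \<le> 1 / 2" "\<tau> \<le> \<epsilon> / (16 * (\<bar>p\<bar> + 1))" 
    proof -
      have "0 < \<epsilon> / (16 * (\<bar>p\<bar> + 1))" using \<epsilon> by (intro divide_pos_pos) auto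
      then show "0 < \<tau>" by (simp add: \<tau>_def)
    qed (unfold \<tau>_def, rule min.cobounded1, rule min.cobounded2)
    have "8 * \<tau> * \<bar>p\<bar> \<le> 8 * (\<epsilon> / (16 * (\<bar>p\<bar> + 1))) * \<bar>p\<bar>" using \<tau>(3) by (intro mult_right_mono mult_left_mono) auto
    also have "\<dots> \<le> \<epsilon> / 2" using \<epsilon> by (simp add: field_simps)
    finally have \<tau>p: "8 * \<tau> * \<bar>p\<bar> \<le> \<epsilon> / 2" .
    define r where "r = min 1 (\<epsilon> / 16) / (\<beta> + \<delta>)"
    have bd: "0 < \<beta> + \<delta>" using \<beta> \<delta>_pos by simp
    have r: "0 < r" using \<epsilon> bd by (auto simp: r_def intro!: divide_pos_pos)
    have "(\<beta> + \<delta>) * r = min 1 (\<epsilon> / 16)" using bd by (simp add: r_def)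
    then have r1: "(\<beta> + \<delta>) * r \<le> 1" "(\<beta> + \<delta>) * r \<le> \<epsilon> / 16" by auto
    define \<eta> where "\<eta> = \<delta> * r * \<tau>"
    have dr: "0 < \<delta> * r" using \<delta>_pos r by simp
    have \<eta>: "0 < \<eta>" unfolding \<eta>_def by (rule mult_pos_pos[OF dr \<tau>(1)])
    have \<eta>2: "\<eta> \<le> \<delta> * r / 2" unfolding \<eta>_def using mult_left_mono[OF \<tau>(2), of "\<delta> * r"] dr by simp
    obtain q0 where q0: "\<delta> * r - \<eta> \<le> \<bar>q0\<bar>" "\<bar>q0\<bar> \<le> \<beta> * r + \<eta>" "\<forall>t. D t q0 \<le> lm e \<eta>"
      using exists_shift[OF ends gv F ns r \<eta>] unfolding \<beta>_def D_def by blast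
    have bdr: "(\<beta> + \<delta>) * r = \<beta> * r + \<delta> * r" by (rule distrib_right)
    have br: "0 \<le> \<beta> * r" using \<beta> r by simp
    have \<eta>1: "\<eta> \<le> 1" using \<eta>2 dr r1(1) br unfolding bdr by linarith
    have lm: "lm e \<eta> \<le> 4 * \<eta>" using \<eta> \<eta>1 e by (intro lm_le) auto
    \<comment> \<open>The sign makes the steps point towards \<open>p\<close>; the bound for the
      reverse translation is the bound for \<open>q0\<close> at another base point, by
      \<open>Dneg\<close>.\<close>
    define q where "q = (if 0 \<le> p * q0 then q0 else - q0)"
    have aq: "\<bar>q\<bar> = \<bar>q0\<bar>" by (simp add: q_def)
    have Dq: "D t q \<le> 4 * \<eta>" for t using q0(3) lm Dneg by (auto simp: q_def intro: order_trans)
    have q_lo: "\<delta> * r / 2 \<le> \<bar>q\<bar>" and q_hi: "\<bar>q\<bar> \<le> (\<beta> + \<delta>) * r" using q0(1,2) \<eta>2 dr unfolding aq bdr by linarith+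
    have qn: "q \<noteq> 0" using q_lo dr by auto
    have pq: "0 \<le> p / q" by (auto simp: q_def zero_le_divide_iff zero_le_mult_iff)
    define n where "n = nat \<lfloor>p / q\<rfloor>"
    have n: "real n \<le> p / q" "p / q < real n + 1" using pq unfolding n_def by linarith+
    define \<rho> where "\<rho> = p - real n * q"
    have "\<rho> / q = p / q - real n" using qn by (simp add: \<rho>_def diff_divide_distrib)
    then have "\<bar>\<rho> / q\<bar> \<le> 1" using n by linarith
    then have \<rho>: "\<bar>\<rho>\<bar> \<le> \<bar>q\<bar>" using qn by (simp add: abs_divide divide_le_eq_1)
    have mult: "D t (real m * q) \<le> real m * (4 * \<eta>)" for m t
    proof (induction m)
      case 0 then show ?case by (simp add: D_def)
    next
      case (Suc m)
      have "D t (real (Suc m) * q) = D t (real m * q + q)" by (simp add: algebra_simps)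
      also have "\<dots> \<le> real m * (4 * \<eta>) + 4 * \<eta>" using Dadd[of t "real m * q" q] Suc Dq[of "t + real m * q"] by linarith
      finally show ?case by (simp add: algebra_simps)
    qed
    have "D t p = D t (real n * q + \<rho>)" by (simp add: \<rho>_def)
    also have "\<dots> \<le> real n * (4 * \<eta>) + 4 * \<bar>\<rho>\<bar>" using Dadd[of t "real n * q" \<rho>] mult[of t n] Dlm[of \<rho> "t + real n * q"] \<rho> q_hi r1(1) by linarith
    also have "real n * (4 * \<eta>) \<le> 8 * \<tau> * \<bar>p\<bar>"
    proof -
      have "real n * (\<delta> * r / 2) \<le> real n * \<bar>q\<bar>" using q_lo by (intro mult_left_mono) auto
      also have "\<dots> \<le> (p / q) * \<bar>q\<bar>" using n(1) by (intro mult_right_mono) auto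
      also have "\<dots> \<le> \<bar>p\<bar>" using qn by (simp add: abs_if)
      finally have "8 * \<tau> * (real n * (\<delta> * r / 2)) \<le> 8 * \<tau> * \<bar>p\<bar>" using \<tau>(1) by (intro mult_left_mono) auto
      then show ?thesis by (simp add: \<eta>_def mult_ac)
    qed
    also have "8 * \<tau> * \<bar>p\<bar> \<le> \<epsilon> / 2" by (rule \<tau>p)
    also have "4 * \<bar>\<rho>\<bar> \<le> \<epsilon> / 2" using \<rho> q_hi r1(2) \<epsilon> by linarith
    finally show "D t p \<le> 0 + \<epsilon>" by simp
  qed
  then have "D t p \<le> 0" by (rule field_le_epsilon)
  moreover have "0 \<le> D t p" unfolding D_def by (intro integral_nonneg_AE) auto
  ultimately have "D t p = 0" by (rule order_antisym)
  then have "(\<integral>x. \<bar>Phi e F x (t + p) - Phi e F x t\<bar> \<partial>M) = 0" by (simp only: D_def)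
  then have "AE x in M. \<bar>Phi e F x (t + p) - Phi e F x t\<bar> = 0" by (subst (asm) integral_nonneg_eq_0_iff_AE[OF di]) auto
  then show ?thesis by eventually_elim simp
qed

text \<open>Once \<open>Phi\<close> is invariant under translations, the shift in
  \<open>maharam_test_zero\<close> can be omitted; all tests vanish and \<open>test_const\<close>
  applies. The constant does not depend on \<open>t\<close>, again by invariance, although the null
  set does.\<close>

lemma Phi_const:
  assumes ends: "\<not> more_than_one_end G" and gv: "good_value e l" and F: "maharam F"
    and ns: "\<not> (\<lambda>g. (pmf (\<mu> g) False - l)\<^sup>2) summable_on carrier G"
  shows "\<exists>c. \<forall>t. AE x in M. Phi e F x t = c"
proof -
  have e: "0 < e" "e \<le> 1" using gv by (auto simp: good_value_def)
  note shift = Phi_shift_zero[OF ends gv F ns]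
  have pi: "integrable M (\<lambda>x. Phi e F x 0)"
    by (rule integrable_bounded[OF Phi_meas[OF F], where C = "2 / e"]) (use Phi_bd[OF F _ e(1)] in \<open>simp del: space_bits\<close>)
  have "AE x in M. Phi e F x 0 = (\<integral>x. Phi e F x 0 \<partial>M)"
  proof (rule test_const[OF pi])
    show "0 \<le> Phi e F x 0" for x unfolding Phi_def using maharam_bd[OF F] by (intro integral_nonneg_AE) auto
    fix b y0 B ys assume b: "b \<in> carrier G" and B: "finite B" "B \<subseteq> carrier G" "b \<notin> B"
    let ?u = "\<lambda>y. ln (pmf (\<mu> b) y / lam l y)"
    have "(\<integral>x. Phi e F x 0 * ts b y0 B ys x \<partial>M) = (\<integral>x. ts b y0 B ys x * Phi e F x (0 + ?u (x b)) \<partial>M)"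
    proof (rule integral_cong_AE)
      show "(\<lambda>x. Phi e F x 0 * ts b y0 B ys x) \<in> borel_measurable M" by (intro borel_measurable_times Phi_meas[OF F] ts_measurable[OF b B(1,2)])
      show "(\<lambda>x. ts b y0 B ys x * Phi e F x (0 + ?u (x b))) \<in> borel_measurable M"
        by (intro borel_measurable_times ts_measurable[OF b B(1,2)] Phi_comp_meas[OF F b])
      show "AE x in M. Phi e F x 0 * ts b y0 B ys x = ts b y0 B ys x * Phi e F x (0 + ?u (x b))"
        using shift[of 0 "?u True"] shift[of 0 "?u False"]
      proof eventually_elim
        case (elim x)
        have "Phi e F x (0 + ?u (x b)) = Phi e F x 0" using elim by (cases "x b") simp_all
        then show ?case by simp
      qed
    qed
    then show "(\<integral>x. Phi e F x 0 * ts b y0 B ys x \<partial>M) = 0" using maharam_test_zero[OF gv F b B, of y0 ys 0] by simp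
  qed
  then have "AE x in M. Phi e F x t = (\<integral>x. Phi e F x 0 \<partial>M)" for t using shift[of 0 t] by eventually_elim simp
  then show ?thesis by blast
qed

end

section \<open>The ratio set\<close>

text \<open>A combination of three translates of \<open>exp (- e \<bar>s\<bar>)\<close> that is supported in \<open>[- h, h]\<close>.\<close>
definition bump :: "real \<Rightarrow> real \<Rightarrow> real \<Rightarrow> real" where
  "bump e h s = (exp (e * h) + exp (- (e * h))) * exp (- (e * \<bar>s\<bar>)) - exp (- (e * \<bar>s - h\<bar>)) - exp (- (e * \<bar>s + h\<bar>))"

lemma bump_zero: assumes "0 \<le> h" "h \<le> \<bar>s\<bar>" shows "bump e h s = 0"
proof (cases "0 \<le> s")
  case True
  then have a: "\<bar>s\<bar> = s" "\<bar>s - h\<bar> = s - h" "\<bar>s + h\<bar> = s + h" using assms by auto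
  show ?thesis unfolding bump_def a by (simp add: distrib_right exp_add[symmetric] algebra_simps)
next
  case False
  then have a: "\<bar>s\<bar> = - s" "\<bar>s - h\<bar> = h - s" "\<bar>s + h\<bar> = - s - h" using assms by auto
  show ?thesis unfolding bump_def a by (simp add: distrib_right exp_add[symmetric] algebra_simps)
qed

context bernoulli
begin

lemma Phi_bump:
  assumes F: "maharam F" and x: "x \<in> space M" and e: "0 < e"
  shows "(\<integral>s. F x s * bump e h (s - u) \<partial>lborel) = (exp (e * h) + exp (- (e * h))) * Phi e F x u - Phi e F x (u + h) - Phi e F x (u - h)"
proof -
  have i: "integrable lborel (\<lambda>s. F x s * exp (- (e * \<bar>s - t\<bar>)))" for t using Phi_int[OF F x e, of 0 "- t"] by simp
  have "(\<integral>s. F x s * bump e h (s - u) \<partial>lborel) = (\<integral>s. (exp (e * h) + exp (- (e * h))) * (F x s * exp (- (e * \<bar>s - u\<bar>)))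
      - F x s * exp (- (e * \<bar>s - (u + h)\<bar>)) - F x s * exp (- (e * \<bar>s - (u - h)\<bar>)) \<partial>lborel)"
    by (intro Bochner_Integration.integral_cong refl) (simp add: bump_def algebra_simps)
  also have "\<dots> = (exp (e * h) + exp (- (e * h))) * Phi e F x u - Phi e F x (u + h) - Phi e F x (u - h)"
    unfolding Phi_def
    using Bochner_Integration.integral_diff[OF Bochner_Integration.integrable_diff[OF integrable_mult_right[OF i] i] i]
      Bochner_Integration.integral_diff[OF integrable_mult_right[OF i] i] by simp
  finally show ?thesis .
qed

lemma dens_one: "AE z in M. dens \<one> z = 1"
  using dens_cocycle[OF one_closed one_closed] dens_pos[OF one_closed] AE_space[of M]
proof eventually_elim
  case (elim z)
  then have "act (inv \<one>) z = z" using act_one[of z] by simp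
  then show ?case using elim by simp
qed

lemma translate_deriv_dens:
  assumes g: "g \<in> carrier G" shows "AE x in M. translate_deriv G M act g x = dens (inv g) x"
proof -
  have i: "inv g \<in> carrier G" using g by simp
  have "AE x in M. ennreal (dens (inv g) x) = RN_deriv M (distr M M (act (inv g))) x"
    by (rule RN_deriv_unique[OF _ distr_act_dens[OF i, symmetric]]) (use dens_measurable[OF i] in simp)
  then show ?thesis
  proof eventually_elim
    case (elim x)
    show ?case unfolding translate_deriv_def elim[symmetric] using dens_nonneg[OF i] by simp
  qed
qed

lemma translate_deriv_measurable: "translate_deriv G M act g \<in> borel_measurable M"
  unfolding translate_deriv_def[abs_def] by measurable

text \<open>\<open>F\<close> is the indicator of the saturation of \<open>U\<close> times the
  interval (- r, r) under the Maharam extension, in which \<open>g\<close> adds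
  \<open>ln (dens (inv g) x)\<close> to the real variable. Invariance is the cocycle identity, valid
  outside one null set since the group is countable.\<close>

lemma maharam_saturation:
  assumes U: "U \<in> sets M" and r: "0 < (r :: real)"
  defines "F \<equiv> \<lambda>x s. of_bool (\<exists>g\<in>carrier G. act g x \<in> U \<and> \<bar>s + ln (dens (inv g) x)\<bar> < r) :: real"
  shows "maharam F"
  unfolding maharam_def
proof (intro conjI allI ballI)
  have pg: "{w \<in> space (M \<Otimes>\<^sub>M lborel). act g (fst w) \<in> U \<and> \<bar>snd w + ln (dens (inv g) (fst w))\<bar> < r} \<in> sets (M \<Otimes>\<^sub>M lborel)"
    if g: "g \<in> carrier G" for g
  proof -
    have i: "inv g \<in> carrier G" using g by simp
    have am: "(\<lambda>w. act g (fst w)) \<in> measurable (M \<Otimes>\<^sub>M lborel) M" by (rule measurable_compose[OF measurable_fst act_measurable[OF g]])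
    have dm: "(\<lambda>w. dens (inv g) (fst w)) \<in> borel_measurable (M \<Otimes>\<^sub>M lborel)" by (rule measurable_compose[OF measurable_fst dens_measurable[OF i]])
    have sm: "(\<lambda>w. snd w :: real) \<in> borel_measurable (M \<Otimes>\<^sub>M lborel)" using measurable_snd[of M "lborel :: real measure"] by simp
    have 1: "{w \<in> space (M \<Otimes>\<^sub>M lborel). \<bar>snd w + ln (dens (inv g) (fst w))\<bar> < r} \<in> sets (M \<Otimes>\<^sub>M lborel)"
      by (intro borel_measurable_less borel_measurable_abs borel_measurable_add borel_measurable_ln sm dm borel_measurable_const)
    have 2: "(\<lambda>w. act g (fst w)) -` U \<inter> space (M \<Otimes>\<^sub>M lborel) \<in> sets (M \<Otimes>\<^sub>M lborel)" by (rule measurable_sets[OF am U])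
    have "{w \<in> space (M \<Otimes>\<^sub>M lborel). act g (fst w) \<in> U \<and> \<bar>snd w + ln (dens (inv g) (fst w))\<bar> < r}
      = {w \<in> space (M \<Otimes>\<^sub>M lborel). \<bar>snd w + ln (dens (inv g) (fst w))\<bar> < r} \<inter> ((\<lambda>w. act g (fst w)) -` U \<inter> space (M \<Otimes>\<^sub>M lborel))" by blast
    then show ?thesis by (simp only: sets.Int[OF 1 2])
  qed
  have "{w \<in> space (M \<Otimes>\<^sub>M lborel). \<exists>g\<in>carrier G. act g (fst w) \<in> U \<and> \<bar>snd w + ln (dens (inv g) (fst w))\<bar> < r}
    = (\<Union>g\<in>carrier G. {w \<in> space (M \<Otimes>\<^sub>M lborel). act g (fst w) \<in> U \<and> \<bar>snd w + ln (dens (inv g) (fst w))\<bar> < r})" by blast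
  also have "\<dots> \<in> sets (M \<Otimes>\<^sub>M lborel)" by (rule sets.countable_UN''[OF countable_carrier pg])
  finally have "indicator {w \<in> space (M \<Otimes>\<^sub>M lborel). \<exists>g\<in>carrier G. act g (fst w) \<in> U \<and> \<bar>snd w + ln (dens (inv g) (fst w))\<bar> < r} \<in> borel_measurable (M \<Otimes>\<^sub>M lborel)"
    by (rule borel_measurable_indicator)
  then show "(\<lambda>w. F (fst w) (snd w)) \<in> borel_measurable (M \<Otimes>\<^sub>M lborel)"
    by (rule measurable_cong[THEN iffD1, rotated]) (simp add: F_def indicator_def)
  show "0 \<le> F x s" "F x s \<le> 1" for x s by (simp_all add: F_def)
  fix g assume g: "g \<in> carrier G"
  have "AE z in M. \<forall>k\<in>carrier G. dens g z * dens k (act (inv g) z) = dens (g \<otimes> k) z \<and> 0 < dens k z"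
    using dens_cocycle[OF g] dens_pos by (intro AE_ball_countable[OF countable_carrier, THEN iffD2] ballI) auto
  then show "AE z in M. \<forall>s. F (act (inv g) z) s = F z (s - ln (dens g z))"
    using AE_space[of M]
  proof eventually_elim
    case (elim z)
    have zs: "z \<in> carrier G \<rightarrow>\<^sub>E UNIV" using elim(2) by simp
    have key: "act k (act (inv g) z) = act (k \<otimes> inv g) z \<and> ln (dens (inv k) (act (inv g) z)) = ln (dens (inv (k \<otimes> inv g)) z) - ln (dens g z)"
      if k: "k \<in> carrier G" for k
    proof
      show "act k (act (inv g) z) = act (k \<otimes> inv g) z" by (rule act_mult[OF zs k]) (use g in simp)
      have i: "inv (k \<otimes> inv g) = g \<otimes> inv k" using g k by (simp add: inv_mult_group)
      have c: "dens g z * dens (inv k) (act (inv g) z) = dens (g \<otimes> inv k) z" and p: "0 < dens g z" "0 < dens (g \<otimes> inv k) z" using elim(1) g k by auto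
      have "0 < dens (inv k) (act (inv g) z)" using p unfolding c[symmetric] by (rule zero_less_mult_pos[rotated])
      then show "ln (dens (inv k) (act (inv g) z)) = ln (dens (inv (k \<otimes> inv g)) z) - ln (dens g z)"
        unfolding i c[symmetric] using p(1) by (simp add: ln_mult)
    qed
    show ?case
    proof
      fix s
      have "(\<exists>k\<in>carrier G. act k (act (inv g) z) \<in> U \<and> \<bar>s + ln (dens (inv k) (act (inv g) z))\<bar> < r)
        \<longleftrightarrow> (\<exists>k\<in>carrier G. act k z \<in> U \<and> \<bar>s - ln (dens g z) + ln (dens (inv k) z)\<bar> < r)" (is "?L \<longleftrightarrow> ?R")
      proof
        assume ?L
        then obtain k where k: "k \<in> carrier G" "act k (act (inv g) z) \<in> U" "\<bar>s + ln (dens (inv k) (act (inv g) z))\<bar> < r" by blast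
        have "\<bar>s - ln (dens g z) + ln (dens (inv (k \<otimes> inv g)) z)\<bar> < r" using k(3) key[OF k(1)] by (simp add: algebra_simps)
        then show ?R using k(2) key[OF k(1)] g k(1) by (intro bexI[of _ "k \<otimes> inv g"]) auto
      next
        assume ?R
        then obtain k where k: "k \<in> carrier G" "act k z \<in> U" "\<bar>s - ln (dens g z) + ln (dens (inv k) z)\<bar> < r" by blast
        have kg: "k \<otimes> g \<in> carrier G" "k \<otimes> g \<otimes> inv g = k" using k(1) g by (auto simp: m_assoc)
        have "\<bar>s + ln (dens (inv (k \<otimes> g)) (act (inv g) z))\<bar> < r" using k(3) conjunct2[OF key[OF kg(1)]] unfolding kg(2) by linarith
        then show ?L using k(2) key[OF kg(1)] kg by (intro bexI[of _ "k \<otimes> g"]) auto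
      qed
      then show "F (act (inv g) z) s = F z (s - ln (dens g z))" by (simp add: F_def)
    qed
  qed
qed

text \<open>If no \<open>g\<close> and \<open>V\<close> exist, the saturation of \<open>U\<close>
  times a short interval around 0 misses almost all points over \<open>U\<close> with real
  coordinate near \<open>- ln t\<close>, while it contains those with real coordinate near 0. But
  \<open>Phi\<close> of its indicator is constant by \<open>Phi_const\<close>, and
  \<open>bump\<close> recovers local integrals from \<open>Phi\<close>; the two local integrals
  would have to agree.\<close>

lemma ratio_set_pos:
  assumes ends: "\<not> more_than_one_end G" and gv: "good_value e l"
    and ns: "\<not> (\<lambda>g. (pmf (\<mu> g) False - l)\<^sup>2) summable_on carrier G"
    and t: "0 < t" and \<epsilon>: "0 < \<epsilon>" and U: "U \<in> sets M" "0 < emeasure M U"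
  shows "\<exists>g\<in>carrier G. \<exists>V\<in>sets M. V \<subseteq> U \<and> emeasure M V > 0 \<and> act g ` V \<subseteq> U \<and> (\<forall>x\<in>V. \<bar>translate_deriv G M act g x - t\<bar> < \<epsilon>)"
proof (rule ccontr)
  assume neg: "\<not> ?thesis"
  have e: "0 < e" using gv by (simp add: good_value_def)
  let ?V = "\<lambda>g. U \<inter> ((act g -` U \<inter> space M) \<inter> {x \<in> space M. \<bar>translate_deriv G M act g x - t\<bar> < \<epsilon>})"
  have Vm: "?V g \<in> sets M" if g: "g \<in> carrier G" for g
  proof -
    have [measurable]: "translate_deriv G M act g \<in> borel_measurable M" by (rule translate_deriv_measurable)
    have "{x \<in> space M. \<bar>translate_deriv G M act g x - t\<bar> < \<epsilon>} \<in> sets M" by measurable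
    then show ?thesis by (intro sets.Int U(1) measurable_sets[OF act_measurable[OF g] U(1)])
  qed
  have null: "AE x in M. \<forall>g\<in>carrier G. x \<notin> ?V g"
  proof (rule AE_ball_countable[OF countable_carrier, THEN iffD2], rule ballI)
    fix g assume g: "g \<in> carrier G"
    have "\<not> 0 < emeasure M (?V g)"
    proof
      assume "0 < emeasure M (?V g)"
      then have "\<exists>V\<in>sets M. V \<subseteq> U \<and> emeasure M V > 0 \<and> act g ` V \<subseteq> U \<and> (\<forall>x\<in>V. \<bar>translate_deriv G M act g x - t\<bar> < \<epsilon>)"
        using Vm[OF g] by (intro bexI[of _ "?V g"] conjI) auto
      then show False using neg g by blast
    qed
    then have "emeasure M (?V g) = 0" by (simp only: not_gr_zero)
    then show "AE x in M. x \<notin> ?V g" using Vm[OF g] by (intro AE_not_in) (simp add: null_sets_def)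
  qed
  have "isCont exp (ln t)" by (intro continuous_intros)
  then obtain d where d: "0 < d" "\<And>u. \<bar>u - ln t\<bar> < d \<Longrightarrow> \<bar>exp u - exp (ln t)\<bar> < \<epsilon>"
    using \<epsilon> unfolding continuous_at_eps_delta dist_real_def by metis
  \<comment> \<open>Two numbers at distance less than \<open>r\<close> from the same point differ by
    less than \<open>d\<close>.\<close>
  define r where "r = d / 2"
  have r: "0 < r" using d(1) by (simp add: r_def)
  define F where "F = (\<lambda>x s. of_bool (\<exists>g\<in>carrier G. act g x \<in> U \<and> \<bar>s + ln (dens (inv g) x)\<bar> < r) :: real)"
  have F: "maharam F" unfolding F_def by (rule maharam_saturation[OF U(1) r])
  obtain c where c: "\<And>t. AE x in M. Phi e F x t = c" using Phi_const[OF ends gv F ns] by blast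
  \<comment> \<open>The coefficient of the central kernel in \<open>bump\<close>. Because
    \<open>C > 2\<close>, a nonzero constant value of \<open>Phi\<close> is not annihilated by the
    combination.\<close>
  define C where "C = exp (e * r) + exp (- (e * r))"
  have C: "2 < C"
  proof -
    define y where "y = exp (e * r)"
    have y: "1 < y" using e r by (simp add: y_def)
    have "C - 2 = (y - 1)\<^sup>2 / y" using y by (simp add: C_def y_def exp_minus power2_eq_square field_simps)
    moreover have "0 < (y - 1)\<^sup>2 / y" using y by (intro divide_pos_pos) auto
    ultimately show ?thesis by linarith
  qed
  have "AE x in M. \<forall>g\<in>carrier G. translate_deriv G M act g x = dens (inv g) x \<and> 0 < dens (inv g) x"
    using translate_deriv_dens dens_pos by (intro AE_ball_countable[OF countable_carrier, THEN iffD2] ballI) auto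
  then have "AE x in M. x \<notin> U"
    using AE_space[of M] null dens_one c[of 0] c[of r] c[of "- r"] c[of "- ln t"] c[of "- ln t + r"] c[of "- ln t - r"]
  proof eventually_elim
    case (elim x)
    show "x \<notin> U"
    proof
      assume xU: "x \<in> U"
      have F1: "F x s = 1" if "\<bar>s\<bar> < r" for s
      proof -
        have "act \<one> x = x" using elim(2) by (intro act_one) simp
        then have "act \<one> x \<in> U \<and> \<bar>s + ln (dens (inv \<one>) x)\<bar> < r" using xU elim(4) that by simp
        then show ?thesis unfolding F_def using one_closed by (subst of_bool_eq_1_iff) blast
      qed
      have F0: "F x s = 0" if s: "\<bar>s + ln t\<bar> < r" for s
      proof -
        have False if g: "g \<in> carrier G" "act g x \<in> U" "\<bar>s + ln (dens (inv g) x)\<bar> < r" for g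
        proof -
          have "\<bar>ln (dens (inv g) x) - ln t\<bar> < d" using s g(3) unfolding r_def by linarith
          from d(2)[OF this] have "\<bar>translate_deriv G M act g x - t\<bar> < \<epsilon>" using elim(1) g(1) t by simp
          then have "x \<in> ?V g" using xU g(2) elim(2) by blast
          then show False using elim(3) g(1) by blast
        qed
        then show ?thesis unfolding F_def by (subst of_bool_eq_0_iff) blast
      qed
      \<comment> \<open>On the support of the bump, \<open>F\<close> is 1 around 0 and 0 around
        \<open>- ln t\<close>; outside, the bump itself vanishes.\<close>
      have B1: "F x s * bump e r (s - 0) = bump e r s" for s
        using F1[of s] bump_zero[of r s e] r by (cases "\<bar>s\<bar> < r") auto
      have B0: "F x s * bump e r (s - - ln t) = 0" for s
        using F0[of s] bump_zero[of r "s + ln t" e] r by (cases "\<bar>s + ln t\<bar> < r") auto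
      have i: "integrable lborel (\<lambda>s. exp (- (e * \<bar>s + a\<bar>)))" "(\<integral>s. exp (- (e * \<bar>s + a\<bar>)) \<partial>lborel) = 2 / e" for a
        using laplace_integral[OF e, of a] by auto
      have "(\<integral>s. bump e r s \<partial>lborel) = (\<integral>s. C * exp (- (e * \<bar>s + 0\<bar>)) - exp (- (e * \<bar>s + - r\<bar>)) - exp (- (e * \<bar>s + r\<bar>)) \<partial>lborel)"
        by (simp add: bump_def C_def)
      also have "\<dots> = C * (2 / e) - 2 / e - 2 / e"
        using Bochner_Integration.integral_diff[OF Bochner_Integration.integrable_diff[OF integrable_mult_right[OF i(1)[of 0]] i(1)[of "- r"]] i(1)[of r]]
          Bochner_Integration.integral_diff[OF integrable_mult_right[OF i(1)[of 0]] i(1)[of "- r"]] i(2)[of 0] i(2)[of "- r"] i(2)[of r] by simp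
      also have "C * k - k - k = (C - 2) * k" for k by (simp add: algebra_simps)
      finally have I1: "(\<integral>s. bump e r s \<partial>lborel) = (C - 2) * (2 / e)" .
      have "(\<integral>s. F x s * bump e r (s - 0) \<partial>lborel) = C * c - c - c"
        unfolding Phi_bump[OF F elim(2) e] C_def using elim(5-7) by simp
      then have "(C - 2) * c = (C - 2) * (2 / e)" unfolding B1 I1 by (simp add: algebra_simps)
      then have c1: "c = 2 / e" using mult_cancel_left[of "C - 2" c "2 / e"] C by linarith
      have "(\<integral>s. F x s * bump e r (s - - ln t) \<partial>lborel) = C * c - c - c"
        unfolding Phi_bump[OF F elim(2) e] C_def using elim(8-10) by simp
      then have "(C - 2) * c = 0" unfolding B0 by (simp add: algebra_simps)
      then show False using C c1 e by simp
    qed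
  qed
  then have "emeasure M U = 0" using AE_iff_null_sets[OF U(1)] by auto
  then show False using U(2) by simp
qed

text \<open>The value 0 has no logarithm; every \<open>t\<close> is approached through the positive
  value \<open>t + \<epsilon> / 2\<close>.\<close>

lemma ratio_set_eq:
  assumes ends: "\<not> more_than_one_end G" and gv: "good_value e l"
    and ns: "\<not> (\<lambda>g. (pmf (\<mu> g) False - l)\<^sup>2) summable_on carrier G"
  shows "ratio_set G M act = {0..}"
proof -
  have "t \<in> ratio_set G M act" if t: "0 \<le> t" for t
    unfolding ratio_set_def
  proof (intro CollectI conjI t allI impI ballI)
    fix \<epsilon> :: real and U assume \<epsilon>: "0 < \<epsilon>" and U: "U \<in> sets M" "0 < emeasure M U"
    have "0 < t + \<epsilon> / 2" "0 < \<epsilon> / 2" using t \<epsilon> by auto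
    from ratio_set_pos[OF ends gv ns this U] obtain g V where gV: "g \<in> carrier G" "V \<in> sets M" "V \<subseteq> U" "emeasure M V > 0" "act g ` V \<subseteq> U"
      "\<forall>x\<in>V. \<bar>translate_deriv G M act g x - (t + \<epsilon> / 2)\<bar> < \<epsilon> / 2" by blast
    have "\<bar>translate_deriv G M act g x - t\<bar> < \<epsilon>" if "x \<in> V" for x using bspec[OF gV(6) that] \<epsilon> by linarith
    then show "\<exists>g\<in>carrier G. \<exists>V\<in>sets M. V \<subseteq> U \<and> emeasure M V > 0 \<and> act g ` V \<subseteq> U \<and> (\<forall>x\<in>V. \<bar>translate_deriv G M act g x - t\<bar> < \<epsilon>)"
      using gV(1-5) by blast
  qed
  then show ?thesis by (auto simp: ratio_set_def)
qed

end

section \<open>Kakutani's criterion and equal marginals\<close>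

text \<open>Equivalent to \<open>(x - y)\<^sup>2 \<le> 4 * (sqrt x - sqrt y)\<^sup>2\<close>, which
  holds because the sum of the roots is at most 2.\<close>

lemma sqrt_mult_le:
  assumes "0 \<le> x" "x \<le> 1" "0 \<le> y" "y \<le> 1"
  shows "sqrt (x * y) \<le> (x + y) / 2 - (x - y)\<^sup>2 / 8"
proof -
  define u v where "u = sqrt x" and "v = sqrt y"
  have u: "0 \<le> u" "u \<le> 1" "u\<^sup>2 = x" and v: "0 \<le> v" "v \<le> 1" "v\<^sup>2 = y" using assms by (auto simp: u_def v_def)
  have "(u + v)\<^sup>2 \<le> 2\<^sup>2" using u v by (intro power_mono) auto
  then have "(u - v)\<^sup>2 * (u + v)\<^sup>2 \<le> (u - v)\<^sup>2 * 4" by (intro mult_left_mono) auto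
  moreover have "(u - v)\<^sup>2 * (u + v)\<^sup>2 = (x - y)\<^sup>2" unfolding u(3)[symmetric] v(3)[symmetric] by (simp add: power2_eq_square algebra_simps)
  moreover have "(u - v)\<^sup>2 = x + y - 2 * (u * v)" unfolding u(3)[symmetric] v(3)[symmetric] by (simp add: power2_eq_square algebra_simps)
  moreover have "sqrt (x * y) = u * v" by (simp add: u_def v_def real_sqrt_mult)
  ultimately have "(x - y)\<^sup>2 \<le> (x + y - 2 * sqrt (x * y)) * 4" by simp
  moreover have "s \<le> (x + y) / 2 - d / 8" if "d \<le> (x + y - 2 * s) * 4" for s d :: real using that by (simp add: field_simps)
  ultimately show ?thesis by blast
qed

text \<open>The left side is the Hellinger integral of \<open>p\<close> and \<open>q\<close>; each
  of the two atoms contributes one eighth of the squared difference of the masses.\<close>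

lemma hellinger_le:
  assumes q: "\<And>y. 0 < pmf q y"
  shows "bexp q (\<lambda>y. sqrt (pmf p y / pmf q y)) \<le> 1 - (pmf p False - pmf q False)\<^sup>2 / 4"
proof -
  have s: "pmf q y * sqrt (pmf p y / pmf q y) = sqrt (pmf p y * pmf q y)" for y
  proof -
    have "pmf q y * sqrt (pmf p y / pmf q y) = sqrt ((pmf q y)\<^sup>2 * (pmf p y / pmf q y))" using q[of y] by (simp only: real_sqrt_mult real_sqrt_abs abs_of_pos)
    also have "(pmf q y)\<^sup>2 * (pmf p y / pmf q y) = pmf p y * pmf q y" using q[of y] by (simp add: power2_eq_square)
    finally show ?thesis .
  qed
  have "sqrt (pmf p y * pmf q y) \<le> (pmf p y + pmf q y) / 2 - (pmf p y - pmf q y)\<^sup>2 / 8" for y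
    by (rule sqrt_mult_le) (auto simp: pmf_le_1)
  note this[of True] this[of False]
  moreover have "(pmf p True - pmf q True)\<^sup>2 = (pmf p False - pmf q False)\<^sup>2" "pmf p True + pmf q True = 2 - (pmf p False + pmf q False)"
    by (simp_all add: pmf_bool_True power2_commute)
  moreover have "s + s' \<le> 1 - d / 4" if "s \<le> (2 - z) / 2 - d / 8" "s' \<le> z / 2 - d / 8" for s s' d z :: real
    using that by (simp add: field_simps)
  ultimately show ?thesis unfolding bexp_def s by metis
qed

text \<open>Kakutani: on a finite set with small product of Hellinger integrals, the two product measures
  are nearly concentrated on the complementary sets \<open>\<Prod> \<rho>\<^sub>i \<ge> 1\<close> and \<open>\<Prod> \<rho>\<^sub>i < 1\<close>.\<close>
lemma kakutani_separation:
  fixes p q :: "'i \<Rightarrow> bool pmf"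
  assumes q: "\<And>i y. i \<in> I \<Longrightarrow> 0 < pmf (q i) y" and p: "\<And>i y. i \<in> I \<Longrightarrow> 0 < pmf (p i) y"
    and ns: "\<not> (\<lambda>i. (pmf (p i) False - pmf (q i) False)\<^sup>2) summable_on I"
  shows "\<exists>E :: nat \<Rightarrow> ('i \<Rightarrow> bool) set. (AE z in bits I q. eventually (\<lambda>n. z \<notin> E n) sequentially) \<and> (AE z in bits I p. eventually (\<lambda>n. z \<in> E n) sequentially)"
proof -
  let ?d = "\<lambda>i. (pmf (p i) False - pmf (q i) False)\<^sup>2"
  \<comment> \<open>The factor 4 compensates the 1 / 4 in \<open>hellinger_le\<close>: the product
    of the Hellinger integrals over \<open>F n\<close> is then at most exp (- n), which is
    summable.\<close>
  have "\<exists>F. finite F \<and> F \<subseteq> I \<and> 4 * real n \<le> sum ?d F" for n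
  proof (rule ccontr)
    assume "\<not> ?thesis"
    then have "bdd_above (sum ?d ` {F. F \<subseteq> I \<and> finite F})" by (intro bdd_aboveI2[of _ _ "4 * real n"]) (auto intro: less_imp_le simp: not_le)
    then have "?d summable_on I" by (intro nonneg_bdd_above_summable_on) auto
    then show False using ns by contradiction
  qed
  then have "\<forall>n. \<exists>F. finite F \<and> F \<subseteq> I \<and> 4 * real n \<le> sum ?d F" by blast
  from choice[OF this] obtain F where F: "\<And>n. finite (F n)" "\<And>n. F n \<subseteq> I" "\<And>n. 4 * real n \<le> sum ?d (F n)" by blast
  let ?P = "\<lambda>p q n z. \<Prod>i\<in>F n. sqrt (pmf (p i) (z i) / pmf (q i) (z i))"
  have tail: "measure (bits I q) {z \<in> space (bits I q). 1 \<le> ?P p q n z} \<le> exp (- 1) ^ n"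
    if q: "\<And>i y. i \<in> I \<Longrightarrow> 0 < pmf (q i) y" and d: "4 * real n \<le> (\<Sum>i\<in>F n. (pmf (p i) False - pmf (q i) False)\<^sup>2)" for p q :: "'i \<Rightarrow> bool pmf" and n
  proof -
    interpret prob_space "bits I q" by (rule prob_space_bits)
    have m: "?P p q n \<in> borel_measurable (bits I q)" by (rule prod_bits_measurable[OF F(2)])
    have i: "integrable (bits I q) (?P p q n)" by (rule integrable_prod_bits[OF F(1,2)]) (rule q)
    have s: "{z \<in> space (bits I q). 1 \<le> ?P p q n z} \<in> sets (bits I q)" by (intro borel_measurable_le m borel_measurable_const)
    have "measure (bits I q) {z \<in> space (bits I q). 1 \<le> ?P p q n z} = (\<integral>z. indicator {z \<in> space (bits I q). 1 \<le> ?P p q n z} z \<partial>bits I q)"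
      using sets.Int_space_eq2[OF s] by simp
    \<comment> \<open>Markov's inequality at level 1.\<close>
    also have "\<dots> \<le> (\<integral>z. ?P p q n z \<partial>bits I q)"
    proof (rule integral_mono[OF _ i])
      show "integrable (bits I q) (indicator {z \<in> space (bits I q). 1 \<le> ?P p q n z} :: _ \<Rightarrow> real)"
        by (rule integrable_real_indicator[OF s]) (simp add: emeasure_eq_measure)
      show "indicator {z \<in> space (bits I q). 1 \<le> ?P p q n z} z \<le> ?P p q n z" for z
        by (auto simp: indicator_def intro!: prod_nonneg)
    qed
    also have "\<dots> = (\<Prod>i\<in>F n. bexp (q i) (\<lambda>y. sqrt (pmf (p i) y / pmf (q i) y)))" by (rule integral_prod_bits[OF F(1,2)]) (rule q)
    also have "\<dots> \<le> exp (\<Sum>i\<in>F n. - ((pmf (p i) False - pmf (q i) False)\<^sup>2 / 4))"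
    proof (rule exp_bound_prod[OF F(1)])
      fix i assume "i \<in> F n"
      then have i: "i \<in> I" using F(2) by blast
      show "0 \<le> bexp (q i) (\<lambda>y. sqrt (pmf (p i) y / pmf (q i) y))" unfolding bexp_def by (intro add_nonneg_nonneg mult_nonneg_nonneg) auto
      show "bexp (q i) (\<lambda>y. sqrt (pmf (p i) y / pmf (q i) y)) \<le> 1 + - ((pmf (p i) False - pmf (q i) False)\<^sup>2 / 4)"
        using hellinger_le[of "q i" "p i"] q[OF i] by simp
    qed
    also have "(\<Sum>i\<in>F n. - ((pmf (p i) False - pmf (q i) False)\<^sup>2 / 4)) \<le> - real n"
      using d by (simp add: sum_negf sum_divide_distrib[symmetric])
    also have "exp (- real n) = exp (- 1) ^ n" by (simp add: exp_of_nat_mult[symmetric])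
    finally show ?thesis by simp
  qed
  have geo: "summable (\<lambda>n. exp (- 1 :: real) ^ n)" by (rule summable_geometric) simp
  define E where "E n = {z \<in> I \<rightarrow>\<^sub>E UNIV. 1 \<le> ?P p q n z}" for n
  define E' where "E' n = {z \<in> I \<rightarrow>\<^sub>E UNIV. 1 \<le> ?P q p n z}" for n
  have bc: "AE z in bits I q. eventually (\<lambda>n. z \<in> space (bits I q) - {z \<in> space (bits I q). 1 \<le> ?P p q n z}) sequentially"
    if q: "\<And>i y. i \<in> I \<Longrightarrow> 0 < pmf (q i) y" and d: "\<And>n. 4 * real n \<le> (\<Sum>i\<in>F n. (pmf (p i) False - pmf (q i) False)\<^sup>2)" for p q :: "'i \<Rightarrow> bool pmf"
  proof (rule borel_cantelli_AE1)
    interpret prob_space "bits I q" by (rule prob_space_bits)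
    show "{z \<in> space (bits I q). 1 \<le> ?P p q n z} \<in> sets (bits I q)" for n by (intro borel_measurable_le prod_bits_measurable F(2) borel_measurable_const)
    show "emeasure (bits I q) {z \<in> space (bits I q). 1 \<le> ?P p q n z} < \<infinity>" for n by (simp only: emeasure_eq_measure ennreal_less_top infinity_ennreal_def)
    show "summable (\<lambda>n. measure (bits I q) {z \<in> space (bits I q). 1 \<le> ?P p q n z})"
      by (rule summable_comparison_test'[OF geo, of 0]) (use tail[OF q d] in simp)
  qed
  have 1: "AE z in bits I q. eventually (\<lambda>n. z \<notin> E n) sequentially"
  proof -
    have "AE z in bits I q. eventually (\<lambda>n. z \<in> space (bits I q) - {z \<in> space (bits I q). 1 \<le> ?P p q n z}) sequentially"
      by (rule bc[OF _ F(3)]) (rule q)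
    then show ?thesis by eventually_elim (auto simp: E_def elim!: eventually_mono)
  qed
  have "4 * real n \<le> (\<Sum>i\<in>F n. (pmf (q i) False - pmf (p i) False)\<^sup>2)" for n using F(3)[of n] by (simp add: power2_commute)
  then have "AE z in bits I p. eventually (\<lambda>n. z \<in> space (bits I p) - {z \<in> space (bits I p). 1 \<le> ?P q p n z}) sequentially"
    using bc[of p q] p by blast
  then have 2: "AE z in bits I p. eventually (\<lambda>n. z \<in> E n) sequentially"
  proof eventually_elim
    case (elim z)
    then show ?case
    proof (rule eventually_mono)
      fix n assume z: "z \<in> space (bits I p) - {z \<in> space (bits I p). 1 \<le> ?P q p n z}"
      then have zs: "z \<in> I \<rightarrow>\<^sub>E UNIV" and lt: "?P q p n z < 1" by auto
      have pos: "0 < ?P q p n z" 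
      proof (rule prod_pos)
        fix i assume "i \<in> F n"
        then have "0 < pmf (p i) (z i)" "0 < pmf (q i) (z i)" using F(2) p q by blast+
        then show "0 < sqrt (pmf (q i) (z i) / pmf (p i) (z i))" by simp
      qed
      \<comment> \<open>The two likelihood ratios are reciprocal, so a point outside the exceptional
        set for \<open>p\<close> lies in \<open>E n\<close>.\<close>
      have "?P p q n z * ?P q p n z = (\<Prod>i\<in>F n. 1)"
        unfolding prod.distrib[symmetric]
      proof (rule prod.cong[OF refl])
        fix i assume "i \<in> F n"
        then have "0 < pmf (p i) (z i)" "0 < pmf (q i) (z i)" using F(2) p q by blast+
        then show "sqrt (pmf (p i) (z i) / pmf (q i) (z i)) * sqrt (pmf (q i) (z i) / pmf (p i) (z i)) = 1"
          by (simp add: real_sqrt_mult[symmetric])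
      qed
      then have m: "?P p q n z * ?P q p n z = 1" by simp
      have "1 \<le> ?P p q n z"
      proof (rule ccontr)
        assume "\<not> 1 \<le> ?P p q n z"
        then have "?P p q n z * ?P q p n z < 1 * ?P q p n z" using pos by (intro mult_strict_right_mono) auto
        then show False using m lt by simp
      qed
      then show "z \<in> E n" using zs by (simp add: E_def)
    qed
  qed
  show ?thesis using 1 2 by blast
qed

context elliptic_marginals
begin

lemma act_image: "g \<in> carrier G \<Longrightarrow> A \<subseteq> space M \<Longrightarrow> act g ` A = act (inv g) -` A \<inter> space M"
proof (rule Set.set_eqI)
  fix x assume g: "g \<in> carrier G" and A: "A \<subseteq> space M"
  have i: "inv g \<in> carrier G" using g by simp
  show "x \<in> act g ` A \<longleftrightarrow> x \<in> act (inv g) -` A \<inter> space M"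
  proof
    assume "x \<in> act g ` A"
    then obtain a where a: "a \<in> A" "x = act g a" by blast
    then have as: "a \<in> carrier G \<rightarrow>\<^sub>E UNIV" using A by auto
    show "x \<in> act (inv g) -` A \<inter> space M" using a(1) act_inv(1)[OF as g] act_space[OF as] unfolding a(2) by simp
  next
    assume x: "x \<in> act (inv g) -` A \<inter> space M"
    then have xs: "x \<in> carrier G \<rightarrow>\<^sub>E UNIV" by simp
    have "x = act g (act (inv g) x)" using act_inv(2)[OF xs g] by simp
    then show "x \<in> act g ` A" using x by blast
  qed
qed

lemma nonsingular_AE:
  assumes ns: "nonsingular_action G M act" and g: "g \<in> carrier G" and P: "AE x in M. P x"
  shows "AE x in M. P (act g x)"
proof -
  obtain N where N: "{x \<in> space M. \<not> P x} \<subseteq> N" "emeasure M N = 0" "N \<in> sets M" using AE_E[OF P] by blast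
  have Bm: "act g -` N \<inter> space M \<in> sets M" by (rule measurable_sets[OF act_measurable[OF g] N(3)])
  have "emeasure M (act g ` (act g -` N \<inter> space M)) \<le> emeasure M N" by (rule emeasure_mono[OF _ N(3)]) blast
  then have "emeasure M (act g ` (act g -` N \<inter> space M)) = 0" using N(2) by simp
  then have "emeasure M (act g -` N \<inter> space M) = 0" using ns g Bm unfolding nonsingular_action_def by blast
  then have "act g -` N \<inter> space M \<in> null_sets M" using Bm by (simp only: null_sets_def mem_Collect_eq simp_thms)
  then show ?thesis
  proof (rule AE_I')
    show "{x \<in> space M. \<not> P (act g x)} \<subseteq> act g -` N \<inter> space M" using N(1) measurable_space[OF act_measurable[OF g]] by blast
  qed
qed

text \<open>Otherwise \<open>kakutani_separation\<close> applies to \<open>M\<close> and its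
  translate: for almost every point the image under \<open>g\<close> is eventually inside
  \<open>E n\<close>, and by nonsingularity it is also eventually outside.\<close>

lemma nonsingular_square_summable:
  assumes ns: "nonsingular_action G M act" and g: "g \<in> carrier G"
  shows "(\<lambda>h. (coc g h)\<^sup>2) summable_on carrier G"
proof (rule ccontr)
  assume "\<not> ?thesis"
  then have "\<not> (\<lambda>h. (pmf (sh g h) False - pmf (\<mu> h) False)\<^sup>2) summable_on carrier G"
    by (simp add: bernoulli_cocycle_def sh_def power2_commute)
  moreover have "0 < pmf (sh g h) y" if "h \<in> carrier G" for h y unfolding sh_def using g that by (intro marg_pos) simp
  ultimately obtain E :: "nat \<Rightarrow> ('a \<Rightarrow> bool) set" where E: "AE z in M. eventually (\<lambda>n. z \<notin> E n) sequentially"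
    "AE z in bits (carrier G) (sh g). eventually (\<lambda>n. z \<in> E n) sequentially"
    using kakutani_separation[of "carrier G" \<mu> "sh g"] marg_pos by blast
  have "AE z in distr M M (act g). eventually (\<lambda>n. z \<in> E n) sequentially" unfolding distr_act[OF g] by (rule E(2))
  from AE_distrD[OF act_measurable[OF g] this] nonsingular_AE[OF ns g E(1)]
  have "AE z in M. False"
  proof eventually_elim
    case (elim z)
    then have "eventually (\<lambda>n :: nat. False) sequentially" by eventually_elim blast
    then show False by simp
  qed
  then show False by simp
qed

text \<open>A cylinder over \<open>n\<close> coordinates has mass at most
  \<open>(1 - \<delta>) ^ n\<close>. For large \<open>n\<close> this is below the mass of
  \<open>A\<close>, and one of the finitely many cylinders meets \<open>A\<close> in positive
  measure.\<close>

lemma nonatomic: "nonatomic M"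
  unfolding nonatomic_def
proof (intro ballI impI)
  fix A assume A: "A \<in> sets M" "0 < emeasure M A"
  have \<delta>1: "\<delta> \<le> 1 / 2" using marginal[OF one_closed] by auto
  have "(\<lambda>n. (1 - \<delta>) ^ n) \<longlonglongrightarrow> 0" using \<delta>_pos \<delta>1 by (intro LIMSEQ_power_zero) auto
  moreover have pA: "0 < measure M A" using A(2) by (simp add: emeasure_eq_measure)
  ultimately have "eventually (\<lambda>n. (1 - \<delta>) ^ n < measure M A) sequentially" by (rule order_tendstoD(2))
  then obtain n where n: "(1 - \<delta>) ^ n < measure M A" by (meson eventually_happens trivial_limit_sequentially)
  obtain J where J: "finite J" "card J = n" "J \<subseteq> carrier G" using infinite_arbitrarily_large[OF infinite_carrier] by blast
  let ?C = "\<lambda>y. cyl (carrier G) J y"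
  have "\<exists>y\<in>J \<rightarrow>\<^sub>E UNIV. emeasure M (A \<inter> ?C y) \<noteq> 0"
  proof (rule ccontr)
    assume neg: "\<not> ?thesis"
    have "A \<inter> ?C y \<in> null_sets M" if "y \<in> J \<rightarrow>\<^sub>E UNIV" for y
      using neg that sets.Int[OF A(1) sets_cyl[OF J(1,3)]] unfolding null_sets_def by blast
    then have "(\<Union>y\<in>J \<rightarrow>\<^sub>E UNIV. A \<inter> ?C y) \<in> null_sets M"
      using J(1) by (intro null_sets.finite_UN finite_PiE) auto
    moreover have "A \<subseteq> (\<Union>y\<in>J \<rightarrow>\<^sub>E UNIV. A \<inter> ?C y)"
    proof
      fix x assume x: "x \<in> A"
      then have "x \<in> carrier G \<rightarrow>\<^sub>E UNIV" using sets.sets_into_space[OF A(1)] by auto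
      then have "x \<in> ?C (restrict x J)" by (simp add: cyl_def)
      moreover have "restrict x J \<in> J \<rightarrow>\<^sub>E UNIV" by simp
      ultimately show "x \<in> (\<Union>y\<in>J \<rightarrow>\<^sub>E UNIV. A \<inter> ?C y)" using x by blast
    qed
    ultimately have "A \<in> null_sets M" using null_sets_subset A(1) by blast
    then show False using A(2) by (simp add: null_sets_def)
  qed
  then obtain y where y: "emeasure M (A \<inter> ?C y) \<noteq> 0" by blast
  have "emeasure M (A \<inter> ?C y) \<le> emeasure M (?C y)" by (intro emeasure_mono sets_cyl J) auto
  also have "\<dots> = ennreal (\<Prod>i\<in>J. pmf (\<mu> i) (y i))" by (rule emeasure_cyl[OF J(1,3)])
  also have "\<dots> \<le> ennreal ((1 - \<delta>) ^ n)"
  proof (rule ennreal_leI)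
    have "(\<Prod>i\<in>J. pmf (\<mu> i) (y i)) \<le> (\<Prod>i\<in>J. 1 - \<delta>)" using J(3) marg_le by (intro prod_mono) auto
    then show "(\<Prod>i\<in>J. pmf (\<mu> i) (y i)) \<le> (1 - \<delta>) ^ n" using J(2) by simp
  qed
  also have "\<dots> < ennreal (measure M A)" using n pA \<delta>1 by (intro ennreal_lessI) auto
  finally have "emeasure M (A \<inter> ?C y) < emeasure M A" by (simp add: emeasure_eq_measure)
  moreover have "A \<inter> ?C y \<in> sets M" by (intro sets.Int A sets_cyl J)
  ultimately show "\<exists>B\<in>sets M. B \<subseteq> A \<and> 0 < emeasure M B \<and> emeasure M B < emeasure M A"
    using y by (intro bexI[of _ "A \<inter> ?C y"] conjI) (auto simp: zero_less_iff_neq_zero)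
qed

text \<open>The product of equal marginals is invariant and, by Kakutani, equivalent to \<open>M\<close>.\<close>
lemma invariant_equivalent_measure:
  assumes a: "0 < a" "a < 1" and sm: "(\<lambda>g. (pmf (\<mu> g) False - a)\<^sup>2) summable_on carrier G"
  shows "\<exists>\<nu>. sets \<nu> = sets M \<and> finite_measure \<nu> \<and> absolutely_continuous M \<nu> \<and> absolutely_continuous \<nu> M \<and>
    (\<forall>g\<in>carrier G. \<forall>A\<in>sets M. emeasure \<nu> (act g ` A) = emeasure \<nu> A)"
proof -
  define \<nu> where "\<nu> = (\<lambda>_ :: 'a. bernoulli_pmf (1 - a))"
  \<comment> \<open>A common lower bound for the marginals of both products, as
    \<open>product_density\<close> requires; it also admits the constant marginals to the
    locale.\<close>
  define d where "d = min \<delta> (min a (1 - a))"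
  have d: "0 < d" "d \<le> \<delta>" "d \<le> a" "d \<le> 1 - a" using \<delta>_pos a by (auto simp: d_def)
  have \<nu>F: "pmf (\<nu> g) False = a" and \<nu>T: "pmf (\<nu> g) True = 1 - a" for g using a by (simp_all add: \<nu>_def)
  have dq: "d \<le> pmf (\<mu> g) y" if "g \<in> carrier G" for g y using marg_ge[OF that, of y] d by linarith
  have dp: "d \<le> pmf (\<nu> g) y" for g y using d by (cases y) (auto simp: \<nu>F \<nu>T)
  have sm': "(\<lambda>g. (pmf (\<nu> g) False - pmf (\<mu> g) False)\<^sup>2) summable_on carrier G" using sm by (simp add: \<nu>F power2_commute)
  have "\<exists>D. D \<in> borel_measurable M \<and> (AE z in M. 0 < D z) \<and> bits (carrier G) \<nu> = density M (\<lambda>z. ennreal (D z))"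
    by (rule product_density[OF countable_carrier d(1) dq dp sm']) blast+
  then obtain D where D: "D \<in> borel_measurable M" "AE z in M. 0 < D z" "bits (carrier G) \<nu> = density M (\<lambda>z. ennreal (D z))" by blast
  have Dm: "(\<lambda>z. ennreal (D z)) \<in> borel_measurable M" using D(1) by simp
  have s: "sets (bits (carrier G) \<nu>) = sets M" by (rule sets_bits_cong)
  interpret N: elliptic_marginals G \<nu> d
    by unfold_locales (use countable_carrier infinite_carrier d in \<open>auto simp: \<nu>F\<close>)
  have "absolutely_continuous M (bits (carrier G) \<nu>)" unfolding D(3) using Dm by (rule absolutely_continuousI_density)
  moreover have "absolutely_continuous (bits (carrier G) \<nu>) M"
    unfolding absolutely_continuous_def
  proof
    fix A assume "A \<in> null_sets (bits (carrier G) \<nu>)"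
    then have A: "A \<in> sets M" "AE x in M. x \<in> A \<longrightarrow> ennreal (D x) = 0" unfolding D(3) null_sets_density_iff[OF Dm] by auto
    from A(2) D(2) have "AE x in M. x \<notin> A"
      by eventually_elim (auto simp: ennreal_eq_0_iff)
    then show "A \<in> null_sets M" using AE_iff_null_sets[OF A(1)] by blast
  qed
  moreover have "emeasure (bits (carrier G) \<nu>) (act g ` A) = emeasure (bits (carrier G) \<nu>) A" if g: "g \<in> carrier G" and A: "A \<in> sets M" for g A
  proof -
    have i: "inv g \<in> carrier G" using g by simp
    have A': "A \<in> sets (bits (carrier G) \<nu>)" using A s by simp
    have "act g ` A = act (inv g) -` A \<inter> space (bits (carrier G) \<nu>)" by (rule N.act_image[OF g sets.sets_into_space[OF A']])
    then have "emeasure (bits (carrier G) \<nu>) (act g ` A) = emeasure (distr (bits (carrier G) \<nu>) (bits (carrier G) \<nu>) (act (inv g))) A"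
      using emeasure_distr[OF N.act_measurable[OF i] A'] by simp
    also have "distr (bits (carrier G) \<nu>) (bits (carrier G) \<nu>) (act (inv g)) = bits (carrier G) \<nu>"
      unfolding N.distr_act[OF i] N.sh_def[abs_def] by (simp add: \<nu>_def)
    finally show ?thesis .
  qed
  moreover have "finite_measure (bits (carrier G) \<nu>)" by (rule N.finite_measure_axioms)
  ultimately show ?thesis using s by blast
qed

end

section \<open>Weak mixing and ergodicity of the given action\<close>

context bernoulli
begin

lemma weakly_mixing:
  assumes gv: "good_value e l"
  shows "weakly_mixing TYPE('y) G M act"
  unfolding weakly_mixing_def
proof (intro allI impI)
  fix N :: "'y measure" and \<beta>
  assume pmp: "pmp_action G N \<beta>" and erg: "ergodic G N \<beta>"
  have N: "prob_space N" and ga: "group_action G (space N) \<beta>" and \<beta>m: "\<And>g. g \<in> carrier G \<Longrightarrow> \<beta> g \<in> measurable N N"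
    and \<beta>p: "\<And>g A. g \<in> carrier G \<Longrightarrow> A \<in> sets N \<Longrightarrow> emeasure N (\<beta> g ` A) = emeasure N A"
    using pmp by (auto simp: pmp_action_def borel_action_def)
  interpret ga: group_action G "space N" \<beta> by (rule ga)
  have sp: "\<beta> g y \<in> space N" if "g \<in> carrier G" "y \<in> space N" for g y by (rule ga.element_image[OF that refl])
  have \<beta>i: "\<beta> (inv g) (\<beta> g y) = y" if "g \<in> carrier G" "y \<in> space N" for g y by (rule ga.orbit_sym_aux[OF that refl])
  have \<beta>i': "\<beta> g (\<beta> (inv g) y) = y" if "g \<in> carrier G" "y \<in> space N" for g y using \<beta>i[of "inv g" y] that by simp
  \<comment> \<open>\<open>pmp_action\<close> is stated with images of sets; a preimage under
    \<open>g\<close> is an image under \<open>inv g\<close>.\<close>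
  have distr: "distr N N (\<beta> g) = N" if g: "g \<in> carrier G" for g
  proof (rule measure_eqI)
    fix A assume "A \<in> sets (distr N N (\<beta> g))"
    then have A: "A \<in> sets N" by simp
    have i: "inv g \<in> carrier G" using g by simp
    have As: "A \<subseteq> space N" by (rule sets.sets_into_space[OF A])
    have "\<beta> g -` A \<inter> space N = \<beta> (inv g) ` A"
    proof (intro equalityI subsetI)
      fix y assume y: "y \<in> \<beta> g -` A \<inter> space N"
      then have "y = \<beta> (inv g) (\<beta> g y)" using \<beta>i[OF g] by simp
      then show "y \<in> \<beta> (inv g) ` A" using y by blast
    next
      fix y assume "y \<in> \<beta> (inv g) ` A"
      then obtain a where a: "a \<in> A" "y = \<beta> (inv g) a" by blast
      then have "a \<in> space N" using As by blast
      then show "y \<in> \<beta> g -` A \<inter> space N" using a \<beta>i'[OF g] sp[OF i] by simp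
    qed
    then show "emeasure (distr N N (\<beta> g)) A = emeasure N A" using emeasure_distr[OF \<beta>m[OF g] A] \<beta>p[OF i A] by simp
  qed simp
  show "ergodic G (M \<Otimes>\<^sub>M N) (diagonal_action M N act \<beta>)"
    unfolding ergodic_def
  proof (intro ballI impI)
    fix A assume A: "A \<in> sets (M \<Otimes>\<^sub>M N)" and inv: "\<forall>g\<in>carrier G. diagonal_action M N act \<beta> g ` A = A"
    have fwd: "(act g x, \<beta> g y) \<in> A" if g: "g \<in> carrier G" and xy: "(x, y) \<in> A" for g x y
    proof -
      have s: "(x, y) \<in> space (M \<Otimes>\<^sub>M N)" using sets.sets_into_space[OF A] xy by blast
      have "diagonal_action M N act \<beta> g (x, y) \<in> A" using inv g xy by blast
      then show ?thesis using s by (simp add: diagonal_action_def del: space_bits)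
    qed
    show "emeasure (M \<Otimes>\<^sub>M N) A = 0 \<or> emeasure (M \<Otimes>\<^sub>M N) A = 1"
    proof (rule diagonal_ergodic[OF gv N, where \<beta> = \<beta>])
      show "A \<in> sets (M \<Otimes>\<^sub>M N)" by (rule A)
      show "\<beta> g \<in> measurable N N" "distr N N (\<beta> g) = N" if "g \<in> carrier G" for g using \<beta>m[OF that] distr[OF that] .
      show "\<beta> (inv g) (\<beta> g y) = y" if "g \<in> carrier G" "y \<in> space N" for g y using \<beta>i[OF that] .
      fix D assume D: "D \<in> sets N" and inv: "\<And>g y. g \<in> carrier G \<Longrightarrow> y \<in> space N \<Longrightarrow> \<beta> g y \<in> D \<longleftrightarrow> y \<in> D"
      have Ds: "y \<in> space N" if "y \<in> D" for y using sets.sets_into_space[OF D] that by blast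
      have "\<beta> g ` D = D" if g: "g \<in> carrier G" for g
      proof (intro equalityI subsetI)
        fix y assume "y \<in> \<beta> g ` D" then show "y \<in> D" using inv[OF g] Ds by auto
      next
        fix y assume y: "y \<in> D"
        have iD: "\<beta> (inv g) y \<in> D" using inv[of "inv g" y] g y Ds by simp
        show "y \<in> \<beta> g ` D" using imageI[OF iD, of "\<beta> g"] unfolding \<beta>i'[OF g Ds[OF y]] .
      qed
      then have "\<forall>g\<in>carrier G. \<beta> g ` D = D" by (rule ballI)
      with bspec[OF erg[unfolded ergodic_def] D] show "emeasure N D = 0 \<or> emeasure N D = 1" by (rule mp)
    next
      fix g x y assume g: "g \<in> carrier G" and x: "x \<in> space M" and y: "y \<in> space N"
      show "(act g x, \<beta> g y) \<in> A \<longleftrightarrow> (x, y) \<in> A"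
      proof
        assume "(act g x, \<beta> g y) \<in> A"
        from fwd[OF inv_closed[OF g] this] show "(x, y) \<in> A" using act_inv(1)[of x g] x g unfolding \<beta>i[OF g y] by simp
      qed (rule fwd[OF g])
    qed
  qed
qed

text \<open>The case of the trivial action on a one-point space in
  \<open>diagonal_ergodic\<close>.\<close>

lemma ergodic:
  assumes gv: "good_value e l"
  shows "ergodic G M act"
  unfolding ergodic_def
proof (intro ballI impI)
  fix A assume A: "A \<in> sets M" and inv: "\<forall>g\<in>carrier G. act g ` A = A"
  let ?N = "return (count_space UNIV) ()"
  have N: "prob_space ?N" by (rule prob_space_return) simp
  interpret N: prob_space ?N by (rule N)
  have fwd: "act g x \<in> A" if "g \<in> carrier G" "x \<in> A" for g x using inv that by blast
  have U: "UNIV \<in> sets ?N" by simp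
  have "emeasure (M \<Otimes>\<^sub>M ?N) (A \<times> UNIV) = 0 \<or> emeasure (M \<Otimes>\<^sub>M ?N) (A \<times> UNIV) = 1"
  proof (rule diagonal_ergodic[OF gv N, where \<beta> = "\<lambda>_ y. y"])
    show "(\<lambda>y. y) \<in> measurable ?N ?N" by simp
    show "distr ?N ?N (\<lambda>y. y) = ?N" by (rule distr_id)
    show "A \<times> UNIV \<in> sets (M \<Otimes>\<^sub>M ?N)" by (rule pair_measureI[OF A U])
    show "emeasure ?N D = 0 \<or> emeasure ?N D = 1" for D by (simp add: indicator_def)
    fix g x and y :: unit assume g: "g \<in> carrier G" and x: "x \<in> space M"
    show "((act g x, y) \<in> A \<times> UNIV) = ((x, y) \<in> A \<times> UNIV)"
    proof
      assume "(act g x, y) \<in> A \<times> UNIV"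
      then have "act (inv g) (act g x) \<in> A" using g by (intro fwd[of "inv g"]) auto
      then show "(x, y) \<in> A \<times> UNIV" using act_inv(1)[of x g] x g by simp
    qed (use fwd[OF g] in auto)
  qed simp
  moreover have "emeasure (M \<Otimes>\<^sub>M ?N) (A \<times> UNIV) = emeasure M A * emeasure ?N UNIV" by (rule N.emeasure_pair_measure_Times[OF A U])
  moreover have "emeasure ?N UNIV = 1" by simp
  ultimately show "emeasure M A = 0 \<or> emeasure M A = 1" by simp
qed

end

theorem theoremC:
  fixes G :: "('g, 'm) monoid_scheme" (structure)
    and \<mu> :: "'g \<Rightarrow> bool pmf"
    and \<delta> \<kappa> :: real
  assumes "group G" and "countable (carrier G)" and "one_end G"
    and "\<delta> > 0"
    and "\<And>g. g \<in> carrier G \<Longrightarrow> pmf (\<mu> g) False \<in> {\<delta>..1 - \<delta>}"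
    and "nonsingular_action G (bernoulli_measure G \<mu>) (bernoulli_action G)"
    and "\<kappa> > inverse \<delta> * inverse (1 - \<delta>)"
    and "\<not> (\<lambda>g. exp (- 4 * \<kappa> * l2_norm_sq G (bernoulli_cocycle G \<mu> g))) summable_on carrier G"
  shows "if \<exists>a\<in>{0<..<1}. (\<lambda>g. (pmf (\<mu> g) False - a)\<^sup>2) summable_on carrier G
         then type_II1 G (bernoulli_measure G \<mu>) (bernoulli_action G)
         else weakly_mixing TYPE('y) G (bernoulli_measure G \<mu>) (bernoulli_action G) \<and>
              type_III1 G (bernoulli_measure G \<mu>) (bernoulli_action G)"
proof -
  interpret group G by (rule assms(1))
  have inf: "infinite (carrier G)" and ends: "\<not> more_than_one_end G" using assms(3) by (auto simp: one_end_def)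
  interpret E: elliptic_marginals G \<mu> \<delta>
    using assms(2,4,5) inf by unfold_locales auto
  have M: "bernoulli_measure G \<mu> = E.M" by (simp add: bernoulli_measure_def)
  have nonsing: "nonsingular_action G E.M (bernoulli_action G)" using assms(6) unfolding M .
  interpret B: bernoulli G \<mu> \<delta>
    by unfold_locales (rule E.nonsingular_square_summable[OF nonsing])
  obtain e l where gv: "B.good_value e l"
    using B.exists_good_value[OF assms(7)] assms(8) unfolding E.wt_def by blast
  show ?thesis
  proof (cases "\<exists>a\<in>{0<..<1}. (\<lambda>g. (pmf (\<mu> g) False - a)\<^sup>2) summable_on carrier G")
    case True
    then obtain a where a: "0 < a" "a < 1" "(\<lambda>g. (pmf (\<mu> g) False - a)\<^sup>2) summable_on carrier G" by auto
    have "type_II1 G E.M (bernoulli_action G)"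
      unfolding type_II1_def using nonsing B.ergodic[OF gv] E.nonatomic E.invariant_equivalent_measure[OF a] by blast
    then show ?thesis using True unfolding M by simp
  next
    case False
    \<comment> \<open>The limit value \<open>l\<close> lies in (0, 1), so the negated condition
      applies to \<open>a = l\<close>.\<close>
    have "\<delta> \<le> l" "l \<le> 1 - \<delta>" using gv by (auto simp: B.good_value_def)
    then have "l \<in> {0<..<1}" using assms(4) by auto
    then have "\<not> (\<lambda>g. (pmf (\<mu> g) False - l)\<^sup>2) summable_on carrier G" using False by blast
    then have "type_III1 G E.M (bernoulli_action G)"
      unfolding type_III1_def using nonsing B.ergodic[OF gv] E.nonatomic B.ratio_set_eq[OF ends gv] by blast
    then show ?thesis using False B.weakly_mixing[OF gv] unfolding M by simp
  qed
qed

end
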